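(* Let $1<p<\infty$ and $\varphi\in C(G)$, and suppose that the group $X$ is not isomorphic to $\mathbb Z$ and is linearly and Archimedean ordered. If the Toeplitz operator $T_\varphi$ on $H^p(G)$ is Fredholm, then it is invertible.
   Context: $G$ is a nontrivial connected compact abelian group with normalized Haar measure $m$; $X$ is its (discrete) character group, written multiplicatively, with unit character $\mathbf 1$. $T\subset X$ is a fixed subsemigroup (positive cone) with $\mathbf 1\in T$, $T\cap T^{-1}=\{\mathbf 1\}$, $X=T^{-1}T$; it defines an order on $X$ by $\xi\le\chi$ iff $\chi\xi^{-1}\in T$. $X$ is linearly ordered means $T\cup T^{-1}=X$; the order is Archimedean if for all $\chi,\xi\in T\setminus\{\mathbf 1\}$ there is a natural number $n$ with $\xi^n\ge\chi$. Fourier transform: $\widehat f(\chi)=\int_G f\overline{\chi}\,dm$. $H^p(G)=\{f\in L^p(G):\widehat f(\chi)=0 \text{ for all }\chi\in X\setminus T\}$ with the $L^p$ norm. $Pol(G)$ and $Pol_T(G)$ are the linear spans of $X$ and of $T$. The Riesz projection $P_T:Pol(G)\to Pol_T(G)$ is $P_T(\sum_{\chi\in M}c_\chi\chi)=\sum_{\chi\in M\cap T}c_\chi\chi$; for linearly ordered $X$ and $1<p<\infty$ it extends to a bounded projection $P_T:L^p(G)\to H^p(G)$ (Bochner–Helson). For $\varphi\in L^\infty(G)$ the Toeplitz operator is $T_\varphi f=P_T(\varphi f)$, $f\in H^p(G)$. *)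

theory Defs
  imports "HOL-Analysis.Analysis" "HOL-Algebra.Coset" "HOL-Algebra.Elementary_Groups"
begin

section \<open>Haar measure and the character group\<close>

definition normalized_haar :: "'g::{topological_ab_group_add, t2_space} measure \<Rightarrow> bool" where
  "normalized_haar m \<longleftrightarrow>
     sets m = sets borel \<and>
     emeasure m UNIV = 1 \<and>
     (\<forall>a. \<forall>A\<in>sets borel. emeasure m ((\<lambda>x. a + x) ` A) = emeasure m A) \<and>
     (\<forall>A\<in>sets borel. emeasure m A = (INF U\<in>{U. open U \<and> A \<subseteq> U}. emeasure m U)) \<and>
     (\<forall>A\<in>sets borel. emeasure m A = (SUP K\<in>{K. compact K \<and> K \<subseteq> A}. emeasure m K))"

definition char_group :: "('g::topological_ab_group_add \<Rightarrow> complex) monoid" where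
  "char_group =
     \<lparr>carrier = {\<eta>. continuous_on UNIV \<eta> \<and> (\<forall>x. cmod (\<eta> x) = 1) \<and>
                     (\<forall>x y. \<eta> (x + y) = \<eta> x * \<eta> y)},
      monoid.mult = (\<lambda>\<eta> \<xi> x. \<eta> x * \<xi> x),
      one = (\<lambda>x. 1)\<rparr>"

lemma comm_group_char_group: "comm_group (char_group :: ('g::topological_ab_group_add \<Rightarrow> complex) monoid)"
proof (rule comm_groupI)
  fix \<eta> :: "'g \<Rightarrow> complex"
  assume \<eta>: "\<eta> \<in> carrier char_group"
  have "cnj (\<eta> x) * \<eta> x = 1" for x
    using \<eta> by (simp add: char_group_def complex_norm_square[symmetric] mult.commute)
  moreover have "(\<lambda>x. cnj (\<eta> x)) \<in> carrier char_group"
    using \<eta> by (auto simp: char_group_def intro!: continuous_intros)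
  ultimately show "\<exists>\<xi>\<in>carrier char_group. \<xi> \<otimes>\<^bsub>char_group\<^esub> \<eta> = \<one>\<^bsub>char_group\<^esub>"
    by (intro bexI[of _ "\<lambda>x. cnj (\<eta> x)"]) (auto simp: char_group_def)
qed (auto simp: char_group_def norm_mult mult_ac intro!: continuous_intros)

section \<open>Orders on a group given by a positive cone\<close>

definition positive_cone :: "('a, 'b) monoid_scheme \<Rightarrow> 'a set \<Rightarrow> bool" where
  "positive_cone X T \<longleftrightarrow>
     T \<subseteq> carrier X \<and>
     (\<forall>\<eta>\<in>T. \<forall>\<xi>\<in>T. \<eta> \<otimes>\<^bsub>X\<^esub> \<xi> \<in> T) \<and>
     \<one>\<^bsub>X\<^esub> \<in> T \<and>
     T \<inter> set_inv\<^bsub>X\<^esub> T = {\<one>\<^bsub>X\<^esub>} \<and>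
     carrier X = set_inv\<^bsub>X\<^esub> T <#>\<^bsub>X\<^esub> T"

definition cone_le :: "('a, 'b) monoid_scheme \<Rightarrow> 'a set \<Rightarrow> 'a \<Rightarrow> 'a \<Rightarrow> bool" where
  "cone_le X T \<xi> \<eta> \<longleftrightarrow> \<eta> \<otimes>\<^bsub>X\<^esub> inv\<^bsub>X\<^esub> \<xi> \<in> T"

definition linearly_ordered :: "('a, 'b) monoid_scheme \<Rightarrow> 'a set \<Rightarrow> bool" where
  "linearly_ordered X T \<longleftrightarrow> T \<union> set_inv\<^bsub>X\<^esub> T = carrier X"

definition archimedean_ordered :: "('a, 'b) monoid_scheme \<Rightarrow> 'a set \<Rightarrow> bool" where
  "archimedean_ordered X T \<longleftrightarrow>
     (\<forall>\<eta>\<in>T - {\<one>\<^bsub>X\<^esub>}. \<forall>\<xi>\<in>T - {\<one>\<^bsub>X\<^esub>}. \<exists>n::nat. cone_le X T \<eta> (\<xi> [^]\<^bsub>X\<^esub> n))"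

section \<open>The spaces \<open>L\<^sup>p\<close> and \<open>H\<^sup>p\<close>\<close>

text \<open>Elements of \<open>L\<^sup>p\<close> are represented by Borel functions. Below, every notion concerning operators
  and subspaces is understood modulo equality almost everywhere.\<close>

definition Lp :: "'g::topological_space measure \<Rightarrow> real \<Rightarrow> ('g \<Rightarrow> complex) set" where
  "Lp m p = {f \<in> borel_measurable m. integrable m (\<lambda>x. cmod (f x) powr p)}"

definition Lp_norm :: "'g measure \<Rightarrow> real \<Rightarrow> ('g \<Rightarrow> complex) \<Rightarrow> real" where
  "Lp_norm m p f = (LINT x|m. cmod (f x) powr p) powr (1 / p)"

definition fourier_coeff :: "'g measure \<Rightarrow> ('g \<Rightarrow> complex) \<Rightarrow> ('g \<Rightarrow> complex) \<Rightarrow> complex" where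
  "fourier_coeff m f \<eta> = (LINT x|m. f x * cnj (\<eta> x))"

definition Hp :: "'g::topological_ab_group_add measure \<Rightarrow> ('g \<Rightarrow> complex) set \<Rightarrow> real \<Rightarrow> ('g \<Rightarrow> complex) set" where
  "Hp m T p = {f \<in> Lp m p. \<forall>\<eta>\<in>carrier char_group - T. fourier_coeff m f \<eta> = 0}"

section \<open>Bounded, Fredholm and invertible operators\<close>

definition bounded_operator ::
  "'g measure \<Rightarrow> real \<Rightarrow> ('g \<Rightarrow> complex) set \<Rightarrow> ('g \<Rightarrow> complex) set \<Rightarrow>
   (('g \<Rightarrow> complex) \<Rightarrow> ('g \<Rightarrow> complex)) \<Rightarrow> bool" where
  "bounded_operator m p V W A \<longleftrightarrow>
     (\<forall>f\<in>V. A f \<in> W) \<and>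
     (\<forall>f\<in>V. \<forall>g\<in>V. AE x in m. A (\<lambda>y. f y + g y) x = A f x + A g x) \<and>
     (\<forall>c. \<forall>f\<in>V. AE x in m. A (\<lambda>y. c * f y) x = c * A f x) \<and>
     (\<exists>C. \<forall>f\<in>V. Lp_norm m p (A f) \<le> C * Lp_norm m p f)"

definition op_kernel ::
  "'g measure \<Rightarrow> ('g \<Rightarrow> complex) set \<Rightarrow> (('g \<Rightarrow> complex) \<Rightarrow> ('g \<Rightarrow> complex)) \<Rightarrow> ('g \<Rightarrow> complex) set" where
  "op_kernel m V A = {f \<in> V. AE x in m. A f x = 0}"

definition op_range ::
  "'g measure \<Rightarrow> ('g \<Rightarrow> complex) set \<Rightarrow> (('g \<Rightarrow> complex) \<Rightarrow> ('g \<Rightarrow> complex)) \<Rightarrow> ('g \<Rightarrow> complex) set" where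
  "op_range m V A = {g \<in> V. \<exists>f\<in>V. AE x in m. g x = A f x}"

definition null_functions :: "'g measure \<Rightarrow> ('g \<Rightarrow> complex) set" where
  "null_functions m = {f \<in> borel_measurable m. AE x in m. f x = 0}"

text \<open>For linear subspaces \<open>V\<close> and \<open>N\<close>, the quotient \<open>(V + N) / N\<close> has finite dimension.\<close>

definition finite_dim_modulo :: "('g \<Rightarrow> complex) set \<Rightarrow> ('g \<Rightarrow> complex) set \<Rightarrow> bool" where
  "finite_dim_modulo V N \<longleftrightarrow>
     (\<exists>B. finite B \<and> B \<subseteq> V \<and>
        (\<forall>f\<in>V. \<exists>c. \<exists>h\<in>N. f = (\<lambda>x. (\<Sum>b\<in>B. c b * b x) + h x)))"

definition closed_subspace :: "'g measure \<Rightarrow> real \<Rightarrow> ('g \<Rightarrow> complex) set \<Rightarrow> ('g \<Rightarrow> complex) set \<Rightarrow> bool" where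
  "closed_subspace m p V W \<longleftrightarrow> W \<subseteq> V \<and>
     (\<forall>u f. (\<forall>n::nat. u n \<in> W) \<and> f \<in> V \<and> (\<lambda>n. Lp_norm m p (\<lambda>x. u n x - f x)) \<longlonglongrightarrow> 0 \<longrightarrow> f \<in> W)"

definition fredholm ::
  "'g measure \<Rightarrow> real \<Rightarrow> ('g \<Rightarrow> complex) set \<Rightarrow> (('g \<Rightarrow> complex) \<Rightarrow> ('g \<Rightarrow> complex)) \<Rightarrow> bool" where
  "fredholm m p V A \<longleftrightarrow>
     bounded_operator m p V V A \<and>
     closed_subspace m p V (op_range m V A) \<and>
     finite_dim_modulo (op_kernel m V A) (null_functions m) \<and>
     finite_dim_modulo V (op_range m V A)"

definition invertible_operator ::
  "'g measure \<Rightarrow> real \<Rightarrow> ('g \<Rightarrow> complex) set \<Rightarrow> (('g \<Rightarrow> complex) \<Rightarrow> ('g \<Rightarrow> complex)) \<Rightarrow> bool" where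
  "invertible_operator m p V A \<longleftrightarrow>
     bounded_operator m p V V A \<and>
     (\<exists>S. bounded_operator m p V V S \<and>
        (\<forall>f\<in>V. AE x in m. S (A f) x = f x) \<and>
        (\<forall>f\<in>V. AE x in m. A (S f) x = f x))"

section \<open>Riesz projection and Toeplitz operators\<close>

definition trig_poly :: "('g \<Rightarrow> complex) set \<Rightarrow> (('g \<Rightarrow> complex) \<Rightarrow> complex) \<Rightarrow> 'g \<Rightarrow> complex" where
  "trig_poly M c x = (\<Sum>\<eta>\<in>M. c \<eta> * \<eta> x)"

definition is_riesz_extension ::
  "'g::topological_ab_group_add measure \<Rightarrow> ('g \<Rightarrow> complex) set \<Rightarrow> real \<Rightarrow>
   (('g \<Rightarrow> complex) \<Rightarrow> ('g \<Rightarrow> complex)) \<Rightarrow> bool" where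
  "is_riesz_extension m T p P \<longleftrightarrow>
     bounded_operator m p (Lp m p) (Hp m T p) P \<and>
     (\<forall>M c. finite M \<and> M \<subseteq> carrier char_group \<longrightarrow>
        (AE x in m. P (trig_poly M c) x = trig_poly (M \<inter> T) c x))"

text \<open>For linearly ordered characters and \<open>1 < p < \<infinity>\<close> a bounded extension exists (Bochner--Helson).
  Trigonometric polynomials being dense in \<open>L\<^sup>p\<close>, any two of them agree almost everywhere on each
  function in \<open>L\<^sup>p\<close>, so the choice below is immaterial.\<close>

definition riesz_projection ::
  "'g::topological_ab_group_add measure \<Rightarrow> ('g \<Rightarrow> complex) set \<Rightarrow> real \<Rightarrow>
   ('g \<Rightarrow> complex) \<Rightarrow> ('g \<Rightarrow> complex)" where
  "riesz_projection m T p = (SOME P. is_riesz_extension m T p P)"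

definition toeplitz ::
  "'g::topological_ab_group_add measure \<Rightarrow> ('g \<Rightarrow> complex) set \<Rightarrow> real \<Rightarrow> ('g \<Rightarrow> complex) \<Rightarrow>
   ('g \<Rightarrow> complex) \<Rightarrow> ('g \<Rightarrow> complex)" where
  "toeplitz m T p \<phi> f = riesz_projection m T p (\<lambda>x. \<phi> x * f x)"

end

theory Submission
  imports Defs
begin

text \<open>A continuous symbol \<open>\<phi>\<close> with a zero is almost annihilated by trigonometric polynomials, which can be
  shifted into \<open>H\<^sup>p\<close> and away from the finite-dimensional kernel; since \<open>T\<^sub>\<phi>\<close> has closed range, it is
  bounded below modulo its kernel, so \<open>\<phi>\<close> has no zeros. As \<open>G\<close> is connected, \<open>\<phi> = \<zeta> exp g\<close> with a
  character \<open>\<zeta>\<close> and a continuous \<open>g\<close>. Approximating \<open>g\<close> by a trigonometric polynomial gives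
  \<open>exp g = exp b \<sdot> (1 + \<theta>) \<sdot> exp a\<close> with \<open>a\<close> analytic, \<open>b\<close> antianalytic and \<open>\<theta>\<close> small; the outer factors
  are inverted explicitly and the middle one by a Neumann series, so the Toeplitz operator of \<open>exp g\<close> is invertible.
  If \<open>\<zeta> \<noteq> 1\<close>, the kernel or the cokernel of \<open>T\<^sub>\<phi>\<close> would have the dimension of the number of characters
  between \<open>1\<close> and \<open>\<zeta>\<^sup>\<plusminus>\<^sup>1\<close>. This number is infinite: otherwise there is a least positive character,
  and by the Archimedean property it generates \<open>X \<cong> \<int>\<close>.\<close>

section \<open>The spaces \<open>L\<^sup>p\<close>\<close>

text \<open>The Toeplitz operator is built on some bounded extension of the Riesz projection, so
  nothing is known about it until such an extension exists (Bochner-Helson). That theorem and the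
  uniqueness of Fourier coefficients both rest on the density of trigonometric polynomials, hence on
  enough characters; these are found as minimal idempotents of the convolution algebra of G. From
  then on elements of \<open>H\<^sup>p\<close> are compared only through their coefficients:
  \<open>P f\<close> is the element of \<open>H\<^sup>p\<close> that agrees with f on T.
  Multiplication by an analytic function therefore preserves \<open>H\<^sup>p\<close>, and
  multiplication by an antianalytic one preserves agreement on T; this is why the outer exponential
  factors can be cancelled one by one. Finite dimension is used through coefficients as well:
  finitely many of them control the norm on a finite-dimensional space, and such a space cannot
  produce all unit vectors on an infinite set of characters. On the circle, where X is \<int>, the
  shift is Fredholm of index -1 and not invertible, so an argument that ignored the kind of order
  could not succeed.\<close>

lemma Lp_norm_nonneg [simp]: "0 \<le> Lp_norm m p f"
  by (simp add: Lp_norm_def)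

lemma Lp_norm_powr: "0 < p \<Longrightarrow> Lp_norm m p f powr p = (LINT x|m. cmod (f x) powr p)"
  by (simp add: Lp_norm_def powr_powr)

lemma Lp_norm_le_iff:
  assumes "0 < p" "0 \<le> B"
  shows "Lp_norm m p f \<le> B \<longleftrightarrow> (LINT x|m. cmod (f x) powr p) \<le> B powr p"
  using assms Lp_norm_powr[of p m f] powr_le_cancel_iff
  by (metis Lp_norm_nonneg powr_mono2 powr_less_mono2 less_eq_real_def not_le)

lemma Lp_measurable: "f \<in> Lp m p \<Longrightarrow> f \<in> borel_measurable m"
  by (simp add: Lp_def)

lemma Lp_integrable: "f \<in> Lp m p \<Longrightarrow> integrable m (\<lambda>x. cmod (f x) powr p)"
  by (simp add: Lp_def)

lemma Lp_dominated:
  assumes "f \<in> Lp m p" "g \<in> borel_measurable m" "AE x in m. cmod (g x) \<le> cmod (f x)" "0 < p"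
  shows "g \<in> Lp m p"
proof -
  have "integrable m (\<lambda>x. cmod (g x) powr p)"
    by (rule Bochner_Integration.integrable_bound[OF Lp_integrable[OF assms(1)]])
       (use assms in \<open>auto intro!: powr_mono2 elim!: eventually_mono\<close>)
  then show ?thesis using assms by (simp add: Lp_def)
qed

lemma Lp_norm_mono:
  assumes "f \<in> Lp m p" "g \<in> borel_measurable m" "AE x in m. cmod (g x) \<le> cmod (f x)" "0 < p"
  shows "Lp_norm m p g \<le> Lp_norm m p f"
  unfolding Lp_norm_def
  by (intro powr_mono2 integral_mono_AE Lp_integrable[OF assms(1)] Lp_integrable[OF Lp_dominated[OF assms]])
     (use assms in \<open>auto intro!: powr_mono2 elim!: eventually_mono\<close>)

lemma Lp_norm_cong_AE:
  assumes "AE x in m. f x = g x" "f \<in> borel_measurable m" "g \<in> borel_measurable m"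
  shows "Lp_norm m p f = Lp_norm m p g"
proof -
  have "(LINT x|m. cmod (f x) powr p) = (LINT x|m. cmod (g x) powr p)"
    by (rule integral_cong_AE) (use assms in \<open>auto elim!: eventually_mono\<close>)
  then show ?thesis by (simp add: Lp_norm_def)
qed

lemma Lp_norm_eq_0_iff:
  assumes "f \<in> Lp m p" "0 < p"
  shows "Lp_norm m p f = 0 \<longleftrightarrow> (AE x in m. f x = 0)"
proof -
  have "Lp_norm m p f = 0 \<longleftrightarrow> (LINT x|m. cmod (f x) powr p) = 0"
    using assms by (simp add: Lp_norm_def)
  also have "\<dots> \<longleftrightarrow> (AE x in m. cmod (f x) powr p = 0)"
    by (rule integral_nonneg_eq_0_iff_AE[OF Lp_integrable[OF assms(1)]]) simp
  finally show ?thesis by simp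
qed

lemma Lp_norm_zero [simp]: "Lp_norm m p (\<lambda>x. 0) = 0"
  by (simp add: Lp_norm_def)

lemma Lp_zero [simp]: "(\<lambda>x. 0) \<in> Lp m p"
  by (simp add: Lp_def)

lemma Lp_cmult: "f \<in> Lp m p \<Longrightarrow> (\<lambda>x. c * f x) \<in> Lp m p"
  by (auto simp: Lp_def norm_mult powr_mult)

lemma Lp_norm_cmult:
  assumes "0 < p"
  shows "Lp_norm m p (\<lambda>x. c * f x) = cmod c * Lp_norm m p f"
  using assms by (simp add: Lp_norm_def norm_mult powr_mult powr_powr)

text \<open>Convexity of the power on the closed half-line. If an argument is 0, the claim reduces
  to s powr p \<le> s for 0 < s < 1.\<close>

lemma convex_powr_nonneg:
  fixes a b t p :: real
  assumes "0 \<le> a" "0 \<le> b" "0 < t" "t < 1" "1 \<le> p"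
  shows "(t * a + (1 - t) * b) powr p \<le> t * a powr p + (1 - t) * b powr p"
proof -
  have small: "s powr p \<le> s" if "0 < s" "s < 1" for s :: real
    using powr_mono'[of 1 p s] that assms by simp
  consider "a = 0" | "b = 0" | "0 < a" "0 < b" using assms by force
  then show ?thesis
  proof cases
    case 1
    have "(1 - t) powr p * b powr p \<le> (1 - t) * b powr p"
      by (intro mult_right_mono small) (use assms in auto)
    then show ?thesis using 1 assms by (simp add: powr_mult)
  next
    case 2
    have "t powr p * a powr p \<le> t * a powr p"
      by (intro mult_right_mono small) (use assms in auto)
    then show ?thesis using 2 assms by (simp add: powr_mult)
  next
    case 3
    then show ?thesis
      using convex_onD[OF powr_convex[OF assms(5)], of "1 - t" a b] assms by simp
  qed
qed

text \<open>(f + g) / (a + b) is the convex combination of f / a and g / b with weights a / (a + b)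
  and b / (a + b); convexity of the p-th power is integrated. Positive upper bounds a, b in place of
  the norms avoid a division by zero, and they exceed the norms by as little as desired.\<close>

lemma Lp_add_and_Minkowski:
  assumes f: "f \<in> Lp m p" and g: "g \<in> Lp m p" and p: "1 \<le> p"
  shows "(\<lambda>x. f x + g x) \<in> Lp m p \<and> Lp_norm m p (\<lambda>x. f x + g x) \<le> Lp_norm m p f + Lp_norm m p g"
proof -
  let ?N = "Lp_norm m p"
  have [measurable]: "f \<in> borel_measurable m" "g \<in> borel_measurable m"
    using f g by (auto simp: Lp_def)
  have key: "(\<lambda>x. f x + g x) \<in> Lp m p \<and> ?N (\<lambda>x. f x + g x) \<le> a + b"
    if a: "?N f \<le> a" "0 < a" and b: "?N g \<le> b" "0 < b" for a b
  proof -
    define t where "t = a / (a + b)"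
    have t: "0 < t" "t < 1" "1 - t = b / (a + b)"
      using a b by (auto simp: t_def field_simps)
    have pw: "cmod (f x + g x) powr p
        \<le> (a + b) powr p * (t * (cmod (f x) powr p / a powr p) + (1 - t) * (cmod (g x) powr p / b powr p))"
      (is "_ \<le> ?h x") for x
    proof -
      have "cmod (f x + g x) \<le> (a + b) * (t * (cmod (f x) / a) + (1 - t) * (cmod (g x) / b))"
      proof -
        have "(a + b) * t = a" "(a + b) * (1 - t) = b" using a b by (auto simp: t_def field_simps)
        then have "(a + b) * (t * (cmod (f x) / a) + (1 - t) * (cmod (g x) / b))
            = a * (cmod (f x) / a) + b * (cmod (g x) / b)"
          by (metis distrib_left mult.assoc)
        then show ?thesis using a b norm_triangle_ineq[of "f x" "g x"] by simp
      qed
      then have "cmod (f x + g x) powr p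
          \<le> ((a + b) * (t * (cmod (f x) / a) + (1 - t) * (cmod (g x) / b))) powr p"
        using p by (intro powr_mono2) auto
      also have "\<dots> = (a + b) powr p * (t * (cmod (f x) / a) + (1 - t) * (cmod (g x) / b)) powr p"
        using a b t by (subst powr_mult) auto
      also have "\<dots> \<le> (a + b) powr p * (t * (cmod (f x) / a) powr p + (1 - t) * (cmod (g x) / b) powr p)"
        using a b t p by (intro mult_left_mono convex_powr_nonneg) auto
      finally show ?thesis using a b by (simp add: powr_divide)
    qed
    have int: "integrable m ?h"
      using f g by (intro integrable_mult_right Bochner_Integration.integrable_add integrable_divide)
        (auto simp: Lp_def)
    have i: "integrable m (\<lambda>x. cmod (f x + g x) powr p)"
      by (rule Bochner_Integration.integrable_bound[OF int]) (use pw in \<open>auto intro: order_trans[OF _ abs_ge_self]\<close>)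
    have "(LINT x|m. cmod (f x + g x) powr p) \<le> (LINT x|m. ?h x)"
      by (rule integral_mono[OF i int pw])
    also have "\<dots> = (a + b) powr p * (t * ((LINT x|m. cmod (f x) powr p) / a powr p)
        + (1 - t) * ((LINT x|m. cmod (g x) powr p) / b powr p))"
      using f g by (simp add: Lp_def)
    also have "\<dots> \<le> (a + b) powr p * (t * 1 + (1 - t) * 1)"
      using a b t p Lp_norm_le_iff[of p a m f] Lp_norm_le_iff[of p b m g]
      by (intro mult_left_mono add_mono) auto
    finally have "?N (\<lambda>x. f x + g x) \<le> a + b"
      using a b p by (subst Lp_norm_le_iff) auto
    with i show ?thesis by (simp add: Lp_def)
  qed
  have "?N (\<lambda>x. f x + g x) \<le> ?N f + ?N g + e" if "0 < e" for e
    using key[of "?N f + e/2" "?N g + e/2"] that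
    by (simp add: add_nonneg_pos)
  then have "?N (\<lambda>x. f x + g x) \<le> ?N f + ?N g"
    by (rule field_le_epsilon)
  moreover have "(\<lambda>x. f x + g x) \<in> Lp m p"
    using key[of "?N f + 1" "?N g + 1"] by (simp add: add_nonneg_pos)
  ultimately show ?thesis by simp
qed

lemmas Lp_add = conjunct1[OF Lp_add_and_Minkowski]
lemmas Lp_norm_triangle = conjunct2[OF Lp_add_and_Minkowski]

lemma Lp_uminus: "f \<in> Lp m p \<Longrightarrow> (\<lambda>x. - f x) \<in> Lp m p"
  using Lp_cmult[of f m p "-1"] by simp

lemma Lp_norm_uminus [simp]: "Lp_norm m p (\<lambda>x. - f x) = Lp_norm m p f"
  by (simp add: Lp_norm_def)

lemma Lp_norm_minus_commute: "Lp_norm m p (\<lambda>x. f x - g x) = Lp_norm m p (\<lambda>x. g x - f x)"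
  by (simp add: Lp_norm_def norm_minus_commute)

lemma Lp_diff: "f \<in> Lp m p \<Longrightarrow> g \<in> Lp m p \<Longrightarrow> 1 \<le> p \<Longrightarrow> (\<lambda>x. f x - g x) \<in> Lp m p"
  using Lp_add[of f m p "\<lambda>x. - g x"] by (simp add: Lp_uminus)

lemma Lp_norm_triangle_diff:
  "f \<in> Lp m p \<Longrightarrow> g \<in> Lp m p \<Longrightarrow> 1 \<le> p \<Longrightarrow> Lp_norm m p (\<lambda>x. f x - g x) \<le> Lp_norm m p f + Lp_norm m p g"
  using Lp_norm_triangle[of f m p "\<lambda>x. - g x"] by (simp add: Lp_uminus)

lemma Lp_norm_diff_triangle:
  assumes "f \<in> Lp m p" "g \<in> Lp m p" "h \<in> Lp m p" "1 \<le> p"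
  shows "Lp_norm m p (\<lambda>x. f x - h x) \<le> Lp_norm m p (\<lambda>x. f x - g x) + Lp_norm m p (\<lambda>x. g x - h x)"
  using Lp_norm_triangle[of "\<lambda>x. f x - g x" m p "\<lambda>x. g x - h x"] assms by (simp add: Lp_diff)

lemma Lp_norm_le_add_diff:
  assumes "f \<in> Lp m p" "g \<in> Lp m p" "1 \<le> p"
  shows "Lp_norm m p f \<le> Lp_norm m p g + Lp_norm m p (\<lambda>x. f x - g x)"
  using Lp_norm_triangle[of g m p "\<lambda>x. f x - g x"] assms by (simp add: Lp_diff)

lemma Lp_sum_and_norm:
  assumes "1 \<le> p" "\<And>i. i \<in> I \<Longrightarrow> f i \<in> Lp m p"
  shows "(\<lambda>x. \<Sum>i\<in>I. f i x) \<in> Lp m p \<and> Lp_norm m p (\<lambda>x. \<Sum>i\<in>I. f i x) \<le> (\<Sum>i\<in>I. Lp_norm m p (f i))"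
  using assms
proof (induction I rule: infinite_finite_induct)
  case (insert a I)
  then have "f a \<in> Lp m p" "(\<lambda>x. \<Sum>i\<in>I. f i x) \<in> Lp m p"
      "Lp_norm m p (\<lambda>x. \<Sum>i\<in>I. f i x) \<le> (\<Sum>i\<in>I. Lp_norm m p (f i))"
    by auto
  with Lp_add_and_Minkowski[of "f a" m p "\<lambda>x. \<Sum>i\<in>I. f i x"] insert(1,2,4) show ?case
    by simp
qed auto

text \<open>Young's inequality for f / a and g / b, where a and b are positive bounds of the norms
  that finally tend to them; vanishing norms need no separate treatment.\<close>

lemma Holder:
  assumes f: "f \<in> Lp m p" and g: "g \<in> Lp m q" and pq: "1 < p" "1 < q" "1 / p + 1 / q = 1"
  shows "integrable m (\<lambda>x. f x * g x)"
    and "(LINT x|m. cmod (f x * g x)) \<le> Lp_norm m p f * Lp_norm m q g"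
    and "cmod (LINT x|m. f x * g x) \<le> Lp_norm m p f * Lp_norm m q g"
proof -
  have [measurable]: "f \<in> borel_measurable m" "g \<in> borel_measurable m"
    using f g by (auto simp: Lp_def)
  have key: "integrable m (\<lambda>x. f x * g x) \<and> (LINT x|m. cmod (f x * g x)) \<le> a * b"
    if a: "Lp_norm m p f \<le> a" "0 < a" and b: "Lp_norm m q g \<le> b" "0 < b" for a b
  proof -
    let ?h = "\<lambda>x. (a * b) * (cmod (f x) powr p / a powr p / p + cmod (g x) powr q / b powr q / q)"
    have pw: "cmod (f x * g x) \<le> ?h x" for x
    proof -
      have "(cmod (f x) / a) * (cmod (g x) / b) \<le> (cmod (f x) / a) powr p / p + (cmod (g x) / b) powr q / q"
        using a b pq by (intro Youngs_inequality) auto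
      then have "(a * b) * ((cmod (f x) / a) * (cmod (g x) / b)) \<le> ?h x"
        using a b by (intro mult_left_mono) (auto simp: powr_divide)
      then show ?thesis using a b by (simp add: norm_mult)
    qed
    have int: "integrable m ?h"
      using f g by (intro integrable_mult_right Bochner_Integration.integrable_add integrable_divide)
        (auto simp: Lp_def)
    have i: "integrable m (\<lambda>x. f x * g x)"
      by (rule Bochner_Integration.integrable_bound[OF int])
        (use pw in \<open>auto intro: order_trans[OF _ abs_ge_self]\<close>)
    have "(LINT x|m. cmod (f x * g x)) \<le> (LINT x|m. ?h x)"
      using i by (intro integral_mono int pw integrable_norm)
    also have "\<dots> = (a * b) * ((LINT x|m. cmod (f x) powr p) / a powr p / p + (LINT x|m. cmod (g x) powr q) / b powr q / q)"
      using f g by (simp add: Lp_def)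
    also have "\<dots> \<le> (a * b) * (1 / p + 1 / q)"
      using a b pq Lp_norm_le_iff[of p a m f] Lp_norm_le_iff[of q b m g]
      by (intro mult_left_mono add_mono divide_right_mono) auto
    finally show ?thesis using i pq by simp
  qed
  show i: "integrable m (\<lambda>x. f x * g x)"
    using key[of "Lp_norm m p f + 1" "Lp_norm m q g + 1"] by (simp add: add_nonneg_pos)
  have "((\<lambda>e. (Lp_norm m p f + e) * (Lp_norm m q g + e)) \<longlongrightarrow> (Lp_norm m p f + 0) * (Lp_norm m q g + 0)) (at_right 0)"
    by (intro tendsto_intros)
  moreover have "\<forall>\<^sub>F e in at_right 0. (LINT x|m. cmod (f x * g x)) \<le> (Lp_norm m p f + e) * (Lp_norm m q g + e)"
    using eventually_at_right_less[of "0::real"]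
    by eventually_elim (use key in \<open>auto simp: add_nonneg_pos\<close>)
  ultimately show le: "(LINT x|m. cmod (f x * g x)) \<le> Lp_norm m p f * Lp_norm m q g"
    using tendsto_lowerbound[of _ _ "at_right (0::real)"] by fastforce
  show "cmod (LINT x|m. f x * g x) \<le> Lp_norm m p f * Lp_norm m q g"
    using integral_norm_bound[of m "\<lambda>x. f x * g x"] le by linarith
qed

text \<open>Fatou's lemma.\<close>

lemma Lp_AE_limit:
  assumes p: "0 < p" and fn: "\<And>n. f n \<in> Lp m p" "\<And>n. Lp_norm m p (f n) \<le> B"
    and [measurable]: "g \<in> borel_measurable m"
    and lim: "AE x in m. (\<lambda>n. f n x) \<longlonglongrightarrow> g x"
  shows "g \<in> Lp m p" and "Lp_norm m p g \<le> B"
proof -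
  have [measurable]: "f n \<in> borel_measurable m" for n using fn by (auto simp: Lp_def)
  have B: "0 \<le> B" using fn(2)[of 0] Lp_norm_nonneg order_trans by blast
  have "(\<integral>\<^sup>+x. ennreal (cmod (g x) powr p) \<partial>m) = (\<integral>\<^sup>+x. liminf (\<lambda>n. ennreal (cmod (f n x) powr p)) \<partial>m)"
  proof (rule nn_integral_cong_AE)
    show "AE x in m. ennreal (cmod (g x) powr p) = liminf (\<lambda>n. ennreal (cmod (f n x) powr p))"
      using lim
    proof eventually_elim
      case (elim x)
      have "(\<lambda>n. ennreal (cmod (f n x) powr p)) \<longlonglongrightarrow> ennreal (cmod (g x) powr p)"
        using p elim by (intro tendsto_ennrealI tendsto_powr2 tendsto_norm) auto
      then show ?case by (intro lim_imp_Liminf[symmetric]) auto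
    qed
  qed
  also have "\<dots> \<le> liminf (\<lambda>n. \<integral>\<^sup>+x. ennreal (cmod (f n x) powr p) \<partial>m)"
    by (rule nn_integral_liminf) auto
  also have "\<dots> \<le> ennreal (B powr p)"
  proof (rule Liminf_le)
    have "(\<integral>\<^sup>+x. ennreal (cmod (f n x) powr p) \<partial>m) \<le> ennreal (B powr p)" for n
    proof -
      have "(\<integral>\<^sup>+x. ennreal (cmod (f n x) powr p) \<partial>m) = ennreal (LINT x|m. cmod (f n x) powr p)"
        using fn by (intro nn_integral_eq_integral) (auto simp: Lp_def)
      then show ?thesis using fn(2)[of n] p B by (simp add: Lp_norm_le_iff ennreal_leI)
    qed
    then show "\<forall>\<^sub>F n in sequentially. (\<integral>\<^sup>+x. ennreal (cmod (f n x) powr p) \<partial>m) \<le> ennreal (B powr p)"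
      by simp
  qed simp
  finally have fin: "(\<integral>\<^sup>+x. ennreal (cmod (g x) powr p) \<partial>m) \<le> ennreal (B powr p)" .
  have i: "integrable m (\<lambda>x. cmod (g x) powr p)"
    by (rule integrableI_bounded) (use fin in \<open>auto simp: order.strict_trans1\<close>)
  then show "g \<in> Lp m p" by (simp add: Lp_def)
  have "ennreal (LINT x|m. cmod (g x) powr p) \<le> ennreal (B powr p)"
    using fin nn_integral_eq_integral[OF i] by simp
  then show "Lp_norm m p g \<le> B"
    using p B by (simp add: Lp_norm_le_iff)
qed


text \<open>Holder's inequality against the constant 1, whose norm is 1 for every exponent because
  the total mass is 1.\<close>

lemma Lp_integrable_and_norm:
  assumes f: "f \<in> Lp m p" and p: "1 < p" and m: "emeasure m (space m) = 1"
  shows "integrable m f" and "(LINT x|m. cmod (f x)) \<le> Lp_norm m p f"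
proof -
  have "measure m (space m) = 1" using m by (simp add: measure_def)
  moreover have "integrable m (\<lambda>x. 1 :: real)"
    using m by (auto intro!: integrableI_bounded)
  ultimately have 1: "(\<lambda>x. 1) \<in> Lp m q" "Lp_norm m q (\<lambda>x. 1) = 1" for q
    by (auto simp: Lp_def Lp_norm_def)
  have pq: "1 < p / (p - 1)" "1 / p + 1 / (p / (p - 1)) = 1"
    using p by (auto simp: field_simps)
  show "integrable m f"
    using Holder(1)[OF f 1(1) p pq] by simp
  show "(LINT x|m. cmod (f x)) \<le> Lp_norm m p f"
    using Holder(2)[OF f 1(1) p pq] 1(2) by simp
qed

text \<open>The series of the \<open>L\<^sup>1\<close> norms converges too, so the series converges
  absolutely almost everywhere; the tail estimate is Fatou's lemma for its partial sums. This
  quantitative form also serves the Neumann series and the open mapping theorem.\<close>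

lemma Lp_series_complete:
  assumes p: "1 < p" and m: "emeasure m (space m) = 1"
    and f: "\<And>n. f n \<in> Lp m p" and sum: "summable (\<lambda>n. Lp_norm m p (f n))"
  shows "\<exists>s\<in>Lp m p. \<forall>n. Lp_norm m p (\<lambda>x. s x - (\<Sum>k<n. f k x)) \<le> (\<Sum>k. Lp_norm m p (f (k + n)))"
proof -
  have [measurable]: "f n \<in> borel_measurable m" for n using f by (auto simp: Lp_def)
  have "summable (\<lambda>n. LINT x|m. cmod (f n x))"
    by (rule summable_comparison_test'[OF sum, of 0])
       (use Lp_integrable_and_norm(2)[OF f p m] in auto)
  moreover have i: "integrable m (\<lambda>x. cmod (f n x))" for n
    using Lp_integrable_and_norm(1)[OF f p m] by simp
  ultimately have "(\<integral>\<^sup>+x. (\<Sum>n. ennreal (cmod (f n x))) \<partial>m) \<noteq> \<infinity>"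
    by (subst nn_integral_suminf) (auto simp: nn_integral_eq_integral suminf_ennreal_eq sums_iff)
  then have "AE x in m. (\<Sum>n. ennreal (cmod (f n x))) \<noteq> \<infinity>"
    by (intro nn_integral_noteq_infinite) auto
  then have conv: "AE x in m. summable (\<lambda>n. f n x)"
  proof eventually_elim
    case (elim x)
    have "summable (\<lambda>n. cmod (f n x))"
      by (rule summable_suminf_not_top) (use elim in simp_all)
    then show ?case by (rule summable_norm_cancel)
  qed
  define s where "s x = (\<Sum>n. f n x)" for x
  have [measurable]: "s \<in> borel_measurable m" unfolding s_def by measurable
  have *: "(\<lambda>x. s x - (\<Sum>k<n. f k x)) \<in> Lp m p \<and>
      Lp_norm m p (\<lambda>x. s x - (\<Sum>k<n. f k x)) \<le> (\<Sum>k. Lp_norm m p (f (k + n)))" for n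
  proof -
    have 1: "AE x in m. (\<lambda>j. \<Sum>k<j. f (k + n) x) \<longlonglongrightarrow> s x - (\<Sum>k<n. f k x)"
      using conv
    proof eventually_elim
      case (elim x)
      then have "(\<lambda>k. f (k + n) x) sums (s x - (\<Sum>k<n. f k x))"
        unfolding s_def by (subst sums_iff_shift) (simp add: summable_sums)
      then show ?case by (simp add: sums_def)
    qed
    have 2: "Lp_norm m p (\<lambda>x. \<Sum>k<j. f (k + n) x) \<le> (\<Sum>k. Lp_norm m p (f (k + n)))" for j
    proof -
      have "Lp_norm m p (\<lambda>x. \<Sum>k<j. f (k + n) x) \<le> (\<Sum>k<j. Lp_norm m p (f (k + n)))"
        using Lp_sum_and_norm[of p "{..<j}" "\<lambda>k. f (k + n)"] p f by auto
      also have "\<dots> \<le> (\<Sum>k. Lp_norm m p (f (k + n)))"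
        using summable_ignore_initial_segment[OF sum, of n] by (intro sum_le_suminf) auto
      finally show ?thesis .
    qed
    have 3: "(\<lambda>x. \<Sum>k<j. f (k + n) x) \<in> Lp m p" for j
      using Lp_sum_and_norm[of p "{..<j}" "\<lambda>k. f (k + n)"] p f by auto
    have 4: "(\<lambda>x. s x - (\<Sum>k<n. f k x)) \<in> borel_measurable m" by measurable
    have "0 < p" using p by simp
    note lim = Lp_AE_limit[OF this 3 2 4 1]
    show ?thesis using lim by simp
  qed
  then show ?thesis using *[of 0] by (intro bexI[of _ s]) auto
qed

lemma Lp_complete:
  assumes p: "1 < p" and m: "emeasure m (space m) = 1" and f: "\<And>n. f n \<in> Lp m p"
    and cauchy: "\<And>e. 0 < e \<Longrightarrow> \<exists>M. \<forall>i\<ge>M. \<forall>j\<ge>M. Lp_norm m p (\<lambda>x. f i x - f j x) < e"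
  shows "\<exists>s\<in>Lp m p. (\<lambda>n. Lp_norm m p (\<lambda>x. f n x - s x)) \<longlonglongrightarrow> 0"
proof -
  have "\<exists>M. \<forall>i\<ge>M. \<forall>j\<ge>M. Lp_norm m p (\<lambda>x. f i x - f j x) < (1/2)^k" for k :: nat
    by (rule cauchy) simp
  then obtain M where M: "\<And>k i j. M k \<le> i \<Longrightarrow> M k \<le> j \<Longrightarrow> Lp_norm m p (\<lambda>x. f i x - f j x) < (1/2)^k"
    by metis
  \<comment> \<open>Summing the thresholds makes r increasing while still r k \<ge> M k, so
    consecutive terms of the subsequence differ by less than (1/2)^k.\<close>
  define r where "r k = (\<Sum>i\<le>k. M i)" for k
  have rM: "M k \<le> r k" "r k \<le> r (Suc k)" for k by (auto simp: r_def intro: member_le_sum)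
  define d where "d k x = f (r (Suc k)) x - f (r k) x" for k x
  have dL: "d k \<in> Lp m p" for k unfolding d_def using p f by (intro Lp_diff) auto
  have dN: "Lp_norm m p (d k) \<le> (1/2)^k" for k
    unfolding d_def using M[of k "r (Suc k)" "r k"] rM[of k] by linarith
  have sm: "summable (\<lambda>k. Lp_norm m p (d k))"
    by (rule summable_comparison_test'[where g = "\<lambda>k. (1/2)^k" and N = 0])
       (use dN in \<open>auto intro: summable_geometric\<close>)
  obtain s where s: "s \<in> Lp m p"
    "\<And>n. Lp_norm m p (\<lambda>x. s x - (\<Sum>k<n. d k x)) \<le> (\<Sum>k. Lp_norm m p (d (k + n)))"
    using Lp_series_complete[OF p m dL sm] by blast
  have tel: "(\<Sum>k<n. d k x) = f (r n) x - f (r 0) x" for n x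
    unfolding d_def by (rule sum_lessThan_telescope)
  define t where "t x = s x + f (r 0) x" for x
  have t: "t \<in> Lp m p" unfolding t_def using p s f by (intro Lp_add) auto
  have sub: "Lp_norm m p (\<lambda>x. f (r n) x - t x) \<le> (\<Sum>k. Lp_norm m p (d (k + n)))" for n
    using s(2)[of n] Lp_norm_minus_commute[of m p t "f (r n)"]
    by (simp add: t_def tel algebra_simps)
  have tail: "(\<lambda>n. \<Sum>k. Lp_norm m p (d (k + n))) \<longlonglongrightarrow> 0"
    using suminf_exist_split[OF _ sm] by (auto simp: LIMSEQ_iff) 
  have "(\<lambda>n. Lp_norm m p (\<lambda>x. f n x - t x)) \<longlonglongrightarrow> 0"
  proof (rule LIMSEQ_I)
    fix e :: real assume e: "0 < e"
    obtain K where K: "\<And>i j. K \<le> i \<Longrightarrow> K \<le> j \<Longrightarrow> Lp_norm m p (\<lambda>x. f i x - f j x) < e/2"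
      using cauchy[of "e/2"] e by auto
    have "\<forall>\<^sub>F n in sequentially. (\<Sum>k. Lp_norm m p (d (k + n))) < e/2"
      using tail e by (intro order_tendstoD) auto
    moreover obtain k0 where "(1/2)^k0 < e/2" using real_arch_pow_inv[of "e/2" "1/2"] e by auto
    ultimately obtain n where n: "(\<Sum>k. Lp_norm m p (d (k + n))) < e/2" "(1/2)^n < e/2"
      using eventually_conj[of "\<lambda>n. (\<Sum>k. Lp_norm m p (d (k + n))) < e/2" sequentially "\<lambda>n. (1/2)^n < e/2"]
        order_tendstoD(2)[OF LIMSEQ_realpow_zero[of "1/2"], of "e/2"] e
      by (auto simp: eventually_sequentially)
    have "Lp_norm m p (\<lambda>x. f i x - t x) < e" if "M n \<le> i" for i
    proof -
      have "Lp_norm m p (\<lambda>x. f i x - t x)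
          \<le> Lp_norm m p (\<lambda>x. f i x - f (r n) x) + Lp_norm m p (\<lambda>x. f (r n) x - t x)"
        using p by (intro Lp_norm_diff_triangle f t) auto
      also have "\<dots> < e/2 + e/2"
        using M[of n i "r n"] that rM[of n] n sub[of n] by linarith
      finally show ?thesis by simp
    qed
    then show "\<exists>no. \<forall>i\<ge>no. norm (Lp_norm m p (\<lambda>x. f i x - t x) - 0) < e" by auto
  qed
  then show ?thesis using t by blast
qed

section \<open>Convolution on a compact group\<close>

locale compact_haar =
  fixes m :: "'g::{topological_ab_group_add, t2_space} measure"
  assumes compact_UNIV: "compact (UNIV :: 'g set)"
    and haar: "normalized_haar m"
begin

lemma sets_m: "sets m = sets borel"
  using haar by (simp add: normalized_haar_def)

lemma space_m [simp]: "space m = UNIV"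
  using sets_eq_imp_space_eq[OF sets_m] by simp

lemma emeasure_space_m: "emeasure m (space m) = 1"
  using haar by (simp add: normalized_haar_def)

lemma emeasure_UNIV [simp]: "emeasure m UNIV = 1"
  using emeasure_space_m by simp

lemma measure_UNIV [simp]: "measure m UNIV = 1"
  by (simp add: measure_def)

sublocale finite_measure m
  by standard simp

lemma continuous_measurable:
  fixes f :: "'g \<Rightarrow> 'b::topological_space"
  assumes "continuous_on UNIV f"
  shows "f \<in> borel_measurable m"
  using borel_measurable_continuous_onI[OF assms] measurable_cong_sets[OF sets_m refl] by auto

lemma continuous_bounded:
  fixes f :: "'g \<Rightarrow> 'b::real_normed_vector"
  assumes "continuous_on UNIV f"
  obtains B where "0 < B" "\<And>x. norm (f x) \<le> B"
proof -
  have "bounded (range f)"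
    using compact_continuous_image[OF assms compact_UNIV] compact_imp_bounded by blast
  then show ?thesis using that unfolding bounded_pos by auto
qed

lemma continuous_integrable:
  fixes f :: "'g \<Rightarrow> 'b::{banach, second_countable_topology}"
  assumes "continuous_on UNIV f"
  shows "integrable m f"
  using continuous_bounded[OF assms] continuous_measurable[OF assms]
  by (metis (no_types, lifting) AE_I2 integrable_const_bound)

lemma emeasure_translation:
  assumes "A \<in> sets borel"
  shows "emeasure m ((\<lambda>x. a + x) ` A) = emeasure m A"
  using haar assms unfolding normalized_haar_def by blast

lemma continuous_positive_lower_bound:
  fixes u :: "'g \<Rightarrow> real"
  assumes u: "continuous_on UNIV u" "\<And>x. 0 < u x"
  obtains d where "0 < d" "\<And>x. d \<le> u x"
proof -
  obtain x0 where "\<And>x. u x0 \<le> u x"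
    using continuous_attains_inf[OF compact_UNIV _ u(1)] by auto
  then show ?thesis using that[of "u x0"] u(2) by blast
qed

lemma translation_measurable: "(\<lambda>x. x + a) \<in> measurable m m"
proof -
  have "(\<lambda>x. x + a) \<in> borel_measurable borel"
    by (intro borel_measurable_continuous_onI continuous_intros)
  then show ?thesis using measurable_cong_sets[OF sets_m sets_m] by auto
qed

lemma distr_translation: "distr m m (\<lambda>x. x + a) = m"
proof (rule measure_eqI)
  fix A assume "A \<in> sets (distr m m (\<lambda>x. x + a))"
  then have A: "A \<in> sets borel" by (simp add: sets_m)
  have "emeasure (distr m m (\<lambda>x. x + a)) A = emeasure m ((\<lambda>x. x + a) -` A)"
    using A by (subst emeasure_distr[OF translation_measurable]) (auto simp: sets_m)
  also have "(\<lambda>x. x + a) -` A = (\<lambda>x. - a + x) ` A"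
    by (auto simp: image_iff intro!: bexI[of _ "_ + a"])
  also have "emeasure m \<dots> = emeasure m A"
    using A by (rule emeasure_translation)
  finally show "emeasure (distr m m (\<lambda>x. x + a)) A = emeasure m A" .
qed simp

lemma integral_translation:
  fixes f :: "'g \<Rightarrow> 'b::{banach, second_countable_topology}"
  assumes "f \<in> borel_measurable m"
  shows "(LINT x|m. f (x + a)) = (LINT x|m. f x)"
  using integral_distr[OF translation_measurable assms, of a] by (simp add: distr_translation)

lemma integral_translation':
  fixes f :: "'g \<Rightarrow> 'b::{banach, second_countable_topology}"
  assumes "continuous_on UNIV f"
  shows "(LINT x|m. f (a + x)) = (LINT x|m. f x)"
  using integral_translation[OF continuous_measurable[OF assms], of a] by (simp add: add.commute)

text \<open>The tube lemma: the condition on (v, x) is open and contains {0} \<times> G, hence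
  contains V \<times> G for some neighbourhood V of 0.\<close>

lemma uniformly_continuous:
  fixes f :: "'g \<Rightarrow> 'b::metric_space"
  assumes f: "continuous_on UNIV f" and e: "0 < e"
  obtains V where "open V" "0 \<in> V" "\<And>x v. v \<in> V \<Longrightarrow> dist (f (x + v)) (f x) < e"
proof -
  let ?W = "{w. dist (f (snd w + fst w)) (f (snd w)) < e}"
  have "continuous_on UNIV (\<lambda>w. dist (f (snd w + fst w)) (f (snd w)))"
    by (intro continuous_intros continuous_on_compose2[OF f]) auto
  then have o: "open ?W"
    by (intro open_Collect_less continuous_on_const)
  have "{0} \<times> UNIV \<subseteq> ?W" using e by auto
  from Elementary_Topology.tube_lemma[OF compact_UNIV o this]
  obtain V where "0 \<in> V" "open V" "V \<times> UNIV \<subseteq> ?W" by auto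
  then show ?thesis by (intro that[of V]) (auto simp: subset_eq)
qed

lemma open_translate:
  assumes "open (V :: 'g set)"
  shows "open {x. x - y \<in> V}"
proof -
  have "continuous_on UNIV (\<lambda>x. x - y)" by (intro continuous_intros)
  from open_vimage[OF assms this] show ?thesis by (simp add: vimage_def)
qed

text \<open>The centres are listed by natural numbers because \<open>conv_approx\<close> makes the
  cover disjoint in that order.\<close>

lemma finite_cover:
  assumes V: "open (V :: 'g set)" "0 \<in> V"
  obtains n :: nat and h where "\<And>x. \<exists>i<n. x - h i \<in> V"
proof -
  obtain Y where Y: "finite Y" "UNIV \<subseteq> (\<Union>y\<in>Y. {x. x - y \<in> V})"
    using compactE_image[OF compact_UNIV, of UNIV "\<lambda>y. {x. x - y \<in> V}"] open_translate[OF V(1)] V(2)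
    by (metis (no_types, lifting) UNIV_I UN_I diff_self mem_Collect_eq subsetI subset_UNIV)
  then obtain h :: "nat \<Rightarrow> 'g" and n where "Y = h ` {i. i < n}"
    using finite_imp_nat_seg_image_inj_on by metis
  then show ?thesis using Y(2) by (intro that[of n h]) fastforce
qed

text \<open>Finitely many translates of a nonempty open set cover G and have equal measure, so they
  cannot all be null.\<close>

lemma open_null_empty:
  assumes U: "open U" "emeasure m U = 0"
  shows "U = {}"
proof (rule ccontr)
  assume "U \<noteq> {}"
  then obtain u where u: "u \<in> U" by auto
  obtain n :: nat and h where h: "\<And>x. \<exists>i<n. x - h i \<in> {x. x - (- u) \<in> U}"
    using finite_cover[OF open_translate[OF U(1), of "- u"]] u by auto
  have eq: "{x. x - h i - (- u) \<in> U} = (\<lambda>x. (h i - u) + x) ` U" for i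
    by (auto simp: image_iff algebra_simps intro!: bexI[of _ "_ - h i + u"])
  have "emeasure m {x. x - h i - (- u) \<in> U} = 0" for i
    unfolding eq using U by (simp add: emeasure_translation)
  moreover have "{x. x - h i - (- u) \<in> U} \<in> sets m" for i
    using open_translate[OF U(1), of "h i - u"] by (simp add: sets_m algebra_simps)
  ultimately have "(\<Union>i\<in>{..<n}. {x. x - h i - (- u) \<in> U}) \<in> null_sets m"
    by (intro null_sets_UN') auto
  moreover have "(\<Union>i\<in>{..<n}. {x. x - h i - (- u) \<in> U}) = UNIV"
    using h by auto
  ultimately show False by auto
qed

lemma continuous_AE_eq:
  fixes f g :: "'g \<Rightarrow> complex"
  assumes f: "continuous_on UNIV f" and g: "continuous_on UNIV g" and "AE x in m. f x = g x"
  shows "f = g"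
proof -
  have o: "open {x. f x \<noteq> g x}"
    by (rule open_Collect_neq[OF f g])
  have "emeasure m {x. f x \<noteq> g x} = 0"
    using AE_iff_measurable[of "{x. f x \<noteq> g x}" m "\<lambda>x. f x = g x"] assms(3) o by (auto simp: sets_m)
  then have "{x. f x \<noteq> g x} = {}" using open_null_empty o by blast
  then show ?thesis by auto
qed

lemma integral_norm_square_eq_0:
  fixes f :: "'g \<Rightarrow> complex"
  assumes f: "continuous_on UNIV f" and "(LINT x|m. (cmod (f x))\<^sup>2) = 0"
  shows "f = (\<lambda>x. 0)"
proof -
  have "AE x in m. (cmod (f x))\<^sup>2 = 0"
    using assms by (subst integral_nonneg_eq_0_iff_AE[symmetric])
      (auto intro!: continuous_integrable continuous_intros)
  then show ?thesis using f by (intro continuous_AE_eq) auto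
qed

section \<open>Convolution of continuous functions\<close>

definition conv :: "('g \<Rightarrow> complex) \<Rightarrow> ('g \<Rightarrow> complex) \<Rightarrow> 'g \<Rightarrow> complex" where
  "conv f g x = (LINT y|m. f (x - y) * g y)"

lemma continuous_reflect:
  assumes "continuous_on UNIV (f :: 'g \<Rightarrow> complex)"
  shows "continuous_on UNIV (\<lambda>y. f (x - y))" "continuous_on UNIV (\<lambda>y. f (- y))"
  by (rule continuous_on_compose2[OF assms]; auto intro!: continuous_intros)+

lemma continuous_shift:
  assumes "continuous_on UNIV (f :: 'g \<Rightarrow> complex)"
  shows "continuous_on UNIV (\<lambda>y. f (y + x))" "continuous_on UNIV (\<lambda>y. f (y - x))"
  by (rule continuous_on_compose2[OF assms]; auto intro!: continuous_intros)+

lemma conv_integrable: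
  fixes f g :: "'g \<Rightarrow> complex"
  assumes "continuous_on UNIV f" "continuous_on UNIV g"
  shows "integrable m (\<lambda>y. f (x - y) * g y)"
  by (rule continuous_integrable) (intro continuous_on_mult continuous_reflect assms)

lemma integral_norm_le_const:
  fixes f :: "'g \<Rightarrow> complex"
  assumes "continuous_on UNIV f" "\<And>x. cmod (f x) \<le> B"
  shows "cmod (LINT x|m. f x) \<le> B"
proof -
  have "cmod (LINT x|m. f x) \<le> (LINT x|m. cmod (f x))" by (rule integral_norm_bound)
  also have "\<dots> \<le> (LINT x|m. B)"
    using assms by (intro integral_mono continuous_integrable continuous_intros) auto
  finally show ?thesis by simp
qed

lemma conv_norm_le:
  assumes "continuous_on UNIV f" "continuous_on UNIV g" "\<And>x. cmod (f x) \<le> B" "\<And>x. cmod (g x) \<le> C"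
  shows "cmod (conv f g x) \<le> B * C"
  unfolding conv_def
  using assms order_trans[OF norm_ge_zero assms(3)]
  by (intro integral_norm_le_const continuous_intros continuous_reflect) (auto simp: norm_mult intro!: mult_mono)

lemma continuous_conv:
  assumes f: "continuous_on UNIV f" and g: "continuous_on UNIV g"
  shows "continuous_on UNIV (conv f g)"
proof -
  obtain B where B: "0 < B" "\<And>x. cmod (g x) \<le> B" using continuous_bounded[OF g] by blast
  have "\<exists>V. open V \<and> x \<in> V \<and> (\<forall>x'\<in>V. dist (conv f g x') (conv f g x) < e)" if e: "0 < e" for e x
  proof -
    obtain V where V: "open V" "0 \<in> V" "\<And>x v. v \<in> V \<Longrightarrow> dist (f (x + v)) (f x) < e / (2 * B)"
      using uniformly_continuous[OF f, of "e / (2 * B)"] e B by auto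
    have "dist (conv f g x') (conv f g x) < e" if x': "x' - x \<in> V" for x'
    proof -
      have "conv f g x' - conv f g x = (LINT y|m. (f (x' - y) - f (x - y)) * g y)"
        unfolding conv_def left_diff_distrib
        by (rule Bochner_Integration.integral_diff[symmetric]) (intro conv_integrable f g)+
      also have "cmod \<dots> \<le> e / (2 * B) * B"
      proof (rule integral_norm_le_const)
        show "cmod ((f (x' - y) - f (x - y)) * g y) \<le> e / (2 * B) * B" for y
          unfolding norm_mult
          using V(3)[OF x', of "x - y"] B e
          by (intro mult_mono) (auto simp: dist_norm algebra_simps less_imp_le)
      qed (intro continuous_intros continuous_reflect f g)
      also have "\<dots> < e" using e B by simp
      finally show ?thesis by (simp add: dist_norm)
    qed
    then show ?thesis using V open_translate[OF V(1), of x] by (intro exI[of _ "{x'. x' - x \<in> V}"]) auto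
  qed
  then show ?thesis
    unfolding continuous_on_def tendsto_iff eventually_at_topological by (metis UNIV_I)
qed

text \<open>Convolution with \<open>g\<close> is a uniform limit of finite combinations of translations. This
  takes the place of Fubini's theorem, which is not available for a Borel measure on a group that
  is not second countable.\<close>

lemma conv_approx:
  assumes f: "continuous_on UNIV f1" "continuous_on UNIV f2" and g: "continuous_on UNIV g" and e: "0 < e"
  shows "\<exists>(n :: nat) h c.
    (\<forall>x. cmod (conv f1 g x - (\<Sum>i<n. c i * f1 (x - h i))) \<le> e) \<and>
    (\<forall>x. cmod (conv f2 g x - (\<Sum>i<n. c i * f2 (x - h i))) \<le> e) \<and>
    (\<Sum>i<n. c i) = (LINT x|m. g x)"
proof -
  obtain B where B: "0 < B" "\<And>x. cmod (g x) \<le> B" using continuous_bounded[OF g] by blast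
  obtain V1 where V1: "open V1" "0 \<in> V1" "\<And>x v. v \<in> V1 \<Longrightarrow> dist (f1 (x + v)) (f1 x) < e / B"
    using uniformly_continuous[OF f(1), of "e / B"] e B by auto
  obtain V2 where V2: "open V2" "0 \<in> V2" "\<And>x v. v \<in> V2 \<Longrightarrow> dist (f2 (x + v)) (f2 x) < e / B"
    using uniformly_continuous[OF f(2), of "e / B"] e B by auto
  \<comment> \<open>A common neighbourhood gives the same nodes and weights for both functions;
    \<open>conv_right_commute\<close> needs this for f and f * k.\<close>
  have V: "open (V1 \<inter> V2)" "0 \<in> V1 \<inter> V2" using V1 V2 by auto
  obtain n :: nat and h where h: "\<And>x. \<exists>i<n. x - h i \<in> V1 \<inter> V2"
    using finite_cover[OF V] by blast
  define A where "A i = (if i < n then {x. x - h i \<in> V1 \<inter> V2} else {})" for i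
  define D where "D = disjointed A"
  have "range A \<subseteq> sets m" using open_translate[OF V(1)] by (auto simp: A_def sets_m)
  then have D_sets [measurable]: "D i \<in> sets m" for i
    unfolding D_def using sets.range_disjointed_sets by blast
  have D_disj: "disjoint_family D" unfolding D_def by (rule disjoint_family_disjointed)
  have D_sub: "D i \<subseteq> A i" for i unfolding D_def by (rule disjointed_subset)
  have UN: "(\<Union>i. D i) = UNIV"
    unfolding D_def UN_disjointed_eq using h by (auto simp: A_def)
  define s where "s y = (THE i. y \<in> D i)" for y
  have s: "y \<in> D (s y)" "s y < n" and s_eq: "y \<in> D i \<Longrightarrow> i = s y" for y i
  proof -
    obtain j where j: "y \<in> D j" using UN by auto
    have "s y = j" unfolding s_def
      by (rule the_equality) (use j D_disj in \<open>auto simp: disjoint_family_on_def\<close>)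
    with j show 1: "y \<in> D (s y)" by simp
    then show "s y < n" using D_sub by (force simp: A_def split: if_splits)
    show "y \<in> D i \<Longrightarrow> i = s y" using 1 D_disj by (auto simp: disjoint_family_on_def)
  qed
  have ind: "(\<Sum>i<n. indicator (D i) y * a i) = (a (s y) :: complex)" for y a
  proof -
    have "(\<Sum>i<n. indicator (D i) y * a i) = (\<Sum>i<n. if i = s y then a i else 0)"
    proof (rule sum.cong)
      show "indicator (D i) y * a i = (if i = s y then a i else 0)" for i
        using s(1)[of y] s_eq[of y i] by (cases "i = s y") (auto simp: indicator_def)
    qed simp
    then show ?thesis using s(2)[of y] by simp
  qed
  define c where "c i = (LINT y|m. indicator (D i) y * g y)" for i
  have int: "integrable m (\<lambda>y. indicator (D i) y * g y * a)" for i a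
    by (rule Bochner_Integration.integrable_bound[OF continuous_integrable[OF continuous_on_mult_right[OF g, of a]]])
       (use continuous_measurable[OF g] in \<open>auto simp: indicator_def norm_mult\<close>)
  have est: "cmod (conv f g x - (\<Sum>i<n. c i * f (x - h i))) \<le> e"
    if f: "continuous_on UNIV f" and V: "\<And>x v. v \<in> V1 \<inter> V2 \<Longrightarrow> dist (f (x + v)) (f x) < e / B" for f x
  proof -
    have sum_eq: "(\<Sum>i<n. c i * f (x - h i)) = (LINT y|m. (\<Sum>i<n. indicator (D i) y * g y * f (x - h i)))"
      unfolding c_def by (subst Bochner_Integration.integral_sum[OF int]) simp
    have int2: "integrable m (\<lambda>y. \<Sum>i<n. indicator (D i) y * g y * f (x - h i))"
      by (intro Bochner_Integration.integrable_sum int)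
    have step: "(\<Sum>i<n. indicator (D i) y * g y * f (x - h i)) = g y * f (x - h (s y))" for y
      using ind[of y "\<lambda>i. g y * f (x - h i)"] by (simp add: mult.assoc)
    have "conv f g x - (\<Sum>i<n. c i * f (x - h i))
        = (LINT y|m. f (x - y) * g y - (\<Sum>i<n. indicator (D i) y * g y * f (x - h i)))"
      unfolding sum_eq conv_def
      by (rule Bochner_Integration.integral_diff[symmetric]) (intro conv_integrable f g int2)+
    also have "cmod \<dots> \<le> (LINT y|m. cmod (f (x - y) * g y - (\<Sum>i<n. indicator (D i) y * g y * f (x - h i))))"
      by (rule integral_norm_bound)
    also have "\<dots> \<le> (LINT y|m. e)"
    proof (intro integral_mono integrable_norm Bochner_Integration.integrable_diff int2 conv_integrable f g)
      fix y
      have "y - h (s y) \<in> V1 \<inter> V2" using s[of y] D_sub[of "s y"] by (auto simp: A_def)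
      from V[OF this, of "x - y"] have "cmod (f (x - y) - f (x - h (s y))) \<le> e / B"
        by (simp add: dist_norm norm_minus_commute algebra_simps)
      then have "cmod (f (x - y) - f (x - h (s y))) * cmod (g y) \<le> e / B * B"
        using B e by (intro mult_mono) auto
      then show "cmod (f (x - y) * g y - (\<Sum>i<n. indicator (D i) y * g y * f (x - h i))) \<le> e"
        unfolding step norm_mult[symmetric] using B by (simp add: algebra_simps)
    qed simp
    finally show ?thesis by simp
  qed
  have "(\<Sum>i<n. c i) = (LINT y|m. (\<Sum>i<n. indicator (D i) y * g y))"
    unfolding c_def using int[of _ 1] by (subst Bochner_Integration.integral_sum) simp_all
  also have "\<dots> = (LINT y|m. g y)"
  proof -
    have "(\<Sum>i<n. indicator (D i) y * g y) = g y" for y using ind[of y "\<lambda>i. g y"] .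
    then show ?thesis by (rule Bochner_Integration.integral_cong[OF refl])
  qed
  finally have "(\<Sum>i<n. c i) = (LINT y|m. g y)" .
  moreover have "\<forall>x. cmod (conv f1 g x - (\<Sum>i<n. c i * f1 (x - h i))) \<le> e"
    using est[OF f(1)] V1(3) by blast
  moreover have "\<forall>x. cmod (conv f2 g x - (\<Sum>i<n. c i * f2 (x - h i))) \<le> e"
    using est[OF f(2)] V2(3) by blast
  ultimately show ?thesis by blast
qed

text \<open>Convolution of f with the constant 1 is constantly the integral of f (- x). It is also a
  uniform limit of combinations of translates of f with weights of sum 1, each of which has the
  integral of f.\<close>

lemma integral_reflect:
  assumes f: "continuous_on UNIV f"
  shows "(LINT x|m. f (- x)) = (LINT x|m. f x :: complex)"
proof -
  have const: "conv f (\<lambda>x. 1) x = (LINT y|m. f (- y))" for x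
    using integral_translation'[of "\<lambda>y. f (x - y)" x] continuous_reflect[OF f]
    by (simp add: conv_def)
  have "cmod ((LINT x|m. f (- x)) - (LINT x|m. f x)) \<le> e" if e: "0 < e" for e
  proof -
    obtain n :: nat and h c where
      c: "\<forall>x. cmod (conv f (\<lambda>x. 1) x - (\<Sum>i<n. c i * f (x - h i))) \<le> e"
        "(\<Sum>i<n. c i) = (LINT x|m. 1 :: complex)"
      using conv_approx[OF f f continuous_on_const e, of 1] by (elim exE conjE) (rule that)
    have sh: "(LINT x|m. f (x - h i)) = (LINT x|m. f x)" for i
      using integral_translation[OF continuous_measurable[OF f], of "- h i"] by simp
    have i: "integrable m (\<lambda>x. c i * f (x - h i))" for i
      by (intro continuous_integrable continuous_intros continuous_shift[OF f])
    have "(LINT x|m. (\<Sum>i<n. c i * f (x - h i))) = (\<Sum>i<n. c i * (LINT x|m. f x))"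
      using i by (subst Bochner_Integration.integral_sum) (auto simp: sh)
    also have "\<dots> = (LINT x|m. f x)" using c(2) by (simp flip: sum_distrib_right)
    finally have "(LINT x|m. f (- x)) - (LINT x|m. f x)
        = (LINT x|m. conv f (\<lambda>x. 1) x - (\<Sum>i<n. c i * f (x - h i)))"
      unfolding const using i by (subst Bochner_Integration.integral_diff) auto
    also have "cmod \<dots> \<le> e"
      by (rule integral_norm_le_const)
         (use c(1) in \<open>auto intro!: continuous_intros continuous_conv[OF f] continuous_shift[OF f]\<close>)
    finally show ?thesis .
  qed
  then have "cmod ((LINT x|m. f (- x)) - (LINT x|m. f x)) \<le> 0"
    by (rule field_le_epsilon) simp
  then show ?thesis by simp
qed

lemma conv_commute:
  assumes f: "continuous_on UNIV f" and g: "continuous_on UNIV g"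
  shows "conv f g = conv g f"
proof
  fix x
  let ?F = "\<lambda>y. f y * g (x - y)"
  have F: "continuous_on UNIV ?F" by (intro continuous_intros continuous_reflect[OF g] f)
  have "conv g f x = (LINT y|m. ?F y)" by (simp add: conv_def mult.commute)
  also have "\<dots> = (LINT y|m. ?F (- y))" using integral_reflect[OF F] by simp
  also have "\<dots> = (LINT y|m. ?F (- (- x + y)))"
    using integral_translation'[of "\<lambda>y. ?F (- y)" "- x"] continuous_reflect(2)[OF F] by simp
  also have "\<dots> = conv f g x" by (simp add: conv_def)
  finally show "conv f g x = conv g f x" ..
qed

lemma conv_sum_left:
  assumes "\<And>i. i \<in> I \<Longrightarrow> continuous_on UNIV (f i)" "continuous_on UNIV g"
  shows "conv (\<lambda>x. \<Sum>i\<in>I. f i x) g x = (\<Sum>i\<in>I. conv (f i) g x)"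
  unfolding conv_def sum_distrib_right
  using assms by (intro Bochner_Integration.integral_sum conv_integrable) auto

lemma conv_diff_left:
  assumes "continuous_on UNIV f" "continuous_on UNIV f'" "continuous_on UNIV g"
  shows "conv (\<lambda>x. f x - f' x) g x = conv f g x - conv f' g x"
  unfolding conv_def left_diff_distrib
  using assms by (intro Bochner_Integration.integral_diff conv_integrable)

lemma conv_add_left:
  assumes "continuous_on UNIV f" "continuous_on UNIV f'" "continuous_on UNIV g"
  shows "conv (\<lambda>x. f x + f' x) g x = conv f g x + conv f' g x"
  unfolding conv_def distrib_right
  using assms by (intro Bochner_Integration.integral_add conv_integrable)

lemma conv_scale_left: "conv (\<lambda>x. a * f x) g x = a * conv f g x"
  unfolding conv_def mult.assoc by simp

lemma conv_scale_right: "conv f (\<lambda>x. a * g x) x = a * conv f g x"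
  unfolding conv_def mult.left_commute[of _ a] by simp

text \<open>Convolution with g is nearly a combination of translations, and translations commute
  with convolution with k.\<close>

lemma conv_right_commute:
  assumes f: "continuous_on UNIV f" and g: "continuous_on UNIV g" and k: "continuous_on UNIV k"
  shows "conv (conv f g) k = conv (conv f k) g"
proof
  fix x
  obtain B where B: "0 < B" "\<And>x. cmod (k x) \<le> B" using continuous_bounded[OF k] by blast
  have ck: "continuous_on UNIV (conv f k)" by (rule continuous_conv[OF f k])
  have "cmod (conv (conv f g) k x - conv (conv f k) g x) \<le> e" if e: "0 < e" for e
  proof -
    \<comment> \<open>The error d is made once before convolving with k, where it grows to at most d
      B, and once after it: together d (B + 1) = e.\<close>
    define d where "d = e / (B + 1)"
    have d: "0 < d" using e B by (simp add: d_def)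
    obtain n :: nat and h c where
      "\<forall>x. cmod (conv f g x - (\<Sum>i<n. c i * f (x - h i))) \<le> d"
      "\<forall>x. cmod (conv (conv f k) g x - (\<Sum>i<n. c i * conv f k (x - h i))) \<le> d"
      using conv_approx[OF f ck g d] by auto
    then have c: "\<And>x. cmod (conv f g x - (\<Sum>i<n. c i * f (x - h i))) \<le> d"
      "\<And>x. cmod (conv (conv f k) g x - (\<Sum>i<n. c i * conv f k (x - h i))) \<le> d" by auto
    have cs: "continuous_on UNIV (\<lambda>x. \<Sum>i<n. c i * f (x - h i))"
      by (intro continuous_intros continuous_shift[OF f])
    have "conv (\<lambda>x. \<Sum>i<n. c i * f (x - h i)) k x = (\<Sum>i<n. c i * conv (\<lambda>x. f (x - h i)) k x)"
      by (subst conv_sum_left) (auto simp: conv_scale_left intro!: continuous_intros continuous_shift[OF f] f k)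
    also have "\<dots> = (\<Sum>i<n. c i * conv f k (x - h i))"
      by (simp add: conv_def algebra_simps)
    finally have eq: "conv (\<lambda>x. \<Sum>i<n. c i * f (x - h i)) k x = (\<Sum>i<n. c i * conv f k (x - h i))" .
    have "conv (conv f g) k x - conv (\<lambda>x. \<Sum>i<n. c i * f (x - h i)) k x
        = conv (\<lambda>x. conv f g x - (\<Sum>i<n. c i * f (x - h i))) k x"
      by (rule conv_diff_left[symmetric]) (intro continuous_conv f g k cs)+
    also have "cmod \<dots> \<le> d * B"
      by (rule conv_norm_le) (use c B in \<open>auto intro!: continuous_intros continuous_conv f g k cs\<close>)
    finally have "cmod (conv (conv f g) k x - conv (conv f k) g x) \<le> d * B + d"
      using c(2)[of x] unfolding eq
      by (metis (no_types, lifting) add_mono norm_diff_triangle_le norm_minus_commute)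
    also have "\<dots> = d * (B + 1)" by (simp add: algebra_simps)
    also have "\<dots> = e" using B by (simp add: d_def)
    finally show ?thesis .
  qed
  then have "cmod (conv (conv f g) k x - conv (conv f k) g x) \<le> 0"
    by (rule field_le_epsilon) simp
  then show "conv (conv f g) k x = conv (conv f k) g x" by simp
qed

lemma conv_assoc:
  assumes f: "continuous_on UNIV f" and g: "continuous_on UNIV g" and k: "continuous_on UNIV k"
  shows "conv (conv f g) k = conv f (conv g k)"
  using conv_right_commute[OF g f k] conv_commute[OF f g] conv_commute[OF continuous_conv[OF g k] f]
  by simp

end

section \<open>Characters separate the points\<close>

text \<open>Meant for b n = \<open>norm_sq (conv_power w n)\<close>, which belongs to n + 1 factors;
  hence the shifts by one. Log-convexity makes the ratios r n increase and submultiplicativity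
  bounds them by b 0; l is their limit, and r n \<le> l makes the quotients decrease.\<close>

lemma log_convex_submultiplicative:
  fixes b :: "nat \<Rightarrow> real"
  assumes pos: "\<And>n. 0 < b n" and convex: "\<And>n. (b (Suc n))\<^sup>2 \<le> b n * b (Suc (Suc n))"
    and submult: "\<And>n k. b (Suc (n + k)) \<le> b n * b k"
  obtains l where "0 < l" "\<And>n. l ^ Suc n \<le> b n" "decseq (\<lambda>n. b n / l ^ Suc n)"
proof -
  define r where "r n = b (Suc n) / b n" for n
  have r_pos: "0 < r n" for n using pos by (simp add: r_def)
  have b_Suc: "b (Suc n) = r n * b n" for n using pos[of n] by (simp add: r_def)
  have "incseq r"
  proof (rule incseq_SucI)
    fix n show "r n \<le> r (Suc n)"
      using convex[of n] pos[of n] pos[of "Suc n"] by (simp add: r_def field_simps power2_eq_square)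
  qed
  moreover have "r n \<le> b 0" for n
    using submult[of n 0] pos[of n] by (simp add: r_def field_simps)
  ultimately obtain l where l: "r \<longlonglongrightarrow> l" "\<And>n. r n \<le> l"
    using incseq_convergent[of r "b 0"] by blast
  have l_pos: "0 < l" using l(2)[of 0] r_pos[of 0] by linarith
  have "decseq (\<lambda>n. b n / l ^ Suc n)"
  proof (rule decseq_SucI)
    fix n
    have "b (Suc n) \<le> l * b n" using l(2)[of n] pos[of n] by (simp add: b_Suc)
    then show "b (Suc n) / l ^ Suc (Suc n) \<le> b n / l ^ Suc n"
      using l_pos by (simp add: field_simps)
  qed
  moreover have "l ^ Suc n \<le> b n" for n
  proof (rule ccontr)
    \<comment> \<open>Some ratio s = r M then has b n < s ^ (n + 1). From M on b grows at least by
      the factor s in each step, whereas submultiplicativity allows only the factor b n for n + 1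
      steps.\<close>
    assume "\<not> l ^ Suc n \<le> b n"
    then have "\<forall>\<^sub>F M in sequentially. b n < r M ^ Suc n"
      using l(1) by (intro order_tendstoD(1)[OF tendsto_power]) auto
    then obtain M where M: "b n < r M ^ Suc n" by (auto simp: eventually_sequentially)
    define s where "s = r M"
    have s: "0 < s" "b n < s ^ Suc n" using r_pos M by (auto simp: s_def)
    have lower: "b M * s ^ j \<le> b (M + j)" for j
    proof (induction j)
      case (Suc j)
      have "s \<le> r (M + j)" unfolding s_def using \<open>incseq r\<close> by (simp add: incseqD)
      then have "s * (b M * s ^ j) \<le> r (M + j) * b (M + j)"
        using Suc r_pos[of "M + j"] s pos[of M] by (intro mult_mono) auto
      then show ?case by (simp add: b_Suc algebra_simps)
    qed simp
    have upper: "b (Suc n * j + n) \<le> b n * b n ^ j" for j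
    proof (induction j)
      case (Suc j)
      have "b (Suc n * Suc j + n) = b (Suc ((Suc n * j + n) + n))" by (simp add: algebra_simps)
      also have "\<dots> \<le> b (Suc n * j + n) * b n" by (rule submult)
      also have "\<dots> \<le> (b n * b n ^ j) * b n" using Suc pos[of n] by (intro mult_right_mono) auto
      finally show ?case by (simp add: algebra_simps)
    qed simp
    define C where "C = b M / s ^ M * s ^ n"
    define q where "q = b n / s ^ Suc n"
    have C: "0 < C" using pos s by (simp add: C_def)
    have q: "0 \<le> q" "q < 1" using s pos[of n] by (auto simp: q_def)
    have "C \<le> b n * q ^ j" if "M \<le> j" for j
    proof -
      define N where "N = Suc n * j + n"
      have "M \<le> N" using that by (simp add: N_def)
      then have "b M * s ^ (N - M) \<le> b n * b n ^ j"
        using lower[of "N - M"] upper[of j] by (simp add: N_def)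
      moreover have "s ^ (N - M) = s ^ n * (s ^ Suc n) ^ j / s ^ M"
      proof -
        have "s ^ N = s ^ n * (s ^ Suc n) ^ j" by (simp only: N_def power_add power_mult mult.commute[of _ "s ^ n"])
        then show ?thesis using \<open>M \<le> N\<close> s by (simp add: power_diff)
      qed
      ultimately have "C * (s ^ Suc n) ^ j \<le> b n * b n ^ j" by (simp add: C_def del: power_Suc)
      then show ?thesis using s by (simp add: q_def power_divide field_simps del: power_Suc)
    qed
    moreover have "(\<lambda>j. b n * q ^ j) \<longlonglongrightarrow> b n * 0"
      using q by (intro tendsto_mult tendsto_const LIMSEQ_realpow_zero) auto
    ultimately have "C \<le> b n * 0"
      by (intro tendsto_lowerbound[of _ _ sequentially]) (auto simp: eventually_sequentially)
    then show False using C by simp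
  qed
  ultimately show ?thesis using that l_pos by blast
qed

section \<open>The convolution algebra as an algebra with involution\<close>

context compact_haar
begin

text \<open>The involution of the convolution algebra: convolution with \<open>tilde f\<close> is
  adjoint to convolution with f.\<close>

definition tilde :: "('g \<Rightarrow> complex) \<Rightarrow> 'g \<Rightarrow> complex" where
  "tilde f x = cnj (f (- x))"

definition norm_sq :: "('g \<Rightarrow> complex) \<Rightarrow> real" where
  "norm_sq f = (LINT x|m. (cmod (f x))\<^sup>2)"

lemma continuous_tilde: "continuous_on UNIV f \<Longrightarrow> continuous_on UNIV (tilde f)"
  unfolding tilde_def by (intro continuous_intros continuous_reflect(2))

lemma tilde_tilde [simp]: "tilde (tilde f) = f"
  by (simp add: tilde_def fun_eq_iff)

lemma tilde_conv:
  assumes f: "continuous_on UNIV f" and g: "continuous_on UNIV g"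
  shows "tilde (conv f g) = conv (tilde f) (tilde g)"
proof
  fix x
  let ?F = "\<lambda>y. f (- x - y) * g y"
  have F: "continuous_on UNIV ?F" by (intro continuous_intros continuous_reflect[OF f] g)
  have "tilde (conv f g) x = cnj (LINT y|m. ?F (- y))"
    using integral_reflect[OF F] by (simp add: tilde_def conv_def)
  also have "\<dots> = (LINT y|m. cnj (?F (- y)))" by (rule Bochner_Integration.integral_cnj[symmetric])
  also have "\<dots> = conv (tilde f) (tilde g) x" by (simp add: conv_def tilde_def algebra_simps)
  finally show "tilde (conv f g) x = conv (tilde f) (tilde g) x" .
qed

lemma norm_sq_nonneg [simp]: "0 \<le> norm_sq f" by (simp add: norm_sq_def)

lemma norm_sq_eq_0_iff:
  assumes "continuous_on UNIV f"
  shows "norm_sq f = 0 \<longleftrightarrow> f = (\<lambda>x. 0)"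
  using integral_norm_square_eq_0[OF assms] by (auto simp: norm_sq_def)

lemma norm_sq_pos:
  assumes "continuous_on UNIV f" "f x \<noteq> 0"
  shows "0 < norm_sq f"
  using norm_sq_eq_0_iff[OF assms(1)] assms(2) norm_sq_nonneg[of f] by (metis less_eq_real_def)

lemma integral_reflect_translate:
  assumes F: "continuous_on UNIV (F :: 'g \<Rightarrow> complex)"
  shows "(LINT y|m. F (x - y)) = (LINT y|m. F y)"
proof -
  have "(LINT y|m. F (x - y)) = (LINT y|m. F (x + y))"
    using integral_reflect[OF continuous_reflect(1)[OF F, of x]] by simp
  then show ?thesis using integral_translation'[OF F, of x] by simp
qed

lemma norm_sq_reflect:
  assumes f: "continuous_on UNIV f"
  shows "norm_sq (\<lambda>y. f (x - y)) = norm_sq f"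
proof -
  have c: "continuous_on UNIV (\<lambda>y. complex_of_real ((cmod (f y))\<^sup>2))"
    by (intro continuous_intros f)
  have "complex_of_real (norm_sq (\<lambda>y. f (x - y))) = complex_of_real (norm_sq f)"
    unfolding norm_sq_def integral_complex_of_real[symmetric]
    by (rule integral_reflect_translate[OF c])
  then show ?thesis by simp
qed

lemma continuous_Lp:
  assumes f: "continuous_on UNIV f" and p: "0 < p"
  shows "f \<in> Lp m p"
proof -
  have "continuous_on UNIV (\<lambda>x. cmod (f x) powr p)"
    using p by (intro continuous_intros continuous_on_powr' f) auto
  then show ?thesis
    using continuous_measurable[OF f] by (simp add: Lp_def continuous_integrable)
qed

lemma Lp_norm_2_sq: "(Lp_norm m 2 f)\<^sup>2 = norm_sq f"
proof -
  have "(Lp_norm m 2 f)\<^sup>2 = (LINT x|m. cmod (f x) powr 2)"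
    using Lp_norm_powr[of 2 m f] by (cases "Lp_norm m 2 f = 0") (auto simp: powr_numeral)
  also have "\<dots> = norm_sq f"
    unfolding norm_sq_def by (rule Bochner_Integration.integral_cong) auto
  finally show ?thesis .
qed

text \<open>This turns convergence in quadratic mean into uniform convergence, as
  \<open>power_method\<close> requires.\<close>

lemma conv_Cauchy_Schwarz:
  assumes f: "continuous_on UNIV f" and g: "continuous_on UNIV g"
  shows "(cmod (conv f g x))\<^sup>2 \<le> norm_sq f * norm_sq g"
proof -
  have "cmod (conv f g x) \<le> Lp_norm m 2 (\<lambda>y. f (x - y)) * Lp_norm m 2 g"
    unfolding conv_def by (intro Holder(3) continuous_Lp continuous_reflect f g) auto
  then have "(cmod (conv f g x))\<^sup>2 \<le> (Lp_norm m 2 (\<lambda>y. f (x - y)) * Lp_norm m 2 g)\<^sup>2"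
    by (rule power_mono) simp
  then show ?thesis by (simp add: power_mult_distrib Lp_norm_2_sq norm_sq_reflect[OF f])
qed

text \<open>Inner products are values of convolutions at 0, so the norms of convolution powers can
  be read off there.\<close>

lemma conv_tilde_0:
  assumes f: "continuous_on UNIV f" and g: "continuous_on UNIV g"
  shows "conv f (tilde g) 0 = (LINT x|m. f x * cnj (g x))"
  using integral_reflect[of "\<lambda>x. f x * cnj (g x)"]
  by (simp add: conv_def tilde_def continuous_on_mult continuous_on_cnj f g)

lemma conv_tilde_self_0:
  assumes f: "continuous_on UNIV f"
  shows "conv f (tilde f) 0 = of_real (norm_sq f)"
  unfolding conv_tilde_0[OF f f] norm_sq_def integral_complex_of_real[symmetric]
  by (rule Bochner_Integration.integral_cong) (simp_all only: complex_norm_square)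

lemma norm_sq_diff:
  assumes f: "continuous_on UNIV f" and g: "continuous_on UNIV g"
  shows "norm_sq (\<lambda>x. f x - g x) = norm_sq f + norm_sq g - 2 * Re (conv f (tilde g) 0)"
proof -
  have i: "integrable m (\<lambda>x. (cmod (f x))\<^sup>2)" "integrable m (\<lambda>x. (cmod (g x))\<^sup>2)"
    "integrable m (\<lambda>x. f x * cnj (g x))"
    by (intro continuous_integrable continuous_intros f g)+
  have "norm_sq (\<lambda>x. f x - g x) = (LINT x|m. (cmod (f x))\<^sup>2 + (cmod (g x))\<^sup>2 - 2 * Re (f x * cnj (g x)))"
    unfolding norm_sq_def
  proof (rule Bochner_Integration.integral_cong[OF refl])
    show "(cmod (f x - g x))\<^sup>2 = (cmod (f x))\<^sup>2 + (cmod (g x))\<^sup>2 - 2 * Re (f x * cnj (g x))" for x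
      by (simp only: cmod_power2) (simp add: power2_eq_square algebra_simps)
  qed
  also have "\<dots> = norm_sq f + norm_sq g - 2 * Re (conv f (tilde g) 0)"
  proof -
    define h where "h x = f x * cnj (g x)" for x
    show ?thesis
      using i unfolding h_def[symmetric] norm_sq_def conv_tilde_0[OF f g] by simp
  qed
  finally show ?thesis .
qed

lemma conv_limit:
  assumes f: "\<And>n. continuous_on UNIV (f n)" "\<And>x. (\<lambda>n. f n x) \<longlonglongrightarrow> f' x" "\<And>n x. cmod (f n x) \<le> B"
    and g: "\<And>n. continuous_on UNIV (g n)" "\<And>x. (\<lambda>n. g n x) \<longlonglongrightarrow> g' x" "\<And>n x. cmod (g n x) \<le> C"
    and f'g': "continuous_on UNIV f'" "continuous_on UNIV g'"
  shows "(\<lambda>n. conv (f n) (g n) x) \<longlonglongrightarrow> conv f' g' x"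
  unfolding conv_def
proof (rule integral_dominated_convergence[where w = "\<lambda>y. B * C"])
  show "(\<lambda>y. f' (x - y) * g' y) \<in> borel_measurable m" "\<And>i. (\<lambda>y. f i (x - y) * g i y) \<in> borel_measurable m"
    by (intro continuous_measurable continuous_on_mult continuous_reflect f g f'g')+
  have "0 \<le> B" using f(3) norm_ge_zero order_trans by blast
  then show "AE y in m. cmod (f i (x - y) * g i y) \<le> B * C" for i
    by (auto simp: norm_mult intro!: mult_mono f g)
qed (auto intro!: tendsto_mult f g)

text \<open>Index n stands for n + 1 factors, since the algebra need not have a unit.\<close>

fun conv_power :: "('g \<Rightarrow> complex) \<Rightarrow> nat \<Rightarrow> 'g \<Rightarrow> complex" where
  "conv_power w 0 = w"
| "conv_power w (Suc n) = conv w (conv_power w n)"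

lemma continuous_conv_power: "continuous_on UNIV w \<Longrightarrow> continuous_on UNIV (conv_power w n)"
  by (induction n) (auto intro: continuous_conv)

lemma conv_power_add:
  assumes "continuous_on UNIV w"
  shows "conv (conv_power w n) (conv_power w k) = conv_power w (Suc (n + k))"
  by (induction n) (simp_all add: conv_assoc continuous_conv_power assms)

lemma tilde_conv_power:
  assumes "continuous_on UNIV w" "tilde w = w"
  shows "tilde (conv_power w n) = conv_power w n"
  by (induction n) (simp_all add: tilde_conv continuous_conv_power assms)

text \<open>Convolution with such an e is an orthogonal projection that commutes with
  translations.\<close>

definition idempotent :: "('g \<Rightarrow> complex) \<Rightarrow> bool" where
  "idempotent e \<longleftrightarrow> continuous_on UNIV e \<and> tilde e = e \<and> conv e e = e"

text \<open>The power method: \<open>w\<^sup>2\<^sup>n / \<lambda>\<^sup>n\<close> converges to the projection onto the top eigenspace of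
  convolution with \<open>w\<^sup>2\<close>.\<close>

lemma power_method:
  assumes w: "continuous_on UNIV w" "tilde w = w" "w x0 \<noteq> 0"
  obtains l E where "0 < l" "idempotent E" "E \<noteq> (\<lambda>x. 0)" "\<And>x. conv (conv w w) E x = complex_of_real l * E x"
proof -
  let ?p = "conv_power w"
  note cp = continuous_conv_power[OF w(1)]
  define b where "b n = norm_sq (?p n)" for n
  \<comment> \<open>V n has 2 n + 2 factors, so it is the (n + 1)-st power of w * w. Its value at 0
    is b n, which also bounds it.\<close>
  define V where "V n = ?p (Suc (n + n))" for n
  have V_conv: "V n = conv (?p n) (?p n)" for n
    using conv_power_add[OF w(1), of n n] by (simp add: V_def)
  have cV: "continuous_on UNIV (V n)" for n unfolding V_def by (rule cp)
  have tV: "tilde (V n) = V n" for n unfolding V_def by (rule tilde_conv_power[OF w(1,2)])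
  have V_add: "conv (V n) (V k) = V (Suc (n + k))" for n k
    unfolding V_def by (simp add: conv_power_add[OF w(1)] ac_simps del: conv_power.simps)
  have V_0: "V n 0 = of_real (b n)" for n
    using conv_tilde_self_0[OF cp, of n] tilde_conv_power[OF w(1,2)] by (simp add: V_conv b_def)
  have b_nonneg: "0 \<le> b n" for n by (simp add: b_def)
  have V_le: "cmod (V n x) \<le> b n" for n x
  proof (rule power2_le_imp_le[OF _ b_nonneg])
    show "(cmod (V n x))\<^sup>2 \<le> (b n)\<^sup>2"
      using conv_Cauchy_Schwarz[OF cp cp, of n n x] unfolding V_conv b_def power2_eq_square .
  qed
  have convex: "(b (Suc n))\<^sup>2 \<le> b n * b (Suc (Suc n))" for n
  proof -
    have "V (Suc n) = conv (?p n) (?p (Suc (Suc n)))"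
      by (simp add: V_def conv_power_add[OF w(1)] del: conv_power.simps)
    then show ?thesis
      using conv_Cauchy_Schwarz[OF cp cp, of n "Suc (Suc n)" 0] V_0[of "Suc n"] b_nonneg
      by (simp add: b_def)
  qed
  have submult: "b (Suc (n + k)) \<le> b n * b k" for n k
    using conv_norm_le[OF cV cV V_le V_le, of n k 0] V_0[of "Suc (n + k)"] b_nonneg
    by (simp add: V_add)
  \<comment> \<open>Log-convexity carries positivity on from two consecutive values.\<close>
  have "b 0 > 0 \<and> b (Suc 0) > 0"
  proof
    show b0: "0 < b 0" using norm_sq_pos[OF w(1,3)] by (simp add: b_def)
    have "?p (Suc 0) 0 \<noteq> 0" using V_0[of 0] b0 by (simp add: V_def)
    then show "0 < b (Suc 0)" unfolding b_def by (intro norm_sq_pos[OF cp])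
  qed
  then have pos': "0 < b n \<and> 0 < b (Suc n)" for n
  proof (induction n)
    case (Suc n)
    then have "0 < b n * b (Suc (Suc n))" using convex[of n] by (metis zero_less_power2 less_le_trans less_irrefl)
    then show ?case using Suc by (simp add: zero_less_mult_iff)
  qed
  then have pos: "0 < b n" for n by blast
  obtain l where l: "0 < l" "\<And>n. l ^ Suc n \<le> b n" "decseq (\<lambda>n. b n / l ^ Suc n)"
    using log_convex_submultiplicative[OF pos convex submult] by blast
  define c where "c n = b n / l ^ Suc n" for n
  have c1: "1 \<le> c n" and c_dec: "c n \<le> c 0" for n
    using l(1) l(2)[of n] decseqD[OF l(3), of 0 n] by (auto simp: c_def simp del: power_Suc)
  obtain L where L: "c \<longlonglongrightarrow> L"
    using decseq_convergent[of c 1] l(3) c1 unfolding c_def by blast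
  define W where "W n x = V n x / of_real (l ^ Suc n)" for n x
  have cW: "continuous_on UNIV (W n)" for n
    unfolding W_def using l(1) by (intro continuous_intros cV) auto
  define a where "a n = 1 / complex_of_real (l ^ Suc n)" for n
  have W_eq: "W n = (\<lambda>x. a n * V n x)" for n by (simp add: W_def a_def fun_eq_iff)
  have W_add: "conv (W n) (W k) = W (Suc (n + k))" for n k
  proof -
    have "a n * a k = a (Suc (n + k))" by (simp add: a_def power_add)
    then show ?thesis
      unfolding W_eq by (simp add: conv_scale_left conv_scale_right V_add fun_eq_iff)
  qed
  have tW: "tilde (W n) = W n" for n
    using tV[of n] by (simp add: W_def tilde_def fun_eq_iff)
  have W_0: "W n 0 = of_real (c n)" for n by (simp add: W_def V_0 c_def)
  have W_le: "cmod (W n x) \<le> c 0" for n x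
  proof -
    have "cmod (W n x) \<le> c n"
      using V_le[of n x] l(1) by (simp add: W_def c_def norm_divide divide_right_mono norm_power norm_mult)
    then show ?thesis using c_dec[of n] by linarith
  qed
  have step: "conv (V 0) (W n) x = of_real l * W (Suc n) x" for n x
  proof -
    have "complex_of_real l * a (Suc n) = a n" using l(1) by (simp add: a_def)
    then show ?thesis
      unfolding W_eq by (simp add: conv_scale_right V_add flip: mult.assoc)
  qed
  have nsqW: "norm_sq (W n) = c (Suc (n + n))" for n
    using conv_tilde_self_0[OF cW, of n] by (simp add: tW W_add W_0)
  \<comment> \<open>Since c converges, W is Cauchy in quadratic mean. One more convolution with V 0
    yields l W (n + 1), and by Cauchy-Schwarz it makes the sequence uniformly Cauchy.\<close>
  have dist: "norm_sq (\<lambda>x. W n x - W k x) = c (Suc (n + n)) + c (Suc (k + k)) - 2 * c (Suc (n + k))" for n k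
    by (simp add: norm_sq_diff[OF cW cW] tW W_add W_0 nsqW)
  have unif_cauchy: "\<exists>M. \<forall>n\<ge>M. \<forall>k\<ge>M. \<forall>x. dist (W n x) (W k x) < e" if e: "0 < e" for e
  proof -
    define d where "d = (e * l)\<^sup>2 / (norm_sq (V 0) + 1)"
    have d: "0 < d" using e l(1) by (auto simp: d_def intro!: divide_pos_pos add_nonneg_pos)
    obtain M where M: "\<And>n. M \<le> n \<Longrightarrow> dist (c n) L < d / 4"
      using L d by (metis lim_sequentially divide_pos_pos zero_less_numeral)
    have "dist (W (Suc n) x) (W (Suc k) x) < e" if "M \<le> n" "M \<le> k" for n k x
    proof -
      have nd: "norm_sq (\<lambda>x. W n x - W k x) < d"
        using M[of "Suc (n + n)"] M[of "Suc (k + k)"] M[of "Suc (n + k)"] that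
        unfolding dist dist_real_def by (simp add: abs_if split: if_splits)
      have "of_real l * (W (Suc n) x - W (Suc k) x) = conv (V 0) (\<lambda>x. W n x - W k x) x"
        using conv_diff_left[OF cW cW cV, of n k 0 x]
        by (simp add: conv_commute[OF cV] cW continuous_on_diff step[symmetric] right_diff_distrib)
      then have "(l * cmod (W (Suc n) x - W (Suc k) x))\<^sup>2 \<le> norm_sq (V 0) * norm_sq (\<lambda>x. W n x - W k x)"
        using conv_Cauchy_Schwarz[OF cV continuous_on_diff[OF cW cW], of 0 n k x] l(1)
        by (metis abs_of_pos norm_mult norm_of_real)
      also have "\<dots> \<le> (norm_sq (V 0)) * d" using nd by (intro mult_left_mono) auto
      also have "\<dots> < (norm_sq (V 0) + 1) * d" using d by simp
      also have "\<dots> = (e * l)\<^sup>2" unfolding d_def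
        by (simp add: add_nonneg_pos less_imp_neq[THEN not_sym])
      finally have "l * cmod (W (Suc n) x - W (Suc k) x) < e * l"
        using e l(1) by (intro power2_less_imp_less[of "l * cmod (W (Suc n) x - W (Suc k) x)"]) auto
      then show ?thesis using l(1) by (simp add: dist_norm mult.commute)
    qed
    then have "\<forall>n\<ge>Suc M. \<forall>k\<ge>Suc M. \<forall>x. dist (W n x) (W k x) < e"
      by (metis Suc_le_D Suc_le_mono)
    then show ?thesis by blast
  qed
  then obtain E where E: "uniform_limit UNIV W E sequentially"
  proof -
    have "uniformly_Cauchy_on UNIV W"
      unfolding uniformly_Cauchy_on_def using unif_cauchy by blast
    then show ?thesis
      using Cauchy_uniformly_convergent that by (auto simp: uniformly_convergent_on_def)
  qed
  have cE: "continuous_on UNIV E"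
    by (rule uniform_limit_theorem[OF _ E]) (auto simp: cW)
  have lim: "(\<lambda>n. W n x) \<longlonglongrightarrow> E x" for x
    using tendsto_uniform_limitI[OF E] by simp
  have lim': "(\<lambda>n. W (Suc n) x) \<longlonglongrightarrow> E x" for x
    using LIMSEQ_Suc[OF lim] .
  have "(\<lambda>n. complex_of_real (c n)) \<longlonglongrightarrow> E 0" using lim[of 0] by (simp add: W_0)
  moreover have "(\<lambda>n. complex_of_real (c n)) \<longlonglongrightarrow> of_real L" by (intro tendsto_of_real L)
  ultimately have "E 0 = of_real L" using LIMSEQ_unique by blast
  \<comment> \<open>The lower bound l ^ (n + 1) \<le> b n is what excludes a zero limit.\<close>
  moreover have "1 \<le> L" using LIMSEQ_le_const[OF L] c1 by blast
  ultimately have "E \<noteq> (\<lambda>x. 0)" by auto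
  moreover have "tilde E = E"
  proof
    fix x
    have "(\<lambda>n. tilde (W n) x) \<longlonglongrightarrow> tilde E x"
      unfolding tilde_def by (intro tendsto_cnj lim)
    then show "tilde E x = E x" unfolding tW using lim LIMSEQ_unique by blast
  qed
  moreover have "conv E E = E"
  proof
    fix x
    have "(\<lambda>n. conv (W n) (W n) x) \<longlonglongrightarrow> conv E E x"
      by (rule conv_limit[OF cW lim W_le cW lim W_le cE cE])
    moreover have "(\<lambda>n. W (Suc (n + n)) x) \<longlonglongrightarrow> E x"
      using LIMSEQ_subseq_LIMSEQ[OF lim, of "\<lambda>n. Suc (n + n)"] by (simp add: strict_mono_def comp_def)
    ultimately show "conv E E x = E x" unfolding W_add using LIMSEQ_unique by blast
  qed
  moreover have "conv (conv w w) E x = of_real l * E x" for x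
  proof -
    have "(\<lambda>n. conv (V 0) (W n) x) \<longlonglongrightarrow> conv (V 0) E x"
      by (rule conv_limit[OF cV tendsto_const V_le cW lim W_le cV cE])
    moreover have "(\<lambda>n. conv (V 0) (W n) x) \<longlonglongrightarrow> of_real l * E x"
      unfolding step by (intro tendsto_intros lim')
    ultimately show ?thesis using LIMSEQ_unique by (simp add: V_conv) blast
  qed
  ultimately show ?thesis using that[of l E] l(1) cE by (simp add: idempotent_def)
qed

section \<open>Idempotents of the convolution algebra\<close>

lemma idempotentD:
  assumes "idempotent e"
  shows "continuous_on UNIV e" "tilde e = e" "conv e e = e"
  using assms by (auto simp: idempotent_def)

lemma idempotent_0:
  assumes e: "idempotent e"
  shows "e 0 = of_real (norm_sq e)"
  using conv_tilde_self_0[of e] idempotentD[OF e] by simp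

lemma idempotent_norm_le:
  assumes e: "idempotent e"
  shows "cmod (e x) \<le> norm_sq e"
proof (rule power2_le_imp_le)
  show "(cmod (e x))\<^sup>2 \<le> (norm_sq e)\<^sup>2"
    using conv_Cauchy_Schwarz[of e e x] idempotentD[OF e] by (simp add: power2_eq_square)
qed simp

text \<open>Since |e| \<le> \<open>norm_sq e\<close> everywhere, integrating the square gives
  \<open>norm_sq e\<close> \<le> (\<open>norm_sq e\<close>)^2.\<close>

lemma idempotent_norm_sq_ge_1:
  assumes e: "idempotent e" "e \<noteq> (\<lambda>x. 0)"
  shows "1 \<le> norm_sq e"
proof -
  have "0 < norm_sq e"
    using norm_sq_eq_0_iff[of e] idempotentD[OF e(1)] e(2) norm_sq_nonneg[of e] by linarith
  moreover have "norm_sq e \<le> (LINT x|m. (norm_sq e)\<^sup>2)"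
    unfolding norm_sq_def[of e]
    by (intro integral_mono continuous_integrable continuous_intros idempotentD[OF e(1)] power_mono)
       (use idempotent_norm_le[OF e(1)] in \<open>auto simp: norm_sq_def\<close>)
  ultimately show ?thesis by (simp add: power2_eq_square)
qed

lemma idempotent_diff:
  assumes e: "idempotent e" and e': "idempotent e'" and sub: "conv e e' = e'"
  shows "idempotent (\<lambda>x. e x - e' x)" "norm_sq (\<lambda>x. e x - e' x) = norm_sq e - norm_sq e'"
proof -
  note E = idempotentD[OF e] idempotentD[OF e']
  have c: "continuous_on UNIV (\<lambda>x. e x - e' x)" by (intro continuous_intros E)
  have sub': "conv e' e = e'" using sub conv_commute[of e e'] E by simp
  have "conv (\<lambda>x. e x - e' x) (\<lambda>x. e x - e' x) x = e x - e' x" for x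
  proof -
    have "conv (\<lambda>x. e x - e' x) (\<lambda>x. e x - e' x) x
        = conv (\<lambda>x. e x - e' x) e x - conv (\<lambda>x. e x - e' x) e' x"
      using conv_diff_left[OF E(1) E(4) c] conv_commute[OF c c] conv_commute[OF c E(1)] conv_commute[OF c E(4)]
      by simp
    also have "\<dots> = e x - e' x"
      using conv_diff_left[OF E(1) E(4) E(1)] conv_diff_left[OF E(1) E(4) E(4)] by (simp add: E sub sub')
    finally show ?thesis .
  qed
  then show i: "idempotent (\<lambda>x. e x - e' x)"
    using c E(2,5) by (auto simp: idempotent_def tilde_def fun_eq_iff)
  have "complex_of_real (norm_sq (\<lambda>x. e x - e' x)) = of_real (norm_sq e - norm_sq e')"
    using idempotent_0[OF i] idempotent_0[OF e] idempotent_0[OF e'] by simp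
  then show "norm_sq (\<lambda>x. e x - e' x) = norm_sq e - norm_sq e'" using of_real_eq_iff by blast
qed

text \<open>A nonzero idempotent satisfies \<open>e 0 \<ge> 1\<close>, so that passing to a proper part lowers \<open>e 0\<close> by at least 1.\<close>

lemma minimal_idempotent:
  assumes e0: "idempotent e0" "e0 \<noteq> (\<lambda>x. 0)"
  obtains e where "idempotent e" "e \<noteq> (\<lambda>x. 0)" "conv e0 e = e"
    "\<And>e'. idempotent e' \<Longrightarrow> e' \<noteq> (\<lambda>x. 0) \<Longrightarrow> conv e e' = e' \<Longrightarrow> e' = e"
proof -
  define P where "P e \<longleftrightarrow> idempotent e \<and> e \<noteq> (\<lambda>x. 0) \<and> conv e0 e = e" for e
  have "P e0" using e0 idempotentD[OF e0(1)] by (simp add: P_def)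
  then obtain e where e: "P e" "\<And>e'. P e' \<Longrightarrow> nat \<lfloor>norm_sq e\<rfloor> \<le> nat \<lfloor>norm_sq e'\<rfloor>"
    using ex_has_least_nat[of P e0 "\<lambda>e. nat \<lfloor>norm_sq e\<rfloor>"] by blast
  have "e' = e" if e': "idempotent e'" "e' \<noteq> (\<lambda>x. 0)" "conv e e' = e'" for e'
  proof (rule ccontr)
    assume "e' \<noteq> e"
    then have ne: "(\<lambda>x. e x - e' x) \<noteq> (\<lambda>x. 0)"
      by (metis eq_iff_diff_eq_0 ext)
    have ie: "idempotent e" and e0e: "conv e0 e = e" using e(1) by (auto simp: P_def)
    have "conv e0 e' = e'"
      using conv_assoc[OF idempotentD(1)[OF e0(1)] idempotentD(1)[OF ie] idempotentD(1)[OF e'(1)]] e'(3) e0e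
      by simp
    then have "P e'" using e' by (simp add: P_def)
    then have "nat \<lfloor>norm_sq e\<rfloor> \<le> nat \<lfloor>norm_sq e'\<rfloor>" by (rule e(2))
    moreover have "norm_sq e' + 1 \<le> norm_sq e"
      using idempotent_norm_sq_ge_1[OF idempotent_diff(1)[OF ie e'(1,3)] ne] idempotent_diff(2)[OF ie e'(1,3)]
      by simp
    ultimately show False using norm_sq_nonneg[of e'] by linarith
  qed
  then show ?thesis using that e(1) by (auto simp: P_def)
qed

text \<open>By the power method \<open>h * h\<close> is a multiple of \<open>e\<close> for every self-adjoint \<open>h = e * h\<close>. Polarization with
  \<open>e\<close> itself shows that \<open>h\<close> is one, too.\<close>

lemma minimal_idempotent_scalar:
  assumes e: "idempotent e" "e \<noteq> (\<lambda>x. 0)"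
    and minimal: "\<And>e'. idempotent e' \<Longrightarrow> e' \<noteq> (\<lambda>x. 0) \<Longrightarrow> conv e e' = e' \<Longrightarrow> e' = e"
    and f: "continuous_on UNIV f" "conv e f = f"
  obtains c where "\<And>x. f x = c * e x"
proof -
  note E = idempotentD[OF e(1)]
  have square: "\<exists>c. \<forall>x. conv h h x = c * e x"
    if h: "continuous_on UNIV h" "tilde h = h" "conv e h = h" for h
  proof (cases "h = (\<lambda>x. 0)")
    case True
    then show ?thesis by (intro exI[of _ 0]) (simp add: conv_def)
  next
    case False
    then obtain x0 where "h x0 \<noteq> 0" by (auto simp: fun_eq_iff)
    then obtain l E' where l: "0 < l" "idempotent E'" "E' \<noteq> (\<lambda>x. 0)"
      "\<And>x. conv (conv h h) E' x = complex_of_real l * E' x"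
      using power_method[OF h(1,2)] by metis
    have hh: "continuous_on UNIV (conv h h)" by (rule continuous_conv[OF h(1) h(1)])
    have cE': "continuous_on UNIV E'" using idempotentD[OF l(2)] by simp
    define a where "a = 1 / complex_of_real l"
    have E'_eq: "E' = (\<lambda>x. a * conv (conv h h) E' x)" using l by (simp add: fun_eq_iff a_def)
    have e_hh: "conv e (conv h h) = conv h h"
      using conv_assoc[OF E(1) h(1) h(1)] h(3) by simp
    have "conv e (conv (conv h h) E') = conv (conv h h) E'"
      using conv_assoc[OF E(1) hh cE'] e_hh by simp
    then have "conv e E' = E'"
      by (subst (1 2) E'_eq) (simp add: conv_scale_right fun_eq_iff)
    then have "E' = e" using minimal l by blast
    then have "conv (conv h h) e x = complex_of_real l * e x" for x using l by simp
    moreover have "conv (conv h h) e = conv h h"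
      using e_hh conv_commute[OF hh E(1)] by simp
    ultimately show ?thesis by auto
  qed
  have self: "\<exists>c. \<forall>x. h x = c * e x"
    if h: "continuous_on UNIV h" "tilde h = h" "conv e h = h" for h
  proof -
    have he: "continuous_on UNIV (\<lambda>x. h x + e x)" by (intro continuous_intros h E)
    have h_e: "conv h e = h" using h(3) conv_commute[OF h(1) E(1)] by simp
    obtain c where c: "\<And>x. conv h h x = c * e x" using square[OF h] by blast
    have "conv e (\<lambda>x. h x + e x) = (\<lambda>x. h x + e x)"
      using conv_add_left[OF h(1) E(1) E(1)] conv_commute[OF he E(1)] by (simp add: fun_eq_iff h_e E)
    moreover have "tilde (\<lambda>x. h x + e x) = (\<lambda>x. h x + e x)"
      using h(2) E(2) by (simp add: tilde_def fun_eq_iff)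
    ultimately obtain d where d: "\<And>x. conv (\<lambda>x. h x + e x) (\<lambda>x. h x + e x) x = d * e x"
      using square[OF he] by blast
    have "conv (\<lambda>x. h x + e x) (\<lambda>x. h x + e x) x = conv h h x + 2 * h x + e x" for x
    proof -
      have "conv (\<lambda>x. h x + e x) (\<lambda>x. h x + e x) x
          = conv (\<lambda>x. h x + e x) h x + conv (\<lambda>x. h x + e x) e x"
        using conv_add_left[OF h(1) E(1) he] conv_commute[OF he he] conv_commute[OF he h(1)] conv_commute[OF he E(1)]
        by simp
      also have "\<dots> = conv h h x + 2 * h x + e x"
        using conv_add_left[OF h(1) E(1) h(1)] conv_add_left[OF h(1) E(1) E(1)] by (simp add: h_e h(3) E)
      finally show ?thesis .
    qed
    then have "h x = (d - c - 1) / 2 * e x" for x using c[of x] d[of x] by (simp add: field_simps)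
    then show ?thesis by blast
  qed
  have ct: "continuous_on UNIV (tilde f)" by (rule continuous_tilde[OF f(1)])
  have e_t: "conv e (tilde f) = tilde f" using tilde_conv[OF E(1) f(1)] f(2) E(2) by simp
  have lin: "conv e (\<lambda>x. a * f x + b * tilde f x) = (\<lambda>x. a * f x + b * tilde f x)" for a b
  proof -
    have c: "continuous_on UNIV (\<lambda>x. a * f x + b * tilde f x)" by (intro continuous_intros f ct)
    show ?thesis
      using conv_add_left[of "\<lambda>x. a * f x" "\<lambda>x. b * tilde f x" e] conv_commute[OF E(1) c]
        conv_commute[OF E(1) f(1)] conv_commute[OF E(1) ct]
      by (simp add: fun_eq_iff conv_scale_left continuous_on_mult_left f ct E e_t)
  qed
  have c: "continuous_on UNIV (\<lambda>x. a * f x + b * tilde f x)" for a b by (intro continuous_intros f ct)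
  \<comment> \<open>Both (f + \<open>tilde f\<close>) / 2 and (f - \<open>tilde f\<close>) / (2
    \<i>) are self-adjoint, and f is the first plus \<i> times the second.\<close>
  obtain c1 where c1: "\<And>x. 1/2 * f x + 1/2 * tilde f x = c1 * e x"
    using self[OF c _ lin, of "1/2" "1/2"] by (auto simp: tilde_def fun_eq_iff)
  obtain c2 where c2: "\<And>x. (- \<i>/2) * f x + (\<i>/2) * tilde f x = c2 * e x"
    using self[OF c _ lin, of "- \<i>/2" "\<i>/2"] by (auto simp: tilde_def fun_eq_iff)
  have "f x = (1/2 * f x + 1/2 * tilde f x) + \<i> * ((- \<i>/2) * f x + (\<i>/2) * tilde f x)" for x
    by (simp add: algebra_simps)
  then have "f x = (c1 + \<i> * c2) * e x" for x
    by (metis c1 c2 distrib_right mult.assoc)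
  then show ?thesis by (rule that)
qed

section \<open>Characters obtained from minimal idempotents\<close>

abbreviation chars :: "('g \<Rightarrow> complex) set" where
  "chars \<equiv> carrier char_group"

lemma char_iff: "\<eta> \<in> chars \<longleftrightarrow> continuous_on UNIV \<eta> \<and> (\<forall>x. cmod (\<eta> x) = 1) \<and> (\<forall>x y. \<eta> (x + y) = \<eta> x * \<eta> y)"
  by (simp add: char_group_def)

lemma char_continuous: "\<eta> \<in> chars \<Longrightarrow> continuous_on UNIV \<eta>"
  and char_norm [simp]: "\<eta> \<in> chars \<Longrightarrow> cmod (\<eta> x) = 1"
  and char_add: "\<eta> \<in> chars \<Longrightarrow> \<eta> (x + y) = \<eta> x * \<eta> y"
  by (auto simp: char_iff)

lemma char_nonzero [simp]: "\<eta> \<in> chars \<Longrightarrow> \<eta> x \<noteq> 0"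
  using char_norm[of \<eta> x] by force

lemma char_0: "\<eta> \<in> chars \<Longrightarrow> \<eta> 0 = 1"
  using char_add[of \<eta> 0 0] by simp

lemma char_cnj_mult: "\<eta> \<in> chars \<Longrightarrow> \<eta> x * cnj (\<eta> x) = 1"
  by (metis char_norm complex_norm_square of_real_1 one_power2)

lemma char_uminus: "\<eta> \<in> chars \<Longrightarrow> \<eta> (- x) = cnj (\<eta> x)"
  using char_add[of \<eta> x "- x"] char_0[of \<eta>] char_cnj_mult[of \<eta> x]
  by (metis add.right_inverse char_nonzero mult_left_cancel)

lemma char_diff: "\<eta> \<in> chars \<Longrightarrow> \<eta> (x - y) = \<eta> x * cnj (\<eta> y)"
  using char_add[of \<eta> x "- y"] by (simp add: char_uminus)

text \<open>|\<eta> x| and |\<eta> (- x)| have product 1, and neither exceeds 1.\<close>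

lemma bounded_hom_char:
  assumes \<eta>: "continuous_on UNIV \<eta>" "\<And>x y. \<eta> (x + y) = \<eta> x * \<eta> y" "\<And>x. cmod (\<eta> x) \<le> 1" "\<eta> 0 = 1"
  shows "\<eta> \<in> chars"
proof -
  have "cmod (\<eta> x) = 1" for x
  proof -
    have "cmod (\<eta> x) * cmod (\<eta> (- x)) = 1"
      using \<eta>(2)[of x "- x"] \<eta>(4) by (metis add.right_inverse norm_mult norm_one)
    moreover have "cmod (\<eta> x) * cmod (\<eta> (- x)) \<le> cmod (\<eta> x) * 1"
      using \<eta>(3) by (intro mult_left_mono) auto
    ultimately show ?thesis using \<eta>(3)[of x] by simp
  qed
  then show ?thesis using \<eta> by (simp add: char_iff)
qed

text \<open>A translate of e is again fixed by convolution with e, hence a multiple of e by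
  \<open>minimal_idempotent_scalar\<close>. Evaluation at 0 identifies the factor: e (x + y) e 0 = e
  x e y.\<close>

lemma minimal_idempotent_char:
  assumes e: "idempotent e" "e \<noteq> (\<lambda>x. 0)"
    and minimal: "\<And>e'. idempotent e' \<Longrightarrow> e' \<noteq> (\<lambda>x. 0) \<Longrightarrow> conv e e' = e' \<Longrightarrow> e' = e"
  shows "(\<lambda>x. e x / e 0) \<in> chars" "e 0 \<noteq> 0"
proof -
  note E = idempotentD[OF e(1)]
  show e0: "e 0 \<noteq> 0" using idempotent_0[OF e(1)] idempotent_norm_sq_ge_1[OF e] by simp
  have hom: "e (x + y) * e 0 = e x * e y" for x y
  proof -
    have "conv e (\<lambda>x. e (x + y)) = (\<lambda>x. e (x + y))"
    proof
      fix x
      have "conv e (\<lambda>x. e (x + y)) x = conv (\<lambda>x. e (x + y)) e x"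
        using conv_commute[OF E(1) continuous_shift(1)[OF E(1)]] by metis
      also have "\<dots> = conv e e (x + y)" by (simp add: conv_def algebra_simps)
      finally show "conv e (\<lambda>x. e (x + y)) x = e (x + y)" using E(3) by simp
    qed
    then obtain c where c: "\<And>x. e (x + y) = c * e x"
      using minimal_idempotent_scalar[OF e minimal continuous_shift(1)[OF E(1)]] by blast
    show ?thesis using c[of 0] c[of x] by (simp add: mult.commute)
  qed
  show "(\<lambda>x. e x / e 0) \<in> chars"
  proof (rule bounded_hom_char)
    show "cmod (e x / e 0) \<le> 1" for x
      using idempotent_norm_le[OF e(1), of x] idempotent_0[OF e(1)] idempotent_norm_sq_ge_1[OF e]
      by (simp add: norm_divide)
    show "e (x + y) / e 0 = e x / e 0 * (e y / e 0)" for x y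
      using hom[of x y] e0 by (simp add: field_simps)
  qed (use e0 in \<open>auto intro!: continuous_intros E\<close>)
qed

lemma conv_zero_left: "conv (\<lambda>x. 0) g = (\<lambda>x. 0)"
  by (simp add: conv_def fun_eq_iff)

lemma conv_char:
  assumes \<eta>: "\<eta> \<in> chars" and k: "continuous_on UNIV k"
  shows "conv k \<eta> x = fourier_coeff m k \<eta> * \<eta> x"
proof -
  have "conv k \<eta> x = conv \<eta> k x"
    using conv_commute[OF k char_continuous[OF \<eta>]] by simp
  also have "\<dots> = (LINT y|m. \<eta> x * (k y * cnj (\<eta> y)))"
    by (simp add: conv_def char_diff[OF \<eta>] mult_ac)
  finally show ?thesis by (simp add: fourier_coeff_def mult.commute)
qed

text \<open>The function w = k * \<open>tilde k\<close> is self-adjoint and nonzero at 0. Below the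
  top projection of w * w there is a minimal idempotent, that is, a multiple of a character \<eta>,
  on which w * w acts by the factor l > 0. If the coefficient of k at \<eta> vanished, convolution
  with k, hence with w, would annihilate it.\<close>

lemma exists_nonzero_fourier_coeff:
  assumes k: "continuous_on UNIV k" "k x0 \<noteq> 0"
  obtains \<eta> where "\<eta> \<in> chars" "fourier_coeff m k \<eta> \<noteq> 0"
proof -
  define w where "w = conv k (tilde k)"
  have ct: "continuous_on UNIV (tilde k)" by (rule continuous_tilde[OF k(1)])
  have w: "continuous_on UNIV w" unfolding w_def by (rule continuous_conv[OF k(1) ct])
  have "tilde w = w"
    using tilde_conv[OF k(1) ct] conv_commute[OF k(1) ct] by (simp add: w_def)
  moreover have "w 0 \<noteq> 0"
    using conv_tilde_self_0[OF k(1)] norm_sq_pos[OF k] by (simp add: w_def)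
  ultimately obtain l E where l: "0 < l" "idempotent E" "E \<noteq> (\<lambda>x. 0)"
    "\<And>x. conv (conv w w) E x = complex_of_real l * E x"
    using power_method[OF w] by metis
  obtain e where e: "idempotent e" "e \<noteq> (\<lambda>x. 0)" "conv E e = e"
    "\<And>e'. idempotent e' \<Longrightarrow> e' \<noteq> (\<lambda>x. 0) \<Longrightarrow> conv e e' = e' \<Longrightarrow> e' = e"
    using minimal_idempotent[OF l(2,3)] by metis
  define \<eta> where "\<eta> x = e x / e 0" for x
  have \<eta>: "\<eta> \<in> chars" unfolding \<eta>_def by (rule minimal_idempotent_char(1)[OF e(1,2,4)])
  have e0: "e 0 \<noteq> 0" by (rule minimal_idempotent_char(2)[OF e(1,2,4)])
  have e_eq: "e = (\<lambda>x. e 0 * \<eta> x)" using e0 by (simp add: \<eta>_def fun_eq_iff)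
  note cE = idempotentD(1)[OF l(2)] and ce = idempotentD(1)[OF e(1)]
  have ww: "continuous_on UNIV (conv w w)" by (rule continuous_conv[OF w w])
  have "conv (conv w w) e x = of_real l * e x" for x
  proof -
    have "conv (conv w w) e = conv (conv (conv w w) E) e"
      using conv_assoc[OF ww cE ce] e(3) by simp
    also have "conv (conv w w) E = (\<lambda>x. of_real l * E x)" using l(4) by auto
    finally show ?thesis using e(3) by (simp add: conv_scale_left)
  qed
  then have *: "conv (conv w w) e 0 \<noteq> 0" using e0 l(1) by simp
  have "fourier_coeff m k \<eta> \<noteq> 0"
  proof
    assume "fourier_coeff m k \<eta> = 0"
    then have "conv k e = (\<lambda>x. 0)"
      by (subst e_eq) (simp add: conv_scale_right conv_char[OF \<eta> k(1)] fun_eq_iff)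
    then have "conv w e = (\<lambda>x. 0)"
      using conv_right_commute[OF k(1) ct ce] unfolding w_def by (simp add: conv_zero_left)
    then have "conv (conv w w) e = (\<lambda>x. 0)"
      using conv_right_commute[OF w w ce] by (simp add: conv_zero_left)
    then show False using * by simp
  qed
  then show ?thesis using that \<eta> by blast
qed

lemma Urysohn_UNIV:
  assumes "closed S" "closed T" "S \<inter> T = {}"
  obtains f :: "'g \<Rightarrow> real" where "continuous_on UNIV f" "\<And>x. 0 \<le> f x \<and> f x \<le> 1"
    "\<And>x. x \<in> S \<Longrightarrow> f x = 0" "\<And>x. x \<in> T \<Longrightarrow> f x = 1"
proof -
  have "compact_space (euclidean :: 'g topology)"
    using compact_UNIV by (simp add: compact_space_def)
  moreover have "Hausdorff_space (euclidean :: 'g topology)"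
    unfolding Hausdorff_space_def using hausdorff by (fastforce simp: disjnt_def)
  ultimately have "normal_space (euclidean :: 'g topology)"
    by (intro compact_Hausdorff_or_regular_imp_normal_space) auto
  then obtain f where "continuous_map euclidean (top_of_set {0..1::real}) f" "f ` S \<subseteq> {0}" "f ` T \<subseteq> {1}"
    using Urysohn_lemma[of euclidean S T 0 1] assms by (auto simp: disjnt_def)
  then show ?thesis
    by (intro that[of f]) (auto simp: continuous_map_in_subtopology Pi_iff)
qed

text \<open>Translation by a - b multiplies the coefficient at \<eta> by \<eta> (a - b), so this
  number is not 1 for any coefficient that survives in k minus its translate. Urysohn's lemma
  supplies a k that differs from its translate.\<close>

theorem chars_separate_points:
  assumes "a \<noteq> b"
  obtains \<eta> where "\<eta> \<in> chars" "\<eta> a \<noteq> \<eta> b"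
proof -
  obtain f :: "'g \<Rightarrow> real" where f: "continuous_on UNIV f" "f 0 = 0" "f (a - b) = 1"
    using Urysohn_UNIV[of "{0}" "{a - b}"] assms by auto
  define k where "k x = complex_of_real (f x)" for x
  have k: "continuous_on UNIV k" unfolding k_def by (intro continuous_intros f)
  have k': "continuous_on UNIV (\<lambda>x. k x - k (x + (a - b)))"
    by (intro continuous_intros k continuous_shift[OF k])
  obtain \<eta> where \<eta>: "\<eta> \<in> chars" "fourier_coeff m (\<lambda>x. k x - k (x + (a - b))) \<eta> \<noteq> 0"
    using exists_nonzero_fourier_coeff[OF k', of 0] f by (auto simp: k_def)
  have c: "continuous_on UNIV (\<lambda>x. k x * cnj (\<eta> x))"
    by (intro continuous_intros k char_continuous \<eta>)
  have *: "(LINT x|m. k (x + (a - b)) * cnj (\<eta> (x + (a - b)))) = fourier_coeff m k \<eta>"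
    unfolding fourier_coeff_def using integral_translation[OF continuous_measurable[OF c]] by simp
  have "(LINT x|m. k (x + (a - b)) * cnj (\<eta> x)) * cnj (\<eta> (a - b)) = fourier_coeff m k \<eta>"
  proof -
    have "(LINT x|m. k (x + (a - b)) * cnj (\<eta> (x + (a - b))))
        = (LINT x|m. (k (x + (a - b)) * cnj (\<eta> x)) * cnj (\<eta> (a - b)))"
      by (simp only: char_add[OF \<eta>(1)] complex_cnj_mult mult.assoc)
    with * show ?thesis by simp
  qed
  note ** = this
  have "\<eta> a \<noteq> \<eta> b"
  proof
    assume "\<eta> a = \<eta> b"
    then have "\<eta> (a - b) = 1" using char_cnj_mult[OF \<eta>(1)] by (simp add: char_diff[OF \<eta>(1)])
    moreover have "fourier_coeff m (\<lambda>x. k x - k (x + (a - b))) \<eta>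
        = fourier_coeff m k \<eta> - (LINT x|m. k (x + (a - b)) * cnj (\<eta> x))"
      unfolding fourier_coeff_def left_diff_distrib
      by (intro Bochner_Integration.integral_diff continuous_integrable continuous_on_mult
          continuous_on_cnj k continuous_shift[OF k] char_continuous \<eta>)
    ultimately show False using ** \<eta>(2) by simp
  qed
  then show ?thesis using that \<eta> by blast
qed

end

section \<open>Trigonometric polynomials and Fourier coefficients\<close>

definition trig_span :: "('g \<Rightarrow> complex) set \<Rightarrow> ('g \<Rightarrow> complex) set" where
  "trig_span S = {f. \<exists>M c. finite M \<and> M \<subseteq> S \<and> f = trig_poly M c}"

lemma trig_spanI: "finite M \<Longrightarrow> M \<subseteq> S \<Longrightarrow> trig_poly M c \<in> trig_span S"
  by (auto simp: trig_span_def)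

lemma trig_span_zero: "(\<lambda>x. 0) \<in> trig_span S"
  using trig_spanI[of "{}" S] by (simp add: trig_poly_def [abs_def])

lemma trig_span_cmult:
  assumes "f \<in> trig_span S"
  shows "(\<lambda>x. a * f x) \<in> trig_span S"
proof -
  obtain M c where "finite M" "M \<subseteq> S" "f = trig_poly M c" using assms by (auto simp: trig_span_def)
  moreover from this have "(\<lambda>x. a * f x) = trig_poly M (\<lambda>\<eta>. a * c \<eta>)"
    by (simp add: trig_poly_def fun_eq_iff sum_distrib_left mult.assoc)
  ultimately show ?thesis by (auto intro: trig_spanI)
qed

lemma trig_span_add:
  assumes "f \<in> trig_span S" "g \<in> trig_span S"
  shows "(\<lambda>x. f x + g x) \<in> trig_span S"
proof -
  obtain M c where f: "finite M" "M \<subseteq> S" "f = trig_poly M c" using assms by (auto simp: trig_span_def)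
  obtain N d where g: "finite N" "N \<subseteq> S" "g = trig_poly N d" using assms by (auto simp: trig_span_def)
  define e where "e \<eta> = (if \<eta> \<in> M then c \<eta> else 0) + (if \<eta> \<in> N then d \<eta> else 0)" for \<eta>
  have "f x + g x = trig_poly (M \<union> N) e x" for x
  proof -
    have "trig_poly (M \<union> N) e x = (\<Sum>\<eta>\<in>M\<union>N. (if \<eta> \<in> M then c \<eta> * \<eta> x else 0)) + (\<Sum>\<eta>\<in>M\<union>N. (if \<eta> \<in> N then d \<eta> * \<eta> x else 0))"
      unfolding trig_poly_def e_def sum.distrib[symmetric] by (rule sum.cong) (auto simp: distrib_right)
    also have "(\<Sum>\<eta>\<in>M\<union>N. (if \<eta> \<in> M then c \<eta> * \<eta> x else 0)) = f x"
      unfolding f(3) trig_poly_def using f(1) g(1) by (intro sum.mono_neutral_cong_right) auto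
    also have "(\<Sum>\<eta>\<in>M\<union>N. (if \<eta> \<in> N then d \<eta> * \<eta> x else 0)) = g x"
      unfolding g(3) trig_poly_def using f(1) g(1) by (intro sum.mono_neutral_cong_right) auto
    finally show ?thesis by simp
  qed
  then have "(\<lambda>x. f x + g x) = trig_poly (M \<union> N) e" by auto
  then show ?thesis using f g by (auto intro: trig_spanI)
qed

lemma trig_span_uminus: "f \<in> trig_span S \<Longrightarrow> (\<lambda>x. - f x) \<in> trig_span S"
  using trig_span_cmult[of f S "-1"] by simp

lemma trig_span_diff: "f \<in> trig_span S \<Longrightarrow> g \<in> trig_span S \<Longrightarrow> (\<lambda>x. f x - g x) \<in> trig_span S"
  using trig_span_add[of f S "\<lambda>x. - g x"] by (simp add: trig_span_uminus)

lemma trig_span_base: "\<eta> \<in> S \<Longrightarrow> \<eta> \<in> trig_span S"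
  using trig_spanI[of "{\<eta>}" S "\<lambda>_. 1"] by (simp add: trig_poly_def [abs_def])

lemma trig_span_induct [consumes 1, case_names zero add]:
  assumes f: "f \<in> trig_span S" and zero: "P (\<lambda>x. 0)"
    and add: "\<And>\<eta> c f. \<eta> \<in> S \<Longrightarrow> f \<in> trig_span S \<Longrightarrow> P f \<Longrightarrow> P (\<lambda>x. c * \<eta> x + f x)"
  shows "P f"
proof -
  obtain M c where M: "finite M" "M \<subseteq> S" "f = trig_poly M c" using f by (auto simp: trig_span_def)
  from M(1,2) have "P (trig_poly M c)"
  proof (induction M)
    case empty
    then show ?case using zero by (simp add: trig_poly_def [abs_def])
  next
    case (insert \<eta> M)
    then have "trig_poly (insert \<eta> M) c = (\<lambda>x. c \<eta> * \<eta> x + trig_poly M c x)"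
      by (simp add: trig_poly_def fun_eq_iff)
    then show ?case using insert add[of \<eta> "trig_poly M c" "c \<eta>"] by (simp add: trig_spanI)
  qed
  then show ?thesis using M by simp
qed

lemma trig_span_mult:
  assumes f: "f \<in> trig_span S" and g: "g \<in> trig_span S'"
    and closed: "\<And>\<eta> \<xi>. \<eta> \<in> S \<Longrightarrow> \<xi> \<in> S' \<Longrightarrow> (\<lambda>x. \<eta> x * \<xi> x) \<in> S''"
  shows "(\<lambda>x. f x * g x) \<in> trig_span S''"
  using f
proof (induction rule: trig_span_induct)
  case (add \<eta> c f)
  have "(\<lambda>x. \<eta> x * g x) \<in> trig_span S''"
    using g
  proof (induction rule: trig_span_induct)
    case (add \<xi> d h)
    then show ?case
      using trig_span_add[OF trig_span_cmult[OF trig_span_base[OF closed[OF \<open>\<eta> \<in> S\<close> add(1)]], of d] add(3)]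
      by (simp add: algebra_simps)
  qed (simp add: trig_span_zero)
  from trig_span_add[OF trig_span_cmult[OF this, of c] add(3)] show ?case by (simp add: algebra_simps)
qed (simp add: trig_span_zero)

lemma trig_span_cnj:
  assumes f: "f \<in> trig_span S" and closed: "\<And>\<eta>. \<eta> \<in> S \<Longrightarrow> (\<lambda>x. cnj (\<eta> x)) \<in> S'"
  shows "(\<lambda>x. cnj (f x)) \<in> trig_span S'"
  using f
proof (induction rule: trig_span_induct)
  case (add \<eta> c f)
  then show ?case
    using trig_span_add[OF trig_span_cmult[OF trig_span_base[OF closed[OF add(1)]], of "cnj c"] add(3)]
    by simp
qed (simp add: trig_span_zero)

lemma mult_divide_add_one_less:
  fixes a e :: real
  assumes "0 < e" "0 \<le> a"
  shows "a * (e / (a + 1)) < e"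
proof -
  have "a * e < e * (a + 1)" using assms by (simp add: algebra_simps)
  then show ?thesis using assms by (simp add: pos_divide_less_eq)
qed

lemma measurable_cnj [measurable (raw)]:
  "f \<in> borel_measurable M \<Longrightarrow> (\<lambda>x. cnj (f x)) \<in> borel_measurable M"
  by (rule measurable_compose[OF _ borel_measurable_continuous_onI]) (auto intro!: continuous_intros)

context compact_haar
begin

lemma char_one [simp]: "(\<lambda>x. 1) \<in> chars"
  and char_mult: "\<eta> \<in> chars \<Longrightarrow> \<xi> \<in> chars \<Longrightarrow> (\<lambda>x. \<eta> x * \<xi> x) \<in> chars"
  and char_cnj: "\<eta> \<in> chars \<Longrightarrow> (\<lambda>x. cnj (\<eta> x)) \<in> chars"
  by (auto simp: char_iff norm_mult mult_ac intro!: continuous_intros)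

lemma trig_span_continuous:
  assumes "f \<in> trig_span S" "S \<subseteq> chars"
  shows "continuous_on UNIV f"
  using assms(1)
proof (induction rule: trig_span_induct)
  case (add \<eta> c f)
  then have "continuous_on UNIV \<eta>" using assms(2) char_continuous by blast
  then show ?case using add by (intro continuous_intros)
qed simp

lemma trig_span_const: "(\<lambda>x. 1) \<in> S \<Longrightarrow> (\<lambda>x. c) \<in> trig_span S"
  using trig_span_cmult[OF trig_span_base, of "\<lambda>x. 1" S c] by simp

text \<open>Stone-Weierstrass for the algebra of real-valued trigonometric polynomials, used for the
  real and the imaginary part of f. Closure under conjugation brings the real and imaginary parts of
  characters into that algebra, so it separates points.\<close>

lemma trig_poly_dense:
  assumes f: "continuous_on UNIV (f :: 'g \<Rightarrow> complex)" and e: "0 < e"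
  obtains q where "q \<in> trig_span chars" "\<And>x. cmod (f x - q x) < e"
proof -
  let ?R = "{g :: 'g \<Rightarrow> real. (\<lambda>x. complex_of_real (g x)) \<in> trig_span chars}"
  have cnj: "(\<lambda>x. cnj (h x)) \<in> trig_span chars" if "h \<in> trig_span chars" for h :: "'g \<Rightarrow> complex"
    by (rule trig_span_cnj[OF that char_cnj])
  have Re: "(\<lambda>x. Re (h x)) \<in> ?R" and Im: "(\<lambda>x. Im (h x)) \<in> ?R" if h: "h \<in> trig_span chars" for h
  proof -
    have "(\<lambda>x. complex_of_real (Re (h x))) = (\<lambda>x. 1/2 * (h x + cnj (h x)))"
      by (simp add: fun_eq_iff complex_add_cnj)
    then show "(\<lambda>x. Re (h x)) \<in> ?R"
      using trig_span_cmult[OF trig_span_add[OF h cnj[OF h]], of "1/2"] by simp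
    have "(\<lambda>x. complex_of_real (Im (h x))) = (\<lambda>x. - \<i>/2 * (h x - cnj (h x)))"
      by (auto simp: fun_eq_iff complex_eq_iff)
    then show "(\<lambda>x. Im (h x)) \<in> ?R"
      using trig_span_cmult[OF trig_span_diff[OF h cnj[OF h]], of "- \<i>/2"] by simp
  qed
  interpret R: function_ring_on ?R UNIV
  proof
    fix g assume "g \<in> ?R"
    then have "continuous_on UNIV (\<lambda>x. complex_of_real (g x))"
      by (intro trig_span_continuous[of _ chars]) auto
    from continuous_on_Re[OF this] show "continuous_on UNIV g" by simp
  next
    fix a b :: 'g assume "a \<noteq> b"
    then obtain \<eta> where \<eta>: "\<eta> \<in> chars" "\<eta> a \<noteq> \<eta> b" by (rule chars_separate_points)
    then have "Re (\<eta> a) \<noteq> Re (\<eta> b) \<or> Im (\<eta> a) \<noteq> Im (\<eta> b)" by (simp add: complex_eq_iff)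
    then show "\<exists>f\<in>?R. f a \<noteq> f b"
    proof
      assume "Re (\<eta> a) \<noteq> Re (\<eta> b)"
      then show ?thesis by (rule bexI[OF _ Re[OF trig_span_base[OF \<eta>(1)]]])
    next
      assume "Im (\<eta> a) \<noteq> Im (\<eta> b)"
      then show ?thesis by (rule bexI[OF _ Im[OF trig_span_base[OF \<eta>(1)]]])
    qed
  next
    fix g h assume "g \<in> ?R" "h \<in> ?R"
    then show "(\<lambda>x. g x + h x) \<in> ?R" "(\<lambda>x. g x * h x) \<in> ?R"
      using trig_span_add[of "\<lambda>x. complex_of_real (g x)" chars "\<lambda>x. complex_of_real (h x)"]
        trig_span_mult[of "\<lambda>x. complex_of_real (g x)" chars "\<lambda>x. complex_of_real (h x)" chars chars]
      by (simp_all add: char_mult)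
  qed (simp_all add: compact_UNIV trig_span_const)
  have "\<exists>g\<in>?R. \<forall>x\<in>UNIV. \<bar>Re (f x) - g x\<bar> < e/2" "\<exists>g\<in>?R. \<forall>x\<in>UNIV. \<bar>Im (f x) - g x\<bar> < e/2"
    using e by (intro R.Stone_Weierstrass_basic continuous_intros f; simp)+
  then obtain g h where g: "g \<in> ?R" "\<And>x. \<bar>Re (f x) - g x\<bar> < e/2" and h: "h \<in> ?R" "\<And>x. \<bar>Im (f x) - h x\<bar> < e/2"
    by auto
  define q where "q x = complex_of_real (g x) + \<i> * complex_of_real (h x)" for x
  have "q \<in> trig_span chars"
    unfolding q_def using g(1) h(1) by (intro trig_span_add trig_span_cmult) auto
  moreover have "cmod (f x - q x) < e" for x
  proof -
    have "cmod (f x - q x) \<le> \<bar>Re (f x - q x)\<bar> + \<bar>Im (f x - q x)\<bar>" by (rule cmod_le)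
    then show ?thesis using g(2)[of x] h(2)[of x] by (simp add: q_def)
  qed
  ultimately show ?thesis by (rule that)
qed

section \<open>Density of trigonometric polynomials in \<open>L\<^sup>p\<close>\<close>

lemma Lp_bounded:
  assumes "f \<in> borel_measurable m" "AE x in m. cmod (f x) \<le> B" "0 \<le> B" "0 < p"
  shows "f \<in> Lp m p" "Lp_norm m p f \<le> B"
proof -
  have c: "(\<lambda>x. complex_of_real B) \<in> Lp m p" by (simp add: Lp_def)
  show "f \<in> Lp m p" by (rule Lp_dominated[OF c]) (use assms in auto)
  have "Lp_norm m p f \<le> Lp_norm m p (\<lambda>x. complex_of_real B)"
    by (rule Lp_norm_mono[OF c]) (use assms in auto)
  also have "\<dots> = B" using assms by (simp add: Lp_norm_def powr_powr)
  finally show "Lp_norm m p f \<le> B" .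
qed

lemma Lp_mult_continuous:
  assumes \<phi>: "continuous_on UNIV \<phi>" "\<And>x. cmod (\<phi> x) \<le> B" and f: "f \<in> Lp m p" and p: "0 < p"
  shows "(\<lambda>x. \<phi> x * f x) \<in> Lp m p" "Lp_norm m p (\<lambda>x. \<phi> x * f x) \<le> B * Lp_norm m p f"
proof -
  have B: "0 \<le> B" using \<phi>(2) norm_ge_zero order_trans by blast
  have me: "(\<lambda>x. \<phi> x * f x) \<in> borel_measurable m"
    using continuous_measurable[OF \<phi>(1)] Lp_measurable[OF f] by simp
  have bd: "AE x in m. cmod (\<phi> x * f x) \<le> cmod (complex_of_real B * f x)"
    using \<phi>(2) B by (auto simp: norm_mult intro!: mult_right_mono)
  show "(\<lambda>x. \<phi> x * f x) \<in> Lp m p"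
    by (rule Lp_dominated[OF Lp_cmult[OF f] me bd p])
  show "Lp_norm m p (\<lambda>x. \<phi> x * f x) \<le> B * Lp_norm m p f"
    using Lp_norm_mono[OF Lp_cmult[OF f] me bd p] B by (simp add: Lp_norm_cmult[OF p])
qed

lemma outer_regular:
  assumes A: "A \<in> sets m" and d: "0 < d"
  obtains U where "open U" "A \<subseteq> U" "measure m U < measure m A + d"
proof -
  have A': "A \<in> sets borel" using A by (simp add: sets_m)
  have "(INF U\<in>{U. open U \<and> A \<subseteq> U}. emeasure m U) = emeasure m A"
    using haar A' unfolding normalized_haar_def by metis
  also have "\<dots> < ennreal (measure m A + d)"
    using d by (simp add: emeasure_eq_measure ennreal_lessI add_nonneg_pos)
  finally obtain U where U: "open U" "A \<subseteq> U" "emeasure m U < ennreal (measure m A + d)"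
    by (auto simp: INF_less_iff)
  then show ?thesis using that[of U] by (simp add: emeasure_eq_measure ennreal_less_iff)
qed

text \<open>Take open sets U around A and V around its complement of nearly the same measures, and a
  Urysohn function that is 0 off U and 1 off V. The error is at most 1 and lives on U \<inter> V. As
  U and V cover G, the two excesses of (e/2) powr p / 2 add up to a bound for the measure of U
  \<inter> V.\<close>

lemma indicator_approx:
  assumes A: "A \<in> sets m" and p: "1 \<le> p" and e: "0 < e"
  obtains g where "continuous_on UNIV g" "Lp_norm m p (\<lambda>x. indicator A x - g x) < e"
proof -
  have d: "0 < (e/2) powr p / 2" using e by simp
  obtain U where U: "open U" "A \<subseteq> U" "measure m U < measure m A + (e/2) powr p / 2"
    by (rule outer_regular[OF A d])
  have A': "- A \<in> sets m" using A sets.compl_sets[of A m] by (simp add: Compl_eq_Diff_UNIV)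
  obtain V where V: "open V" "- A \<subseteq> V" "measure m V < measure m (- A) + (e/2) powr p / 2"
    by (rule outer_regular[OF A' d])
  have UV: "U \<union> V = UNIV" using U V by auto
  have sets: "U \<in> sets m" "V \<in> sets m" using U V by (auto simp: sets_m)
  have "measure m (- A) = 1 - measure m A"
    using finite_measure_compl[OF A] by (simp add: Compl_eq_Diff_UNIV)
  moreover have "measure m (U \<inter> V) = measure m U + measure m V - 1"
    using measure_Un3[of U m V] sets UV by (simp add: fmeasurable_eq_sets)
  ultimately have mUV: "measure m (U \<inter> V) < (e/2) powr p" using U V by simp
  obtain f :: "'g \<Rightarrow> real" where f: "continuous_on UNIV f" "\<And>x. 0 \<le> f x \<and> f x \<le> 1"
    "\<And>x. x \<in> - U \<Longrightarrow> f x = 0" "\<And>x. x \<in> - V \<Longrightarrow> f x = 1"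
    by (rule Urysohn_UNIV[of "- U" "- V"]) (use U V UV in auto)
  define g where "g x = complex_of_real (f x)" for x
  have g: "continuous_on UNIV g" unfolding g_def by (intro continuous_intros f)
  have bd: "cmod (indicator A x - g x) \<le> cmod (indicator (U \<inter> V) x :: complex)" for x
  proof -
    consider "x \<notin> U" | "x \<notin> V" | "x \<in> U \<inter> V" by blast
    then show ?thesis
    proof cases
      case 3
      have "cmod (indicator A x - g x) = \<bar>indicator A x - f x\<bar>"
        unfolding g_def by (metis norm_of_real of_real_diff of_real_indicator)
      then show ?thesis using 3 f(2)[of x] by (auto simp: indicator_def)
    qed (use U V f in \<open>auto simp: g_def indicator_def\<close>)
  qed
  have i: "(indicator (U \<inter> V) :: 'g \<Rightarrow> complex) \<in> Lp m p"
    using sets p by (intro Lp_bounded(1)[of _ 1]) (auto simp: indicator_def)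
  have "Lp_norm m p (\<lambda>x. indicator A x - g x) \<le> Lp_norm m p (indicator (U \<inter> V))"
    using A continuous_measurable[OF g] bd p by (intro Lp_norm_mono[OF i]) auto
  also have "\<dots> \<le> e/2"
  proof -
    have "(LINT x|m. cmod (indicator (U \<inter> V) x) powr p) = (LINT x|m. indicator (U \<inter> V) x)"
      by (rule Bochner_Integration.integral_cong) (auto simp: indicator_def)
    also have "\<dots> = measure m (U \<inter> V)" using sets by simp
    finally show ?thesis using mUV p e by (subst Lp_norm_le_iff) auto
  qed
  finally show ?thesis using that g e by fastforce
qed

definition cont_approximable :: "real \<Rightarrow> ('g \<Rightarrow> complex) \<Rightarrow> bool" where
  "cont_approximable p f \<longleftrightarrow> f \<in> Lp m p \<and> (\<forall>e>0. \<exists>g. continuous_on UNIV g \<and> Lp_norm m p (\<lambda>x. f x - g x) < e)"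

lemma cont_approximable_add:
  assumes f: "cont_approximable p f" and g: "cont_approximable p g" and p: "1 \<le> p"
  shows "cont_approximable p (\<lambda>x. f x + g x)"
  unfolding cont_approximable_def
proof (intro conjI allI impI)
  show "(\<lambda>x. f x + g x) \<in> Lp m p" using f g p by (auto simp: cont_approximable_def intro: Lp_add)
  fix e :: real assume "0 < e"
  then have "0 < e/2" by simp
  obtain f' where f': "continuous_on UNIV f'" "Lp_norm m p (\<lambda>x. f x - f' x) < e/2"
    using f \<open>0 < e/2\<close> unfolding cont_approximable_def by blast
  obtain g' where g': "continuous_on UNIV g'" "Lp_norm m p (\<lambda>x. g x - g' x) < e/2"
    using g \<open>0 < e/2\<close> unfolding cont_approximable_def by blast
  have "Lp_norm m p (\<lambda>x. (f x - f' x) + (g x - g' x)) \<le> Lp_norm m p (\<lambda>x. f x - f' x) + Lp_norm m p (\<lambda>x. g x - g' x)"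
    using f g f' g' p
    by (intro Lp_norm_triangle Lp_diff continuous_Lp[OF f'(1)] continuous_Lp[OF g'(1)])
       (auto simp: cont_approximable_def)
  then have "Lp_norm m p (\<lambda>x. f x + g x - (f' x + g' x)) < e"
    using f' g' by (simp add: algebra_simps)
  then show "\<exists>h. continuous_on UNIV h \<and> Lp_norm m p (\<lambda>x. f x + g x - h x) < e"
    using f' g' by (intro exI[of _ "\<lambda>x. f' x + g' x"]) (auto intro: continuous_intros)
qed

lemma cont_approximable_sum:
  assumes "finite I" "\<And>i. i \<in> I \<Longrightarrow> cont_approximable p (f i)" "1 \<le> p"
  shows "cont_approximable p (\<lambda>x. \<Sum>i\<in>I. f i x)"
  using assms
proof (induction I)
  case empty
  have "\<exists>g. continuous_on UNIV g \<and> Lp_norm m p (\<lambda>x. 0 - g x) < e" if "0 < e" for e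
    using that by (intro exI[of _ "\<lambda>x. 0"]) auto
  then show ?case by (auto simp: cont_approximable_def)
next
  case (insert i I)
  then show ?case using cont_approximable_add[of p "f i" "\<lambda>x. \<Sum>i\<in>I. f i x"] by simp
qed

lemma cont_approximable_indicator:
  assumes A: "A \<in> sets m" and p: "1 \<le> p"
  shows "cont_approximable p (\<lambda>x. indicator A x * c)"
  unfolding cont_approximable_def
proof (intro conjI allI impI)
  show "(\<lambda>x. indicator A x * c) \<in> Lp m p"
    using A p by (intro Lp_bounded(1)[of _ "cmod c"]) (auto simp: indicator_def)
  fix e :: real assume e: "0 < e"
  have "0 < e / (cmod c + 1)" using e by (simp add: add_nonneg_pos)
  then obtain g where g: "continuous_on UNIV g" "Lp_norm m p (\<lambda>x. indicator A x - g x) < e / (cmod c + 1)"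
    using indicator_approx[OF A p] by metis
  have "Lp_norm m p (\<lambda>x. c * (indicator A x - g x)) \<le> cmod c * (e / (cmod c + 1))"
  proof -
    have "cmod c * Lp_norm m p (\<lambda>x. indicator A x - g x) \<le> cmod c * (e / (cmod c + 1))"
      using g by (intro mult_left_mono) auto
    then show ?thesis using p by (simp add: Lp_norm_cmult)
  qed
  also have "\<dots> < e" using e by (intro mult_divide_add_one_less) auto
  finally show "\<exists>h. continuous_on UNIV h \<and> Lp_norm m p (\<lambda>x. indicator A x * c - h x) < e"
    using g by (intro exI[of _ "\<lambda>x. c * g x"]) (auto simp: algebra_simps intro!: continuous_intros)
qed

text \<open>Simple functions with |F i| \<le> 2 |f| converge to f in norm, dominated by 3 |f|, and a
  simple function is a finite combination of indicators.\<close>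

lemma continuous_dense_Lp:
  assumes f: "f \<in> Lp m p" and p: "1 \<le> p" and e: "0 < e"
  obtains g where "continuous_on UNIV g" "Lp_norm m p (\<lambda>x. f x - g x) < e"
proof -
  have fm: "f \<in> borel_measurable m" using f by (rule Lp_measurable)
  obtain F where F: "\<And>i. simple_function m (F i)" "\<And>x. (\<lambda>i. F i x) \<longlonglongrightarrow> f x"
    "\<And>i x. cmod (F i x) \<le> 2 * cmod (f x)"
    using borel_measurable_implies_sequence_metric[OF fm, of 0] by auto
  have Fm: "F i \<in> borel_measurable m" for i using F(1) by (rule borel_measurable_simple_function)
  have "(\<lambda>i. LINT x|m. cmod (f x - F i x) powr p) \<longlonglongrightarrow> (LINT x|m. 0)"
  proof (rule integral_dominated_convergence[where w = "\<lambda>x. cmod (3 * f x) powr p"])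
    show "integrable m (\<lambda>x. cmod (3 * f x) powr p)" by (rule Lp_integrable[OF Lp_cmult[OF f]])
    show "AE x in m. (\<lambda>i. cmod (f x - F i x) powr p) \<longlonglongrightarrow> 0"
    proof (rule AE_I2)
      fix x
      have "(\<lambda>i. cmod (f x - F i x)) \<longlonglongrightarrow> cmod (f x - f x)"
        by (intro tendsto_intros F)
      then have "(\<lambda>i. cmod (f x - F i x) powr p) \<longlonglongrightarrow> 0 powr p"
        using p by (intro tendsto_powr2) auto
      then show "(\<lambda>i. cmod (f x - F i x) powr p) \<longlonglongrightarrow> 0" using p by simp
    qed
    show "AE x in m. norm (cmod (f x - F i x) powr p) \<le> cmod (3 * f x) powr p" for i
    proof (rule AE_I2)
      fix x
      have "cmod (f x - F i x) \<le> cmod (3 * f x)"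
        using F(3)[of i x] norm_triangle_ineq4[of "f x" "F i x"] by (simp add: norm_mult)
      then show "norm (cmod (f x - F i x) powr p) \<le> cmod (3 * f x) powr p"
        using p by (auto intro: powr_mono2)
    qed
  qed (use fm Fm in measurable)
  then have "(\<lambda>i. LINT x|m. cmod (f x - F i x) powr p) \<longlonglongrightarrow> 0" by simp
  then have "\<forall>\<^sub>F i in sequentially. (LINT x|m. cmod (f x - F i x) powr p) < (e/3) powr p"
    using e by (intro order_tendstoD) auto
  then obtain i where i: "(LINT x|m. cmod (f x - F i x) powr p) < (e/3) powr p"
    by (auto simp: eventually_sequentially)
  have fi: "Lp_norm m p (\<lambda>x. f x - F i x) \<le> e/3"
    using i e p by (subst Lp_norm_le_iff) auto
  have "cont_approximable p (\<lambda>x. \<Sum>y\<in>F i ` UNIV. indicator (F i -` {y}) x * y)"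
  proof (rule cont_approximable_sum[OF _ _ p])
    show "finite (range (F i))" using simple_functionD(1)[OF F(1), of i] by simp
    show "cont_approximable p (\<lambda>x. indicator (F i -` {y}) x * y)" for y
      using simple_functionD(2)[OF F(1), of i "{y}"] by (intro cont_approximable_indicator p) simp
  qed
  moreover have "(\<lambda>x. \<Sum>y\<in>F i ` UNIV. indicator (F i -` {y}) x * y) = F i"
  proof
    fix x
    have "(\<Sum>y\<in>F i ` UNIV. indicator (F i -` {y}) x * y) = (\<Sum>y\<in>F i ` UNIV. if y = F i x then y else 0)"
      by (rule sum.cong) (auto simp: indicator_def)
    then show "(\<Sum>y\<in>F i ` UNIV. indicator (F i -` {y}) x * y) = F i x"
      using simple_functionD(1)[OF F(1), of i] by simp
  qed
  ultimately have ap: "cont_approximable p (F i)" by simp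
  then obtain g where g: "continuous_on UNIV g" "Lp_norm m p (\<lambda>x. F i x - g x) < e/3"
    using e unfolding cont_approximable_def by (metis divide_pos_pos zero_less_numeral)
  have "Lp_norm m p (\<lambda>x. f x - g x) \<le> Lp_norm m p (\<lambda>x. f x - F i x) + Lp_norm m p (\<lambda>x. F i x - g x)"
    using ap p by (intro Lp_norm_diff_triangle continuous_Lp[OF g(1)] f) (auto simp: cont_approximable_def)
  also have "\<dots> < e" using fi g e by simp
  finally show ?thesis using that g by blast
qed

lemma trig_poly_dense_Lp:
  assumes f: "f \<in> Lp m p" and p: "1 \<le> p" and e: "0 < e"
  obtains q where "q \<in> trig_span chars" "Lp_norm m p (\<lambda>x. f x - q x) < e"
proof -
  obtain g where g: "continuous_on UNIV g" "Lp_norm m p (\<lambda>x. f x - g x) < e/2"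
    by (rule continuous_dense_Lp[OF f p, of "e/2"]) (use e in auto)
  obtain q where q: "q \<in> trig_span chars" "\<And>x. cmod (g x - q x) < e/2"
    by (rule trig_poly_dense[OF g(1), of "e/2"]) (use e in auto)
  have cq: "continuous_on UNIV q" by (rule trig_span_continuous[OF q(1)]) simp
  have "Lp_norm m p (\<lambda>x. g x - q x) \<le> e/2"
    using q(2) p e by (intro Lp_bounded(2) continuous_measurable continuous_intros g cq) (auto intro: less_imp_le)
  moreover have "Lp_norm m p (\<lambda>x. f x - q x) \<le> Lp_norm m p (\<lambda>x. f x - g x) + Lp_norm m p (\<lambda>x. g x - q x)"
    using p by (intro Lp_norm_diff_triangle continuous_Lp f g cq) auto
  ultimately show ?thesis using that q g by force
qed

section \<open>Fourier coefficients\<close>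

lemma integral_char:
  assumes \<eta>: "\<eta> \<in> chars"
  shows "(LINT x|m. \<eta> x) = (if \<eta> = (\<lambda>x. 1) then 1 else 0)"
proof (cases "\<eta> = (\<lambda>x. 1)")
  case False
  then obtain a where a: "\<eta> a \<noteq> 1" by auto
  have "(LINT x|m. \<eta> x) = (LINT x|m. \<eta> (x + a))"
    using integral_translation[OF continuous_measurable[OF char_continuous[OF \<eta>]], of a] by simp
  also have "\<dots> = (LINT x|m. \<eta> x) * \<eta> a" by (simp add: char_add[OF \<eta>])
  finally have "(LINT x|m. \<eta> x) * (\<eta> a - 1) = 0" by (simp add: algebra_simps)
  then show ?thesis using a False by simp
qed simp

lemma fourier_coeff_char:
  assumes \<eta>: "\<eta> \<in> chars" and \<xi>: "\<xi> \<in> chars"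
  shows "fourier_coeff m \<xi> \<eta> = (if \<xi> = \<eta> then 1 else 0)"
proof -
  have "(\<lambda>x. \<xi> x * cnj (\<eta> x)) = (\<lambda>x. 1) \<longleftrightarrow> \<xi> = \<eta>"
  proof
    assume *: "(\<lambda>x. \<xi> x * cnj (\<eta> x)) = (\<lambda>x. 1)"
    have "\<xi> x = \<eta> x" for x
    proof -
      have "\<eta> x = (\<xi> x * cnj (\<eta> x)) * \<eta> x" using fun_cong[OF *, of x] by simp
      also have "\<dots> = \<xi> x * (\<eta> x * cnj (\<eta> x))" by (simp only: mult_ac)
      finally show ?thesis using char_cnj_mult[OF \<eta>, of x] by simp
    qed
    then show "\<xi> = \<eta>" by auto
  qed (use \<eta> in \<open>auto simp: char_cnj_mult\<close>)
  then show ?thesis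
    using integral_char[OF char_mult[OF \<xi> char_cnj[OF \<eta>]]] by (simp add: fourier_coeff_def)
qed

lemma fourier_integrable:
  assumes f: "f \<in> Lp m p" and p: "1 < p" and \<eta>: "\<eta> \<in> chars"
  shows "integrable m (\<lambda>x. f x * cnj (\<eta> x))"
proof -
  have "(\<lambda>x. cnj (\<eta> x) * f x) \<in> Lp m p"
    using p \<eta> by (intro Lp_mult_continuous(1)[where B = 1] f continuous_intros char_continuous) auto
  from Lp_integrable_and_norm(1)[OF this p emeasure_space_m] show ?thesis by (simp add: mult.commute)
qed

lemma fourier_coeff_add:
  assumes "f \<in> Lp m p" "g \<in> Lp m p" "1 < p" "\<eta> \<in> chars"
  shows "fourier_coeff m (\<lambda>x. f x + g x) \<eta> = fourier_coeff m f \<eta> + fourier_coeff m g \<eta>"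
  unfolding fourier_coeff_def distrib_right
  using fourier_integrable assms by (intro Bochner_Integration.integral_add) blast+

lemma fourier_coeff_diff:
  assumes "f \<in> Lp m p" "g \<in> Lp m p" "1 < p" "\<eta> \<in> chars"
  shows "fourier_coeff m (\<lambda>x. f x - g x) \<eta> = fourier_coeff m f \<eta> - fourier_coeff m g \<eta>"
  unfolding fourier_coeff_def left_diff_distrib
  using fourier_integrable assms by (intro Bochner_Integration.integral_diff) blast+

lemma fourier_coeff_cmult: "fourier_coeff m (\<lambda>x. c * f x) \<eta> = c * fourier_coeff m f \<eta>"
  by (simp add: fourier_coeff_def mult.assoc)

lemma fourier_coeff_zero [simp]: "fourier_coeff m (\<lambda>x. 0) \<eta> = 0"
  by (simp add: fourier_coeff_def)

lemma fourier_coeff_cong_AE: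
  assumes "AE x in m. f x = g x" "f \<in> borel_measurable m" "g \<in> borel_measurable m" "\<eta> \<in> chars"
  shows "fourier_coeff m f \<eta> = fourier_coeff m g \<eta>"
  unfolding fourier_coeff_def
  by (rule integral_cong_AE)
     (use assms continuous_measurable[OF char_continuous[OF assms(4)]] in \<open>auto elim!: eventually_mono\<close>)

lemma fourier_coeff_le:
  assumes f: "f \<in> Lp m p" and p: "1 < p" and \<eta>: "\<eta> \<in> chars"
  shows "cmod (fourier_coeff m f \<eta>) \<le> Lp_norm m p f"
proof -
  have "cmod (fourier_coeff m f \<eta>) \<le> (LINT x|m. cmod (f x * cnj (\<eta> x)))"
    unfolding fourier_coeff_def by (rule integral_norm_bound)
  also have "\<dots> = (LINT x|m. cmod (f x))" using \<eta> by (simp add: norm_mult)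
  also have "\<dots> \<le> Lp_norm m p f" by (rule Lp_integrable_and_norm(2)[OF f p emeasure_space_m])
  finally show ?thesis .
qed

lemma fourier_coeff_tendsto:
  assumes f: "\<And>n. f n \<in> Lp m p" and g: "g \<in> Lp m p" and p: "1 < p" and \<eta>: "\<eta> \<in> chars"
    and lim: "(\<lambda>n. Lp_norm m p (\<lambda>x. f n x - g x)) \<longlonglongrightarrow> 0"
  shows "(\<lambda>n. fourier_coeff m (f n) \<eta>) \<longlonglongrightarrow> fourier_coeff m g \<eta>"
proof (rule LIM_zero_cancel, rule Lim_null_comparison[OF _ lim], rule always_eventually, rule allI)
  fix n
  show "cmod (fourier_coeff m (f n) \<eta> - fourier_coeff m g \<eta>) \<le> Lp_norm m p (\<lambda>x. f n x - g x)"
    using fourier_coeff_le[OF Lp_diff[OF f g] p \<eta>] fourier_coeff_diff[OF f g p \<eta>] p by simp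
qed

lemma fourier_coeff_modulate:
  "fourier_coeff m (\<lambda>x. \<xi> x * f x) \<eta> = fourier_coeff m f (\<lambda>x. \<eta> x * cnj (\<xi> x))"
  by (simp add: fourier_coeff_def mult_ac)

text \<open>The conjugate sign h of f is bounded, hence lies in the dual space, where trigonometric
  polynomials approximate it. These integrate to 0 against f, so the integral of f h = |f| is
  0.\<close>

theorem fourier_coeff_unique:
  assumes f: "f \<in> Lp m p" and p: "1 < p" and zero: "\<And>\<eta>. \<eta> \<in> chars \<Longrightarrow> fourier_coeff m f \<eta> = 0"
  shows "AE x in m. f x = 0"
proof -
  have [measurable]: "f \<in> borel_measurable m" using f by (rule Lp_measurable)
  define q where "q = p / (p - 1)"
  have pq: "1 < q" "1 / p + 1 / q = 1" using p by (auto simp: q_def field_simps)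
  define h where "h x = (if f x = 0 then 0 else cnj (f x) / of_real (cmod (f x)))" for x
  have [measurable]: "h \<in> borel_measurable m" unfolding h_def by measurable
  have h: "h \<in> Lp m q"
    using pq by (intro Lp_bounded(1)[of _ 1]) (auto simp: h_def norm_divide)
  have fh: "f x * h x = of_real (cmod (f x))" for x
    by (auto simp: h_def complex_norm_square[symmetric] power2_eq_square)
  have "cmod (LINT x|m. f x * h x) \<le> e" if e: "0 < e" for e
  proof -
    have "0 < e / (Lp_norm m p f + 1)" using e by (simp add: add_nonneg_pos)
    then obtain r where r: "r \<in> trig_span chars" "Lp_norm m q (\<lambda>x. h x - r x) < e / (Lp_norm m p f + 1)"
      using trig_poly_dense_Lp[OF h] pq(1) by (metis less_imp_le)
    have rq: "s \<in> Lp m q" if "s \<in> trig_span chars" for s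
      using trig_span_continuous[OF that] pq by (intro continuous_Lp) auto
    have "(LINT x|m. f x * r x) = 0"
      using r(1)
    proof (induction rule: trig_span_induct)
      case (add \<eta> c s)
      have "(LINT x|m. f x * \<eta> x) = 0"
        using zero[OF char_cnj[OF add(1)]] by (simp add: fourier_coeff_def)
      moreover have "f x * (c * \<eta> x + s x) = c * (f x * \<eta> x) + f x * s x" for x by (simp add: algebra_simps)
      ultimately show ?case
        using add Holder(1)[OF f rq p pq, of \<eta>] Holder(1)[OF f rq p pq, of s] trig_span_base[of \<eta>]
        by simp
    qed simp
    then have "(LINT x|m. f x * h x) = (LINT x|m. f x * (h x - r x))"
      using Holder(1)[OF f rq[OF r(1)] p pq] Holder(1)[OF f h p pq] by (simp add: right_diff_distrib)
    also have "cmod \<dots> \<le> Lp_norm m p f * Lp_norm m q (\<lambda>x. h x - r x)"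
      using pq by (intro Holder(3)[OF f _ p pq] Lp_diff h rq r) auto
    also have "\<dots> \<le> Lp_norm m p f * (e / (Lp_norm m p f + 1))"
      using r by (intro mult_left_mono) auto
    also have "\<dots> \<le> e" using e by (intro less_imp_le[OF mult_divide_add_one_less]) auto
    finally show ?thesis .
  qed
  then have "cmod (LINT x|m. f x * h x) \<le> 0" by (rule field_le_epsilon) simp
  then have "(LINT x|m. cmod (f x)) = 0"
    unfolding fh integral_complex_of_real norm_of_real by (metis abs_le_zero_iff)
  then have "AE x in m. cmod (f x) = 0"
    using Lp_integrable_and_norm(1)[OF f p emeasure_space_m] by (subst integral_nonneg_eq_0_iff_AE[symmetric]) auto
  then show ?thesis by simp
qed

lemma fourier_coeff_eq_imp_AE_eq:
  assumes f: "f \<in> Lp m p" and g: "g \<in> Lp m p" and p: "1 < p"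
    and eq: "\<And>\<eta>. \<eta> \<in> chars \<Longrightarrow> fourier_coeff m f \<eta> = fourier_coeff m g \<eta>"
  shows "AE x in m. f x = g x"
proof -
  have "AE x in m. f x - g x = 0"
    using p by (intro fourier_coeff_unique[OF Lp_diff[OF f g] p]) (auto simp: fourier_coeff_diff[OF f g p] eq)
  then show ?thesis by simp
qed

end

section \<open>The Riesz projection\<close>

text \<open>The pointwise inequality behind M. Riesz's theorem. For |arg w| \<ge> \<gamma> the real
  part of w powr p is at most -\<delta> |w| powr p, and B = 1 / \<delta> suffices. For smaller
  angles Re w \<ge> c |w|, and A is large enough to pay for the B term as well.\<close>

lemma powr_real_part_bound:
  fixes p :: real
  assumes p: "1 < p" "p \<le> 2"
  obtains A B where "0 < A" "0 < B"
    "\<And>w. 0 < Re w \<Longrightarrow> cmod w powr p \<le> A * Re w powr p - B * Re (w powr of_real p)"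
proof -
  \<comment> \<open>For 1 < p \<le> 2 this choice gives \<gamma> < pi / 2, while p \<gamma> = (p +
    1) pi / 4 lies strictly between pi / 2 and pi.\<close>
  define \<gamma> where "\<gamma> = (p + 1) * pi / (4 * p)"
  have \<gamma>: "0 < \<gamma>" "\<gamma> < pi / 2" "pi / 2 < p * \<gamma>" "p * \<gamma> < pi"
  proof -
    have "(p + 1) * pi < (2 * p) * pi" using p by (intro mult_strict_right_mono) auto
    then show "\<gamma> < pi / 2" using p by (simp add: \<gamma>_def field_simps)
    have "p * \<gamma> = (p + 1) * pi / 4" using p by (simp add: \<gamma>_def)
    moreover have "2 * pi < (p + 1) * pi" "(p + 1) * pi \<le> 3 * pi"
      using p by (intro mult_strict_right_mono mult_right_mono; simp)+
    ultimately show "pi / 2 < p * \<gamma>" "p * \<gamma> < pi" using pi_gt_zero by linarith+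
    show "0 < \<gamma>" using p by (simp add: \<gamma>_def)
  qed
  define \<delta> where "\<delta> = - cos (p * \<gamma>)"
  have \<delta>: "0 < \<delta>"
    using cos_lt_zero_pi[of "p * \<gamma>"] \<gamma> by (simp add: \<delta>_def)
  define c where "c = cos \<gamma>"
  have c: "0 < c" unfolding c_def using \<gamma> by (intro cos_gt_zero) auto
  define B where "B = 1 / \<delta>"
  define A where "A = (1 + B) / c powr p"
  have AB: "0 < A" "0 < B" using \<delta> c by (auto simp: A_def B_def intro!: divide_pos_pos add_pos_pos)
  have angle: "1 \<le> A * cos t powr p - B * cos (p * t)" if t: "0 \<le> t" "t < pi / 2" for t
  proof (cases "t < \<gamma>")
    case True
    then have "c \<le> cos t" unfolding c_def using t \<gamma> by (intro cos_monotone_0_pi_le) auto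
    then have "A * c powr p \<le> A * cos t powr p"
      using AB c p by (intro mult_left_mono powr_mono2) auto
    moreover have "A * c powr p = 1 + B" using c by (simp add: A_def)
    moreover have "B * cos (p * t) \<le> B * 1" using AB by (intro mult_left_mono) auto
    ultimately show ?thesis by simp
  next
    case False
    have "p * t \<le> 2 * (pi / 2)" using p t by (intro mult_mono) auto
    then have "cos (p * t) \<le> cos (p * \<gamma>)"
      using False p \<gamma> by (intro cos_monotone_0_pi_le mult_left_mono) auto
    then have "B * \<delta> \<le> B * - cos (p * t)" using AB by (intro mult_left_mono) (auto simp: \<delta>_def)
    moreover have "B * \<delta> = 1" using \<delta> by (simp add: B_def)
    moreover have "0 \<le> A * cos t powr p" using AB by simp
    ultimately show ?thesis by simp
  qed
  have "cmod w powr p \<le> A * Re w powr p - B * Re (w powr of_real p)" if w: "0 < Re w" for w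
  proof -
    have w0: "w \<noteq> 0" using w by auto
    define \<theta> where "\<theta> = Im (Ln w)"
    have \<theta>: "\<bar>\<theta>\<bar> < pi / 2" using Re_Ln_pos_lt[OF w0] w by (simp add: \<theta>_def)
    have Ln: "Ln w = Complex (ln (cmod w)) \<theta>" using w0 by (simp add: \<theta>_def complex_eq_iff)
    have "Re w = Re (exp (Ln w))" using w0 by simp
    then have Re_w: "Re w = cmod w * cos \<theta>" using w0 unfolding Ln by (simp add: Re_exp)
    have "w powr of_real p = exp (of_real p * Ln w)" using w0 by (simp add: powr_def)
    then have Re_wp: "Re (w powr of_real p) = cmod w powr p * cos (p * \<theta>)"
      using w0 unfolding Ln by (simp add: Re_exp powr_def)
    have cos_abs: "cos \<theta> = cos \<bar>\<theta>\<bar>" "cos (p * \<theta>) = cos (p * \<bar>\<theta>\<bar>)"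
      by (auto simp: abs_if)
    have "0 \<le> cos \<theta>" using \<theta> by (intro cos_ge_zero) auto
    then have "A * Re w powr p - B * Re (w powr of_real p)
        = cmod w powr p * (A * cos \<theta> powr p - B * cos (p * \<theta>))"
      unfolding Re_w Re_wp by (simp add: powr_mult algebra_simps)
    moreover have "cmod w powr p * 1 \<le> cmod w powr p * (A * cos \<theta> powr p - B * cos (p * \<theta>))"
      unfolding cos_abs using angle[of "\<bar>\<theta>\<bar>"] \<theta> by (intro mult_left_mono) auto
    ultimately show ?thesis by simp
  qed
  then show ?thesis using that AB by blast
qed

section \<open>Polynomials over a linearly ordered character group\<close>

locale ordered_dual = compact_haar m for m :: "'g::{topological_ab_group_add, t2_space} measure" +
  fixes T :: "('g \<Rightarrow> complex) set"
  assumes cone: "positive_cone (char_group :: ('g \<Rightarrow> complex) monoid) T"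
    and linear: "linearly_ordered (char_group :: ('g \<Rightarrow> complex) monoid) T"
begin

lemma char_group_simps:
  "\<eta> \<otimes>\<^bsub>char_group\<^esub> \<xi> = (\<lambda>x. \<eta> x * \<xi> x)" "\<one>\<^bsub>char_group\<^esub> = (\<lambda>x. 1)"
  by (simp_all add: char_group_def)

lemma inv_char: "\<eta> \<in> chars \<Longrightarrow> inv\<^bsub>char_group\<^esub> \<eta> = (\<lambda>x. cnj (\<eta> x))"
proof -
  assume \<eta>: "\<eta> \<in> chars"
  interpret comm_group "char_group :: ('g \<Rightarrow> complex) monoid" by (rule comm_group_char_group)
  have "(\<lambda>x. cnj (\<eta> x)) \<otimes>\<^bsub>char_group\<^esub> \<eta> = \<one>\<^bsub>char_group\<^esub>"
    using char_cnj_mult[OF \<eta>] by (simp add: char_group_simps fun_eq_iff mult.commute)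
  then show ?thesis by (rule inv_equality[OF _ \<eta> char_cnj[OF \<eta>]])
qed

lemma T_chars: "T \<subseteq> chars"
  and T_mult: "\<eta> \<in> T \<Longrightarrow> \<xi> \<in> T \<Longrightarrow> (\<lambda>x. \<eta> x * \<xi> x) \<in> T"
  and T_one: "(\<lambda>x. 1) \<in> T"
  and T_inter: "T \<inter> set_inv\<^bsub>char_group\<^esub> T = {\<lambda>x. 1}"
  using cone unfolding positive_cone_def char_group_simps by blast+

lemma set_inv_T: "set_inv\<^bsub>char_group\<^esub> T = (\<lambda>\<eta> x. cnj (\<eta> x)) ` T"
  unfolding SET_INV_def using T_chars inv_char by (auto simp: subset_iff)

lemma T_antisym: "\<eta> \<in> T \<Longrightarrow> (\<lambda>x. cnj (\<eta> x)) \<in> T \<Longrightarrow> \<eta> = (\<lambda>x. 1)"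
proof -
  assume \<eta>: "\<eta> \<in> T" "(\<lambda>x. cnj (\<eta> x)) \<in> T"
  have "\<eta> \<in> set_inv\<^bsub>char_group\<^esub> T"
    unfolding set_inv_T using \<eta>(2) by (auto intro: image_eqI[of _ _ "\<lambda>x. cnj (\<eta> x)"])
  then show ?thesis using T_inter \<eta> by blast
qed

lemma T_total: "\<eta> \<in> chars \<Longrightarrow> \<eta> \<in> T \<or> (\<lambda>x. cnj (\<eta> x)) \<in> T"
  using linear unfolding linearly_ordered_def set_inv_T by auto

lemma T_mult_ne_one:
  assumes "\<eta> \<in> T" "\<xi> \<in> T" "\<eta> \<noteq> (\<lambda>x. 1)"
  shows "(\<lambda>x. \<eta> x * \<xi> x) \<noteq> (\<lambda>x. 1)"
proof
  assume *: "(\<lambda>x. \<eta> x * \<xi> x) = (\<lambda>x. 1)"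
  have "\<xi> x = cnj (\<eta> x)" for x
  proof -
    have "\<eta> x * \<xi> x = \<eta> x * cnj (\<eta> x)"
      using fun_cong[OF *, of x] char_cnj_mult[of \<eta> x] assms(1) T_chars by auto
    then show ?thesis using char_nonzero[of \<eta> x] assms(1) T_chars by auto
  qed
  then have "\<xi> = (\<lambda>x. cnj (\<eta> x))" by auto
  then show False using T_antisym assms by blast
qed

lemma trig_span_T_continuous: "f \<in> trig_span T \<Longrightarrow> continuous_on UNIV f"
  by (rule trig_span_continuous[OF _ T_chars])

lemma trig_continuous: "f \<in> trig_span chars \<Longrightarrow> continuous_on UNIV f"
  by (rule trig_span_continuous[OF _ subset_refl])

lemma trig_Lp: "f \<in> trig_span chars \<Longrightarrow> 0 < p \<Longrightarrow> f \<in> Lp m p"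
  by (rule continuous_Lp[OF trig_continuous])

lemma fourier_coeff_add_cont:
  assumes "continuous_on UNIV f" "continuous_on UNIV g" "\<eta> \<in> chars"
  shows "fourier_coeff m (\<lambda>x. f x + g x) \<eta> = fourier_coeff m f \<eta> + fourier_coeff m g \<eta>"
  using assms by (intro fourier_coeff_add[of _ 2] continuous_Lp) auto

lemma fourier_coeff_one: "fourier_coeff m f (\<lambda>x. 1) = (LINT x|m. f x)"
  by (simp add: fourier_coeff_def)

lemma continuous_fourier_unique:
  assumes "continuous_on UNIV f" "continuous_on UNIV g"
    and "\<And>\<eta>. \<eta> \<in> chars \<Longrightarrow> fourier_coeff m f \<eta> = fourier_coeff m g \<eta>"
  shows "f = g"
  using assms by (intro continuous_AE_eq fourier_coeff_eq_imp_AE_eq[of _ 2] continuous_Lp) auto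

lemma finite_spectrum:
  assumes "f \<in> trig_span chars"
  shows "finite {\<eta> \<in> chars. fourier_coeff m f \<eta> \<noteq> 0}"
  using assms
proof (induction rule: trig_span_induct)
  case (add \<eta> c f)
  have "fourier_coeff m (\<lambda>x. c * \<eta> x + f x) \<xi> = c * fourier_coeff m \<eta> \<xi> + fourier_coeff m f \<xi>"
    if "\<xi> \<in> chars" for \<xi>
    using that add trig_continuous char_continuous
    by (subst fourier_coeff_add_cont) (auto simp: fourier_coeff_cmult intro!: continuous_intros)
  then have "{\<xi> \<in> chars. fourier_coeff m (\<lambda>x. c * \<eta> x + f x) \<xi> \<noteq> 0}
      \<subseteq> insert \<eta> {\<xi> \<in> chars. fourier_coeff m f \<xi> \<noteq> 0}"
    using add(1) by (auto simp: fourier_coeff_char)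
  then show ?case using add(3) by (simp add: finite_subset)
qed simp

lemma fourier_coeff_trig_poly:
  assumes "finite M" "M \<subseteq> chars" "\<eta> \<in> chars"
  shows "fourier_coeff m (trig_poly M c) \<eta> = (if \<eta> \<in> M then c \<eta> else 0)"
  using assms(1,2)
proof (induction M)
  case empty
  then show ?case by (simp add: trig_poly_def [abs_def])
next
  case (insert \<xi> M)
  have eq: "trig_poly (insert \<xi> M) c = (\<lambda>x. c \<xi> * \<xi> x + trig_poly M c x)"
    using insert by (simp add: trig_poly_def fun_eq_iff)
  have "continuous_on UNIV (trig_poly M c)"
    using insert by (intro trig_continuous trig_spanI) auto
  then show ?case
    unfolding eq using insert assms(3) char_continuous[of \<xi>]
    by (subst fourier_coeff_add_cont) (auto simp: fourier_coeff_cmult fourier_coeff_char intro!: continuous_intros)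
qed

text \<open>Given by the coefficients of f, so it does not depend on how f is written as a
  polynomial.\<close>

definition riesz :: "('g \<Rightarrow> complex) \<Rightarrow> 'g \<Rightarrow> complex" where
  "riesz f = trig_poly {\<eta> \<in> T. fourier_coeff m f \<eta> \<noteq> 0} (fourier_coeff m f)"

lemma riesz_span: "f \<in> trig_span chars \<Longrightarrow> riesz f \<in> trig_span T"
  unfolding riesz_def
  by (rule trig_spanI, rule finite_subset[OF _ finite_spectrum]) (use T_chars in auto)

lemma riesz_continuous: "f \<in> trig_span chars \<Longrightarrow> continuous_on UNIV (riesz f)"
  by (rule trig_span_T_continuous[OF riesz_span])

lemma fourier_coeff_riesz:
  assumes f: "f \<in> trig_span chars" and \<eta>: "\<eta> \<in> chars"
  shows "fourier_coeff m (riesz f) \<eta> = (if \<eta> \<in> T then fourier_coeff m f \<eta> else 0)"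
proof -
  have "finite {\<eta> \<in> T. fourier_coeff m f \<eta> \<noteq> 0}"
    by (rule finite_subset[OF _ finite_spectrum[OF f]]) (use T_chars in auto)
  then show ?thesis
    unfolding riesz_def using T_chars \<eta> by (subst fourier_coeff_trig_poly) auto
qed

lemma riesz_eqI:
  assumes "f \<in> trig_span chars" "continuous_on UNIV h"
    "\<And>\<eta>. \<eta> \<in> chars \<Longrightarrow> fourier_coeff m h \<eta> = (if \<eta> \<in> T then fourier_coeff m f \<eta> else 0)"
  shows "riesz f = h"
  using assms by (intro continuous_fourier_unique riesz_continuous) (auto simp: fourier_coeff_riesz)

lemma riesz_add:
  assumes f: "f \<in> trig_span chars" and g: "g \<in> trig_span chars"
  shows "riesz (\<lambda>x. f x + g x) = (\<lambda>x. riesz f x + riesz g x)"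
  by (rule riesz_eqI)
     (use f g in \<open>auto intro!: trig_span_add continuous_intros riesz_continuous simp: fourier_coeff_add_cont riesz_continuous trig_continuous fourier_coeff_riesz\<close>)

lemma riesz_cmult:
  assumes f: "f \<in> trig_span chars"
  shows "riesz (\<lambda>x. c * f x) = (\<lambda>x. c * riesz f x)"
  by (rule riesz_eqI)
     (use f in \<open>auto intro!: trig_span_cmult continuous_intros riesz_continuous simp: fourier_coeff_cmult fourier_coeff_riesz\<close>)

lemma riesz_diff:
  assumes f: "f \<in> trig_span chars" and g: "g \<in> trig_span chars"
  shows "riesz (\<lambda>x. f x - g x) = (\<lambda>x. riesz f x - riesz g x)"
  using riesz_add[OF f trig_span_cmult[OF g], of "-1"] riesz_cmult[OF g, of "-1"] by (simp add: fun_eq_iff)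

text \<open>A product of two characters in T is trivial only if both are, so only the constant terms
  contribute to the integral.\<close>

lemma integral_mult_T:
  assumes F: "F \<in> trig_span T" and G: "G \<in> trig_span T"
  shows "(LINT x|m. F x * G x) = (LINT x|m. F x) * (LINT x|m. G x)"
  using F
proof (induction rule: trig_span_induct)
  case (add \<eta> c f)
  have \<eta>: "\<eta> \<in> chars" using add T_chars by blast
  have *: "(LINT x|m. \<eta> x * G x) = (LINT x|m. \<eta> x) * (LINT x|m. G x)"
    using G
  proof (induction rule: trig_span_induct)
    case (add \<xi> d g)
    have \<xi>: "\<xi> \<in> chars" using add T_chars by blast
    have "(LINT x|m. \<eta> x * \<xi> x) = (LINT x|m. \<eta> x) * (LINT x|m. \<xi> x)"
    proof (cases "\<eta> = (\<lambda>x. 1)")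
      case False
      then show ?thesis
        using T_mult_ne_one[OF \<open>\<eta> \<in> T\<close> add(1)] by (simp add: integral_char char_mult \<eta> \<xi>)
    qed simp
    moreover have "integrable m (\<lambda>x. \<eta> x * \<xi> x)" "integrable m (\<lambda>x. \<eta> x * g x)" "integrable m \<xi>" "integrable m g"
      by (intro continuous_integrable continuous_intros char_continuous \<eta> \<xi> trig_span_T_continuous[OF add(2)])+
    moreover have "\<eta> x * (d * \<xi> x + g x) = d * (\<eta> x * \<xi> x) + \<eta> x * g x" for x by (simp add: algebra_simps)
    ultimately show ?case using add(3) by (simp add: algebra_simps)
  qed simp
  have "integrable m (\<lambda>x. \<eta> x * G x)" "integrable m (\<lambda>x. f x * G x)" "integrable m \<eta>" "integrable m f"
    by (intro continuous_integrable continuous_intros char_continuous \<eta>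
        trig_span_T_continuous[OF add(2)] trig_span_T_continuous[OF G])+
  moreover have "(c * \<eta> x + f x) * G x = c * (\<eta> x * G x) + f x * G x" for x by (simp add: algebra_simps)
  ultimately show ?case using add(3) * by (simp add: algebra_simps)
qed simp

lemma integral_power_T:
  assumes F: "F \<in> trig_span T"
  shows "(\<lambda>x. F x ^ n) \<in> trig_span T \<and> (LINT x|m. F x ^ n) = (LINT x|m. F x) ^ n"
proof (induction n)
  case 0
  then show ?case using trig_span_const[OF T_one] by simp
next
  case (Suc n)
  then have n: "(\<lambda>x. F x ^ n) \<in> trig_span T" "(LINT x|m. F x ^ n) = (LINT x|m. F x) ^ n" by auto
  have "(\<lambda>x. F x * F x ^ n) \<in> trig_span T"
    by (rule trig_span_mult[OF F n(1)]) (rule T_mult)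
  then show ?case using integral_mult_T[OF F n(1)] n(2) by simp
qed

text \<open>The binomial series in F - 1 is dominated by its values at \<rho> < 1 and may be
  integrated term by term; \<open>integral_power_T\<close> handles each term.\<close>

lemma integral_powr_T:
  assumes F: "F \<in> trig_span T" and \<rho>: "\<rho> < 1" "\<And>x. cmod (F x - 1) \<le> \<rho>"
  shows "(LINT x|m. F x powr a) = (LINT x|m. F x) powr a"
proof -
  define z where "z x = F x - 1" for x
  have \<rho>0: "0 \<le> \<rho>" using \<rho>(2) norm_ge_zero order_trans by blast
  have z: "z \<in> trig_span T"
    unfolding z_def using trig_span_diff[OF F trig_span_const[OF T_one]] .
  have cz: "continuous_on UNIV (\<lambda>x. z x ^ n)" for n
    using integral_power_T[OF z] trig_span_T_continuous by blast
  have zle: "cmod (z x) \<le> \<rho>" for x using \<rho> by (simp add: z_def)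
  \<comment> \<open>Convergence of the binomial series at a point r beyond \<rho> gives absolute
    convergence at \<rho>.\<close>
  define r where "r = (1 + \<rho>) / 2"
  have r: "\<rho> < r" "r < 1" using \<rho>(1) by (auto simp: r_def)
  have "summable (\<lambda>n. (a gchoose n) * complex_of_real r ^ n)"
    using gen_binomial_complex[of "complex_of_real r" a] r \<rho>0 by (auto simp: sums_iff)
  then have sm: "summable (\<lambda>n. cmod ((a gchoose n) * complex_of_real \<rho> ^ n))"
    by (rule powser_insidea) (use r \<rho>0 in simp)
  have le: "cmod ((a gchoose n) * z x ^ n) \<le> cmod ((a gchoose n) * complex_of_real \<rho> ^ n)" for n x
    using zle[of x] \<rho>0 by (simp add: norm_mult norm_power mult_left_mono power_mono)
  have i: "integrable m (\<lambda>x. (a gchoose n) * z x ^ n)" for n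
    by (rule continuous_integrable[OF continuous_on_mult_left[OF cz]])
  have "(\<lambda>n. LINT x|m. (a gchoose n) * z x ^ n) sums (LINT x|m. (\<Sum>n. (a gchoose n) * z x ^ n))"
  proof (rule sums_integral[OF i])
    show "AE x in m. summable (\<lambda>n. cmod ((a gchoose n) * z x ^ n))"
      by (intro AE_I2 summable_comparison_test'[OF sm, of 0]) (use le in auto)
    show "summable (\<lambda>n. LINT x|m. cmod ((a gchoose n) * z x ^ n))"
    proof (rule summable_comparison_test'[OF sm, of 0])
      fix n
      have "(LINT x|m. cmod ((a gchoose n) * z x ^ n)) \<le> (LINT x|m. cmod ((a gchoose n) * complex_of_real \<rho> ^ n))"
        using le i by (intro integral_mono integrable_norm) auto
      then show "norm (LINT x|m. cmod ((a gchoose n) * z x ^ n)) \<le> cmod ((a gchoose n) * complex_of_real \<rho> ^ n)"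
        by simp
    qed
  qed
  moreover have "(\<Sum>n. (a gchoose n) * z x ^ n) = F x powr a" for x
    using gen_binomial_complex[of "z x" a] zle[of x] \<rho>(1) by (simp add: sums_iff z_def)
  moreover have "(LINT x|m. (a gchoose n) * z x ^ n) = (a gchoose n) * (LINT x|m. z x) ^ n" for n
    using integral_power_T[OF z, of n] by simp
  ultimately have "(\<lambda>n. (a gchoose n) * (LINT x|m. z x) ^ n) sums (LINT x|m. F x powr a)" by (simp only:)
  moreover have "cmod (LINT x|m. z x) \<le> \<rho>"
    using trig_span_T_continuous[OF z] zle by (intro integral_norm_le_const) auto
  then have "(\<lambda>n. (a gchoose n) * (LINT x|m. z x) ^ n) sums (1 + (LINT x|m. z x)) powr a"
    using \<rho>(1) by (intro gen_binomial_complex) auto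
  moreover have "1 + (LINT x|m. z x) = (LINT x|m. F x)"
    using continuous_integrable[OF trig_span_T_continuous[OF F]] by (simp add: z_def)
  ultimately show ?thesis using sums_unique2 by metis
qed

text \<open>In the integral of the pointwise inequality the B term has a good sign: by
  \<open>integral_powr_T\<close> the integral of F powr p is the p-th power of the mean of F, which
  is real and nonnegative. Scaling F by 1 / R places its values in a disc of radius below 1 around
  1, as that lemma requires.\<close>

lemma integral_powr_le_T:
  assumes p: "1 < p"
    and AB: "0 < B" "\<And>w. 0 < Re w \<Longrightarrow> cmod w powr p \<le> A * Re w powr p - B * Re (w powr of_real p)"
    and F: "F \<in> trig_span T" "\<And>x. 0 < Re (F x)" "Im (LINT x|m. F x) = 0"
  shows "(LINT x|m. cmod (F x) powr p) \<le> A * (LINT x|m. Re (F x) powr p)"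
proof -
  have cF: "continuous_on UNIV F" by (rule trig_span_T_continuous[OF F(1)])
  obtain d where d: "0 < d" "\<And>x. d \<le> Re (F x)"
    using continuous_positive_lower_bound[of "\<lambda>x. Re (F x)"] F(2) cF by (metis continuous_on_Re)
  obtain K where K: "0 < K" "\<And>x. cmod (F x) \<le> K" using continuous_bounded[OF cF] by blast
  \<comment> \<open>With R d = K^2 + 1, d \<le> Re F and |F| \<le> K one gets |F / R - 1|^2 = |F|^2
    / R^2 - 2 Re F / R + 1 \<le> 1 - (K^2 + 2) / R^2.\<close>
  define R where "R = (K\<^sup>2 + 1) / d"
  have R: "0 < R" using d K by (simp add: R_def add_nonneg_pos)
  define f where "f x = (1 / complex_of_real R) * F x" for x
  have f: "f \<in> trig_span T" unfolding f_def by (rule trig_span_cmult[OF F(1)])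
  have cf: "continuous_on UNIV f" by (rule trig_span_T_continuous[OF f])
  have Re_f: "Re (f x) = Re (F x) / R" for x by (simp add: f_def)
  have Re_f_pos: "0 < Re (f x)" for x using F(2) R by (simp add: Re_f)
  define \<rho> where "\<rho> = sqrt (1 - 1 / R\<^sup>2)"
  have "\<rho> < 1" using R by (simp add: \<rho>_def)
  have "(cmod (f x - 1))\<^sup>2 \<le> 1 - 1 / R\<^sup>2" for x
  proof -
    have "(cmod (f x - 1))\<^sup>2 = (cmod (f x))\<^sup>2 - 2 * Re (f x) + 1"
      by (simp only: cmod_power2) (simp add: power2_eq_square algebra_simps)
    moreover have "(cmod (f x))\<^sup>2 \<le> K\<^sup>2 / R\<^sup>2"
      using K(2)[of x] R by (simp add: f_def norm_mult norm_divide power_divide divide_right_mono power_mono)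
    moreover have "2 * Re (f x) \<ge> 2 * (K\<^sup>2 + 1) / R\<^sup>2"
    proof -
      have "K\<^sup>2 + 1 = R * d" using d by (simp add: R_def)
      then have "2 * (K\<^sup>2 + 1) / R\<^sup>2 = 2 * d / R" using R by (simp add: power2_eq_square)
      then show ?thesis using d(2)[of x] R by (simp add: Re_f divide_right_mono)
    qed
    ultimately have "(cmod (f x - 1))\<^sup>2 \<le> K\<^sup>2 / R\<^sup>2 - 2 * (K\<^sup>2 + 1) / R\<^sup>2 + 1" by linarith
    also have "\<dots> = 1 - (K\<^sup>2 + 2) / R\<^sup>2" by (simp add: diff_divide_distrib add_divide_distrib)
    also have "\<dots> \<le> 1 - 1 / R\<^sup>2" by (intro diff_left_mono divide_right_mono) auto
    finally show ?thesis .
  qed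
  then have "cmod (f x - 1) \<le> \<rho>" for x
    unfolding \<rho>_def by (rule real_le_rsqrt)
  then have int_eq: "(LINT x|m. f x powr of_real p) = (LINT x|m. f x) powr of_real p"
    using integral_powr_T[OF f \<open>\<rho> < 1\<close>] by blast
  have mean: "(LINT x|m. f x) = of_real (Re (LINT x|m. F x) / R)"
    using F(3) by (simp add: f_def complex_eq_iff)
  have "Re (LINT x|m. F x) = (LINT x|m. Re (F x))"
    using continuous_integrable[OF cF] by simp
  also have "\<dots> \<ge> 0" using F(2) by (intro Bochner_Integration.integral_nonneg) (auto intro: less_imp_le)
  finally have Re_nonneg: "0 \<le> Re (LINT x|m. f x powr of_real p)"
    unfolding int_eq mean using R by (subst powr_of_real) auto
  have cont_powr: "continuous_on UNIV (\<lambda>x. f x powr of_real p)"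
    using Re_f_pos p by (intro continuous_on_powr_complex cf continuous_intros) (auto simp: complex_nonpos_Reals_iff less_imp_le dest: less_imp_le order.strict_implies_not_eq)
  have ip: "integrable m (\<lambda>x. f x powr of_real p)" by (rule continuous_integrable[OF cont_powr])
  have ic: "integrable m (\<lambda>x. cmod (f x) powr p)" "integrable m (\<lambda>x. Re (f x) powr p)"
  proof -
    have p0: "0 < p" using p by simp
    have "continuous_on UNIV (\<lambda>x. cmod (f x) powr p)"
      by (rule continuous_on_powr') (use p0 in \<open>auto intro!: continuous_intros cf\<close>)
    then show "integrable m (\<lambda>x. cmod (f x) powr p)" by (rule continuous_integrable)
    have "continuous_on UNIV (\<lambda>x. Re (f x) powr p)"
      by (rule continuous_on_powr') (use p0 less_imp_le[OF Re_f_pos] in \<open>auto intro!: continuous_intros cf\<close>)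
    then show "integrable m (\<lambda>x. Re (f x) powr p)" by (rule continuous_integrable)
  qed
  have "(LINT x|m. cmod (f x) powr p) \<le> (LINT x|m. A * Re (f x) powr p - B * Re (f x powr of_real p))"
    using ic ip AB(2) Re_f_pos by (intro integral_mono) auto
  also have "\<dots> = A * (LINT x|m. Re (f x) powr p) - B * Re (LINT x|m. f x powr of_real p)"
    using ic ip by simp
  also have "\<dots> \<le> A * (LINT x|m. Re (f x) powr p)" using Re_nonneg AB(1) by simp
  finally have *: "(LINT x|m. cmod (f x) powr p) \<le> A * (LINT x|m. Re (f x) powr p)" .
  have "cmod (f x) powr p = cmod (F x) powr p / R powr p" for x
    using R by (simp add: f_def norm_mult norm_divide powr_divide powr_mult)
  moreover have "Re (f x) powr p = Re (F x) powr p / R powr p" for x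
    using R F(2)[of x] by (simp add: Re_f powr_divide)
  ultimately show ?thesis using * R by (simp add: divide_le_cancel)
qed

section \<open>The Bochner-Helson inequality on polynomials\<close>

lemma char_not_T_cnj:
  assumes "\<eta> \<in> chars" "\<eta> \<notin> T"
  shows "(\<lambda>x. cnj (\<eta> x)) \<in> T"
  using T_total assms by blast

lemma fourier_coeff_cnj: "fourier_coeff m (\<lambda>x. cnj (f x)) \<eta> = cnj (fourier_coeff m f (\<lambda>x. cnj (\<eta> x)))"
  unfolding fourier_coeff_def Bochner_Integration.integral_cnj[symmetric] by simp

text \<open>\<open>F = 2 P q - \<integral>q\<close> has real part \<open>q > 0\<close>, and \<open>\<integral>F\<^sup>p = (\<integral>F)\<^sup>p > 0\<close> because integration is multiplicative on
  polynomials with spectrum in \<open>T\<close>.\<close>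

lemma riesz_bound_positive:
  assumes p: "1 < p" "p \<le> 2"
  shows "\<exists>C>0. \<forall>q\<in>trig_span chars. (\<forall>x. q x \<in> \<real>) \<longrightarrow> (\<forall>x. 0 < Re (q x)) \<longrightarrow>
      Lp_norm m p (riesz q) \<le> C * Lp_norm m p q"
proof -
  obtain A B where AB: "0 < A" "0 < B"
    "\<And>w. 0 < Re w \<Longrightarrow> cmod w powr p \<le> A * Re w powr p - B * Re (w powr of_real p)"
    using powr_real_part_bound[OF p] by metis
  have p0: "0 < p" using p by simp
  have "Lp_norm m p (riesz q) \<le> (A powr (1 / p) + 1) * Lp_norm m p q"
    if q: "q \<in> trig_span chars" "\<And>x. q x \<in> \<real>" "\<And>x. 0 < Re (q x)" for q
  proof -
    define c where "c = (LINT x|m. q x)"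
    have q_real: "q x = of_real (Re (q x))" for x using q(2)[of x] by (simp add: complex_is_Real_iff complex_eq_iff)
    have cnj_q: "cnj (q x) = q x" for x using q(2) by (simp add: Reals_cnj_iff)
    have iq: "integrable m q" by (rule continuous_integrable[OF trig_continuous[OF q(1)]])
    have c_real: "Im c = 0"
    proof -
      have "Im c = (LINT x|m. Im (q x))" using iq by (simp add: c_def)
      also have "\<dots> = 0" using q(2) by (simp add: complex_is_Real_iff)
      finally show ?thesis .
    qed
    define F where "F x = 2 * riesz q x - c" for x
    have F: "F \<in> trig_span T"
      unfolding F_def by (intro trig_span_diff trig_span_cmult riesz_span q trig_span_const T_one)
    have cF: "continuous_on UNIV F" by (rule trig_span_T_continuous[OF F])
    have const: "fourier_coeff m (\<lambda>x. c) \<eta> = (if \<eta> = (\<lambda>x. 1) then c else 0)" if "\<eta> \<in> chars" for \<eta>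
      using fourier_coeff_cmult[of c "\<lambda>x. 1" \<eta>] fourier_coeff_char[OF that char_one] by auto
    have fc_F: "fourier_coeff m F \<eta> = 2 * (if \<eta> \<in> T then fourier_coeff m q \<eta> else 0) - (if \<eta> = (\<lambda>x. 1) then c else 0)"
      if \<eta>: "\<eta> \<in> chars" for \<eta>
    proof -
      have "fourier_coeff m F \<eta> = fourier_coeff m (\<lambda>x. 2 * riesz q x) \<eta> - fourier_coeff m (\<lambda>x. c) \<eta>"
        unfolding F_def using q(1) \<eta>
        by (intro fourier_coeff_diff[of _ 2] continuous_Lp continuous_intros riesz_continuous) auto
      then show ?thesis by (simp add: fourier_coeff_cmult fourier_coeff_riesz[OF q(1) \<eta>] const[OF \<eta>])
    qed
    \<comment> \<open>Coefficients are compared. At a nontrivial \<eta> exactly one of F and its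
      conjugate contributes, because exactly one of \<eta> and its inverse is in T; at the unit both
      contribute the real number c.\<close>
    have "(\<lambda>x. F x + cnj (F x)) = (\<lambda>x. 2 * q x)"
    proof (rule continuous_fourier_unique)
      show "continuous_on UNIV (\<lambda>x. F x + cnj (F x))" "continuous_on UNIV (\<lambda>x. 2 * q x)"
        by (intro continuous_intros cF trig_continuous q)+
      fix \<eta> assume \<eta>: "\<eta> \<in> chars"
      let ?e = "\<lambda>x. cnj (\<eta> x)"
      have e: "?e \<in> chars" by (rule char_cnj[OF \<eta>])
      have qe: "cnj (fourier_coeff m q ?e) = fourier_coeff m q \<eta>"
        using fourier_coeff_cnj[of q \<eta>] by (simp add: cnj_q)
      have one: "?e = (\<lambda>x. 1) \<longleftrightarrow> \<eta> = (\<lambda>x. 1)"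
        by (auto simp: fun_eq_iff)
      have "fourier_coeff m (\<lambda>x. F x + cnj (F x)) \<eta> = fourier_coeff m F \<eta> + cnj (fourier_coeff m F ?e)"
        using cF \<eta> by (subst fourier_coeff_add_cont) (auto simp: fourier_coeff_cnj intro!: continuous_intros)
      also have "\<dots> = 2 * fourier_coeff m q \<eta>"
      proof (cases "\<eta> = (\<lambda>x. 1)")
        case True
        then show ?thesis
          using T_one c_real unfolding fc_F[OF \<eta>] fc_F[OF e]
          by (simp add: fourier_coeff_one c_def[symmetric] complex_eq_iff)
      next
        case False
        have "\<eta> \<in> T \<longleftrightarrow> ?e \<notin> T" using T_total[OF \<eta>] T_antisym False by blast
        then show ?thesis
          unfolding fc_F[OF \<eta>] fc_F[OF e] one using False qe by auto
      qed
      finally show "fourier_coeff m (\<lambda>x. F x + cnj (F x)) \<eta> = fourier_coeff m (\<lambda>x. 2 * q x) \<eta>"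
        by (simp add: fourier_coeff_cmult)
    qed
    then have "F x + cnj (F x) = 2 * q x" for x by (rule fun_cong)
    then have Re_F: "Re (F x) = Re (q x)" for x
      by (metis complex_add_cnj mult_cancel_left of_real_eq_iff of_real_mult of_real_numeral q_real zero_neq_numeral)
    have "(LINT x|m. F x) = c"
      using fc_F[OF char_one] T_one by (simp add: fourier_coeff_one c_def[symmetric])
    then have "(LINT x|m. cmod (F x) powr p) \<le> A * (LINT x|m. Re (F x) powr p)"
      using q(3) c_real by (intro integral_powr_le_T[OF p(1) AB(2,3) F]) (auto simp: Re_F)
    also have "(LINT x|m. Re (F x) powr p) = Lp_norm m p q powr p"
    proof -
      have "cmod (q x) = Re (F x)" for x
        using q(3)[of x] unfolding Re_F by (subst q_real) simp
      then show ?thesis using p0 by (simp add: Lp_norm_powr)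
    qed
    also have "A * Lp_norm m p q powr p = (A powr (1/p) * Lp_norm m p q) powr p"
      using AB p0 by (simp add: powr_mult powr_powr)
    finally have NF: "Lp_norm m p F \<le> A powr (1/p) * Lp_norm m p q"
      using p0 by (subst Lp_norm_le_iff) auto
    have c_le: "cmod c \<le> Lp_norm m p q"
      using fourier_coeff_le[OF trig_Lp[OF q(1) p0] p(1) char_one] by (simp add: fourier_coeff_one c_def)
    have Nc: "Lp_norm m p (\<lambda>x. c) \<le> cmod c" by (rule Lp_bounded(2)) (use p0 in auto)
    have "riesz q = (\<lambda>x. 1/2 * (F x + c))" by (simp add: F_def fun_eq_iff)
    then have "Lp_norm m p (riesz q) = 1/2 * Lp_norm m p (\<lambda>x. F x + c)"
      using Lp_norm_cmult[OF p0, of m "1/2"] by simp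
    also have "\<dots> \<le> 1/2 * (Lp_norm m p F + Lp_norm m p (\<lambda>x. c))"
      using p p0 by (intro mult_left_mono Lp_norm_triangle continuous_Lp cF) auto
    also have "\<dots> \<le> 1/2 * (A powr (1/p) * Lp_norm m p q + Lp_norm m p q)"
      using NF Nc c_le by (intro mult_left_mono) auto
    also have "\<dots> = ((A powr (1/p) + 1) * Lp_norm m p q) / 2" by (simp add: algebra_simps)
    also have "\<dots> \<le> (A powr (1/p) + 1) * Lp_norm m p q"
    proof -
      have "0 \<le> (A powr (1/p) + 1) * Lp_norm m p q" by (intro mult_nonneg_nonneg add_nonneg_nonneg) auto
      then show ?thesis by linarith
    qed
    finally show ?thesis .
  qed
  moreover have "0 < A powr (1 / p) + 1" using AB by (simp add: add_nonneg_pos)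
  ultimately show ?thesis by blast
qed

lemma real_trig_poly_dense:
  assumes u: "continuous_on UNIV (u :: 'g \<Rightarrow> real)" and e: "0 < e"
  obtains q where "q \<in> trig_span chars" "\<And>x. q x \<in> \<real>" "\<And>x. \<bar>Re (q x) - u x\<bar> < e"
proof -
  obtain r where r: "r \<in> trig_span chars" "\<And>x. cmod (of_real (u x) - r x) < e"
    using trig_poly_dense[of "\<lambda>x. of_real (u x)" e] u e by (auto intro: continuous_on_of_real)
  define q where "q x = 1/2 * (r x + cnj (r x))" for x
  have "q \<in> trig_span chars"
    unfolding q_def by (intro trig_span_cmult trig_span_add r trig_span_cnj[OF r(1) char_cnj])
  moreover have q: "q x = of_real (Re (r x))" for x by (simp add: q_def complex_add_cnj)
  moreover have "\<bar>Re (r x) - u x\<bar> < e" for x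
    using abs_Re_le_cmod[of "of_real (u x) - r x"] r(2)[of x] by simp
  ultimately show ?thesis by (intro that[of q]) auto
qed

lemma Lp_norm_le_real_part:
  assumes f: "continuous_on UNIV f" and p: "0 < p"
  shows "Lp_norm m p (\<lambda>x. of_real (Re (f x))) \<le> Lp_norm m p f"
    "Lp_norm m p (\<lambda>x. of_real (Im (f x))) \<le> Lp_norm m p f"
  by (intro Lp_norm_mono[OF continuous_Lp[OF f p]] continuous_measurable continuous_intros f p;
      simp add: abs_Re_le_cmod abs_Im_le_cmod)+

text \<open>A real polynomial is a difference of two positive ones whose norms are controlled by its own: the first is a
  uniform approximation of its positive part plus a constant.\<close>

lemma riesz_bound_le_2:
  assumes p: "1 < p" "p \<le> 2"
  shows "\<exists>C>0. \<forall>q\<in>trig_span chars. Lp_norm m p (riesz q) \<le> C * Lp_norm m p q"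
proof -
  have p0: "0 < p" "1 \<le> p" using p by auto
  let ?N = "Lp_norm m p"
  obtain C where C: "0 < C"
    "\<And>q. q \<in> trig_span chars \<Longrightarrow> (\<And>x. q x \<in> \<real>) \<Longrightarrow> (\<And>x. 0 < Re (q x)) \<Longrightarrow>
      ?N (riesz q) \<le> C * ?N q"
    using riesz_bound_positive[OF p] by blast
  have real_case: "?N (riesz q) \<le> 3 * C * ?N q"
    if q: "q \<in> trig_span chars" "\<And>x. q x \<in> \<real>" for q
  proof (rule field_le_epsilon)
    fix \<epsilon> :: real assume \<epsilon>: "0 < \<epsilon>"
    \<comment> \<open>The polynomial g will exceed the positive part of q by less than 2 e. This
      excess enters the bounds for g and for g - q once each, multiplied by C: 4 C e in all.\<close>
    define e where "e = \<epsilon> / (4 * C)"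
    have e: "0 < e" using \<epsilon> C by (simp add: e_def)
    have cq: "continuous_on UNIV q" by (rule trig_continuous[OF q(1)])
    have "continuous_on UNIV (\<lambda>x. max (Re (q x)) 0 + e)" by (intro continuous_intros cq)
    then obtain g where g: "g \<in> trig_span chars" "\<And>x. g x \<in> \<real>" "\<And>x. \<bar>Re (g x) - (max (Re (q x)) 0 + e)\<bar> < e"
      using real_trig_poly_dense[OF _ e] by blast
    have g_bounds: "max (Re (q x)) 0 < Re (g x)" "Re (g x) < max (Re (q x)) 0 + 2 * e" for x
      using g(3)[of x] by (simp_all add: abs_less_iff)
    define k where "k x = g x - q x" for x
    have k: "k \<in> trig_span chars" unfolding k_def by (rule trig_span_diff[OF g(1) q(1)])
    have L: "g \<in> Lp m p" "q \<in> Lp m p" "k \<in> Lp m p" using g q k p0 by (auto intro: trig_Lp)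
    have "?N (riesz g) \<le> C * ?N g"
    proof (rule C(2)[OF g(1,2)])
      show "0 < Re (g x)" for x using g_bounds(1)[of x] by simp
    qed
    moreover have "?N (riesz k) \<le> C * ?N k"
    proof (rule C(2)[OF k])
      show "k x \<in> \<real>" for x unfolding k_def using g q by (intro Reals_diff) auto
      show "0 < Re (k x)" for x using g_bounds(1)[of x] by (simp add: k_def)
    qed
    moreover have "?N g \<le> ?N q + 2 * e"
    proof -
      have "?N g \<le> ?N (\<lambda>x. of_real (max (Re (q x)) 0 + 2 * e))"
      proof (intro Lp_norm_mono continuous_Lp continuous_measurable AE_I2 p0)
        show "cmod (g x) \<le> cmod (of_real (max (Re (q x)) 0 + 2 * e))" for x
        proof -
          have "cmod (g x) = Re (g x)"
            using g(2)[of x] g_bounds(1)[of x] by (auto simp: in_Reals_norm complex_is_Real_iff)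
          also have "\<dots> \<le> \<bar>max (Re (q x)) 0 + 2 * e\<bar>" using g_bounds(2)[of x] by linarith
          finally show ?thesis by (simp only: norm_of_real)
        qed
      qed (intro continuous_intros cq trig_continuous g)+
      also have "\<dots> \<le> ?N (\<lambda>x. of_real (max (Re (q x)) 0)) + ?N (\<lambda>x. of_real (2 * e))"
        unfolding of_real_add by (intro Lp_norm_triangle continuous_Lp continuous_intros cq p0)
      also have "?N (\<lambda>x. of_real (max (Re (q x)) 0)) \<le> ?N q"
        using abs_Re_le_cmod
        by (intro Lp_norm_mono L continuous_measurable continuous_intros cq p0 AE_I2) (auto simp: max_def abs_le_iff)
      also have "?N (\<lambda>x. of_real (2 * e)) \<le> 2 * e"
        using e p0 by (intro Lp_bounded(2)) auto
      finally show ?thesis by simp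
    qed
    moreover have "?N k \<le> ?N g + ?N q" unfolding k_def using L p0 by (intro Lp_norm_triangle_diff) auto
    moreover have "?N (riesz q) \<le> ?N (riesz g) + ?N (riesz k)"
    proof -
      have "riesz k = (\<lambda>x. riesz g x - riesz q x)" unfolding k_def by (rule riesz_diff[OF g(1) q(1)])
      then have "riesz q = (\<lambda>x. riesz g x - riesz k x)" by simp
      moreover have "riesz g \<in> Lp m p" "riesz k \<in> Lp m p"
        using riesz_continuous g k p0 continuous_Lp by blast+
      ultimately show ?thesis using Lp_norm_triangle_diff p0 by metis
    qed
    ultimately have "?N (riesz q) \<le> C * (?N q + 2 * e) + C * (?N q + 2 * e + ?N q)"
      using C(1) by (smt (verit) mult_left_mono)
    also have "\<dots> = 3 * C * ?N q + 4 * C * e" by (simp add: algebra_simps)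
    also have "4 * C * e = \<epsilon>" using C(1) by (simp add: e_def)
    finally show "?N (riesz q) \<le> 3 * C * ?N q + \<epsilon>" .
  qed
  have "?N (riesz q) \<le> 6 * C * ?N q" if q: "q \<in> trig_span chars" for q
  proof -
    have cq: "(\<lambda>x. cnj (q x)) \<in> trig_span chars" by (rule trig_span_cnj[OF q char_cnj])
    have re: "(\<lambda>x. complex_of_real (Re (q x))) = (\<lambda>x. 1/2 * (q x + cnj (q x)))"
      by (simp add: fun_eq_iff complex_add_cnj)
    have im: "(\<lambda>x. complex_of_real (Im (q x))) = (\<lambda>x. - \<i>/2 * (q x - cnj (q x)))"
      by (auto simp: fun_eq_iff complex_eq_iff)
    have R: "(\<lambda>x. complex_of_real (Re (q x))) \<in> trig_span chars"
      unfolding re by (intro trig_span_cmult trig_span_add q cq)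
    have I: "(\<lambda>x. complex_of_real (Im (q x))) \<in> trig_span chars"
      unfolding im by (intro trig_span_cmult trig_span_diff q cq)
    have "riesz q = riesz (\<lambda>x. of_real (Re (q x)) + \<i> * of_real (Im (q x)))"
      by (simp add: complex_eq[symmetric])
    also have "\<dots> = (\<lambda>x. riesz (\<lambda>x. of_real (Re (q x))) x + \<i> * riesz (\<lambda>x. of_real (Im (q x))) x)"
      using riesz_add[OF R trig_span_cmult[OF I, of \<i>]] riesz_cmult[OF I, of \<i>] by simp
    finally have "?N (riesz q) \<le> ?N (riesz (\<lambda>x. of_real (Re (q x)))) + ?N (\<lambda>x. \<i> * riesz (\<lambda>x. of_real (Im (q x))) x)"
      using Lp_norm_triangle[of "riesz (\<lambda>x. of_real (Re (q x)))" m p "\<lambda>x. \<i> * riesz (\<lambda>x. of_real (Im (q x))) x"]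
        continuous_Lp[OF riesz_continuous[OF R] p0(1)] Lp_cmult[OF continuous_Lp[OF riesz_continuous[OF I] p0(1)]] p0
      by simp
    also have "\<dots> \<le> 3 * C * ?N (\<lambda>x. of_real (Re (q x))) + 3 * C * ?N (\<lambda>x. of_real (Im (q x)))"
      using real_case[OF R] real_case[OF I] Lp_norm_cmult[OF p0(1), of m \<i>] by simp
    also have "\<dots> \<le> 3 * C * ?N q + 3 * C * ?N q"
      using C(1) Lp_norm_le_real_part[OF trig_continuous[OF q] p0(1)] by (intro add_mono mult_left_mono) auto
    finally show ?thesis by simp
  qed
  then show ?thesis using C(1) by (intro exI[of _ "6 * C"]) auto
qed

lemma integral_riesz_cnj:
  assumes f: "f \<in> trig_span chars" and g: "g \<in> trig_span chars"
  shows "(LINT x|m. riesz f x * cnj (g x)) = (LINT x|m. f x * cnj (riesz g x))"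
  using g
proof (induction rule: trig_span_induct)
  case zero
  have "riesz (\<lambda>x. 0) = (\<lambda>x. 0)" using riesz_cmult[OF f, of 0] by simp
  then show ?case by simp
next
  case (add \<eta> c g)
  have \<eta>s: "\<eta> \<in> trig_span chars" by (rule trig_span_base[OF add(1)])
  have r\<eta>: "riesz \<eta> = (if \<eta> \<in> T then \<eta> else (\<lambda>x. 0))"
    by (rule riesz_eqI[OF \<eta>s]) (use add(1) in \<open>auto simp: char_continuous fourier_coeff_char\<close>)
  have base: "(LINT x|m. riesz f x * cnj (\<eta> x)) = (LINT x|m. f x * cnj (riesz \<eta> x))"
    using fourier_coeff_riesz[OF f add(1)] by (auto simp: r\<eta> fourier_coeff_def)
  have rg: "riesz (\<lambda>x. c * \<eta> x + g x) = (\<lambda>x. c * riesz \<eta> x + riesz g x)"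
    using riesz_add[OF trig_span_cmult[OF \<eta>s] add(2)] riesz_cmult[OF \<eta>s] by simp
  have i: "integrable m (\<lambda>x. h x * cnj (k x))" if "continuous_on UNIV h" "continuous_on UNIV k" for h k :: "'g \<Rightarrow> complex"
    using that by (intro continuous_integrable continuous_intros)
  note c = trig_continuous[OF f] riesz_continuous[OF f] trig_continuous[OF \<eta>s] riesz_continuous[OF \<eta>s]
    trig_continuous[OF add(2)] riesz_continuous[OF add(2)]
  have "h x * cnj (c * k x + l x) = cnj c * (h x * cnj (k x)) + h x * cnj (l x)" for h k l :: "'g \<Rightarrow> complex" and x
    by (simp add: algebra_simps)
  then show ?case
    unfolding rg using i[OF c(2,3)] i[OF c(1,4)] i[OF c(2,5)] i[OF c(1,6)] base add(3) by simp
qed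

text \<open>For \<open>p > 2\<close> the bound is dual to that for the conjugate exponent, since the projection is
  formally self-adjoint.\<close>

lemma riesz_bound:
  assumes p: "1 < p"
  shows "\<exists>C>0. \<forall>q\<in>trig_span chars. Lp_norm m p (riesz q) \<le> C * Lp_norm m p q"
proof (cases "p \<le> 2")
  case True
  then show ?thesis using riesz_bound_le_2[OF p True] by simp
next
  case False
  then have p2: "2 < p" by simp
  define p' where "p' = p / (p - 1)"
  have p': "1 < p'" "p' \<le> 2" "1 / p + 1 / p' = 1" using p2 by (auto simp: p'_def field_simps)
  obtain C where C: "0 < C" "\<And>q. q \<in> trig_span chars \<Longrightarrow> Lp_norm m p' (riesz q) \<le> C * Lp_norm m p' q"
    using riesz_bound_le_2[OF p'(1,2)] by blast
  have "Lp_norm m p (riesz f) \<le> C * Lp_norm m p f" if f: "f \<in> trig_span chars" for f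
  proof -
    define F where "F = riesz f"
    define N where "N = Lp_norm m p F"
    have cF: "continuous_on UNIV F" unfolding F_def by (rule riesz_continuous[OF f])
    have FL: "F \<in> Lp m p" "f \<in> Lp m p" using p cF f by (auto intro: continuous_Lp trig_Lp)
    \<comment> \<open>The function that norms F: F times the conjugate of g0 is |F| powr p, and |g0|
      powr p' = |F| powr p. It is continuous since p > 2.\<close>
    define g0 where "g0 x = F x * of_real (cmod (F x) powr (p - 2))" for x
    have cg0: "continuous_on UNIV g0"
      unfolding g0_def using p2 by (intro continuous_intros continuous_on_powr' cF) auto
    have norm_g0: "cmod (g0 x) = cmod (F x) powr (p - 1)" for x
    proof (cases "F x = 0")
      case False
      then have "cmod (F x) * cmod (F x) powr (p - 2) = cmod (F x) powr (1 + (p - 2))"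
        by (subst powr_add) simp
      then show ?thesis by (simp add: g0_def norm_mult)
    qed (use p in \<open>simp add: g0_def\<close>)
    have prod: "F x * cnj (g0 x) = of_real (cmod (F x) powr p)" for x
    proof (cases "F x = 0")
      case False
      have "F x * cnj (g0 x) = of_real ((cmod (F x))\<^sup>2 * cmod (F x) powr (p - 2))"
      proof -
        have "F x * cnj (g0 x) = (F x * cnj (F x)) * of_real (cmod (F x) powr (p - 2))"
          by (simp add: g0_def mult_ac)
        then show ?thesis by (simp only: complex_norm_square[symmetric] of_real_mult)
      qed
      also have "(cmod (F x))\<^sup>2 * cmod (F x) powr (p - 2) = cmod (F x) powr (2 + (p - 2))"
        using False by (subst powr_add) (simp add: powr_numeral)
      finally show ?thesis by simp
    qed (use p in simp)
    have int_prod: "(LINT x|m. F x * cnj (g0 x)) = of_real (N powr p)"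
      unfolding prod integral_complex_of_real N_def using p by (simp add: Lp_norm_powr)
    have Ng0: "Lp_norm m p' g0 = N powr (p - 1)"
    proof -
      have "cmod (g0 x) powr p' = cmod (F x) powr p" for x
        using p2 by (simp add: norm_g0 powr_powr p'_def)
      then have "Lp_norm m p' g0 = (N powr p) powr (1 / p')"
        using p by (simp add: Lp_norm_def[of m p' g0] N_def Lp_norm_powr)
      also have "p * (1 / p') = p - 1" using p2 by (simp add: p'_def)
      then have "(N powr p) powr (1 / p') = N powr (p - 1)" by (simp only: powr_powr)
      finally show ?thesis .
    qed
    \<comment> \<open>Self-adjointness is available for polynomials only, so a polynomial within e
      replaces g0; e tends to 0 afterwards.\<close>
    have est: "N powr p \<le> (C * Lp_norm m p f) * (N powr (p - 1) + e) + e * N" if e: "0 < e" for e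
    proof -
      obtain g where g: "g \<in> trig_span chars" "\<And>x. cmod (g0 x - g x) < e"
        using trig_poly_dense[OF cg0 e] by blast
      have cg: "continuous_on UNIV g" by (rule trig_continuous[OF g(1)])
      have sup: "Lp_norm m p' (\<lambda>x. g x - g0 x) \<le> e"
        using g(2) e p'(1) cg cg0
        by (intro Lp_bounded(2) continuous_measurable continuous_intros) (auto simp: norm_minus_commute less_imp_le)
      have Ng: "Lp_norm m p' g \<le> N powr (p - 1) + e"
        using Lp_norm_le_add_diff[of g m p' g0] continuous_Lp[OF cg] continuous_Lp[OF cg0] p'(1) sup Ng0 by simp
      have i: "integrable m (\<lambda>x. F x * cnj (g x))" "integrable m (\<lambda>x. F x * cnj (g0 x - g x))"
        by (intro continuous_integrable continuous_intros cF cg cg0)+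
      have "F x * cnj (g0 x) = F x * cnj (g x) + F x * cnj (g0 x - g x)" for x by (simp add: algebra_simps)
      then have "complex_of_real (N powr p) = (LINT x|m. F x * cnj (g x)) + (LINT x|m. F x * cnj (g0 x - g x))"
        using int_prod i by simp
      then have "N powr p \<le> cmod (LINT x|m. F x * cnj (g x)) + cmod (LINT x|m. F x * cnj (g0 x - g x))"
        by (metis abs_of_nonneg norm_of_real norm_triangle_ineq powr_ge_zero)
      also have "cmod (LINT x|m. F x * cnj (g0 x - g x)) \<le> e * N"
      proof -
        have "cmod (LINT x|m. F x * cnj (g0 x - g x)) \<le> (LINT x|m. cmod (F x * cnj (g0 x - g x)))"
          by (rule integral_norm_bound)
        also have "\<dots> \<le> (LINT x|m. e * cmod (F x))"
        proof (rule integral_mono)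
          show "cmod (F x * cnj (g0 x - g x)) \<le> e * cmod (F x)" for x
            using g(2)[of x] mult_left_mono[of "cmod (g0 x - g x)" e "cmod (F x)"]
            by (simp add: norm_mult mult.commute flip: complex_cnj_diff)
        qed (intro continuous_integrable continuous_intros cF cg cg0)+
        also have "\<dots> \<le> e * N"
          using Lp_integrable_and_norm(2)[OF FL(1) p emeasure_space_m] e by (simp add: N_def)
        finally show ?thesis .
      qed
      also have "cmod (LINT x|m. F x * cnj (g x)) \<le> (C * Lp_norm m p f) * (N powr (p - 1) + e)"
      proof -
        have rg: "(\<lambda>x. cnj (riesz g x)) \<in> Lp m p'"
          using riesz_continuous[OF g(1)] p' by (intro continuous_Lp continuous_intros) auto
        have "cmod (LINT x|m. F x * cnj (g x)) = cmod (LINT x|m. f x * cnj (riesz g x))"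
          unfolding F_def using integral_riesz_cnj[OF f g(1)] by simp
        also have "\<dots> \<le> Lp_norm m p f * Lp_norm m p' (\<lambda>x. cnj (riesz g x))"
          by (rule Holder(3)[OF FL(2) rg p p'(1,3)])
        also have "Lp_norm m p' (\<lambda>x. cnj (riesz g x)) = Lp_norm m p' (riesz g)"
          by (simp add: Lp_norm_def)
        also have "Lp_norm m p f * Lp_norm m p' (riesz g) \<le> Lp_norm m p f * (C * (N powr (p - 1) + e))"
          using C(2)[OF g(1)] Ng C(1) by (intro mult_left_mono) (auto intro: order_trans)
        finally show ?thesis by (simp add: mult_ac)
      qed
      finally show ?thesis by simp
    qed
    have "((\<lambda>e. (C * Lp_norm m p f) * (N powr (p - 1) + e) + e * N) \<longlongrightarrow> (C * Lp_norm m p f) * (N powr (p - 1) + 0) + 0 * N) (at_right 0)"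
      by (intro tendsto_intros)
    moreover have "\<forall>\<^sub>F e in at_right 0. N powr p \<le> (C * Lp_norm m p f) * (N powr (p - 1) + e) + e * N"
      using eventually_at_right_less[of "0::real"] by eventually_elim (rule est)
    ultimately have le: "N powr p \<le> (C * Lp_norm m p f) * N powr (p - 1)"
      using tendsto_lowerbound[of _ _ "at_right (0::real)"] by fastforce
    show ?thesis
    proof (cases "N = 0")
      case False
      then have N: "0 < N" using Lp_norm_nonneg[of m p F] by (simp add: N_def less_le)
      then have "N powr p = N * N powr (p - 1)" by (simp add: powr_diff)
      then show ?thesis using le N by (simp add: N_def F_def)
    qed (use C(1) in \<open>simp add: N_def F_def\<close>)
  qed
  then show ?thesis using C(1) by blast
qed

end

section \<open>Toeplitz operators\<close>

lemma squeeze_zero: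
  fixes f g :: "nat \<Rightarrow> real"
  assumes "\<And>n. 0 \<le> f n" "\<And>n. f n \<le> g n" "g \<longlonglongrightarrow> 0"
  shows "f \<longlonglongrightarrow> 0"
  by (rule tendsto_sandwich[of "\<lambda>_. 0" f sequentially g]) (simp_all add: assms)

locale Hp_space = ordered_dual m T
  for m :: "'g::{topological_ab_group_add, t2_space} measure" and T +
  fixes p :: real
  assumes p: "1 < p"
begin

abbreviation N :: "('g \<Rightarrow> complex) \<Rightarrow> real" where "N \<equiv> Lp_norm m p"
abbreviation fc :: "('g \<Rightarrow> complex) \<Rightarrow> ('g \<Rightarrow> complex) \<Rightarrow> complex" where "fc \<equiv> fourier_coeff m"
abbreviation H :: "('g \<Rightarrow> complex) set" where "H \<equiv> Hp m T p"

lemma p_pos: "0 < p" "1 \<le> p" using p by auto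

section \<open>The space \<open>H\<^sup>p\<close> and the bounded extension of the Riesz
  projection\<close>

lemma Hp_Lp: "f \<in> H \<Longrightarrow> f \<in> Lp m p"
  by (simp add: Hp_def)

lemma Hp_iff: "f \<in> H \<longleftrightarrow> f \<in> Lp m p \<and> (\<forall>\<eta>\<in>chars - T. fc f \<eta> = 0)"
  by (simp add: Hp_def)

lemma Hp_zero: "(\<lambda>x. 0) \<in> H" by (simp add: Hp_iff)

lemma Hp_add: "f \<in> H \<Longrightarrow> g \<in> H \<Longrightarrow> (\<lambda>x. f x + g x) \<in> H"
  using p_pos by (auto simp: Hp_iff fourier_coeff_add[OF _ _ p] intro: Lp_add)

lemma Hp_diff: "f \<in> H \<Longrightarrow> g \<in> H \<Longrightarrow> (\<lambda>x. f x - g x) \<in> H"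
  using p_pos by (auto simp: Hp_iff fourier_coeff_diff[OF _ _ p] intro: Lp_diff)

lemma Hp_cmult: "f \<in> H \<Longrightarrow> (\<lambda>x. c * f x) \<in> H"
  by (auto simp: Hp_iff fourier_coeff_cmult intro: Lp_cmult)

lemma Hp_trig_span: "f \<in> trig_span T \<Longrightarrow> f \<in> H"
proof (induction rule: trig_span_induct)
  case (add \<eta> c f)
  have \<eta>: "\<eta> \<in> chars" using add(1) T_chars by blast
  have "\<eta> \<in> H"
    using continuous_Lp[OF char_continuous[OF \<eta>] p_pos(1)] fourier_coeff_char[OF _ \<eta>] add(1)
    by (auto simp: Hp_iff)
  then show ?case using Hp_add[OF Hp_cmult] add(3) by blast
qed (rule Hp_zero)

lemma Hp_limit:
  assumes "\<And>n. f n \<in> H" "g \<in> Lp m p" "(\<lambda>n. N (\<lambda>x. f n x - g x)) \<longlonglongrightarrow> 0"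
  shows "g \<in> H"
  unfolding Hp_iff
proof (intro conjI ballI)
  fix \<eta> assume \<eta>: "\<eta> \<in> chars - T"
  have "(\<lambda>n. fc (f n) \<eta>) \<longlonglongrightarrow> fc g \<eta>"
    by (rule fourier_coeff_tendsto[OF Hp_Lp[OF assms(1)] assms(2) p _ assms(3)]) (use \<eta> in auto)
  moreover have "(\<lambda>n. fc (f n) \<eta>) = (\<lambda>n. 0)" using assms(1) \<eta> by (auto simp: Hp_iff)
  ultimately show "fc g \<eta> = 0" using LIMSEQ_unique tendsto_const by metis
qed (rule assms)

lemma Hp_AE_eqI:
  assumes f: "f \<in> H" and g: "g \<in> H" and eq: "\<And>\<eta>. \<eta> \<in> T \<Longrightarrow> fc f \<eta> = fc g \<eta>"
  shows "AE x in m. f x = g x"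
proof (rule fourier_coeff_eq_imp_AE_eq[OF Hp_Lp[OF f] Hp_Lp[OF g] p])
  fix \<eta> assume "\<eta> \<in> chars"
  then show "fc f \<eta> = fc g \<eta>" using f g eq by (cases "\<eta> \<in> T") (auto simp: Hp_iff)
qed

lemma Lp_norm_AE_eq:
  "AE x in m. f x = g x \<Longrightarrow> f \<in> Lp m p \<Longrightarrow> g \<in> Lp m p \<Longrightarrow> N f = N g"
  by (rule Lp_norm_cong_AE) (auto intro: Lp_measurable)

lemma fc_AE_eq:
  "AE x in m. f x = g x \<Longrightarrow> f \<in> Lp m p \<Longrightarrow> g \<in> Lp m p \<Longrightarrow> \<eta> \<in> chars \<Longrightarrow> fc f \<eta> = fc g \<eta>"
  by (rule fourier_coeff_cong_AE) (auto intro: Lp_measurable)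

lemma trig_approx_seq:
  assumes f: "f \<in> Lp m p"
  obtains q where "\<And>n :: nat. q n \<in> trig_span chars" "(\<lambda>n. N (\<lambda>x. q n x - f x)) \<longlonglongrightarrow> 0"
proof -
  have "\<exists>q. q \<in> trig_span chars \<and> N (\<lambda>x. q x - f x) < 1 / real (Suc n)" for n
    using trig_poly_dense_Lp[OF f p_pos(2), of "1 / real (Suc n)"] Lp_norm_minus_commute[of m p f] by auto
  then obtain q where q: "\<And>n. q n \<in> trig_span chars" "\<And>n. N (\<lambda>x. q n x - f x) < 1 / real (Suc n)"
    by metis
  have "(\<lambda>n. N (\<lambda>x. q n x - f x)) \<longlonglongrightarrow> 0"
  proof (rule tendsto_sandwich[OF _ _ tendsto_const])
    show "(\<lambda>n. 1 / real (Suc n)) \<longlonglongrightarrow> 0" using lim_1_over_n LIMSEQ_Suc by blast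
    show "\<forall>\<^sub>F n in sequentially. N (\<lambda>x. q n x - f x) \<le> 1 / real (Suc n)"
      by (intro always_eventually allI less_imp_le q)
  qed simp
  with q(1) show ?thesis by (rule that)
qed

text \<open>Extension by density: the projections of approximating polynomials form a Cauchy
  sequence. The limit is described by its coefficients on T, which determine it almost
  everywhere.\<close>

lemma riesz_extension_value:
  assumes C: "0 < C" "\<And>q. q \<in> trig_span chars \<Longrightarrow> N (riesz q) \<le> C * N q" and f: "f \<in> Lp m p"
  shows "\<exists>h\<in>H. N h \<le> C * N f \<and> (\<forall>\<eta>\<in>T. fc h \<eta> = fc f \<eta>)"
proof -
  obtain q where q: "\<And>n :: nat. q n \<in> trig_span chars" "(\<lambda>n. N (\<lambda>x. q n x - f x)) \<longlonglongrightarrow> 0"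
    using trig_approx_seq[OF f] by blast
  have qL: "q n \<in> Lp m p" for n by (rule trig_Lp[OF q(1) p_pos(1)])
  define r where "r n = riesz (q n)" for n
  have rH: "r n \<in> H" for n unfolding r_def by (rule Hp_trig_span[OF riesz_span[OF q(1)]])
  have rL: "r n \<in> Lp m p" for n by (rule Hp_Lp[OF rH])
  have cauchy: "\<exists>M. \<forall>i\<ge>M. \<forall>j\<ge>M. N (\<lambda>x. r i x - r j x) < e" if e: "0 < e" for e
  proof -
    have "\<forall>\<^sub>F n in sequentially. N (\<lambda>x. q n x - f x) < e / (2 * C)"
      using q(2) C(1) e by (intro order_tendstoD) auto
    then obtain M where M: "\<And>n. M \<le> n \<Longrightarrow> N (\<lambda>x. q n x - f x) < e / (2 * C)"
      by (auto simp: eventually_sequentially)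
    have "N (\<lambda>x. r i x - r j x) < e" if "M \<le> i" "M \<le> j" for i j
    proof -
      have "N (\<lambda>x. r i x - r j x) = N (riesz (\<lambda>x. q i x - q j x))"
        by (simp add: r_def riesz_diff[OF q(1) q(1)])
      also have "\<dots> \<le> C * N (\<lambda>x. q i x - q j x)" by (intro C(2) trig_span_diff q)
      also have "\<dots> \<le> C * (N (\<lambda>x. q i x - f x) + N (\<lambda>x. f x - q j x))"
        using C(1) p_pos by (intro mult_left_mono Lp_norm_diff_triangle qL f) auto
      also have "\<dots> < C * (e / (2 * C) + e / (2 * C))"
        using M[OF that(1)] M[OF that(2)] C(1) Lp_norm_minus_commute[of m p f "q j"]
        by (intro mult_strict_left_mono add_strict_mono) auto
      also have "\<dots> = e" using C(1) by (simp add: field_simps)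
      finally show ?thesis .
    qed
    then show ?thesis by blast
  qed
  obtain h where h: "h \<in> Lp m p" "(\<lambda>n. N (\<lambda>x. r n x - h x)) \<longlonglongrightarrow> 0"
    using Lp_complete[OF p emeasure_space_m rL cauchy] by blast
  have hH: "h \<in> H" by (rule Hp_limit[OF rH h])
  moreover have "fc h \<eta> = fc f \<eta>" if \<eta>: "\<eta> \<in> T" for \<eta>
  proof -
    have \<eta>': "\<eta> \<in> chars" using \<eta> T_chars by blast
    have "fc (r n) \<eta> = fc (q n) \<eta>" for n
      unfolding r_def using fourier_coeff_riesz[OF q(1) \<eta>'] \<eta> by simp
    then show ?thesis
      using LIMSEQ_unique fourier_coeff_tendsto[OF rL h(1) p \<eta>' h(2)] fourier_coeff_tendsto[OF qL f p \<eta>' q(2)]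
      by simp
  qed
  moreover have "N h \<le> C * N f"
  proof -
    have "N h \<le> N (\<lambda>x. r n x - h x) + C * (N f + N (\<lambda>x. q n x - f x))" for n
    proof -
      have "N h \<le> N (r n) + N (\<lambda>x. h x - r n x)" by (rule Lp_norm_le_add_diff[OF h(1) rL p_pos(2)])
      also have "N (r n) \<le> C * N (q n)" unfolding r_def by (rule C(2)[OF q(1)])
      also have "C * N (q n) \<le> C * (N f + N (\<lambda>x. q n x - f x))"
        using C(1) by (intro mult_left_mono Lp_norm_le_add_diff qL f p_pos) auto
      finally show ?thesis using Lp_norm_minus_commute[of m p h "r n"] by simp
    qed
    moreover have "(\<lambda>n. N (\<lambda>x. r n x - h x) + C * (N f + N (\<lambda>x. q n x - f x))) \<longlonglongrightarrow> 0 + C * (N f + 0)"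
      by (intro tendsto_intros h q)
    ultimately show ?thesis using LIMSEQ_le_const by fastforce
  qed
  ultimately show ?thesis by blast
qed

text \<open>The Bochner-Helson theorem. Values may be chosen function by function: a value is
  determined almost everywhere by the coefficients of f on T, so linearity is inherited from the
  coefficients.\<close>

lemma riesz_extension_exists: "\<exists>P. is_riesz_extension m T p P"
proof -
  obtain C where C: "0 < C" "\<And>q. q \<in> trig_span chars \<Longrightarrow> N (riesz q) \<le> C * N q"
    using riesz_bound[OF p] by blast
  have "\<forall>f\<in>Lp m p. \<exists>h. h \<in> H \<and> N h \<le> C * N f \<and> (\<forall>\<eta>\<in>T. fc h \<eta> = fc f \<eta>)"
    using riesz_extension_value[OF C] by blast
  then obtain P where "\<forall>f\<in>Lp m p. P f \<in> H \<and> N (P f) \<le> C * N f \<and> (\<forall>\<eta>\<in>T. fc (P f) \<eta> = fc f \<eta>)"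
    using bchoice[of "Lp m p" "\<lambda>f h. h \<in> H \<and> N h \<le> C * N f \<and> (\<forall>\<eta>\<in>T. fc h \<eta> = fc f \<eta>)"] by auto
  then have P: "\<And>f. f \<in> Lp m p \<Longrightarrow> P f \<in> H" "\<And>f. f \<in> Lp m p \<Longrightarrow> N (P f) \<le> C * N f"
    "\<And>f \<eta>. f \<in> Lp m p \<Longrightarrow> \<eta> \<in> T \<Longrightarrow> fc (P f) \<eta> = fc f \<eta>" by auto
  have add: "AE x in m. P (\<lambda>y. f y + g y) x = P f x + P g x" if "f \<in> Lp m p" "g \<in> Lp m p" for f g
  proof (rule Hp_AE_eqI)
    fix \<eta> assume "\<eta> \<in> T"
    moreover from this have "\<eta> \<in> chars" using T_chars by blast
    ultimately show "fc (P (\<lambda>y. f y + g y)) \<eta> = fc (\<lambda>x. P f x + P g x) \<eta>"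
      using that P p p_pos by (simp add: fourier_coeff_add[of _ p] Lp_add Hp_Lp)
  qed (use that P p_pos in \<open>auto intro: Lp_add Hp_add\<close>)
  have cmult: "AE x in m. P (\<lambda>y. c * f y) x = c * P f x" if "f \<in> Lp m p" for c f
    by (rule Hp_AE_eqI)
       (use that P Lp_cmult[OF that, of c] in \<open>auto intro: Hp_cmult simp: fourier_coeff_cmult\<close>)
  have "\<exists>C. \<forall>f\<in>Lp m p. N (P f) \<le> C * N f" using P(2) by blast
  then have "bounded_operator m p (Lp m p) H P"
    unfolding bounded_operator_def using add cmult P(1) by simp
  moreover have "AE x in m. P (trig_poly M c) x = trig_poly (M \<inter> T) c x" if M: "finite M" "M \<subseteq> chars" for M c
  proof (rule Hp_AE_eqI)
    have q: "trig_poly M c \<in> Lp m p" by (intro trig_Lp trig_spanI M p_pos)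
    show "P (trig_poly M c) \<in> H" by (rule P(1)[OF q])
    show "trig_poly (M \<inter> T) c \<in> H" by (intro Hp_trig_span trig_spanI) (use M in auto)
    fix \<eta> assume \<eta>: "\<eta> \<in> T"
    then have \<eta>': "\<eta> \<in> chars" using T_chars by blast
    show "fc (P (trig_poly M c)) \<eta> = fc (trig_poly (M \<inter> T) c) \<eta>"
      using P(3)[OF q \<eta>] fourier_coeff_trig_poly[OF M \<eta>', of c] fourier_coeff_trig_poly[OF finite_Int[OF disjI1[OF M(1)]] le_infI1[OF M(2)] \<eta>', of T c]
        M \<eta> by auto
  qed
  ultimately show ?thesis unfolding is_riesz_extension_def by blast
qed

definition P :: "('g \<Rightarrow> complex) \<Rightarrow> 'g \<Rightarrow> complex" where
  "P = riesz_projection m T p"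

lemma P_extension: "is_riesz_extension m T p P"
  unfolding P_def riesz_projection_def by (rule someI_ex[OF riesz_extension_exists])

lemma P_Hp: "f \<in> Lp m p \<Longrightarrow> P f \<in> H"
  using P_extension by (simp add: is_riesz_extension_def bounded_operator_def)

lemma P_Lp: "f \<in> Lp m p \<Longrightarrow> P f \<in> Lp m p"
  by (rule Hp_Lp[OF P_Hp])

lemma P_add: "f \<in> Lp m p \<Longrightarrow> g \<in> Lp m p \<Longrightarrow> AE x in m. P (\<lambda>y. f y + g y) x = P f x + P g x"
  and P_cmult: "f \<in> Lp m p \<Longrightarrow> AE x in m. P (\<lambda>y. c * f y) x = c * P f x"
  using P_extension unfolding is_riesz_extension_def bounded_operator_def by blast+

lemma P_bound: "\<exists>C>0. \<forall>f\<in>Lp m p. N (P f) \<le> C * N f"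
proof -
  obtain C where "\<forall>f\<in>Lp m p. N (P f) \<le> C * N f"
    using P_extension unfolding is_riesz_extension_def bounded_operator_def by blast
  then have C: "\<And>f. f \<in> Lp m p \<Longrightarrow> N (P f) \<le> C * N f" by blast
  have "N (P f) \<le> max C 1 * N f" if "f \<in> Lp m p" for f
    using C[OF that] by (intro order_trans[OF _ mult_right_mono[of C "max C 1"]]) auto
  then show ?thesis by (intro exI[of _ "max C 1"]) auto
qed

text \<open>True for polynomials by the choice of \<open>P\<close>; both sides depend continuously
  on f. Together with \<open>P_Hp\<close> this determines \<open>P f\<close> almost
  everywhere.\<close>

lemma fc_P:
  assumes f: "f \<in> Lp m p" and \<eta>: "\<eta> \<in> T"
  shows "fc (P f) \<eta> = fc f \<eta>"
proof -
  have \<eta>': "\<eta> \<in> chars" using \<eta> T_chars by blast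
  obtain C where C: "0 < C" "\<And>f. f \<in> Lp m p \<Longrightarrow> N (P f) \<le> C * N f" using P_bound by blast
  obtain q where q: "\<And>n :: nat. q n \<in> trig_span chars" "(\<lambda>n. N (\<lambda>x. q n x - f x)) \<longlonglongrightarrow> 0"
    using trig_approx_seq[OF f] by blast
  have qL: "q n \<in> Lp m p" for n by (rule trig_Lp[OF q(1) p_pos(1)])
  have dL: "(\<lambda>x. q n x - f x) \<in> Lp m p" for n by (intro Lp_diff qL f p_pos)
  have fcq: "fc (P (q n)) \<eta> = fc (q n) \<eta>" for n
  proof -
    obtain M c where M: "finite M" "M \<subseteq> chars" "q n = trig_poly M c" using q(1)[of n] by (auto simp: trig_span_def)
    have "AE x in m. P (q n) x = trig_poly (M \<inter> T) c x"
      unfolding M(3) using P_extension M(1,2) unfolding is_riesz_extension_def by blast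
    moreover have "trig_poly (M \<inter> T) c \<in> Lp m p"
      using M by (intro trig_Lp[OF trig_spanI] p_pos) auto
    ultimately have "fc (P (q n)) \<eta> = fc (trig_poly (M \<inter> T) c) \<eta>"
      by (intro fc_AE_eq P_Lp qL \<eta>')
    then show ?thesis
      using fourier_coeff_trig_poly[OF M(1,2) \<eta>', of c] fourier_coeff_trig_poly[OF finite_Int[OF disjI1[OF M(1)]] le_infI1[OF M(2)] \<eta>', of T c]
        M \<eta> by auto
  qed
  have le: "N (\<lambda>x. P (q n) x - P f x) \<le> C * N (\<lambda>x. q n x - f x)" for n
  proof -
    have "AE x in m. P (\<lambda>y. (q n y - f y) + f y) x = P (\<lambda>x. q n x - f x) x + P f x"
      by (rule P_add[OF dL f])
    then have "AE x in m. P (q n) x - P f x = P (\<lambda>x. q n x - f x) x"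
      by eventually_elim simp
    then have "N (\<lambda>x. P (q n) x - P f x) = N (P (\<lambda>x. q n x - f x))"
      by (intro Lp_norm_AE_eq Lp_diff P_Lp qL f dL p_pos)
    then show ?thesis using C(2)[OF dL] by simp
  qed
  have "(\<lambda>n. N (\<lambda>x. P (q n) x - P f x)) \<longlonglongrightarrow> 0"
    by (rule squeeze_zero[OF Lp_norm_nonneg le tendsto_mult_right_zero[OF q(2)]])
  from fourier_coeff_tendsto[OF P_Lp[OF qL] P_Lp[OF f] p \<eta>' this]
  have "(\<lambda>n. fc (q n) \<eta>) \<longlonglongrightarrow> fc (P f) \<eta>" unfolding fcq .
  with fourier_coeff_tendsto[OF qL f p \<eta>' q(2)] show ?thesis using LIMSEQ_unique by blast
qed

lemma P_AE_eqI:
  assumes f: "f \<in> Lp m p" and h: "h \<in> H" and "\<And>\<eta>. \<eta> \<in> T \<Longrightarrow> fc f \<eta> = fc h \<eta>"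
  shows "AE x in m. P f x = h x"
  by (rule Hp_AE_eqI[OF P_Hp[OF f] h]) (simp add: fc_P[OF f] assms)

section \<open>Analytic and antianalytic multipliers\<close>

definition uniform_closure :: "('g \<Rightarrow> complex) set \<Rightarrow> ('g \<Rightarrow> complex) set" where
  "uniform_closure S = {\<psi>. continuous_on UNIV \<psi> \<and> (\<forall>e>0. \<exists>q\<in>trig_span S. \<forall>x. cmod (\<psi> x - q x) < e)}"

text \<open>Two instances matter: \<open>S = T\<close> with \<open>Z\<close> the complement of \<open>T\<close>, where the functions with vanishing
  coefficients form \<open>H\<^sup>p\<close>, and \<open>S = T\<inverse>\<close> with \<open>Z = T\<close>, where they form the kernel of the Riesz projection.\<close>

lemma fc_mult_vanish:
  assumes S: "S \<subseteq> chars" and Z: "Z \<subseteq> chars" and closed: "\<And>\<eta> \<xi>. \<eta> \<in> Z \<Longrightarrow> \<xi> \<in> S \<Longrightarrow> (\<lambda>x. \<eta> x * cnj (\<xi> x)) \<in> Z"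
    and \<psi>: "\<psi> \<in> uniform_closure S" and f: "f \<in> Lp m p" and zero: "\<And>\<eta>. \<eta> \<in> Z \<Longrightarrow> fc f \<eta> = 0"
    and \<eta>: "\<eta> \<in> Z"
  shows "fc (\<lambda>x. \<psi> x * f x) \<eta> = 0"
proof -
  have c\<psi>: "continuous_on UNIV \<psi>" using \<psi> by (simp add: uniform_closure_def)
  have \<eta>': "\<eta> \<in> chars" using \<eta> Z by blast
  have prod: "(\<lambda>x. \<theta> x * f x) \<in> Lp m p" if \<theta>: "continuous_on UNIV \<theta>" for \<theta>
  proof -
    obtain B where "\<And>x. cmod (\<theta> x) \<le> B" using continuous_bounded[OF \<theta>] by blast
    then show ?thesis by (rule Lp_mult_continuous(1)[OF \<theta> _ f p_pos(1)])
  qed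
  have poly: "fc (\<lambda>x. q x * f x) \<eta> = 0" if "q \<in> trig_span S" for q
    using that
  proof (induction rule: trig_span_induct)
    case (add \<xi> c q)
    have \<xi>: "continuous_on UNIV \<xi>" "continuous_on UNIV q"
      using add S char_continuous trig_span_continuous[OF add(2) S] by blast+
    have "fc (\<lambda>x. c * (\<xi> x * f x) + q x * f x) \<eta> = c * fc (\<lambda>x. \<xi> x * f x) \<eta> + fc (\<lambda>x. q x * f x) \<eta>"
      by (subst fourier_coeff_add[OF Lp_cmult[OF prod[OF \<xi>(1)]] prod[OF \<xi>(2)] p \<eta>'])
         (simp add: fourier_coeff_cmult)
    also have "fc (\<lambda>x. \<xi> x * f x) \<eta> = 0"
      unfolding fourier_coeff_modulate by (rule zero[OF closed[OF \<eta> add(1)]])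
    finally show ?case using add(3) by (simp add: algebra_simps)
  qed simp
  have "cmod (fc (\<lambda>x. \<psi> x * f x) \<eta>) \<le> e" if e: "0 < e" for e
  proof -
    have "0 < e / (N f + 1)" using e by (simp add: add_nonneg_pos)
    then obtain q where q: "q \<in> trig_span S" "\<And>x. cmod (\<psi> x - q x) < e / (N f + 1)"
      using \<psi> unfolding uniform_closure_def by blast
    have cq: "continuous_on UNIV q" by (rule trig_span_continuous[OF q(1) S])
    have cd: "continuous_on UNIV (\<lambda>x. \<psi> x - q x)" by (intro continuous_intros c\<psi> cq)
    have "fc (\<lambda>x. \<psi> x * f x) \<eta> = fc (\<lambda>x. \<psi> x * f x - q x * f x) \<eta>"
      using fourier_coeff_diff[OF prod[OF c\<psi>] prod[OF cq] p \<eta>'] poly[OF q(1)] by simp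
    also have "cmod \<dots> \<le> N (\<lambda>x. (\<psi> x - q x) * f x)"
      using fourier_coeff_le[OF prod[OF cd] p \<eta>'] by (simp add: left_diff_distrib)
    also have "\<dots> \<le> (e / (N f + 1)) * N f"
      using q(2) by (intro Lp_mult_continuous(2)[OF cd _ f p_pos(1)]) (auto intro: less_imp_le)
    also have "\<dots> \<le> e"
      using mult_divide_add_one_less[OF e, of "N f"] by (simp add: mult.commute)
    finally show ?thesis .
  qed
  then have "cmod (fc (\<lambda>x. \<psi> x * f x) \<eta>) \<le> 0" by (rule field_le_epsilon) simp
  then show ?thesis by simp
qed

definition T_inv :: "('g \<Rightarrow> complex) set" where
  "T_inv = {\<eta> \<in> chars. (\<lambda>x. cnj (\<eta> x)) \<in> T}"

lemma T_inv_chars: "T_inv \<subseteq> chars" by (auto simp: T_inv_def)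

lemma T_inv_mult: "\<eta> \<in> T_inv \<Longrightarrow> \<xi> \<in> T_inv \<Longrightarrow> (\<lambda>x. \<eta> x * \<xi> x) \<in> T_inv"
  using T_mult by (auto simp: T_inv_def char_mult)

lemma T_inv_one: "(\<lambda>x. 1) \<in> T_inv"
  using T_one by (simp add: T_inv_def)

lemma Lp_mult:
  assumes \<theta>: "continuous_on UNIV \<theta>" and f: "f \<in> Lp m p"
  shows "(\<lambda>x. \<theta> x * f x) \<in> Lp m p"
proof -
  obtain B where "\<And>x. cmod (\<theta> x) \<le> B" using continuous_bounded[OF \<theta>] by blast
  then show ?thesis by (rule Lp_mult_continuous(1)[OF \<theta> _ f p_pos(1)])
qed

lemma cnj_not_T:
  assumes "\<eta> \<in> chars - T" "\<xi> \<in> T"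
  shows "(\<lambda>x. \<eta> x * cnj (\<xi> x)) \<in> chars - T"
proof
  have \<xi>: "\<xi> \<in> chars" using assms T_chars by blast
  show "(\<lambda>x. \<eta> x * cnj (\<xi> x)) \<in> chars" using assms \<xi> by (auto intro: char_mult char_cnj)
  show "(\<lambda>x. \<eta> x * cnj (\<xi> x)) \<notin> T"
  proof
    assume "(\<lambda>x. \<eta> x * cnj (\<xi> x)) \<in> T"
    from T_mult[OF this assms(2)] have "(\<lambda>x. \<eta> x * (\<xi> x * cnj (\<xi> x))) \<in> T" by (simp add: mult_ac)
    then show False using char_cnj_mult[OF \<xi>] assms(1) by simp
  qed
qed

lemma Hp_mult_closure:
  assumes \<psi>: "\<psi> \<in> uniform_closure T" and f: "f \<in> H"
  shows "(\<lambda>x. \<psi> x * f x) \<in> H"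
  unfolding Hp_iff
proof (intro conjI ballI)
  show "(\<lambda>x. \<psi> x * f x) \<in> Lp m p"
    using \<psi> f by (intro Lp_mult) (auto simp: uniform_closure_def Hp_iff)
  show "fc (\<lambda>x. \<psi> x * f x) \<eta> = 0" if "\<eta> \<in> chars - T" for \<eta>
    by (rule fc_mult_vanish[OF T_chars _ cnj_not_T \<psi> Hp_Lp[OF f] _ that]) (use f in \<open>auto simp: Hp_iff\<close>)
qed

text \<open>An antianalytic multiplier only lowers characters, so it cannot carry the part of f - h
  outside T into T. With h = \<open>P f\<close> this is P (\<psi> f) = P (\<psi> P f), which lets
  antianalytic factors be split off on the left.\<close>

lemma fc_mult_T_inv:
  assumes \<psi>: "\<psi> \<in> uniform_closure T_inv" and f: "f \<in> Lp m p" "h \<in> Lp m p"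
    and eq: "\<And>\<eta>. \<eta> \<in> T \<Longrightarrow> fc f \<eta> = fc h \<eta>" and \<eta>: "\<eta> \<in> T"
  shows "fc (\<lambda>x. \<psi> x * f x) \<eta> = fc (\<lambda>x. \<psi> x * h x) \<eta>"
proof -
  have c: "continuous_on UNIV \<psi>" using \<psi> by (simp add: uniform_closure_def)
  have "fc (\<lambda>x. \<psi> x * (f x - h x)) \<eta> = 0"
  proof (rule fc_mult_vanish[OF T_inv_chars T_chars _ \<psi> Lp_diff[OF f p_pos(2)] _ \<eta>])
    show "(\<lambda>x. \<eta> x * cnj (\<xi> x)) \<in> T" if "\<eta> \<in> T" "\<xi> \<in> T_inv" for \<eta> \<xi>
      using that T_mult by (auto simp: T_inv_def)
    show "fc (\<lambda>x. f x - h x) \<eta> = 0" if "\<eta> \<in> T" for \<eta>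
      using that eq T_chars by (subst fourier_coeff_diff[OF f p]) auto
  qed
  then have "fc (\<lambda>x. \<psi> x * f x - \<psi> x * h x) \<eta> = 0" by (simp add: right_diff_distrib)
  then show ?thesis
    using \<eta> T_chars by (subst (asm) fourier_coeff_diff[OF Lp_mult[OF c f(1)] Lp_mult[OF c f(2)] p]) auto
qed

lemma trig_span_closure: "S \<subseteq> chars \<Longrightarrow> q \<in> trig_span S \<Longrightarrow> q \<in> uniform_closure S"
  by (auto simp: uniform_closure_def intro!: bexI[of _ q] trig_span_continuous[of q S])

text \<open>The exponential series converges uniformly on the bounded range of q, and its partial
  sums are polynomials over S. Used for q and - q, it puts a multiplier and its inverse into the
  same closure.\<close>

lemma exp_closure:
  assumes S: "S \<subseteq> chars" "(\<lambda>x. 1) \<in> S" "\<And>\<eta> \<xi>. \<eta> \<in> S \<Longrightarrow> \<xi> \<in> S \<Longrightarrow> (\<lambda>x. \<eta> x * \<xi> x) \<in> S"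
    and q: "q \<in> trig_span S"
  shows "(\<lambda>x. exp (q x)) \<in> uniform_closure S"
proof -
  have cq: "continuous_on UNIV q" by (rule trig_span_continuous[OF q S(1)])
  obtain B where B: "0 < B" "\<And>x. cmod (q x) \<le> B" using continuous_bounded[OF cq] by blast
  have pow: "(\<lambda>x. q x ^ k) \<in> trig_span S" for k
  proof (induction k)
    case 0
    then show ?case using trig_span_const[OF S(2)] by simp
  next
    case (Suc k)
    have "(\<lambda>x. q x * q x ^ k) \<in> trig_span S" by (rule trig_span_mult[OF q Suc]) (rule S(3))
    then show ?case by simp
  qed
  have poly: "(\<lambda>x. \<Sum>k\<le>n. q x ^ k / fact k) \<in> trig_span S" for n
  proof (induction n)
    case 0
    then show ?case using trig_span_const[OF S(2)] by simp
  next
    case (Suc n)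
    show ?case
      using trig_span_add[OF Suc trig_span_cmult[OF pow[of "Suc n"], of "1 / fact (Suc n)"]] by simp
  qed
  have "\<exists>r\<in>trig_span S. \<forall>x. cmod (exp (q x) - r x) < e" if e: "0 < e" for e
  proof -
    have "(\<lambda>n. exp B * B * (B ^ n / fact n)) \<longlonglongrightarrow> exp B * B * 0"
      using summable_LIMSEQ_zero[OF summable_exp[of B]]
      by (intro tendsto_mult tendsto_const) (simp add: field_simps)
    then have "\<forall>\<^sub>F n in sequentially. exp B * B * (B ^ n / fact n) < e"
      using e by (intro order_tendstoD) auto
    then obtain n where n: "exp B * B * (B ^ n / fact n) < e" by (auto simp: eventually_sequentially)
    have "cmod (exp (q x) - (\<Sum>k\<le>n. q x ^ k / fact k)) < e" for x
    proof -
      have "cmod (exp (q x) - (\<Sum>k\<le>n. q x ^ k / fact k)) \<le> exp \<bar>Re (q x)\<bar> * cmod (q x) ^ Suc n / fact n"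
        by (rule Taylor_exp)
      also have "\<dots> \<le> exp B * B ^ Suc n / fact n"
        using B(2)[of x] abs_Re_le_cmod[of "q x"] by (intro divide_right_mono mult_mono power_mono) auto
      also have "\<dots> < e" using n by simp
      finally show ?thesis .
    qed
    then show ?thesis using poly[of n] by (intro bexI[of _ "\<lambda>x. \<Sum>k\<le>n. q x ^ k / fact k"]) auto
  qed
  then show ?thesis unfolding uniform_closure_def by (auto intro: continuous_intros cq)
qed

lemma trig_span_split:
  assumes "q \<in> trig_span chars"
  obtains a b where "a \<in> trig_span T" "b \<in> trig_span T_inv" "\<And>x. q x = a x + b x"
proof -
  have "\<exists>a\<in>trig_span T. \<exists>b\<in>trig_span T_inv. \<forall>x. q x = a x + b x"
    using assms
  proof (induction rule: trig_span_induct)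
    case zero
    show ?case by (intro bexI[of _ "\<lambda>x. 0"] trig_span_zero) simp
  next
    case (add \<eta> c q)
    then obtain a b where ab: "a \<in> trig_span T" "b \<in> trig_span T_inv" "\<And>x. q x = a x + b x" by blast
    show ?case
    proof (cases "\<eta> \<in> T")
      case True
      have "(\<lambda>x. c * \<eta> x + a x) \<in> trig_span T"
        by (intro trig_span_add trig_span_cmult trig_span_base True ab)
      then show ?thesis using ab by (intro bexI[of _ "\<lambda>x. c * \<eta> x + a x"] bexI[of _ b]) auto
    next
      case False
      then have "\<eta> \<in> T_inv" using T_total[OF add(1)] add(1) by (simp add: T_inv_def)
      then have "(\<lambda>x. c * \<eta> x + b x) \<in> trig_span T_inv"
        by (intro trig_span_add trig_span_cmult trig_span_base ab)
      then show ?thesis using ab by (intro bexI[of _ a] bexI[of _ "\<lambda>x. c * \<eta> x + b x"]) auto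
    qed
  qed
  then show ?thesis using that by blast
qed

section \<open>Toeplitz operators with exponential symbols\<close>

lemma toeplitz_eq: "toeplitz m T p \<phi> f = P (\<lambda>x. \<phi> x * f x)"
  by (simp add: toeplitz_def P_def)

text \<open>The map K f = P (\<theta> f) has norm at most C / (2 C) = 1/2, so the iteration f = h -
  K f converges. Its limit solves P ((1 + \<theta>) f) = h, stated here by coefficients on
  T.\<close>

lemma Neumann_solution:
  assumes C: "0 < C" "\<And>f. f \<in> Lp m p \<Longrightarrow> N (P f) \<le> C * N f"
    and \<theta>: "continuous_on UNIV \<theta>" "\<And>x. cmod (\<theta> x) \<le> 1 / (2 * C)" and h: "h \<in> H"
  shows "\<exists>f\<in>H. \<forall>\<eta>\<in>T. fc (\<lambda>x. (1 + \<theta> x) * f x) \<eta> = fc h \<eta>"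
proof -
  have small: "N (P (\<lambda>x. \<theta> x * f x)) \<le> 1/2 * N f" if f: "f \<in> Lp m p" for f
  proof -
    have "N (P (\<lambda>x. \<theta> x * f x)) \<le> C * N (\<lambda>x. \<theta> x * f x)" by (rule C(2)[OF Lp_mult[OF \<theta>(1) f]])
    also have "\<dots> \<le> C * (1 / (2 * C) * N f)"
      using C(1) by (intro mult_left_mono Lp_mult_continuous(2)[OF \<theta> f p_pos(1)]) auto
    finally show ?thesis using C(1) by simp
  qed
  define K where "K f = P (\<lambda>x. \<theta> x * f x)" for f
  have KH: "K f \<in> H" if "f \<in> H" for f
    unfolding K_def by (intro P_Hp Lp_mult \<theta> Hp_Lp that)
  \<comment> \<open>K is linear only up to null sets, so the difference is compared through
    coefficients.\<close>
  have K_diff: "N (\<lambda>x. K f x - K g x) \<le> 1/2 * N (\<lambda>x. f x - g x)" if fg: "f \<in> H" "g \<in> H" for f g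
  proof -
    have d: "(\<lambda>x. f x - g x) \<in> H" by (rule Hp_diff[OF fg])
    note L = Hp_Lp[OF fg(1)] Hp_Lp[OF fg(2)] Hp_Lp[OF d]
    have "AE x in m. K (\<lambda>x. f x - g x) x = K f x - K g x"
      unfolding K_def
    proof (rule P_AE_eqI)
      show "(\<lambda>x. P (\<lambda>x. \<theta> x * f x) x - P (\<lambda>x. \<theta> x * g x) x) \<in> H"
        by (intro Hp_diff P_Hp Lp_mult \<theta> L)
      fix \<eta> assume \<eta>: "\<eta> \<in> T"
      then have \<eta>': "\<eta> \<in> chars" using T_chars by blast
      have "fc (\<lambda>x. \<theta> x * (f x - g x)) \<eta> = fc (\<lambda>x. \<theta> x * f x) \<eta> - fc (\<lambda>x. \<theta> x * g x) \<eta>"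
        unfolding right_diff_distrib by (intro fourier_coeff_diff[OF _ _ p \<eta>'] Lp_mult \<theta> L)
      also have "\<dots> = fc (\<lambda>x. P (\<lambda>x. \<theta> x * f x) x - P (\<lambda>x. \<theta> x * g x) x) \<eta>"
        using fourier_coeff_diff[OF P_Lp[OF Lp_mult[OF \<theta>(1) L(1)]] P_Lp[OF Lp_mult[OF \<theta>(1) L(2)]] p \<eta>']
          fc_P[OF Lp_mult[OF \<theta>(1) L(1)] \<eta>] fc_P[OF Lp_mult[OF \<theta>(1) L(2)] \<eta>] by simp
      finally show "fc (\<lambda>x. \<theta> x * (f x - g x)) \<eta> = fc (\<lambda>x. P (\<lambda>x. \<theta> x * f x) x - P (\<lambda>x. \<theta> x * g x) x) \<eta>" .
    qed (intro Lp_mult \<theta> L)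
    then have "N (\<lambda>x. K f x - K g x) = N (K (\<lambda>x. f x - g x))"
      using KH fg d p_pos by (intro Lp_norm_AE_eq[symmetric]) (auto intro: Hp_Lp Lp_diff)
    then show ?thesis using small[OF L(3)] by (simp add: K_def)
  qed
  define s where "s = rec_nat (\<lambda>x. 0) (\<lambda>_ f x. h x - K f x)"
  have s_simps: "s 0 = (\<lambda>x. 0)" "s (Suc n) = (\<lambda>x. h x - K (s n) x)" for n by (simp_all add: s_def)
  have sH: "s n \<in> H" for n by (induction n) (auto simp: s_simps intro: Hp_zero Hp_diff h KH)
  have sL: "s n \<in> Lp m p" for n by (rule Hp_Lp[OF sH])
  define d where "d n x = s (Suc n) x - s n x" for n x
  have dL: "d n \<in> Lp m p" for n unfolding d_def by (intro Lp_diff sL p_pos)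
  have dN: "N (d n) \<le> (1/2) ^ n * N (d 0)" for n
  proof (induction n)
    case (Suc n)
    have "s (Suc k) x = h x - K (s k) x" for k x by (simp add: s_simps)
    then have "d (Suc n) = (\<lambda>x. K (s n) x - K (s (Suc n)) x)" by (simp add: d_def fun_eq_iff)
    then have "N (d (Suc n)) = N (\<lambda>x. K (s n) x - K (s (Suc n)) x)" by simp
    also have "\<dots> \<le> 1/2 * N (\<lambda>x. s n x - s (Suc n) x)" by (rule K_diff[OF sH sH])
    also have "N (\<lambda>x. s n x - s (Suc n) x) = N (d n)"
      unfolding d_def by (rule Lp_norm_minus_commute)
    finally show ?case using Suc by simp
  qed simp
  have sm: "summable (\<lambda>n. N (d n))"
    by (rule summable_comparison_test'[where g = "\<lambda>n. (1/2) ^ n * N (d 0)" and N = 0])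
       (use dN in \<open>auto intro!: summable_mult2 summable_geometric\<close>)
  obtain f where f: "f \<in> Lp m p" "\<And>n. N (\<lambda>x. f x - (\<Sum>k<n. d k x)) \<le> (\<Sum>k. N (d (k + n)))"
    using Lp_series_complete[OF p emeasure_space_m dL sm] by blast
  have "(\<Sum>k<n. d k x) = s n x" for n x
    unfolding d_def using sum_lessThan_telescope[of "\<lambda>n. s n x" n] by (simp add: s_simps)
  then have le: "N (\<lambda>x. s n x - f x) \<le> (\<Sum>k. N (d (k + n)))" for n
    using f(2)[of n] Lp_norm_minus_commute[of m p "s n" f] by simp
  have "(\<lambda>n. \<Sum>k. N (d (k + n))) \<longlonglongrightarrow> 0"
    using suminf_exist_split[OF _ sm] by (auto simp: LIMSEQ_iff)
  then have lim: "(\<lambda>n. N (\<lambda>x. s n x - f x)) \<longlonglongrightarrow> 0"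
    by (rule squeeze_zero[OF Lp_norm_nonneg le])
  have fH: "f \<in> H" by (rule Hp_limit[OF sH f(1) lim])
  have "fc (\<lambda>x. (1 + \<theta> x) * f x) \<eta> = fc h \<eta>" if \<eta>: "\<eta> \<in> T" for \<eta>
  proof -
    have \<eta>': "\<eta> \<in> chars" using \<eta> T_chars by blast
    have step: "fc (s (Suc n)) \<eta> = fc h \<eta> - fc (\<lambda>x. \<theta> x * s n x) \<eta>" for n
      unfolding s_simps
      by (subst fourier_coeff_diff[OF Hp_Lp[OF h] Hp_Lp[OF KH[OF sH]] p \<eta>'])
         (simp add: K_def fc_P[OF Lp_mult[OF \<theta>(1) sL] \<eta>])
    have lim1: "(\<lambda>n. fc (s (Suc n)) \<eta>) \<longlonglongrightarrow> fc f \<eta>"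
      using LIMSEQ_Suc[OF fourier_coeff_tendsto[OF sL f(1) p \<eta>' lim]] .
    have "(\<lambda>n. fc (\<lambda>x. \<theta> x * s n x) \<eta>) \<longlonglongrightarrow> fc (\<lambda>x. \<theta> x * f x) \<eta>"
    proof (rule fourier_coeff_tendsto[OF Lp_mult[OF \<theta>(1) sL] Lp_mult[OF \<theta>(1) f(1)] p \<eta>'])
      have le: "N (\<lambda>x. \<theta> x * s n x - \<theta> x * f x) \<le> 1 / (2 * C) * N (\<lambda>x. s n x - f x)" for n
        using Lp_mult_continuous(2)[OF \<theta> Lp_diff[OF sL f(1) p_pos(2)] p_pos(1), of n] by (simp add: right_diff_distrib)
      show "(\<lambda>n. N (\<lambda>x. \<theta> x * s n x - \<theta> x * f x)) \<longlonglongrightarrow> 0"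
        by (rule squeeze_zero[OF Lp_norm_nonneg le tendsto_mult_right_zero[OF lim]])
    qed
    note lim2 = this
    have "(\<lambda>n. fc (s (Suc n)) \<eta>) \<longlonglongrightarrow> fc h \<eta> - fc (\<lambda>x. \<theta> x * f x) \<eta>"
      unfolding step by (intro tendsto_diff tendsto_const lim2)
    then have "fc f \<eta> = fc h \<eta> - fc (\<lambda>x. \<theta> x * f x) \<eta>"
      using lim1 LIMSEQ_unique by blast
    then show ?thesis
      using fourier_coeff_add[OF f(1) Lp_mult[OF \<theta>(1) f(1)] p \<eta>'] by (simp add: distrib_right)
  qed
  then show ?thesis using fH by blast
qed

text \<open>Surjectivity and a lower bound take the place of an inverse operator, so the solutions
  need not be chosen linearly; \<open>invertibleI\<close> recovers linearity.\<close>

lemma toeplitz_exp: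
  assumes g: "continuous_on UNIV g"
  shows "\<forall>h\<in>H. \<exists>f\<in>H. AE x in m. toeplitz m T p (\<lambda>x. exp (g x)) f x = h x"
    and "\<exists>K. \<forall>f\<in>H. N f \<le> K * N (toeplitz m T p (\<lambda>x. exp (g x)) f)"
proof -
  obtain C where C: "0 < C" "\<And>f. f \<in> Lp m p \<Longrightarrow> N (P f) \<le> C * N f" using P_bound by blast
  \<comment> \<open>\<epsilon> is chosen so that |g - q| < \<epsilon> makes \<theta> = exp (g - q) -
    1 as small as \<open>Neumann_solution\<close> demands.\<close>
  have "(exp \<longlongrightarrow> exp (0::complex)) (at 0)" by (intro tendsto_intros)
  then obtain \<epsilon> where \<epsilon>: "0 < \<epsilon>" "\<And>w :: complex. w \<noteq> 0 \<Longrightarrow> cmod w < \<epsilon> \<Longrightarrow> cmod (exp w - 1) < 1 / (2 * C)"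
    using LIM_D[of exp "exp (0::complex)" 0 "1 / (2 * C)"] C(1) by auto
  obtain q where q: "q \<in> trig_span chars" "\<And>x. cmod (g x - q x) < \<epsilon>"
    using trig_poly_dense[OF g \<epsilon>(1)] by blast
  obtain a b where ab: "a \<in> trig_span T" "b \<in> trig_span T_inv" "\<And>x. q x = a x + b x"
    using trig_span_split[OF q(1)] by blast
  define \<theta> where "\<theta> x = exp (g x - q x) - 1" for x
  have c\<theta>: "continuous_on UNIV \<theta>" unfolding \<theta>_def by (intro continuous_intros g trig_continuous q)
  have \<theta>_le: "cmod (\<theta> x) \<le> 1 / (2 * C)" for x
    using \<epsilon>(2)[of "g x - q x"] q(2)[of x] C(1) by (cases "g x - q x = 0") (auto simp: \<theta>_def)
  have eg: "exp (g x) = exp (b x) * ((1 + \<theta> x) * exp (a x))" for x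
    by (simp add: \<theta>_def ab(3) flip: exp_add)
  have pa: "(\<lambda>x. exp (a x)) \<in> uniform_closure T" "(\<lambda>x. exp (- a x)) \<in> uniform_closure T"
    by (intro exp_closure T_chars T_one T_mult ab trig_span_uminus; assumption)+
  have pb: "(\<lambda>x. exp (b x)) \<in> uniform_closure T_inv" "(\<lambda>x. exp (- b x)) \<in> uniform_closure T_inv"
    by (intro exp_closure T_inv_chars T_inv_one T_inv_mult ab trig_span_uminus; assumption)+
  have ca: "continuous_on UNIV (\<lambda>x. exp (- a x))" and cb: "continuous_on UNIV (\<lambda>x. exp (- b x))" "continuous_on UNIV (\<lambda>x. exp (b x))"
    using pa pb by (auto simp: uniform_closure_def)
  have ceg: "continuous_on UNIV (\<lambda>x. exp (g x))" and c1\<theta>: "continuous_on UNIV (\<lambda>x. 1 + \<theta> x)"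
    by (intro continuous_intros g c\<theta>)+
  show "\<forall>h\<in>H. \<exists>f\<in>H. AE x in m. toeplitz m T p (\<lambda>x. exp (g x)) f x = h x"
  proof
    fix h assume h: "h \<in> H"
    \<comment> \<open>The three factors are inverted in turn: exp (- b) and projection, the Neumann
      series, then exp (- a).\<close>
    have bh: "(\<lambda>x. exp (- b x) * h x) \<in> Lp m p" by (rule Lp_mult[OF cb(1) Hp_Lp[OF h]])
    obtain k where k: "k \<in> H" "\<And>\<eta>. \<eta> \<in> T \<Longrightarrow> fc (\<lambda>x. (1 + \<theta> x) * k x) \<eta> = fc (P (\<lambda>x. exp (- b x) * h x)) \<eta>"
      using Neumann_solution[OF C c\<theta> \<theta>_le P_Hp[OF bh]] by blast
    define f where "f x = exp (- a x) * k x" for x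
    have f: "f \<in> H" unfolding f_def by (rule Hp_mult_closure[OF pa(2) k(1)])
    have "AE x in m. P (\<lambda>x. exp (g x) * f x) x = h x"
    proof (rule P_AE_eqI[OF Lp_mult[OF ceg Hp_Lp[OF f]] h])
      fix \<eta> assume \<eta>: "\<eta> \<in> T"
      have "exp (g x) * f x = exp (b x) * ((1 + \<theta> x) * k x)" for x
      proof -
        have "exp (a x) * exp (- a x) = 1" by (simp flip: exp_add)
        then show ?thesis by (simp add: eg f_def mult_ac)
      qed
      then have "fc (\<lambda>x. exp (g x) * f x) \<eta> = fc (\<lambda>x. exp (b x) * ((1 + \<theta> x) * k x)) \<eta>" by simp
      also have "\<dots> = fc (\<lambda>x. exp (b x) * (exp (- b x) * h x)) \<eta>"
        using k(2) fc_P[OF bh] by (intro fc_mult_T_inv[OF pb(1) _ bh _ \<eta>] Lp_mult c1\<theta> Hp_Lp k) auto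
      also have "\<dots> = fc h \<eta>" by (simp add: mult.assoc[symmetric] flip: exp_add)
      finally show "fc (\<lambda>x. exp (g x) * f x) \<eta> = fc h \<eta>" .
    qed
    then show "\<exists>f\<in>H. AE x in m. toeplitz m T p (\<lambda>x. exp (g x)) f x = h x"
      using f unfolding toeplitz_eq by blast
  qed
  obtain A where A: "0 < A" "\<And>x. cmod (exp (- a x)) \<le> A" using continuous_bounded[OF ca] by blast
  obtain B where B: "0 < B" "\<And>x. cmod (exp (- b x)) \<le> B" using continuous_bounded[OF cb(1)] by blast
  \<comment> \<open>Multiplying the image k by exp (- b) and projecting leaves f2 + P (\<theta> f2),
    where f2 = exp a f. The second term has norm at most N f2 / 2 and is absorbed on the left,
    whence the factor 2.\<close>
  have "N f \<le> (A * (2 * (C * B))) * N (P (\<lambda>x. exp (g x) * f x))" if f: "f \<in> H" for f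
  proof -
    define k where "k = P (\<lambda>x. exp (g x) * f x)"
    have egf: "(\<lambda>x. exp (g x) * f x) \<in> Lp m p" by (rule Lp_mult[OF ceg Hp_Lp[OF f]])
    have k: "k \<in> H" unfolding k_def by (rule P_Hp[OF egf])
    have bk: "(\<lambda>x. exp (- b x) * k x) \<in> Lp m p" by (rule Lp_mult[OF cb(1) Hp_Lp[OF k]])
    define f2 where "f2 x = exp (a x) * f x" for x
    have f2: "f2 \<in> H" unfolding f2_def by (rule Hp_mult_closure[OF pa(1) f])
    have \<theta>f2: "(\<lambda>x. \<theta> x * f2 x) \<in> Lp m p" by (rule Lp_mult[OF c\<theta> Hp_Lp[OF f2]])
    have "AE x in m. f2 x = P (\<lambda>x. exp (- b x) * k x) x - P (\<lambda>x. \<theta> x * f2 x) x"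
    proof (rule Hp_AE_eqI[OF f2 Hp_diff[OF P_Hp[OF bk] P_Hp[OF \<theta>f2]]])
      fix \<eta> assume \<eta>: "\<eta> \<in> T"
      then have \<eta>': "\<eta> \<in> chars" using T_chars by blast
      have "exp (- b x) * (exp (g x) * f x) = f2 x + \<theta> x * f2 x" for x
      proof -
        have "exp (- b x) * (exp (g x) * f x) = (exp (- b x) * exp (b x)) * ((1 + \<theta> x) * (exp (a x) * f x))"
          by (simp only: eg mult_ac)
        also have "exp (- b x) * exp (b x) = 1" by (simp flip: exp_add)
        finally show ?thesis by (simp add: f2_def algebra_simps)
      qed
      then have "fc f2 \<eta> + fc (\<lambda>x. \<theta> x * f2 x) \<eta> = fc (\<lambda>x. exp (- b x) * (exp (g x) * f x)) \<eta>"
        using fourier_coeff_add[OF Hp_Lp[OF f2] \<theta>f2 p \<eta>'] by simp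
      also have "\<dots> = fc (\<lambda>x. exp (- b x) * k x) \<eta>"
        unfolding k_def using fc_P[OF egf] by (intro fc_mult_T_inv[OF pb(2) egf P_Lp[OF egf] _ \<eta>]) simp
      finally show "fc f2 \<eta> = fc (\<lambda>x. P (\<lambda>x. exp (- b x) * k x) x - P (\<lambda>x. \<theta> x * f2 x) x) \<eta>"
        unfolding fourier_coeff_diff[OF P_Lp[OF bk] P_Lp[OF \<theta>f2] p \<eta>'] fc_P[OF bk \<eta>] fc_P[OF \<theta>f2 \<eta>]
        by (simp only: eq_diff_eq)
    qed
    then have "N f2 = N (\<lambda>x. P (\<lambda>x. exp (- b x) * k x) x - P (\<lambda>x. \<theta> x * f2 x) x)"
      by (rule Lp_norm_AE_eq[OF _ Hp_Lp[OF f2] Lp_diff[OF P_Lp[OF bk] P_Lp[OF \<theta>f2] p_pos(2)]])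
    also have "\<dots> \<le> N (P (\<lambda>x. exp (- b x) * k x)) + N (P (\<lambda>x. \<theta> x * f2 x))"
      by (rule Lp_norm_triangle_diff[OF P_Lp[OF bk] P_Lp[OF \<theta>f2] p_pos(2)])
    also have "\<dots> \<le> C * (B * N k) + C * (1 / (2 * C) * N f2)"
      using C(1) by (intro add_mono order_trans[OF C(2)[OF bk]] order_trans[OF C(2)[OF \<theta>f2]] mult_left_mono
          Lp_mult_continuous(2)[OF cb(1) B(2) Hp_Lp[OF k] p_pos(1)]
          Lp_mult_continuous(2)[OF c\<theta> \<theta>_le Hp_Lp[OF f2] p_pos(1)]) auto
    finally have f2_le: "N f2 \<le> 2 * (C * B) * N k" using C(1) by simp
    have "f x = exp (- a x) * f2 x" for x
    proof -
      have "exp (- a x) * exp (a x) = 1" by (simp flip: exp_add)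
      then show ?thesis by (simp add: f2_def flip: mult.assoc)
    qed
    then have "N f = N (\<lambda>x. exp (- a x) * f2 x)" by (intro arg_cong[of _ _ N]) auto
    also have "\<dots> \<le> A * N f2" by (rule Lp_mult_continuous(2)[OF ca A(2) Hp_Lp[OF f2] p_pos(1)])
    also have "\<dots> \<le> A * (2 * (C * B) * N k)" using f2_le A(1) by (intro mult_left_mono) auto
    finally show ?thesis by (simp add: k_def mult.assoc)
  qed
  then show "\<exists>K. \<forall>f\<in>H. N f \<le> K * N (toeplitz m T p (\<lambda>x. exp (g x)) f)"
    unfolding toeplitz_eq by blast
qed

lemma bounded_operator_toeplitz:
  assumes \<phi>: "continuous_on UNIV \<phi>"
  shows "bounded_operator m p H H (toeplitz m T p \<phi>)"
proof -
  obtain C where C: "0 < C" "\<And>f. f \<in> Lp m p \<Longrightarrow> N (P f) \<le> C * N f" using P_bound by blast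
  obtain B where B: "0 < B" "\<And>x. cmod (\<phi> x) \<le> B" using continuous_bounded[OF \<phi>] by blast
  have L: "(\<lambda>x. \<phi> x * f x) \<in> Lp m p" if "f \<in> H" for f by (rule Lp_mult[OF \<phi> Hp_Lp[OF that]])
  have "AE x in m. P (\<lambda>x. \<phi> x * (f x + g x)) x = P (\<lambda>x. \<phi> x * f x) x + P (\<lambda>x. \<phi> x * g x) x"
    if "f \<in> H" "g \<in> H" for f g
    using P_add[OF L[OF that(1)] L[OF that(2)]] by (simp add: distrib_left)
  moreover have "AE x in m. P (\<lambda>x. \<phi> x * (c * f x)) x = c * P (\<lambda>x. \<phi> x * f x) x" if "f \<in> H" for c f
    using P_cmult[OF L[OF that], of c] by (simp add: mult.left_commute[of _ c])
  moreover have "N (P (\<lambda>x. \<phi> x * f x)) \<le> (C * B) * N f" if "f \<in> H" for f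
    using order_trans[OF C(2)[OF L[OF that]] mult_left_mono[OF Lp_mult_continuous(2)[OF \<phi> B(2) Hp_Lp[OF that] p_pos(1)]]] C(1)
    by (simp add: mult.assoc)
  ultimately show ?thesis
    unfolding bounded_operator_def toeplitz_eq using P_Hp L by blast
qed

text \<open>The lower bound makes A injective up to null functions. Arbitrarily chosen preimages are
  therefore additive and homogeneous almost everywhere, and the same bound is the norm bound of the
  inverse.\<close>

lemma invertibleI:
  assumes A: "bounded_operator m p H H A"
    and surj: "\<forall>h\<in>H. \<exists>f\<in>H. AE x in m. A f x = h x"
    and below: "\<forall>f\<in>H. N f \<le> K * N (A f)"
  shows "invertible_operator m p H A"
proof -
  have AH: "\<And>f. f \<in> H \<Longrightarrow> A f \<in> H"
    and A_add: "\<And>f g. f \<in> H \<Longrightarrow> g \<in> H \<Longrightarrow> AE x in m. A (\<lambda>y. f y + g y) x = A f x + A g x"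
    and A_cmult: "\<And>c f. f \<in> H \<Longrightarrow> AE x in m. A (\<lambda>y. c * f y) x = c * A f x"
    using A by (auto simp: bounded_operator_def)
  have inj: "AE x in m. f x = g x"
    if fg: "f \<in> H" "g \<in> H" "AE x in m. A f x = A g x" for f g
  proof -
    have d: "(\<lambda>x. f x - g x) \<in> H" by (rule Hp_diff[OF fg(1,2)])
    have "AE x in m. A (\<lambda>y. (f y - g y) + g y) x = A (\<lambda>x. f x - g x) x + A g x"
      by (rule A_add[OF d fg(2)])
    then have "AE x in m. A (\<lambda>x. f x - g x) x = 0"
      using fg(3) by eventually_elim simp
    then have "N (A (\<lambda>x. f x - g x)) = 0"
      using Lp_norm_eq_0_iff[OF Hp_Lp[OF AH[OF d]] p_pos(1)] by simp
    then have "N (\<lambda>x. f x - g x) = 0" using below d by (metis Lp_norm_nonneg mult_zero_right order_antisym)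
    then show ?thesis using Lp_norm_eq_0_iff[OF Hp_Lp[OF d] p_pos(1)] by simp
  qed
  obtain S where S: "\<And>h. h \<in> H \<Longrightarrow> S h \<in> H" "\<And>h. h \<in> H \<Longrightarrow> AE x in m. A (S h) x = h x"
    using surj by metis
  have "AE x in m. S (\<lambda>y. f y + g y) x = S f x + S g x" if fg: "f \<in> H" "g \<in> H" for f g
  proof (rule inj)
    show "AE x in m. A (S (\<lambda>y. f y + g y)) x = A (\<lambda>x. S f x + S g x) x"
      using S(2)[OF Hp_add[OF fg]] A_add[OF S(1)[OF fg(1)] S(1)[OF fg(2)]] S(2)[OF fg(1)] S(2)[OF fg(2)]
      by eventually_elim simp
  qed (use fg S(1) in \<open>auto intro: Hp_add\<close>)
  moreover have "AE x in m. S (\<lambda>y. c * f y) x = c * S f x" if f: "f \<in> H" for c f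
  proof (rule inj)
    show "AE x in m. A (S (\<lambda>y. c * f y)) x = A (\<lambda>x. c * S f x) x"
      using S(2)[OF Hp_cmult[OF f, of c]] A_cmult[OF S(1)[OF f], of c] S(2)[OF f] by eventually_elim simp
  qed (use f S(1) in \<open>auto intro: Hp_cmult\<close>)
  moreover have "N (S f) \<le> K * N f" if f: "f \<in> H" for f
    using below S(1)[OF f] Lp_norm_AE_eq[OF S(2)[OF f] Hp_Lp[OF AH[OF S(1)[OF f]]] Hp_Lp[OF f]] by metis
  ultimately have "bounded_operator m p H H S"
    unfolding bounded_operator_def using S(1) by blast
  moreover have "AE x in m. S (A f) x = f x" if "f \<in> H" for f
    by (rule inj) (use that S AH in auto)
  ultimately show ?thesis
    unfolding invertible_operator_def using A S(2) by blast
qed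

lemma invertible_toeplitz_exp:
  assumes g: "continuous_on UNIV g"
  shows "invertible_operator m p H (toeplitz m T p (\<lambda>x. exp (g x)))"
  using toeplitz_exp[OF g] invertibleI[OF bounded_operator_toeplitz[OF continuous_on_exp[OF g]]] by blast

end

section \<open>Continuous logarithms on a connected group\<close>

locale connected_haar = compact_haar m for m :: "'g::{topological_ab_group_add, t2_space} measure" +
  assumes connected_UNIV: "connected (UNIV :: 'g set)"
begin

text \<open>Cosets of an open subgroup are open, so it is closed as well, and G is
  connected.\<close>

lemma open_subgroup_UNIV:
  assumes V: "open V" "0 \<in> V" "V \<subseteq> S" and add: "\<And>a b. a \<in> S \<Longrightarrow> b \<in> S \<Longrightarrow> a + b \<in> S"
    and uminus: "\<And>a. a \<in> S \<Longrightarrow> - a \<in> S"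
  shows "S = (UNIV :: 'g set)"
proof -
  have "open S"
    unfolding open_subopen[of S]
  proof
    fix a assume a: "a \<in> S"
    have "{x. x - a \<in> V} \<subseteq> S" using add[OF _ a] V(3) by force
    then show "\<exists>W. open W \<and> a \<in> W \<and> W \<subseteq> S"
      using open_translate[OF V(1), of a] V(2) by (intro exI[of _ "{x. x - a \<in> V}"]) auto
  qed
  moreover have "open (- S)"
    unfolding open_subopen[of "- S"]
  proof
    fix a assume a: "a \<in> - S"
    have "{x. x - a \<in> V} \<subseteq> - S"
    proof
      fix x assume "x \<in> {x. x - a \<in> V}"
      then have "- (x - a) \<in> S" using V(3) uminus by blast
      then have "x \<in> S \<Longrightarrow> a \<in> S" using add[of x "- (x - a)"] by simp
      then show "x \<in> - S" using a by blast
    qed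
    then show "\<exists>W. open W \<and> a \<in> W \<and> W \<subseteq> - S"
      using open_translate[OF V(1), of a] V(2) by (intro exI[of _ "{x. x - a \<in> V}"]) auto
  qed
  moreover have "S \<noteq> {}" using V by blast
  ultimately show ?thesis
    using connectedD[OF connected_UNIV, of S "- S"] by auto
qed

text \<open>The difference of the logarithms has a constant exponential, so its values lie 2 pi
  apart or coincide; on a connected group it is constant, and the means fix the constant as
  0.\<close>

lemma log_unique:
  assumes h: "continuous_on UNIV h" "continuous_on UNIV k" and mean: "(LINT x|m. h x) = 0" "(LINT x|m. k x) = (0 :: complex)"
    and eq: "\<And>x. a * exp (h x) = b * exp (k x)" and ab: "a \<noteq> 0"
  shows "h = k" "a = b"
proof -
  have b: "b \<noteq> 0" using eq[of 0] ab by auto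
  define d where "d x = h x - k x" for x
  have cd: "continuous_on UNIV d" unfolding d_def by (intro continuous_intros h)
  have ed: "exp (d x) = b / a" for x
    using eq[of x] ab by (simp add: d_def exp_diff field_simps)
  have "d constant_on UNIV"
  proof (rule continuous_discrete_range_constant[OF connected_UNIV cd])
    fix x :: 'g
    have "1 \<le> cmod (d y - d x)" if "d y \<noteq> d x" for y
    proof -
      have "exp (d y) = exp (d x)" by (simp add: ed)
      then obtain n :: int where n: "d y = d x + (of_int (2 * n) * pi) * \<i>"
        by (auto simp: exp_eq)
      then have "n \<noteq> 0" using that by auto
      have "cmod (d y - d x) = 2 * pi * \<bar>real_of_int n\<bar>" by (simp add: n norm_mult abs_mult)
      moreover have "1 \<le> \<bar>real_of_int n\<bar>" using \<open>n \<noteq> 0\<close> by linarith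
      then have "2 * pi * 1 \<le> 2 * pi * \<bar>real_of_int n\<bar>" by (intro mult_left_mono) auto
      ultimately show ?thesis using pi_gt3 by linarith
    qed
    then show "\<exists>e>0. \<forall>y. y \<in> UNIV \<and> d y \<noteq> d x \<longrightarrow> e \<le> cmod (d y - d x)"
      by (intro exI[of _ 1]) auto
  qed
  then obtain c where c: "\<And>x. d x = c" by (auto simp: constant_on_def)
  have "(LINT x|m. d x) = 0"
    unfolding d_def using mean h by (simp add: continuous_integrable)
  then have "c = 0" by (simp add: c)
  then show "h = k" using c by (auto simp: d_def fun_eq_iff)
  then show "a = b" using eq[of 0] by simp
qed

text \<open>Each quotient \<open>\<phi>(x + y) / \<phi>(x)\<close> has a continuous logarithm, since this holds for small \<open>y\<close> and the
  set of such \<open>y\<close> is a subgroup. Split off its mean: the exponential \<open>\<gamma>(y)\<close> of the mean is a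
  character, and the normalized logarithm \<open>h y\<close> is an additive cocycle, hence \<open>h x 0\<close> is a
  logarithm of \<open>\<phi>(x) / (\<phi>(0) \<gamma>(x))\<close>.\<close>

theorem nonvanishing_eq_char_times_exp:
  assumes \<phi>: "continuous_on UNIV \<phi>" "\<And>x. \<phi> x \<noteq> 0"
  obtains \<zeta> g where "\<zeta> \<in> chars" "continuous_on UNIV g" "\<And>x. \<phi> x = \<zeta> x * exp (g x)"
proof -
  define Q where "Q y \<gamma> h \<longleftrightarrow> \<gamma> \<noteq> 0 \<and> continuous_on UNIV h \<and> (LINT x|m. h x) = 0 \<and>
    (\<forall>x. \<phi> (x + y) = \<phi> x * (\<gamma> * exp (h x)))" for y :: 'g and \<gamma> :: complex and h :: "'g \<Rightarrow> complex"
  have Q_add: "Q (a + b) (\<gamma> * \<delta>) (\<lambda>x. h (x + b) + k x)" if "Q a \<gamma> h" "Q b \<delta> k" for a b \<gamma> \<delta> h k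
  proof -
    have c: "continuous_on UNIV h" "continuous_on UNIV k" using that by (auto simp: Q_def)
    have i: "integrable m (\<lambda>x. h (x + b))" "integrable m k"
      by (intro continuous_integrable continuous_shift[OF c(1)] c)+
    have "\<phi> (x + (a + b)) = \<phi> x * (\<gamma> * \<delta> * exp (h (x + b) + k x))" for x
    proof -
      have "\<phi> ((x + b) + a) = \<phi> (x + b) * (\<gamma> * exp (h (x + b)))" using that by (simp add: Q_def)
      also have "\<phi> (x + b) = \<phi> x * (\<delta> * exp (k x))" using that by (simp add: Q_def)
      finally show ?thesis by (simp add: exp_add algebra_simps)
    qed
    moreover have "(LINT x|m. h (x + b) + k x) = 0"
      using i that integral_translation[OF continuous_measurable[OF c(1)], of b] by (simp add: Q_def)
    moreover have "continuous_on UNIV (\<lambda>x. h (x + b) + k x)"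
      by (intro continuous_intros continuous_shift[OF c(1)] c)
    ultimately show ?thesis using that by (simp add: Q_def)
  qed
  have Q_uminus: "Q (- a) (1 / \<gamma>) (\<lambda>x. - h (x - a))" if "Q a \<gamma> h" for a \<gamma> h
  proof -
    have c: "continuous_on UNIV h" using that by (auto simp: Q_def)
    have "\<phi> (x + - a) = \<phi> x * (1 / \<gamma> * exp (- h (x - a)))" for x
    proof -
      have "\<phi> ((x - a) + a) = \<phi> (x - a) * (\<gamma> * exp (h (x - a)))" using that unfolding Q_def by blast
      then show ?thesis using that by (simp add: Q_def exp_minus field_simps)
    qed
    moreover have "(LINT x|m. - h (x - a)) = 0"
      using that integral_translation[OF continuous_measurable[OF c], of "- a"] by (simp add: Q_def)
    moreover have "continuous_on UNIV (\<lambda>x. - h (x - a))"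
      by (intro continuous_intros continuous_shift[OF c])
    ultimately show ?thesis using that by (simp add: Q_def)
  qed
  have Q_unique: "\<gamma> = \<delta> \<and> h = k" if "Q a \<gamma> h" "Q a \<delta> k" for a \<gamma> \<delta> h k
  proof -
    have "\<gamma> * exp (h x) = \<delta> * exp (k x)" for x
      using that \<phi>(2)[of x] unfolding Q_def by (metis mult_left_cancel)
    then show ?thesis using log_unique[of h k \<gamma> \<delta>] that by (auto simp: Q_def)
  qed
  \<comment> \<open>For y near 0 the quotient is uniformly close to 1 and the principal logarithm
    applies. The sizes of \<gamma> - 1 and h are recorded because they later give continuity in
    y.\<close>
  have small: "\<exists>V. open V \<and> 0 \<in> V \<and> (\<forall>y\<in>V. \<exists>\<gamma> h. Q y \<gamma> h \<and> cmod (\<gamma> - 1) < e \<and> (\<forall>x. cmod (h x) < e))"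
    if e: "0 < e" for e
  proof -
    obtain \<delta> where \<delta>: "0 < \<delta>" "\<And>w :: complex. cmod w < \<delta> \<Longrightarrow> cmod (exp w - 1) < e"
    proof -
      have "isCont exp (0::complex)" by simp
      then show ?thesis
        using that e LIM_D[of exp "exp (0::complex)" 0 e] unfolding isCont_def by (auto, metis diff_self exp_zero norm_zero)
    qed
    define e1 where "e1 = min (e / 2) \<delta>"
    have e1: "0 < e1" "e1 \<le> \<delta>" "2 * e1 \<le> e" using e \<delta>(1) by (auto simp: e1_def)
    obtain \<eta> where \<eta>: "0 < \<eta>" "\<eta> \<le> 1" "\<And>z. cmod (z - 1) < \<eta> \<Longrightarrow> cmod (Ln z) < e1 / 2"
    proof -
      have "isCont Ln (1::complex)" by (intro continuous_at_Ln) simp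
      then obtain r where r: "0 < r" "\<And>z. z \<noteq> 1 \<Longrightarrow> cmod (z - 1) < r \<Longrightarrow> cmod (Ln z - Ln 1) < e1 / 2"
        using e1(1) LIM_D[of Ln "Ln 1" 1 "e1 / 2"] unfolding isCont_def by auto
      have "cmod (Ln z) < e1 / 2" if "cmod (z - 1) < min r 1" for z
        using r(2)[of z] that e1(1) by (cases "z = 1") auto
      then show ?thesis using r(1) by (intro that[of "min r 1"]) auto
    qed
    have c\<phi>: "continuous_on UNIV (\<lambda>x. cmod (\<phi> x))" by (intro continuous_on_norm \<phi>)
    have \<phi>_pos: "0 < cmod (\<phi> x)" for x using \<phi>(2)[of x] by simp
    obtain d where d: "0 < d" "\<And>x. d \<le> cmod (\<phi> x)"
      using continuous_positive_lower_bound[OF c\<phi> \<phi>_pos] by blast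
    obtain V where V: "open V" "0 \<in> V" "\<And>x v. v \<in> V \<Longrightarrow> dist (\<phi> (x + v)) (\<phi> x) < \<eta> * d"
      using uniformly_continuous[OF \<phi>(1) mult_pos_pos[OF \<eta>(1) d(1)]] by blast
    have "\<exists>\<gamma> h. Q y \<gamma> h \<and> cmod (\<gamma> - 1) < e \<and> (\<forall>x. cmod (h x) < e)" if y: "y \<in> V" for y
    proof -
      define z where "z x = \<phi> (x + y) / \<phi> x" for x
      have z1: "cmod (z x - 1) < \<eta>" for x
      proof -
        have "z x - 1 = (\<phi> (x + y) - \<phi> x) / \<phi> x" using \<phi>(2)[of x] by (simp add: z_def field_simps)
        then have "cmod (z x - 1) = cmod (\<phi> (x + y) - \<phi> x) / cmod (\<phi> x)" by (simp add: norm_divide)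
        also have "\<dots> < \<eta>"
        proof -
          have "cmod (\<phi> (x + y) - \<phi> x) < \<eta> * d" using V(3)[OF y, of x] by (simp add: dist_norm)
          also have "\<dots> \<le> \<eta> * cmod (\<phi> x)" using d(2)[of x] \<eta>(1) by (intro mult_left_mono) auto
          finally show ?thesis using \<phi>_pos[of x] by (simp add: divide_less_eq)
        qed
        finally show ?thesis .
      qed
      have cz: "continuous_on UNIV z"
        unfolding z_def by (intro continuous_intros continuous_shift[OF \<phi>(1)] \<phi>) (use \<phi>(2) in auto)
      have zpos: "0 < Re (z x)" for x
        using z1[of x] \<eta>(2) abs_Re_le_cmod[of "z x - 1"] by (simp add: abs_le_iff)
      define l where "l x = Ln (z x)" for x
      have cl: "continuous_on UNIV l"
        unfolding l_def using zpos
        by (intro continuous_on_Ln' cz) (auto simp: complex_nonpos_Reals_iff not_le dest: less_imp_le)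
      have el: "exp (l x) = z x" for x unfolding l_def using zpos[of x] by (intro exp_Ln) auto
      have l_le: "cmod (l x) < e1 / 2" for x unfolding l_def by (rule \<eta>(3)[OF z1])
      define c where "c = (LINT x|m. l x)"
      have c_le: "cmod c \<le> e1 / 2"
        unfolding c_def using l_le by (intro integral_norm_le_const cl) (auto intro: less_imp_le)
      have "Q y (exp c) (\<lambda>x. l x - c)"
        unfolding Q_def
      proof (intro conjI allI)
        show "(LINT x|m. l x - c) = 0"
          using continuous_integrable[OF cl] by (simp add: c_def)
        show "continuous_on UNIV (\<lambda>x. l x - c)" by (intro continuous_intros cl)
        show "\<phi> (x + y) = \<phi> x * (exp c * exp (l x - c))" for x
          using \<phi>(2)[of x] el[of x] by (simp add: z_def flip: exp_add)
      qed simp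
      moreover have "cmod (exp c - 1) < e" using c_le e1 by (intro \<delta>(2)) linarith
      moreover have "cmod (l x - c) < e" for x
        using norm_triangle_ineq4[of "l x" c] l_le[of x] c_le e1 by linarith
      ultimately show ?thesis by blast
    qed
    then show ?thesis using V by blast
  qed
  have "{y. \<exists>\<gamma> h. Q y \<gamma> h} = UNIV"
  proof -
    obtain V where V: "open V" "0 \<in> V" "\<forall>y\<in>V. \<exists>\<gamma> h. Q y \<gamma> h \<and> cmod (\<gamma> - 1) < 1 \<and> (\<forall>x. cmod (h x) < 1)"
      using small[of 1] by auto
    show ?thesis
      by (rule open_subgroup_UNIV[OF V(1,2)]) (use V(3) Q_add Q_uminus in blast)+
  qed
  then have "\<forall>y. \<exists>\<gamma> h. Q y \<gamma> h" by blast
  then obtain \<gamma> h where Q: "\<And>y. Q y (\<gamma> y) (h y)" by metis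
  have \<gamma>_add: "\<gamma> (a + b) = \<gamma> a * \<gamma> b" and h_add: "h (a + b) x = h a (x + b) + h b x" for a b x
    using Q_unique[OF Q Q_add[OF Q Q], of a b] by auto
  have Q_def': "\<gamma> y \<noteq> 0" "continuous_on UNIV (h y)" "(LINT x|m. h y x) = 0"
    "\<phi> (x + y) = \<phi> x * (\<gamma> y * exp (h y x))" for x y
    using Q[of y] by (auto simp: Q_def)
  have near: "\<exists>V. open V \<and> 0 \<in> V \<and> (\<forall>y\<in>V. cmod (\<gamma> y - 1) < e \<and> (\<forall>x. cmod (h y x) < e))"
    if e: "0 < e" for e
  proof -
    obtain V where V: "open V" "0 \<in> V" "\<forall>y\<in>V. \<exists>\<gamma> h. Q y \<gamma> h \<and> cmod (\<gamma> - 1) < e \<and> (\<forall>x. cmod (h x) < e)"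
      using small[OF e] by auto
    have "cmod (\<gamma> y - 1) < e \<and> (\<forall>x. cmod (h y x) < e)" if "y \<in> V" for y
      using V(3) that Q_unique[OF Q] by metis
    then show ?thesis using V by blast
  qed
  \<comment> \<open>The integral of ln |\<phi>| is translation invariant, so ln |\<phi> (x + y) /
    \<phi> x| has mean 0; since h y has mean 0 as well, this mean is ln |\<gamma> y|.\<close>
  have \<gamma>_norm: "cmod (\<gamma> y) = 1" for y
  proof -
    have cln: "continuous_on UNIV (\<lambda>x. ln (cmod (\<phi> x)))" by (intro continuous_intros \<phi>) (use \<phi>(2) in auto)
    have "ln (cmod (\<phi> (x + y))) = ln (cmod (\<phi> x)) + (ln (cmod (\<gamma> y)) + Re (h y x))" for x
      using Q_def'(1)[of y] Q_def'(4)[of x y] \<phi>(2)[of x] by (simp add: norm_mult ln_mult)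
    then have "(LINT x|m. ln (cmod (\<phi> (x + y)))) = (LINT x|m. ln (cmod (\<phi> x)) + (ln (cmod (\<gamma> y)) + Re (h y x)))"
      by simp
    also have "\<dots> = (LINT x|m. ln (cmod (\<phi> x))) + (ln (cmod (\<gamma> y)) + Re (LINT x|m. h y x))"
      using continuous_integrable[OF cln] continuous_integrable[OF Q_def'(2)[of y]] by simp
    finally have "ln (cmod (\<gamma> y)) = 0"
      using integral_translation[OF continuous_measurable[OF cln], of y] Q_def'(3)[of y] by simp
    then show ?thesis using Q_def'(1)[of y] by simp
  qed
  have c\<gamma>: "continuous_on UNIV \<gamma>"
  proof -
    have "\<exists>V. open V \<and> x \<in> V \<and> (\<forall>y\<in>V. dist (\<gamma> y) (\<gamma> x) < e)" if e: "0 < e" for e x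
    proof -
      obtain V where V: "open V" "0 \<in> V" "\<forall>y\<in>V. cmod (\<gamma> y - 1) < e \<and> (\<forall>x. cmod (h y x) < e)"
        using near[OF e] by blast
      have "dist (\<gamma> y) (\<gamma> x) < e" if "y - x \<in> V" for y
      proof -
        have "\<gamma> y - \<gamma> x = (\<gamma> (y - x) - 1) * \<gamma> x" using \<gamma>_add[of "y - x" x] by (simp add: algebra_simps)
        then show ?thesis using V(3) that by (simp add: dist_norm norm_mult \<gamma>_norm)
      qed
      then show ?thesis using open_translate[OF V(1), of x] V(2) by (intro exI[of _ "{y. y - x \<in> V}"]) auto
    qed
    then show ?thesis unfolding continuous_on_def tendsto_iff eventually_at_topological by (metis UNIV_I)
  qed
  have ch: "continuous_on UNIV (\<lambda>y. h y 0)"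
  proof -
    have "\<exists>V. open V \<and> x \<in> V \<and> (\<forall>y\<in>V. dist (h y 0) (h x 0) < e)" if e: "0 < e" for e x
    proof -
      obtain V where V: "open V" "0 \<in> V" "\<forall>y\<in>V. cmod (\<gamma> y - 1) < e \<and> (\<forall>x. cmod (h y x) < e)"
        using near[OF e] by blast
      have "dist (h y 0) (h x 0) < e" if "y - x \<in> V" for y
      proof -
        have "h y 0 - h x 0 = h (y - x) x" using h_add[of "y - x" x 0] by simp
        then show ?thesis using V(3) that by (simp add: dist_norm)
      qed
      then show ?thesis using open_translate[OF V(1), of x] V(2) by (intro exI[of _ "{y. y - x \<in> V}"]) auto
    qed
    then show ?thesis unfolding continuous_on_def tendsto_iff eventually_at_topological by (metis UNIV_I)
  qed
  have "\<gamma> \<in> chars" using c\<gamma> \<gamma>_norm \<gamma>_add by (simp add: char_iff)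
  moreover have "continuous_on UNIV (\<lambda>y. h y 0 + Ln (\<phi> 0))" by (intro continuous_intros ch)
  moreover have "\<phi> x = \<gamma> x * exp (h x 0 + Ln (\<phi> 0))" for x
    using Q_def'(4)[of 0 x] \<phi>(2)[of 0] by (simp add: exp_add mult_ac)
  ultimately show ?thesis by (rule that)
qed

end

section \<open>Fredholm Toeplitz operators have nonvanishing symbols\<close>

text \<open>Gaussian elimination for the span of the vectors v b in the functions on I, where the v
  b may be dependent: finitely many coordinates E determine the span, and the combinations d \<xi>
  form the basis dual to them. E gains a coordinate only if a combination vanishes on E but not on
  I.\<close>

lemma finite_dual_family:
  fixes v :: "'b \<Rightarrow> 'i \<Rightarrow> complex"
  assumes "finite B"
  shows "\<exists>E d. finite E \<and> E \<subseteq> I \<and>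
    (\<forall>\<xi>\<in>E. \<forall>\<eta>\<in>E. (\<Sum>b\<in>B. d \<xi> b * v b \<eta>) = (if \<xi> = \<eta> then 1 else 0)) \<and>
    (\<forall>c. (\<forall>\<eta>\<in>E. (\<Sum>b\<in>B. c b * v b \<eta>) = 0) \<longrightarrow> (\<forall>\<eta>\<in>I. (\<Sum>b\<in>B. c b * v b \<eta>) = 0))"
  using assms
proof (induction B)
  case empty
  show ?case by (intro exI[of _ "{}"]) simp
next
  case (insert a B)
  from insert(3) obtain E d where Ed: "finite E" "E \<subseteq> I"
    "\<forall>\<xi>\<in>E. \<forall>\<eta>\<in>E. (\<Sum>b\<in>B. d \<xi> b * v b \<eta>) = (if \<xi> = \<eta> then 1 else 0)"
    "\<forall>c. (\<forall>\<eta>\<in>E. (\<Sum>b\<in>B. c b * v b \<eta>) = 0) \<longrightarrow> (\<forall>\<eta>\<in>I. (\<Sum>b\<in>B. c b * v b \<eta>) = 0)"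
    by (elim exE conjE) (rule that)
  then have E: "finite E" "E \<subseteq> I"
    "\<And>\<xi> \<eta>. \<xi> \<in> E \<Longrightarrow> \<eta> \<in> E \<Longrightarrow> (\<Sum>b\<in>B. d \<xi> b * v b \<eta>) = (if \<xi> = \<eta> then 1 else 0)"
    "\<And>c \<eta>. (\<forall>\<eta>\<in>E. (\<Sum>b\<in>B. c b * v b \<eta>) = 0) \<Longrightarrow> \<eta> \<in> I \<Longrightarrow> (\<Sum>b\<in>B. c b * v b \<eta>) = 0"
    by (simp_all only:)
  define S where "S c \<eta> = (\<Sum>b\<in>insert a B. c b * v b \<eta>)" for c \<eta>
  have S_0: "S c \<eta> = (\<Sum>b\<in>B. c b * v b \<eta>)" if "c a = 0" for c \<eta>
    using insert(1,2) that by (simp add: S_def)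
  define d0 where "d0 \<xi> b = (if b = a then 0 else d \<xi> b)" for \<xi> b
  have S_d0: "S (d0 \<xi>) \<eta> = (\<Sum>b\<in>B. d \<xi> b * v b \<eta>)" for \<xi> \<eta>
    using insert(2) by (subst S_0) (auto simp: d0_def intro!: sum.cong)
  have S_lin: "S (\<lambda>b. c b - t * e b) \<eta> = S c \<eta> - t * S e \<eta>" for c t e \<eta>
    unfolding S_def by (simp add: left_diff_distrib sum_subtractf sum_distrib_left mult.assoc)
  show ?case
  proof (cases "\<exists>c. \<exists>\<eta>0\<in>I. (\<forall>\<eta>\<in>E. S c \<eta> = 0) \<and> S c \<eta>0 \<noteq> 0")
    case False
    show ?thesis
      unfolding S_def[symmetric]
      by (intro exI[of _ E] exI[of _ d0] conjI E ballI) (use False in \<open>auto simp: S_d0 E(3)\<close>)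
  next
    case True
    then obtain c0 \<eta>0 where c0: "\<eta>0 \<in> I" "\<And>\<eta>. \<eta> \<in> E \<Longrightarrow> S c0 \<eta> = 0" "S c0 \<eta>0 \<noteq> 0" by blast
    define e0 where "e0 b = c0 b / S c0 \<eta>0" for b
    have S_e0: "S e0 \<eta> = S c0 \<eta> / S c0 \<eta>0" for \<eta>
      unfolding S_def[of e0] S_def[of c0 \<eta>] e0_def by (simp add: sum_divide_distrib)
    have e0: "S e0 \<eta>0 = 1" "\<And>\<eta>. \<eta> \<in> E \<Longrightarrow> S e0 \<eta> = 0" using c0 by (auto simp: S_e0)
    have e0a: "e0 a \<noteq> 0"
    proof
      assume "e0 a = 0"
      then have "S e0 \<eta>0 = 0" using e0(2) E(4)[of e0 \<eta>0] c0(1) by (simp add: S_0)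
      then show False using e0(1) by simp
    qed
    have \<eta>0: "\<eta>0 \<notin> E" using e0 by auto
    \<comment> \<open>The multiple of e0 makes the old dual vectors vanish at the new coordinate
      without changing them on E.\<close>
    define d' where "d' \<xi> b = (if \<xi> = \<eta>0 then e0 b else d0 \<xi> b - S (d0 \<xi>) \<eta>0 * e0 b)" for \<xi> b
    have d': "S (d' \<xi>) \<eta> = (if \<xi> = \<eta>0 then S e0 \<eta> else S (d0 \<xi>) \<eta> - S (d0 \<xi>) \<eta>0 * S e0 \<eta>)" for \<xi> \<eta>
      using S_lin[of "d0 \<xi>" "S (d0 \<xi>) \<eta>0" e0 \<eta>] by (auto simp: d'_def[abs_def])
    have "S (d' \<xi>) \<eta> = (if \<xi> = \<eta> then 1 else 0)" if "\<xi> \<in> insert \<eta>0 E" "\<eta> \<in> insert \<eta>0 E" for \<xi> \<eta>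
      using that \<eta>0 e0 E(3) by (auto simp: d' S_d0)
    moreover have "S c \<eta> = 0" if c: "\<forall>\<eta>\<in>insert \<eta>0 E. S c \<eta> = 0" and \<eta>: "\<eta> \<in> I" for c \<eta>
    proof -
      \<comment> \<open>Subtracting t e0 removes the vector of a, so the induction hypothesis
        applies to the remainder.\<close>
      define t where "t = c a / e0 a"
      have ca: "c a - t * e0 a = 0" using e0a by (simp add: t_def)
      have eq: "S c \<zeta> = t * S e0 \<zeta>" if "\<zeta> \<in> I" for \<zeta>
      proof -
        have "S (\<lambda>b. c b - t * e0 b) \<zeta> = 0"
          unfolding S_0[of "\<lambda>b. c b - t * e0 b", OF ca]
        proof (rule E(4)[OF _ that], rule ballI)
          fix \<eta> assume "\<eta> \<in> E"
          then have "S (\<lambda>b. c b - t * e0 b) \<eta> = 0" using c e0(2) by (simp add: S_lin)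
          then show "(\<Sum>b\<in>B. (c b - t * e0 b) * v b \<eta>) = 0"
            unfolding S_0[of "\<lambda>b. c b - t * e0 b", OF ca] .
        qed
        then show ?thesis by (simp add: S_lin)
      qed
      have "t = 0" using eq[OF c0(1)] c e0(1) by simp
      then show ?thesis using eq[OF \<eta>] by simp
    qed
    ultimately show ?thesis
      unfolding S_def[symmetric] using E(1,2) c0(1)
      by (intro exI[of _ "insert \<eta>0 E"] exI[of _ d']) blast
  qed
qed

text \<open>Finitely many coordinates E determine the span. The unit vector at a point of I outside
  E vanishes on E, so it would have to vanish on I.\<close>

lemma no_finite_span_of_deltas:
  fixes v :: "'b \<Rightarrow> 'i \<Rightarrow> complex"
  assumes B: "finite B" and I: "infinite I"
    and delta: "\<And>\<xi>. \<xi> \<in> I \<Longrightarrow> \<exists>c. \<forall>\<zeta>\<in>I. (\<Sum>b\<in>B. c b * v b \<zeta>) = (if \<xi> = \<zeta> then 1 else 0)"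
  shows False
proof -
  obtain E where E: "finite E" "E \<subseteq> I"
    "\<And>c. (\<forall>\<eta>\<in>E. (\<Sum>b\<in>B. c b * v b \<eta>) = 0) \<Longrightarrow> (\<forall>\<eta>\<in>I. (\<Sum>b\<in>B. c b * v b \<eta>) = 0)"
    using finite_dual_family[OF B, of I v] by blast
  obtain \<xi> where \<xi>: "\<xi> \<in> I" "\<xi> \<notin> E" using I E(1) by (meson finite_subset subsetI)
  obtain c where c: "\<And>\<zeta>. \<zeta> \<in> I \<Longrightarrow> (\<Sum>b\<in>B. c b * v b \<zeta>) = (if \<xi> = \<zeta> then 1 else 0)"
    using delta[OF \<xi>(1)] by blast
  have "\<forall>\<eta>\<in>E. (\<Sum>b\<in>B. c b * v b \<eta>) = 0" using c E(2) \<xi>(2) by auto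
  then have "(\<Sum>b\<in>B. c b * v b \<xi>) = 0" using E(3) \<xi>(1) by blast
  then show False using c[OF \<xi>(1)] by simp
qed

section \<open>Bounded operators on \<open>H\<^sup>p\<close> with closed range\<close>

context Hp_space
begin

lemma Lp_norm_scale: "0 \<le> t \<Longrightarrow> N (\<lambda>x. complex_of_real t * f x) = t * N f"
  by (simp add: Lp_norm_cmult[OF p_pos(1)])

lemma Hp_sum: "(\<And>i. i \<in> I \<Longrightarrow> f i \<in> H) \<Longrightarrow> (\<lambda>x. \<Sum>i\<in>I. f i x) \<in> H"
  by (induction I rule: infinite_finite_induct) (auto intro: Hp_zero Hp_add)

lemma fc_sum:
  assumes "\<And>i. i \<in> I \<Longrightarrow> f i \<in> Lp m p" "\<eta> \<in> chars"
  shows "fc (\<lambda>x. \<Sum>i\<in>I. f i x) \<eta> = (\<Sum>i\<in>I. fc (f i) \<eta>)"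
  unfolding fourier_coeff_def sum_distrib_right
  using assms by (intro Bochner_Integration.integral_sum fourier_integrable[OF _ p])

lemma fc_lincomb:
  assumes "\<And>b. b \<in> B \<Longrightarrow> f b \<in> Lp m p" "\<eta> \<in> chars"
  shows "fc (\<lambda>x. \<Sum>b\<in>B. c b * f b x) \<eta> = (\<Sum>b\<in>B. c b * fc (f b) \<eta>)"
  by (subst fc_sum) (use assms in \<open>auto intro: Lp_cmult simp: fourier_coeff_cmult\<close>)

lemma bounded_operatorD:
  assumes "bounded_operator m p H H A"
  shows "f \<in> H \<Longrightarrow> A f \<in> H"
    and "f \<in> H \<Longrightarrow> g \<in> H \<Longrightarrow> AE x in m. A (\<lambda>y. f y + g y) x = A f x + A g x"
    and "f \<in> H \<Longrightarrow> AE x in m. A (\<lambda>y. c * f y) x = c * A f x"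
  using assms by (auto simp: bounded_operator_def)

lemma bounded_operator_bound:
  assumes "bounded_operator m p H H A"
  obtains C where "0 < C" "\<And>f. f \<in> H \<Longrightarrow> N (A f) \<le> C * N f"
proof -
  obtain C where "\<forall>f\<in>H. N (A f) \<le> C * N f" using assms by (auto simp: bounded_operator_def)
  then have "N (A f) \<le> max C 1 * N f" if "f \<in> H" for f
    using that by (intro order_trans[OF _ mult_right_mono[of C "max C 1"]]) auto
  then show ?thesis by (intro that[of "max C 1"]) auto
qed

lemma operator_diff:
  assumes A: "bounded_operator m p H H A" and f: "f \<in> H" "g \<in> H"
  shows "AE x in m. A (\<lambda>y. f y - g y) x = A f x - A g x"
  using bounded_operatorD(2)[OF A Hp_diff[OF f] f(2)] by (auto elim!: eventually_mono)

text \<open>The bound sends functions of norm 0 to functions of norm 0, so operators respect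
  equality almost everywhere.\<close>

lemma operator_cong_AE:
  assumes A: "bounded_operator m p H H A" and f: "f \<in> H" "g \<in> H" and eq: "AE x in m. f x = g x"
  shows "AE x in m. A f x = A g x"
proof -
  obtain C where C: "0 < C" "\<And>f. f \<in> H \<Longrightarrow> N (A f) \<le> C * N f" by (rule bounded_operator_bound[OF A]) blast
  have d: "(\<lambda>x. f x - g x) \<in> H" by (rule Hp_diff[OF f])
  have "AE x in m. f x - g x = 0" using eq by eventually_elim simp
  then have "N (\<lambda>x. f x - g x) = 0" using Lp_norm_eq_0_iff[OF Hp_Lp[OF d] p_pos(1)] by simp
  then have "N (A (\<lambda>x. f x - g x)) = 0"
    using C(2)[OF d] Lp_norm_nonneg[of m p "A (\<lambda>x. f x - g x)"] by simp
  then have "AE x in m. A (\<lambda>x. f x - g x) x = 0"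
    using Lp_norm_eq_0_iff[OF Hp_Lp[OF bounded_operatorD(1)[OF A d]] p_pos(1)] by simp
  with operator_diff[OF A f] show ?thesis by eventually_elim simp
qed

lemma operator_zero:
  assumes A: "bounded_operator m p H H A"
  shows "AE x in m. A (\<lambda>x. 0) x = 0"
  using bounded_operatorD(3)[OF A Hp_zero, of 0] by simp

lemma operator_lincomb:
  assumes A: "bounded_operator m p H H A" and f: "\<And>b. b \<in> B \<Longrightarrow> f b \<in> H"
  shows "AE x in m. A (\<lambda>x. \<Sum>b\<in>B. c b * f b x) x = (\<Sum>b\<in>B. c b * A (f b) x)"
  using f
proof (induction B rule: infinite_finite_induct)
  case (insert a B)
  have s: "(\<lambda>x. \<Sum>b\<in>B. c b * f b x) \<in> H" using insert by (intro Hp_sum Hp_cmult) auto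
  have "AE x in m. A (\<lambda>x. c a * f a x + (\<Sum>b\<in>B. c b * f b x)) x
      = A (\<lambda>x. c a * f a x) x + A (\<lambda>x. \<Sum>b\<in>B. c b * f b x) x"
    using insert by (intro bounded_operatorD(2)[OF A] Hp_cmult s) auto
  moreover have "AE x in m. A (\<lambda>x. c a * f a x) x = c a * A (f a) x"
    using insert by (intro bounded_operatorD(3)[OF A]) auto
  moreover have "AE x in m. A (\<lambda>x. \<Sum>b\<in>B. c b * f b x) x = (\<Sum>b\<in>B. c b * A (f b) x)"
    using insert by auto
  ultimately show ?case using insert(1,2) by (auto elim!: eventually_elim2 eventually_rev_mp)
qed (use operator_zero[OF A] in auto)

lemma op_range_iff: "w \<in> op_range m H A \<longleftrightarrow> w \<in> H \<and> (\<exists>f\<in>H. AE x in m. w x = A f x)"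
  by (simp add: op_range_def)

text \<open>The open mapping theorem, by Baire's argument.\<close>

lemma bounded_preimages:
  assumes A: "bounded_operator m p H H A" and closed: "closed_subspace m p H (op_range m H A)"
  obtains K where "0 < K" "\<And>w. w \<in> op_range m H A \<Longrightarrow> \<exists>f\<in>H. (AE x in m. w x = A f x) \<and> N f \<le> K * N w"
proof -
  define R where "R = op_range m H A"
  have RH: "w \<in> H" if "w \<in> R" for w using that by (simp add: R_def op_range_iff)
  have RL: "w \<in> Lp m p" if "w \<in> R" for w by (rule Hp_Lp[OF RH[OF that]])
  have R_image: "A f \<in> R" if "f \<in> H" for f
    using bounded_operatorD(1)[OF A that] that unfolding R_def op_range_iff by auto
  have R_add: "(\<lambda>x. w x + z x) \<in> R" and R_diff: "(\<lambda>x. w x - z x) \<in> R" if wz: "w \<in> R" "z \<in> R" for w z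
  proof -
    obtain f g where fg: "f \<in> H" "AE x in m. w x = A f x" "g \<in> H" "AE x in m. z x = A g x"
      using wz unfolding R_def op_range_iff by blast
    have "AE x in m. w x + z x = A (\<lambda>x. f x + g x) x"
      using fg(2,4) bounded_operatorD(2)[OF A fg(1,3)] by eventually_elim simp
    then show "(\<lambda>x. w x + z x) \<in> R"
      unfolding R_def op_range_iff using Hp_add[OF RH[OF wz(1)] RH[OF wz(2)]] Hp_add[OF fg(1,3)] by blast
    have "AE x in m. w x - z x = A (\<lambda>x. f x - g x) x"
      using fg(2,4) operator_diff[OF A fg(1,3)] by eventually_elim simp
    then show "(\<lambda>x. w x - z x) \<in> R"
      unfolding R_def op_range_iff using Hp_diff[OF RH[OF wz(1)] RH[OF wz(2)]] Hp_diff[OF fg(1,3)] by blast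
  qed
  have R_cmult: "(\<lambda>x. c * w x) \<in> R" if w: "w \<in> R" for c w
  proof -
    obtain f where f: "f \<in> H" "AE x in m. w x = A f x" using w unfolding R_def op_range_iff by blast
    have "AE x in m. c * w x = A (\<lambda>x. c * f x) x"
      using f(2) bounded_operatorD(3)[OF A f(1), of c] by eventually_elim simp
    then show ?thesis
      unfolding R_def op_range_iff using Hp_cmult[OF RH[OF w], of c] Hp_cmult[OF f(1), of c] by blast
  qed
  have R_closed: "w \<in> R" if "\<And>n. u n \<in> R" "w \<in> Lp m p" "(\<lambda>n. N (\<lambda>x. u n x - w x)) \<longlonglongrightarrow> 0" for u :: "nat \<Rightarrow> _" and w
    using closed that Hp_limit[OF RH[OF that(1)] that(2,3)] unfolding closed_subspace_def R_def by blast
  \<comment> \<open>Distance less than e from the image of the ball of radius n. By Baire's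
    argument, for some n the closure of that image contains a ball of the range.\<close>
  define near where "near n z e \<longleftrightarrow> (\<exists>f\<in>H. N f \<le> real n \<and> N (\<lambda>x. z x - A f x) < e)" for n :: nat and z e
  have "\<exists>n. \<exists>w0\<in>R. \<exists>r>0. \<forall>w\<in>R. N (\<lambda>x. w x - w0 x) < r \<longrightarrow> (\<forall>e>0. near n w e)"
  proof (rule ccontr)
    assume "\<not> ?thesis"
    then have no_ball: "\<exists>w\<in>R. N (\<lambda>x. w x - w0 x) < r \<and> (\<exists>e>0. \<not> near n w e)" if "w0 \<in> R" "0 < r" for n w0 r
      using that by blast
    \<comment> \<open>Pairs of centre and radius: the centre moves by less than half the radius and
      the radius at least halves, so the limit u stays within r n of w n. As u has a preimage in the
      ball of some radius n, w (n + 1) is within r (n + 1) of the image of that ball, against the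
      construction, which demands 2 r (n + 1).\<close>
    have "\<exists>s :: nat \<Rightarrow> ('g \<Rightarrow> complex) \<times> real. \<forall>n. (fst (s n) \<in> R \<and> 0 < snd (s n)) \<and>
        (N (\<lambda>x. fst (s (Suc n)) x - fst (s n) x) < snd (s n) / 2 \<and> snd (s (Suc n)) \<le> snd (s n) / 2 \<and>
         \<not> near n (fst (s (Suc n))) (2 * snd (s (Suc n))))"
    proof (rule dependent_nat_choice)
      show "\<exists>s :: ('g \<Rightarrow> complex) \<times> real. fst s \<in> R \<and> 0 < snd s"
        using R_image[OF Hp_zero] by (intro exI[of _ "(A (\<lambda>x. 0), 1)"]) simp
      fix s :: "('g \<Rightarrow> complex) \<times> real" and n :: nat
      assume s: "fst s \<in> R \<and> 0 < snd s"
      then obtain w e where w: "w \<in> R" "N (\<lambda>x. w x - fst s x) < snd s / 2" "0 < e" "\<not> near n w e"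
        using no_ball[of "fst s" "snd s / 2" n] by auto
      have "\<not> near n w (2 * min (snd s / 2) (e / 2))" using w(4) by (auto simp: near_def min_def)
      then show "\<exists>t. (fst t \<in> R \<and> 0 < snd t) \<and> N (\<lambda>x. fst t x - fst s x) < snd s / 2 \<and>
          snd t \<le> snd s / 2 \<and> \<not> near n (fst t) (2 * snd t)"
        using w s by (intro exI[of _ "(w, min (snd s / 2) (e / 2))"]) auto
    qed
    then obtain s where s: "\<And>n :: nat. fst (s n) \<in> R" "\<And>n. 0 < snd (s n)"
      "\<And>n. N (\<lambda>x. fst (s (Suc n)) x - fst (s n) x) < snd (s n) / 2" "\<And>n. snd (s (Suc n)) \<le> snd (s n) / 2"
      "\<And>n. \<not> near n (fst (s (Suc n))) (2 * snd (s (Suc n)))" by blast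
    define w where "w n = fst (s n)" for n
    define r where "r n = snd (s n)" for n
    have w: "w n \<in> R" "0 < r n" "N (\<lambda>x. w (Suc n) x - w n x) < r n / 2" "r (Suc n) \<le> r n / 2"
      "\<not> near n (w (Suc n)) (2 * r (Suc n))" for n
      using s by (auto simp: w_def r_def)
    have r_geo: "r (k + n) \<le> r n * (1/2) ^ k" for n k
    proof (induction k)
      case (Suc k)
      then show ?case using w(4)[of "k + n"] by simp
    qed simp
    define d where "d n x = w (Suc n) x - w n x" for n x
    have dL: "d n \<in> Lp m p" for n unfolding d_def by (intro Lp_diff RL w p_pos)
    have dN: "N (d (k + n)) \<le> r n / 2 * (1/2) ^ k" for k n
      using w(3)[of "k + n"] r_geo[of k n] by (simp add: d_def[abs_def])
    have geo: "(\<lambda>k. r n / 2 * (1/2) ^ k) sums (r n / 2 * (1 / (1 - 1/2)))" for n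
      by (intro sums_mult geometric_sums) simp
    have sm: "summable (\<lambda>k. N (d (k + n)))" for n
      by (rule summable_comparison_test'[OF sums_summable[OF geo], of 0]) (use dN in auto)
    have tail: "(\<Sum>k. N (d (k + n))) \<le> r n" for n
      using suminf_le[OF dN sm sums_summable[OF geo], of n] sums_unique[OF geo[of n]] by simp
    obtain g where g: "g \<in> Lp m p" "\<And>n. N (\<lambda>x. g x - (\<Sum>k<n. d k x)) \<le> (\<Sum>k. N (d (k + n)))"
      using Lp_series_complete[where f = d, OF p emeasure_space_m dL] sm[of 0] by auto
    define u where "u x = w 0 x + g x" for x
    have uL: "u \<in> Lp m p" unfolding u_def by (intro Lp_add RL w g p_pos)
    have tel: "(\<Sum>k<n. d k x) = w n x - w 0 x" for n x
      unfolding d_def by (rule sum_lessThan_telescope)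
    have uw: "N (\<lambda>x. w n x - u x) \<le> r n" for n
      using order_trans[OF g(2) tail, of n] Lp_norm_minus_commute[of m p "w n" u]
      by (simp add: u_def tel algebra_simps)
    have "(\<lambda>n. r 0 * (1/2) ^ n) \<longlonglongrightarrow> 0"
      by (intro tendsto_mult_right_zero LIMSEQ_realpow_zero) auto
    then have "(\<lambda>n. N (\<lambda>x. w n x - u x)) \<longlonglongrightarrow> 0"
      by (rule squeeze_zero[OF Lp_norm_nonneg, rotated]) (use uw r_geo[of _ 0] order_trans in fastforce)
    from R_closed[OF w(1) uL this] have "u \<in> R" .
    then obtain f where f: "f \<in> H" "AE x in m. u x = A f x" unfolding R_def op_range_iff by blast
    obtain n where n: "N f \<le> real n" using real_arch_simple by blast
    have "N (\<lambda>x. w (Suc n) x - A f x) = N (\<lambda>x. w (Suc n) x - u x)"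
      using f(2) by (intro Lp_norm_AE_eq Lp_diff RL[OF w(1)] uL RL[OF R_image[OF f(1)]] p_pos) (auto elim: eventually_mono)
    also have "\<dots> < 2 * r (Suc n)" using uw[of "Suc n"] w(2)[of "Suc n"] by linarith
    finally show False using w(5)[of n] f(1) n by (auto simp: near_def)
  qed
  then obtain n w0 r where ball: "w0 \<in> R" "0 < r"
    "\<And>w e. w \<in> R \<Longrightarrow> N (\<lambda>x. w x - w0 x) < r \<Longrightarrow> 0 < e \<Longrightarrow> near n w e" by blast
  \<comment> \<open>For z in the range, w0 and w0 + t z with t = r / (2 N z) lie in the ball found
    above. The difference of their approximate preimages, divided by t, has norm at most 2 n / t =
    (4 n / r) N z; the summand 1 keeps K positive.\<close>
  define K where "K = 4 * real n / r + 1"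
  have K: "0 < K" using ball(2) by (simp add: K_def add_nonneg_pos)
  have approx: "\<exists>f\<in>H. N f \<le> K * N z \<and> N (\<lambda>x. z x - A f x) < e" if z: "z \<in> R" and e: "0 < e" for z e
  proof (cases "N z = 0")
    case True
    have "N (\<lambda>x. z x - A (\<lambda>x. 0) x) = N z"
      using operator_zero[OF A] by (intro Lp_norm_AE_eq Lp_diff RL z R_image[OF Hp_zero] p_pos) (auto elim: eventually_mono)
    then show ?thesis using True e by (intro bexI[of _ "\<lambda>x. 0"] Hp_zero) simp
  next
    case False
    define t where "t = r / (2 * N z)"
    have Nz: "0 < N z" using False by (simp add: less_le)
    have t: "0 < t" "t * N z < r" using Nz ball(2) by (auto simp: t_def)
    have tz: "(\<lambda>x. of_real t * z x) \<in> R" by (rule R_cmult[OF z])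
    have "N (\<lambda>x. (w0 x + of_real t * z x) - w0 x) < r"
      using t Lp_norm_scale[of t z] by simp
    then have "near n (\<lambda>x. w0 x + of_real t * z x) (e * t / 2)"
      using e t by (intro ball R_add tz) auto
    then obtain f1 where f1: "f1 \<in> H" "N f1 \<le> real n" "N (\<lambda>x. (w0 x + of_real t * z x) - A f1 x) < e * t / 2"
      unfolding near_def by blast
    have "near n w0 (e * t / 2)" using e t ball(2) by (intro ball(3) ball(1)) auto
    then obtain f0 where f0: "f0 \<in> H" "N f0 \<le> real n" "N (\<lambda>x. w0 x - A f0 x) < e * t / 2"
      unfolding near_def by blast
    define f where "f x = of_real (1 / t) * (f1 x - f0 x)" for x
    have f10: "(\<lambda>x. f1 x - f0 x) \<in> H" by (rule Hp_diff[OF f1(1) f0(1)])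
    have fH: "f \<in> H" unfolding f_def by (rule Hp_cmult[OF f10])
    have Nf: "N f = (1 / t) * N (\<lambda>x. f1 x - f0 x)"
      unfolding f_def by (rule Lp_norm_scale) (use t in simp)
    have "N (\<lambda>x. f1 x - f0 x) \<le> 2 * real n"
      using Lp_norm_triangle_diff[OF Hp_Lp[OF f1(1)] Hp_Lp[OF f0(1)] p_pos(2)] f1(2) f0(2) by linarith
    then have "N f \<le> (1 / t) * (2 * real n)" unfolding Nf using t by (intro mult_left_mono) auto
    also have "\<dots> = (4 * real n / r) * N z" using Nz ball(2) by (simp add: t_def)
    also have "\<dots> \<le> K * N z" using Nz by (intro mult_right_mono) (auto simp: K_def)
    finally have fK: "N f \<le> K * N z" .
    define D where "D x = ((w0 x + of_real t * z x) - A f1 x) - (w0 x - A f0 x)" for x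
    have L: "(\<lambda>x. (w0 x + of_real t * z x) - A f1 x) \<in> Lp m p" "(\<lambda>x. w0 x - A f0 x) \<in> Lp m p"
      using f1 f0 ball(1) tz by (auto intro!: RL R_diff R_add R_image)
    have "AE x in m. z x - A f x = of_real (1 / t) * D x"
      using bounded_operatorD(3)[OF A f10, of "of_real (1 / t)"] operator_diff[OF A f1(1) f0(1)]
      unfolding f_def
      by eventually_elim (use t in \<open>simp add: D_def field_simps\<close>)
    then have "N (\<lambda>x. z x - A f x) = N (\<lambda>x. of_real (1 / t) * D x)"
      unfolding D_def by (intro Lp_norm_AE_eq Lp_cmult Lp_diff L p_pos RL z R_image fH)
    also have "\<dots> = (1 / t) * N D" by (rule Lp_norm_scale) (use t in simp)
    also have "\<dots> < (1 / t) * (e * t / 2 + e * t / 2)"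
      using Lp_norm_triangle_diff[OF L p_pos(2)] f1(3) f0(3) t
      by (intro mult_strict_left_mono) (auto simp: D_def[abs_def])
    also have "\<dots> = e" using t by simp
    finally show ?thesis using fH fK by blast
  qed
  obtain C where C: "0 < C" "\<And>f. f \<in> H \<Longrightarrow> N (A f) \<le> C * N f" by (rule bounded_operator_bound[OF A]) blast
  have "\<exists>f\<in>H. (AE x in m. w x = A f x) \<and> N f \<le> (2 * K) * N w" if w: "w \<in> R" for w
  proof (cases "N w = 0")
    case True
    then have "AE x in m. w x = 0" using Lp_norm_eq_0_iff[OF RL[OF w] p_pos(1)] by simp
    with operator_zero[OF A] have "AE x in m. w x = A (\<lambda>x. 0) x" by eventually_elim simp
    then show ?thesis using True by (intro bexI[of _ "\<lambda>x. 0"] Hp_zero) auto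
  next
    case False
    then have Nw: "0 < N w" by (simp add: less_le)
    \<comment> \<open>Pairs of a residual and an approximate preimage of it. The tolerance halves in
      each step, so the preimages sum to an exact one with norm at most K N w (1 + 1/2 + ...) = 2 K
      N w. The tolerances are positive because N w > 0.\<close>
    have "\<exists>s. \<forall>n :: nat. (fst (s n) \<in> R \<and> snd (s n) \<in> H \<and> N (fst (s n)) \<le> N w * (1/2) ^ n \<and>
          N (snd (s n)) \<le> K * N (fst (s n)) \<and> N (\<lambda>x. fst (s n) x - A (snd (s n)) x) < N w * (1/2) ^ Suc n \<and> (n = 0 \<longrightarrow> fst (s n) = w)) \<and>
        (fst (s (Suc n)) = (\<lambda>x. fst (s n) x - A (snd (s n)) x))"
    proof (rule dependent_nat_choice)
      obtain f where "f \<in> H" "N f \<le> K * N w" "N (\<lambda>x. w x - A f x) < N w * (1/2) ^ Suc 0"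
        using approx[OF w, of "N w * (1/2) ^ Suc 0"] Nw by auto
      then show "\<exists>s. fst s \<in> R \<and> snd s \<in> H \<and> N (fst s) \<le> N w * (1/2) ^ 0 \<and> N (snd s) \<le> K * N (fst s) \<and>
          N (\<lambda>x. fst s x - A (snd s) x) < N w * (1/2) ^ Suc 0 \<and> ((0::nat) = 0 \<longrightarrow> fst s = w)"
        using w by (intro exI[of _ "(w, f)"]) auto
      fix s :: "('g \<Rightarrow> complex) \<times> ('g \<Rightarrow> complex)" and n :: nat
      assume s: "fst s \<in> R \<and> snd s \<in> H \<and> N (fst s) \<le> N w * (1/2) ^ n \<and> N (snd s) \<le> K * N (fst s) \<and>
          N (\<lambda>x. fst s x - A (snd s) x) < N w * (1/2) ^ Suc n \<and> (n = 0 \<longrightarrow> fst s = w)"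
      define z where "z x = fst s x - A (snd s) x" for x
      have z: "z \<in> R" unfolding z_def using s by (intro R_diff R_image) auto
      obtain f where "f \<in> H" "N f \<le> K * N z" "N (\<lambda>x. z x - A f x) < N w * (1/2) ^ Suc (Suc n)"
        using approx[OF z, of "N w * (1/2) ^ Suc (Suc n)"] Nw by auto
      then show "\<exists>t. (fst t \<in> R \<and> snd t \<in> H \<and> N (fst t) \<le> N w * (1/2) ^ Suc n \<and> N (snd t) \<le> K * N (fst t) \<and>
          N (\<lambda>x. fst t x - A (snd t) x) < N w * (1/2) ^ Suc (Suc n) \<and> (Suc n = 0 \<longrightarrow> fst t = w)) \<and>
          fst t = (\<lambda>x. fst s x - A (snd s) x)"
        using z s by (intro exI[of _ "(z, f)"]) (auto simp: z_def[abs_def])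
    qed
    then obtain s where s: "\<And>n :: nat. fst (s n) \<in> R" "\<And>n. snd (s n) \<in> H" "\<And>n. N (fst (s n)) \<le> N w * (1/2) ^ n"
      "\<And>n. N (snd (s n)) \<le> K * N (fst (s n))" "fst (s 0) = w"
      "\<And>n. fst (s (Suc n)) = (\<lambda>x. fst (s n) x - A (snd (s n)) x)" by blast
    define z where "z n = fst (s n)" for n
    define f where "f n = snd (s n)" for n
    have z: "z n \<in> R" "f n \<in> H" "N (z n) \<le> N w * (1/2) ^ n" "z 0 = w" "z (Suc n) = (\<lambda>x. z n x - A (f n) x)" for n
      using s by (auto simp: z_def f_def)
    have fN: "N (f n) \<le> K * N w * (1/2) ^ n" for n
      using order_trans[OF s(4) mult_left_mono[OF s(3)], of n] K by (simp add: f_def mult.assoc)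
    have geo: "(\<lambda>n. K * N w * (1/2) ^ n) sums (K * N w * (1 / (1 - 1/2)))"
      by (intro sums_mult geometric_sums) simp
    have sm: "summable (\<lambda>n. N (f n))"
      by (rule summable_comparison_test'[OF sums_summable[OF geo], of 0]) (use fN in auto)
    obtain g where g: "g \<in> Lp m p" "\<And>n. N (\<lambda>x. g x - (\<Sum>k<n. f k x)) \<le> (\<Sum>k. N (f (k + n)))"
      using Lp_series_complete[OF p emeasure_space_m Hp_Lp[OF z(2)] sm] by blast
    have sumH: "(\<lambda>x. \<Sum>k<n. f k x) \<in> H" for n by (intro Hp_sum z)
    have "(\<lambda>n. \<Sum>k. N (f (k + n))) \<longlonglongrightarrow> 0"
      using suminf_exist_split[OF _ sm] by (auto simp: LIMSEQ_iff)
    then have lim: "(\<lambda>n. N (\<lambda>x. g x - (\<Sum>k<n. f k x))) \<longlonglongrightarrow> 0"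
      by (rule squeeze_zero[OF Lp_norm_nonneg g(2)])
    then have gH: "g \<in> H"
      unfolding Lp_norm_minus_commute[of m p g] by (rule Hp_limit[OF sumH g(1)])
    have "N g \<le> (\<Sum>k. N (f k))" using g(2)[of 0] by simp
    also have "\<dots> \<le> (\<Sum>k. K * N w * (1/2) ^ k)" by (rule suminf_le[OF fN sm sums_summable[OF geo]])
    also have "\<dots> = (2 * K) * N w" using sums_unique[OF geo] by simp
    finally have gN: "N g \<le> (2 * K) * N w" .
    have z_eq: "AE x in m. w x - A (\<lambda>x. \<Sum>k<n. f k x) x = z n x" for n
    proof (induction n)
      case 0
      then show ?case using operator_zero[OF A] by (auto simp: z(4) elim: eventually_mono)
    next
      case (Suc n)
      have "AE x in m. A (\<lambda>x. (\<Sum>k<n. f k x) + f n x) x = A (\<lambda>x. \<Sum>k<n. f k x) x + A (f n) x"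
        by (rule bounded_operatorD(2)[OF A sumH z(2)])
      with Suc show ?case by eventually_elim (simp add: z(5))
    qed
    have "N (\<lambda>x. w x - A g x) \<le> N w * (1/2) ^ n + C * N (\<lambda>x. g x - (\<Sum>k<n. f k x))" for n
    proof -
      have L: "w \<in> Lp m p" "A g \<in> Lp m p" "A (\<lambda>x. \<Sum>k<n. f k x) \<in> Lp m p"
        using w gH sumH by (auto intro: RL R_image)
      have dH: "(\<lambda>x. g x - (\<Sum>k<n. f k x)) \<in> H" by (rule Hp_diff[OF gH sumH])
      have "N (\<lambda>x. w x - A g x) \<le> N (\<lambda>x. w x - A (\<lambda>x. \<Sum>k<n. f k x) x) + N (\<lambda>x. A (\<lambda>x. \<Sum>k<n. f k x) x - A g x)"
        by (rule Lp_norm_diff_triangle[OF L(1,3,2) p_pos(2)])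
      also have "N (\<lambda>x. w x - A (\<lambda>x. \<Sum>k<n. f k x) x) = N (z n)"
        by (rule Lp_norm_AE_eq[OF z_eq Lp_diff[OF L(1,3) p_pos(2)] RL[OF z(1)]])
      also have "N (\<lambda>x. A (\<lambda>x. \<Sum>k<n. f k x) x - A g x) = N (\<lambda>x. A g x - A (\<lambda>x. \<Sum>k<n. f k x) x)"
        by (rule Lp_norm_minus_commute)
      also have "\<dots> = N (A (\<lambda>x. g x - (\<Sum>k<n. f k x)))"
        by (rule Lp_norm_AE_eq[symmetric, OF operator_diff[OF A gH sumH] RL[OF R_image[OF dH]] Lp_diff[OF L(2,3) p_pos(2)]])
      also have "N (z n) + \<dots> \<le> N w * (1/2) ^ n + C * N (\<lambda>x. g x - (\<Sum>k<n. f k x))"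
        by (rule add_mono[OF z(3) C(2)[OF dH]])
      finally show ?thesis by simp
    qed
    moreover have "(\<lambda>n. N w * (1/2) ^ n + C * N (\<lambda>x. g x - (\<Sum>k<n. f k x))) \<longlonglongrightarrow> N w * 0 + C * 0"
      by (intro tendsto_intros lim LIMSEQ_realpow_zero) auto
    ultimately have "N (\<lambda>x. w x - A g x) \<le> 0" using LIMSEQ_le_const by fastforce
    then have "N (\<lambda>x. w x - A g x) = 0" using Lp_norm_nonneg[of m p "\<lambda>x. w x - A g x"] by linarith
    then have "AE x in m. w x = A g x"
      using Lp_norm_eq_0_iff[OF Lp_diff[OF RL[OF w] RL[OF R_image[OF gH]] p_pos(2)] p_pos(1)] by simp
    then show ?thesis using gH gN by blast
  qed
  then show ?thesis using that[of "2 * K"] K unfolding R_def by simp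
qed

end

section \<open>Zeros of the symbol\<close>

locale toeplitz_setting = Hp_space m T p + connected_haar m
  for m :: "'g::{topological_ab_group_add, t2_space} measure" and T and p +
  assumes nontrivial: "(UNIV :: 'g set) \<noteq> {0}"
begin

lemma nontrivial_positive_char:
  obtains \<xi> where "\<xi> \<in> T" "\<xi> \<noteq> (\<lambda>x. 1)"
proof -
  obtain a :: 'g where a: "a \<noteq> 0" using nontrivial by auto
  obtain \<eta> where \<eta>: "\<eta> \<in> chars" "\<eta> a \<noteq> \<eta> 0" by (rule chars_separate_points[OF a])
  then have ne: "\<eta> a \<noteq> 1" by (simp add: char_0)
  show ?thesis
  proof (cases "\<eta> \<in> T")
    case True
    then show ?thesis using that[of \<eta>] ne by auto
  next
    case False
    have "cnj (\<eta> a) \<noteq> 1" using ne by (metis complex_cnj_cnj complex_cnj_one)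
    then have "(\<lambda>x. cnj (\<eta> x)) \<noteq> (\<lambda>x. 1)" by metis
    then show ?thesis using that char_not_T_cnj[OF \<eta>(1) False] by blast
  qed
qed

lemma T_strict_mult: "\<eta> \<in> T - {\<lambda>x. 1} \<Longrightarrow> \<xi> \<in> T \<Longrightarrow> (\<lambda>x. \<eta> x * \<xi> x) \<in> T - {\<lambda>x. 1}"
  using T_mult T_mult_ne_one by blast

text \<open>Any s outside T is compensated by multiplying \<zeta> by its inverse, which lies in T
  and so spoils none of the earlier products. Strictness starts from a nontrivial positive
  character.\<close>

lemma shift_into_T:
  assumes "finite F" "F \<subseteq> chars"
  shows "\<exists>\<zeta>\<in>T - {\<lambda>x. 1}. \<forall>s\<in>F. (\<lambda>x. \<zeta> x * s x) \<in> T - {\<lambda>x. 1}"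
  using assms
proof (induction F)
  case empty
  then show ?case using nontrivial_positive_char by blast
next
  case (insert s F)
  then obtain \<zeta> where \<zeta>: "\<zeta> \<in> T - {\<lambda>x. 1}" "\<And>s. s \<in> F \<Longrightarrow> (\<lambda>x. \<zeta> x * s x) \<in> T - {\<lambda>x. 1}" by auto
  have s: "s \<in> chars" using insert by simp
  show ?case
  proof (cases "s \<in> T")
    case True
    then show ?thesis using \<zeta> T_strict_mult[OF \<zeta>(1) True] by (intro bexI[of _ \<zeta>]) auto
  next
    case False
    have c: "(\<lambda>x. cnj (s x)) \<in> T" by (rule char_not_T_cnj[OF s False])
    let ?z = "\<lambda>x. \<zeta> x * cnj (s x)"
    have "(\<lambda>x. ?z x * s x) = \<zeta>"
    proof
      fix x
      have "?z x * s x = \<zeta> x * (s x * cnj (s x))" by (simp only: mult_ac)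
      then show "?z x * s x = \<zeta> x" by (simp add: char_cnj_mult[OF s])
    qed
    moreover have "(\<lambda>x. ?z x * t x) \<in> T - {\<lambda>x. 1}" if "t \<in> F" for t
    proof -
      have "(\<lambda>x. ?z x * t x) = (\<lambda>x. (\<zeta> x * t x) * cnj (s x))" by (simp only: mult_ac)
      then show ?thesis using T_strict_mult[OF \<zeta>(2)[OF that] c] by simp
    qed
    ultimately show ?thesis
      using \<zeta> T_strict_mult[OF \<zeta>(1) c] by (intro bexI[of _ ?z]) auto
  qed
qed

text \<open>On a finite-dimensional space all norms are equivalent, and the largest coefficient on a
  suitable finite set E is one, because coefficients determine a function. Concretely, k is the sum
  of \<open>fc k \<xi>\<close> D \<xi> over E for the dual family D.\<close>

lemma finite_dim_coeff_bound:
  assumes V: "finite_dim_modulo V (null_functions m)" "V \<subseteq> Lp m p"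
  obtains E K where "finite E" "E \<subseteq> chars" "0 \<le> K"
    "\<And>k e. k \<in> V \<Longrightarrow> (\<And>\<eta>. \<eta> \<in> E \<Longrightarrow> cmod (fc k \<eta>) \<le> e) \<Longrightarrow> 0 \<le> e \<Longrightarrow> N k \<le> K * e"
proof -
  obtain B where B: "finite B" "B \<subseteq> V" "\<And>k. k \<in> V \<Longrightarrow> \<exists>c. \<exists>h\<in>null_functions m. k = (\<lambda>x. (\<Sum>b\<in>B. c b * b x) + h x)"
    using V(1) unfolding finite_dim_modulo_def by blast
  have BL: "b \<in> Lp m p" if "b \<in> B" for b using that B(2) V(2) by blast
  obtain E d where Ed: "finite E" "E \<subseteq> chars"
    "\<forall>\<xi>\<in>E. \<forall>\<eta>\<in>E. (\<Sum>b\<in>B. d \<xi> b * fc b \<eta>) = (if \<xi> = \<eta> then 1 else 0)"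
    "\<forall>c. (\<forall>\<eta>\<in>E. (\<Sum>b\<in>B. c b * fc b \<eta>) = 0) \<longrightarrow> (\<forall>\<eta>\<in>chars. (\<Sum>b\<in>B. c b * fc b \<eta>) = 0)"
    using finite_dual_family[OF B(1), of chars fc] by (elim exE conjE) (rule that)
  define D where "D \<xi> x = (\<Sum>b\<in>B. d \<xi> b * b x)" for \<xi> x
  have DL: "D \<xi> \<in> Lp m p" for \<xi>
    unfolding D_def[abs_def] using Lp_sum_and_norm[of p B "\<lambda>b x. d \<xi> b * b x" m] BL p_pos by (auto intro: Lp_cmult)
  define K where "K = (\<Sum>\<xi>\<in>E. N (D \<xi>))"
  have "N k \<le> K * e" if k: "k \<in> V" and e: "\<And>\<eta>. \<eta> \<in> E \<Longrightarrow> cmod (fc k \<eta>) \<le> e" "0 \<le> e" for k e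
  proof -
    obtain c h where c: "h \<in> null_functions m" "k = (\<lambda>x. (\<Sum>b\<in>B. c b * b x) + h x)" using B(3)[OF k] by blast
    have kL: "k \<in> Lp m p" using k V(2) by blast
    define s where "s x = (\<Sum>b\<in>B. c b * b x)" for x
    have sL: "s \<in> Lp m p"
      unfolding s_def[abs_def] using Lp_sum_and_norm[of p B "\<lambda>b x. c b * b x" m] BL p_pos by (auto intro: Lp_cmult)
    have ks: "AE x in m. k x = s x" using c by (auto simp: null_functions_def s_def elim: eventually_mono)
    define t where "t x = (\<Sum>\<xi>\<in>E. fc k \<xi> * D \<xi> x)" for x
    have tL: "t \<in> Lp m p"
      unfolding t_def[abs_def] using Lp_sum_and_norm[of p E "\<lambda>\<xi> x. fc k \<xi> * D \<xi> x" m] DL p_pos by (auto intro: Lp_cmult)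
    define c' where "c' b = c b - (\<Sum>\<xi>\<in>E. fc k \<xi> * d \<xi> b)" for b
    have fck: "fc k \<eta> = (\<Sum>b\<in>B. c b * fc b \<eta>)" if "\<eta> \<in> chars" for \<eta>
      using fc_AE_eq[OF ks kL sL that] fc_lincomb[of B "\<lambda>b. b" \<eta> c] BL that by (simp add: s_def[abs_def])
    have fcD: "fc (D \<xi>) \<eta> = (\<Sum>b\<in>B. d \<xi> b * fc b \<eta>)" if "\<eta> \<in> chars" for \<xi> \<eta>
      unfolding D_def[abs_def] using fc_lincomb[of B "\<lambda>b. b" \<eta> "d \<xi>"] BL that by simp
    have c'_eq: "(\<Sum>b\<in>B. c' b * fc b \<eta>) = fc k \<eta> - (\<Sum>\<xi>\<in>E. fc k \<xi> * fc (D \<xi>) \<eta>)" if "\<eta> \<in> chars" for \<eta>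
    proof -
      have "(\<Sum>b\<in>B. (\<Sum>\<xi>\<in>E. fc k \<xi> * d \<xi> b) * fc b \<eta>) = (\<Sum>\<xi>\<in>E. fc k \<xi> * (\<Sum>b\<in>B. d \<xi> b * fc b \<eta>))"
        unfolding sum_distrib_right sum_distrib_left by (subst sum.swap) (simp add: mult.assoc)
      then show ?thesis
        unfolding fcD[OF that] c'_def left_diff_distrib sum_subtractf fck[OF that, symmetric] by simp
    qed
    have "(\<Sum>b\<in>B. c' b * fc b \<eta>) = 0" if "\<eta> \<in> E" for \<eta>
    proof -
      have \<eta>: "\<eta> \<in> chars" using that Ed(2) by blast
      have "(\<Sum>\<xi>\<in>E. fc k \<xi> * fc (D \<xi>) \<eta>) = (\<Sum>\<xi>\<in>E. if \<xi> = \<eta> then fc k \<xi> else 0)"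
        using Ed(3) that by (intro sum.cong) (auto simp: fcD[OF \<eta>])
      then show ?thesis using Ed(1) that by (simp add: c'_eq[OF \<eta>])
    qed
    then have "(\<Sum>b\<in>B. c' b * fc b \<eta>) = 0" if "\<eta> \<in> chars" for \<eta> using Ed(4) that by blast
    then have "fc k \<eta> = fc t \<eta>" if "\<eta> \<in> chars" for \<eta>
      using c'_eq[OF that] fc_lincomb[of E D \<eta> "fc k"] DL that by (simp add: t_def[abs_def])
    then have "AE x in m. k x = t x" by (rule fourier_coeff_eq_imp_AE_eq[OF kL tL p])
    then have "N k = N t" by (rule Lp_norm_AE_eq[OF _ kL tL])
    also have "\<dots> \<le> (\<Sum>\<xi>\<in>E. N (\<lambda>x. fc k \<xi> * D \<xi> x))"
      unfolding t_def[abs_def] using Lp_sum_and_norm[of p E "\<lambda>\<xi> x. fc k \<xi> * D \<xi> x" m] DL p_pos by (auto intro: Lp_cmult)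
    also have "\<dots> \<le> (\<Sum>\<xi>\<in>E. e * N (D \<xi>))"
      using e by (intro sum_mono) (auto simp: Lp_norm_cmult[OF p_pos(1)] intro: mult_right_mono)
    also have "\<dots> = K * e" by (simp add: K_def mult.commute flip: sum_distrib_left)
    finally show ?thesis .
  qed
  moreover have "0 \<le> K" by (simp add: K_def sum_nonneg)
  ultimately show ?thesis using that[of E K] Ed(1,2) by blast
qed

text \<open>Near a zero of \<open>\<phi>\<close> there is a trigonometric polynomial of norm about 1 that \<open>\<phi>\<close> nearly annihilates;
  a shift by a large character makes it analytic and moves its spectrum off any given finite set.\<close>

lemma almost_annihilated:
  assumes \<phi>: "continuous_on UNIV \<phi>" "\<phi> x0 = 0" and \<delta>: "0 < \<delta>" and E: "finite E" "E \<subseteq> chars"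
  obtains v where "v \<in> H" "1/2 \<le> N v" "N (\<lambda>x. \<phi> x * v x) \<le> \<delta>" "\<And>\<eta>. \<eta> \<in> E \<Longrightarrow> fc v \<eta> = 0"
proof -
  define U where "U = {x. cmod (\<phi> x) < \<delta> / 2}"
  have "open U" unfolding U_def by (intro open_Collect_less continuous_intros \<phi>)
  then have cl: "closed (- U)" by (simp add: closed_def)
  have x0: "x0 \<in> U" using \<phi>(2) \<delta> by (simp add: U_def)
  obtain b :: "'g \<Rightarrow> real" where b: "continuous_on UNIV b" "\<And>x. 0 \<le> b x \<and> b x \<le> 1" "\<And>x. x \<in> - U \<Longrightarrow> b x = 0"
    "\<And>x. x \<in> {x0} \<Longrightarrow> b x = 1"
    by (rule Urysohn_UNIV[OF cl, of "{x0}"]) (use x0 in auto)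
  define g where "g x = complex_of_real (b x)" for x
  have cg: "continuous_on UNIV g" unfolding g_def by (intro continuous_intros b)
  have gL: "g \<in> Lp m p" by (rule continuous_Lp[OF cg p_pos(1)])
  have "g \<noteq> (\<lambda>x. 0)" using b(4)[of x0] by (auto simp: g_def dest: fun_cong[of _ _ x0])
  then have "\<not> (AE x in m. g x = 0)" using continuous_AE_eq[OF cg continuous_on_const] by blast
  then have Ng: "0 < N g" using Lp_norm_eq_0_iff[OF gL p_pos(1)] Lp_norm_nonneg[of m p g] by linarith
  define f where "f x = of_real (1 / N g) * g x" for x
  have cf: "continuous_on UNIV f" unfolding f_def by (intro continuous_intros cg)
  have fL: "f \<in> Lp m p" by (rule continuous_Lp[OF cf p_pos(1)])
  have Nf: "N f = 1"
    using Ng Lp_norm_scale[of "1 / N g" g] unfolding f_def[abs_def] by simp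
  have \<phi>f: "cmod (\<phi> x * f x) \<le> cmod (of_real (\<delta> / 2) * f x)" for x
  proof (cases "x \<in> U")
    case True
    then show ?thesis using \<delta> unfolding norm_mult by (intro mult_right_mono) (auto simp: U_def)
  next
    case False
    then show ?thesis using b(3)[of x] by (simp add: f_def g_def)
  qed
  have "N (\<lambda>x. \<phi> x * f x) \<le> N (\<lambda>x. of_real (\<delta> / 2) * f x)"
    using \<phi>f by (intro Lp_norm_mono Lp_cmult fL continuous_measurable continuous_intros \<phi> cf p_pos) auto
  also have "\<dots> = \<delta> / 2" using \<delta> Nf Lp_norm_scale[of "\<delta> / 2" f] by simp
  finally have N\<phi>f: "N (\<lambda>x. \<phi> x * f x) \<le> \<delta> / 2" .
  obtain B where B: "0 < B" "\<And>x. cmod (\<phi> x) \<le> B" using continuous_bounded[OF \<phi>(1)] by blast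
  define e where "e = min (1/2) (\<delta> / (2 * B))"
  have e: "0 < e" "e \<le> 1/2" "B * e \<le> \<delta> / 2"
  proof -
    show "0 < e" "e \<le> 1/2" using \<delta> B by (auto simp: e_def)
    have "B * e \<le> B * (\<delta> / (2 * B))" using B by (intro mult_left_mono) (auto simp: e_def)
    then show "B * e \<le> \<delta> / 2" using B by simp
  qed
  obtain q where q: "q \<in> trig_span chars" "N (\<lambda>x. f x - q x) < e"
    using trig_poly_dense_Lp[OF fL p_pos(2) e(1)] by blast
  have cq: "continuous_on UNIV q" by (rule trig_continuous[OF q(1)])
  have qL: "q \<in> Lp m p" by (rule continuous_Lp[OF cq p_pos(1)])
  have Nq: "1/2 \<le> N q" using Lp_norm_le_add_diff[OF fL qL p_pos(2)] q(2) e(2) Nf by linarith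
  have N\<phi>q: "N (\<lambda>x. \<phi> x * q x) \<le> \<delta>"
  proof -
    have L: "(\<lambda>x. \<phi> x * q x) \<in> Lp m p" "(\<lambda>x. \<phi> x * f x) \<in> Lp m p"
      by (intro Lp_mult \<phi> qL fL)+
    have "N (\<lambda>x. \<phi> x * q x - \<phi> x * f x) \<le> B * N (\<lambda>x. q x - f x)"
      using Lp_mult_continuous(2)[OF \<phi>(1) B(2) Lp_diff[OF qL fL p_pos(2)] p_pos(1)]
      by (simp add: right_diff_distrib)
    also have "\<dots> \<le> B * e"
      using q(2) B(1) Lp_norm_minus_commute[of m p q f] by (intro mult_left_mono) auto
    finally show ?thesis using Lp_norm_le_add_diff[OF L p_pos(2)] N\<phi>f e(3) by linarith
  qed
  define M where "M = {\<eta> \<in> chars. fc q \<eta> \<noteq> 0}"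
  have M: "finite M" "M \<subseteq> chars" unfolding M_def using finite_spectrum[OF q(1)] by auto
  \<comment> \<open>If \<zeta> \<mu> is in T for \<mu> in the spectrum M of q, then \<zeta> q is
    analytic. If \<zeta> \<mu> is also different from each \<epsilon> in E, its coefficients on E
    vanish; the quotients of \<mu> by \<epsilon> in F ensure this.\<close>
  define F where "F = M \<union> (\<lambda>(\<mu>, \<epsilon>). (\<lambda>x. \<mu> x * cnj (\<epsilon> x))) ` (M \<times> E)"
  have F: "finite F" "F \<subseteq> chars"
    unfolding F_def using M E by (auto intro!: char_mult char_cnj)
  from shift_into_T[OF F] obtain \<zeta> where \<zeta>1: "\<zeta> \<in> T - {\<lambda>x. 1}" "\<forall>s\<in>F. (\<lambda>x. \<zeta> x * s x) \<in> T - {\<lambda>x. 1}"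
    by (elim bexE) (rule that)
  then have \<zeta>: "\<zeta> \<in> T - {\<lambda>x. 1}" "\<And>s. s \<in> F \<Longrightarrow> (\<lambda>x. \<zeta> x * s x) \<in> T - {\<lambda>x. 1}"
    by blast+
  have \<zeta>c: "\<zeta> \<in> chars" using \<zeta>(1) T_chars by blast
  define v where "v x = \<zeta> x * q x" for x
  have cv: "continuous_on UNIV v" unfolding v_def by (intro continuous_intros cq char_continuous \<zeta>c)
  have fcv: "fc v \<eta> = fc q (\<lambda>x. \<eta> x * cnj (\<zeta> x))" for \<eta>
    unfolding v_def[abs_def] by (rule fourier_coeff_modulate)
  have inM: "\<exists>\<mu>\<in>M. \<eta> = (\<lambda>x. \<zeta> x * \<mu> x)" if "\<eta> \<in> chars" "fc v \<eta> \<noteq> 0" for \<eta>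
  proof (rule bexI)
    show "(\<lambda>x. \<eta> x * cnj (\<zeta> x)) \<in> M"
      using that \<zeta>c unfolding M_def fcv by (auto intro: char_mult char_cnj)
    show "\<eta> = (\<lambda>x. \<zeta> x * (\<eta> x * cnj (\<zeta> x)))"
      using char_cnj_mult[OF \<zeta>c] by (simp add: fun_eq_iff mult.left_commute[of "\<zeta> _"])
  qed
  have "v \<in> H"
    unfolding Hp_iff
  proof (intro conjI ballI)
    show "v \<in> Lp m p" by (rule continuous_Lp[OF cv p_pos(1)])
    fix \<eta> assume \<eta>: "\<eta> \<in> chars - T"
    show "fc v \<eta> = 0"
    proof (rule ccontr)
      assume "fc v \<eta> \<noteq> 0"
      then obtain \<mu> where "\<mu> \<in> M" "\<eta> = (\<lambda>x. \<zeta> x * \<mu> x)" using inM \<eta> by blast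
      then show False using \<zeta>(2)[of \<mu>] \<eta> by (auto simp: F_def)
    qed
  qed
  moreover have "fc v \<eta> = 0" if \<eta>: "\<eta> \<in> E" for \<eta>
  proof (rule ccontr)
    assume nz: "fc v \<eta> \<noteq> 0"
    have \<eta>c: "\<eta> \<in> chars" using \<eta> E by blast
    obtain \<mu> where \<mu>: "\<mu> \<in> M" "\<eta> = (\<lambda>x. \<zeta> x * \<mu> x)" using inM[OF \<eta>c nz] by blast
    have "(\<lambda>x. \<mu> x * cnj (\<eta> x)) \<in> F" unfolding F_def using \<mu>(1) \<eta> by force
    from \<zeta>(2)[OF this] have "(\<lambda>x. \<zeta> x * (\<mu> x * cnj (\<eta> x))) \<noteq> (\<lambda>x. 1)" by blast
    moreover have "\<zeta> x * (\<mu> x * cnj (\<eta> x)) = 1" for x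
    proof -
      have "\<zeta> x * (\<mu> x * cnj (\<eta> x)) = \<eta> x * cnj (\<eta> x)" using fun_cong[OF \<mu>(2), of x] by simp
      then show ?thesis by (simp add: char_cnj_mult[OF \<eta>c])
    qed
    ultimately show False by simp
  qed
  moreover have "N v = N q" "N (\<lambda>x. \<phi> x * v x) = N (\<lambda>x. \<phi> x * q x)"
    using \<zeta>c by (simp_all add: Lp_norm_def v_def norm_mult)
  ultimately show ?thesis using that[of v] Nq N\<phi>q by simp
qed

text \<open>The image of v is small, so it has another preimage f that is small. The difference v -
  f lies in the kernel and has on E the small coefficients of - f, so it is small too, although v
  has norm at least 1/2.\<close>

lemma fredholm_imp_nonvanishing:
  assumes \<phi>: "continuous_on UNIV \<phi>" and fredholm: "fredholm m p H (toeplitz m T p \<phi>)"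
  shows "\<phi> x0 \<noteq> 0"
proof
  assume zero: "\<phi> x0 = 0"
  let ?A = "toeplitz m T p \<phi>"
  have A: "bounded_operator m p H H ?A" by (rule bounded_operator_toeplitz[OF \<phi>])
  obtain K where K: "0 < K" "\<And>w. w \<in> op_range m H ?A \<Longrightarrow> \<exists>f\<in>H. (AE x in m. w x = ?A f x) \<and> N f \<le> K * N w"
    using bounded_preimages[OF A] fredholm unfolding fredholm_def by blast
  have kerL: "op_kernel m H ?A \<subseteq> Lp m p" by (auto simp: op_kernel_def intro: Hp_Lp)
  obtain E L where E: "finite E" "E \<subseteq> chars" "0 \<le> L"
    "\<And>k e. k \<in> op_kernel m H ?A \<Longrightarrow> (\<And>\<eta>. \<eta> \<in> E \<Longrightarrow> cmod (fc k \<eta>) \<le> e) \<Longrightarrow> 0 \<le> e \<Longrightarrow> N k \<le> L * e"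
    using finite_dim_coeff_bound[OF _ kerL] fredholm unfolding fredholm_def by blast
  obtain C where C: "0 < C" "\<And>f. f \<in> Lp m p \<Longrightarrow> N (P f) \<le> C * N f" using P_bound by blast
  \<comment> \<open>N f \<le> K C \<delta> and N (v - f) \<le> L K C \<delta> give N v \<le> M
    \<delta>; the choice \<delta> = 1 / (4 M) contradicts 1/2 \<le> N v.\<close>
  define M where "M = (L + 1) * K * C"
  have M: "0 < M" using E(3) K(1) C(1) by (simp add: M_def)
  define \<delta> where "\<delta> = 1 / (4 * M)"
  have \<delta>: "0 < \<delta>" using M by (simp add: \<delta>_def)
  obtain v where v: "v \<in> H" "1/2 \<le> N v" "N (\<lambda>x. \<phi> x * v x) \<le> \<delta>" "\<And>\<eta>. \<eta> \<in> E \<Longrightarrow> fc v \<eta> = 0"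
    by (rule almost_annihilated[OF \<phi> zero \<delta> E(1,2)]) blast
  have "?A v \<in> op_range m H ?A"
    using bounded_operatorD(1)[OF A v(1)] v(1) unfolding op_range_iff by auto
  then obtain f where f: "f \<in> H" "AE x in m. ?A v x = ?A f x" "N f \<le> K * N (?A v)" using K(2) by blast
  have "N (?A v) \<le> C * \<delta>"
    unfolding toeplitz_eq using C(1) v(3)
    by (intro order_trans[OF C(2)[OF Lp_mult[OF \<phi> Hp_Lp[OF v(1)]]]] mult_left_mono) auto
  then have Nf: "N f \<le> K * (C * \<delta>)"
    using f(3) K(1) by (meson mult_left_mono less_imp_le order_trans)
  define k where "k x = v x - f x" for x
  have k: "k \<in> op_kernel m H ?A"
    unfolding op_kernel_def
  proof (intro CollectI conjI)
    show "k \<in> H" unfolding k_def[abs_def] by (rule Hp_diff[OF v(1) f(1)])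
    show "AE x in m. ?A k x = 0"
      using operator_diff[OF A v(1) f(1)] f(2) unfolding k_def[abs_def] by eventually_elim simp
  qed
  have "cmod (fc k \<eta>) \<le> K * (C * \<delta>)" if \<eta>: "\<eta> \<in> E" for \<eta>
  proof -
    have \<eta>': "\<eta> \<in> chars" using \<eta> E(2) by blast
    have "fc k \<eta> = - fc f \<eta>"
      unfolding k_def[abs_def] using fourier_coeff_diff[OF Hp_Lp[OF v(1)] Hp_Lp[OF f(1)] p \<eta>'] v(4)[OF \<eta>] by simp
    then show ?thesis using fourier_coeff_le[OF Hp_Lp[OF f(1)] p \<eta>'] Nf by simp
  qed
  then have "N k \<le> L * (K * (C * \<delta>))" using K(1) C(1) \<delta> by (intro E(4)[OF k]) auto
  moreover have "N v \<le> N f + N k"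
    unfolding k_def[abs_def] by (rule Lp_norm_le_add_diff[OF Hp_Lp[OF v(1)] Hp_Lp[OF f(1)] p_pos(2)])
  ultimately have "1/2 \<le> K * (C * \<delta>) + L * (K * (C * \<delta>))" using v(2) Nf by linarith
  also have "\<dots> = M * \<delta>" by (simp add: M_def algebra_simps)
  also have "\<dots> = 1/4" using M by (simp add: \<delta>_def)
  finally show False by simp
qed

section \<open>Archimedean orders that are not discrete\<close>

lemma finite_chars_minimum:
  assumes "finite J" "J \<noteq> {}" "J \<subseteq> chars"
  shows "\<exists>\<xi>0\<in>J. \<forall>\<xi>\<in>J. (\<lambda>x. \<xi> x * cnj (\<xi>0 x)) \<in> T"
  using assms
proof (induction J rule: finite_ne_induct)
  case (singleton s)
  then show ?case using T_one by (simp add: char_cnj_mult)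
next
  case (insert s J)
  then obtain \<xi>0 where \<xi>0: "\<xi>0 \<in> J" "\<And>\<xi>. \<xi> \<in> J \<Longrightarrow> (\<lambda>x. \<xi> x * cnj (\<xi>0 x)) \<in> T" by auto
  have s: "s \<in> chars" and \<xi>0c: "\<xi>0 \<in> chars" using insert \<xi>0 by auto
  let ?q = "\<lambda>x. s x * cnj (\<xi>0 x)"
  show ?case
  proof (cases "?q \<in> T")
    case True
    then show ?thesis using \<xi>0 by (intro bexI[of _ \<xi>0]) auto
  next
    case False
    have "(\<lambda>x. cnj (?q x)) \<in> T" by (rule char_not_T_cnj[OF char_mult[OF s char_cnj[OF \<xi>0c]] False])
    then have q: "(\<lambda>x. \<xi>0 x * cnj (s x)) \<in> T" by (simp add: mult.commute)
    have "(\<lambda>x. \<xi> x * cnj (s x)) \<in> T" if "\<xi> \<in> J" for \<xi>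
    proof -
      have "(\<lambda>x. (\<xi> x * cnj (\<xi>0 x)) * (\<xi>0 x * cnj (s x))) \<in> T" by (rule T_mult[OF \<xi>0(2)[OF that] q])
      moreover have "(\<xi> x * cnj (\<xi>0 x)) * (\<xi>0 x * cnj (s x)) = \<xi> x * cnj (s x)" for x
      proof -
        have "(\<xi> x * cnj (\<xi>0 x)) * (\<xi>0 x * cnj (s x)) = \<xi> x * cnj (s x) * (\<xi>0 x * cnj (\<xi>0 x))" by (simp only: mult_ac)
        then show ?thesis by (simp add: char_cnj_mult[OF \<xi>0c])
      qed
      ultimately show ?thesis by simp
    qed
    moreover have "(\<lambda>x. s x * cnj (s x)) \<in> T" using T_one by (simp add: char_cnj_mult[OF s])
    ultimately show ?thesis by (intro bexI[of _ s]) auto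
  qed
qed

lemma char_power: "\<xi> \<in> chars \<Longrightarrow> (\<lambda>x. \<xi> x ^ n) \<in> chars"
proof (induction n)
  case (Suc n)
  then show ?case using char_mult[of \<xi> "\<lambda>x. \<xi> x ^ n"] by simp
qed simp

lemma T_power: "\<xi> \<in> T \<Longrightarrow> (\<lambda>x. \<xi> x ^ n) \<in> T"
proof (induction n)
  case (Suc n)
  then show ?case using T_mult[of \<xi> "\<lambda>x. \<xi> x ^ n"] by simp
qed (simp add: T_one)

lemma char_group_pow: "\<xi> [^]\<^bsub>char_group\<^esub> (n :: nat) = (\<lambda>x. \<xi> x ^ n)"
proof (induction n)
  case 0
  show ?case by (simp add: nat_pow_def char_group_simps)
next
  case (Suc n)
  have "\<xi> [^]\<^bsub>char_group\<^esub> Suc n = (\<xi> [^]\<^bsub>char_group\<^esub> n) \<otimes>\<^bsub>char_group\<^esub> \<xi>"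
    by (simp add: nat_pow_def)
  then show ?case by (simp add: Suc char_group_simps mult.commute)
qed

lemma cyclic_iso_integer_group:
  assumes \<xi>0: "\<xi>0 \<in> T - {\<lambda>x. 1}" and gen: "\<And>\<zeta>. \<zeta> \<in> T \<Longrightarrow> \<exists>n. \<zeta> = (\<lambda>x. \<xi>0 x ^ n)"
  shows "(char_group :: ('g \<Rightarrow> complex) monoid) \<cong> integer_group"
proof -
  have c: "\<xi>0 \<in> chars" using \<xi>0 T_chars by blast
  have nz: "\<xi>0 x \<noteq> 0" for x by (rule char_nonzero[OF c])
  define F where "F k x = \<xi>0 x powi k" for k :: int and x
  have F_neg: "F (- int n) = (\<lambda>x. cnj (\<xi>0 x ^ n))" for n
  proof
    fix x
    have "\<xi>0 x ^ n * cnj (\<xi>0 x ^ n) = 1"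
      using char_cnj_mult[OF char_power[OF c, of n], of x] by simp
    then have "inverse (\<xi>0 x ^ n) = cnj (\<xi>0 x ^ n)" by (rule inverse_unique)
    then show "F (- int n) x = cnj (\<xi>0 x ^ n)" by (simp add: F_def power_int_minus)
  qed
  have F_nat: "F (int n) = (\<lambda>x. \<xi>0 x ^ n)" for n by (simp add: F_def[abs_def])
  have F_chars: "F k \<in> chars" for k
  proof (cases k)
    case (nonneg n)
    then show ?thesis using F_nat char_power[OF c] by simp
  next
    case (neg n)
    have "F k = (\<lambda>x. cnj (\<xi>0 x ^ Suc n))" unfolding neg by (rule F_neg)
    then show ?thesis using char_cnj[OF char_power[OF c, of "Suc n"]] by (simp only:)
  qed
  have F_add: "F (j + k) = (\<lambda>x. F j x * F k x)" for j k
    using nz by (simp add: F_def fun_eq_iff power_int_add)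
  have F_ne_one: "F (int (Suc n)) \<noteq> (\<lambda>x. 1)" for n
    using T_mult_ne_one[of \<xi>0 "\<lambda>x. \<xi>0 x ^ n"] T_power[of \<xi>0 n] \<xi>0 unfolding F_nat by simp
  have inj_aux: "j = k" if le: "j \<le> k" and eq: "F j = F k" for j k
  proof (rule ccontr)
    assume "j \<noteq> k"
    then obtain n where n: "k = j + int (Suc n)" using le by (metis zless_iff_Suc_zadd order_le_less)
    have "F (int (Suc n)) x = 1" for x
    proof -
      have "F j x * F (int (Suc n)) x = F j x" using eq fun_cong[OF F_add[of j "int (Suc n)"], of x] n by simp
      moreover have "F j x \<noteq> 0" using nz by (simp add: F_def)
      ultimately show ?thesis by simp
    qed
    then show False using F_ne_one by (metis ext)
  qed
  have "inj F"
  proof (rule injI)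
    show "j = k" if "F j = F k" for j k
      using inj_aux[of j k] inj_aux[of k j] that by (cases "j \<le> k") auto
  qed
  moreover have "F ` UNIV = chars"
  proof
    show "chars \<subseteq> F ` UNIV"
    proof
      fix \<eta> assume \<eta>: "\<eta> \<in> chars"
      show "\<eta> \<in> F ` UNIV"
      proof (cases "\<eta> \<in> T")
        case True
        then obtain n where "\<eta> = (\<lambda>x. \<xi>0 x ^ n)" using gen by blast
        then have "\<eta> = F (int n)" by (simp add: F_nat)
        then show ?thesis by blast
      next
        case False
        then obtain n where n: "(\<lambda>x. cnj (\<eta> x)) = (\<lambda>x. \<xi>0 x ^ n)" using gen char_not_T_cnj[OF \<eta>] by blast
        have "\<eta> x = cnj (\<xi>0 x ^ n)" for x using fun_cong[OF n, of x] by (metis complex_cnj_cnj)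
        then have "\<eta> = F (- int n)" by (simp add: F_neg fun_eq_iff)
        then show ?thesis by blast
      qed
    qed
  qed (use F_chars in auto)
  ultimately have "F \<in> iso integer_group char_group"
    by (auto simp: iso_def hom_def bij_betw_def integer_group_def char_group_simps F_add F_chars)
  then have "integer_group \<cong> (char_group :: ('g \<Rightarrow> complex) monoid)"
    by (auto simp: is_iso_def)
  then show ?thesis by (rule group.iso_sym[OF group_integer_group])
qed

lemma infinite_interval:
  assumes arch: "archimedean_ordered (char_group :: ('g \<Rightarrow> complex) monoid) T"
    and not_Z: "\<not> (char_group :: ('g \<Rightarrow> complex) monoid) \<cong> integer_group"
    and \<omega>: "\<omega> \<in> T - {\<lambda>x. 1}"
  shows "infinite {\<xi> \<in> T. (\<lambda>x. \<omega> x * cnj (\<xi> x)) \<in> T - {\<lambda>x. 1}}"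
proof
  assume fin: "finite {\<xi> \<in> T. (\<lambda>x. \<omega> x * cnj (\<xi> x)) \<in> T - {\<lambda>x. 1}}"
  have \<omega>c: "\<omega> \<in> chars" using \<omega> T_chars by blast
  have Tc: "\<xi> \<in> chars" if "\<xi> \<in> T" for \<xi> using that T_chars by blast
  have cancel: "a = b" if "(\<lambda>x. a x * cnj (b x)) = (\<lambda>x. 1)" "b \<in> chars" for a b :: "'g \<Rightarrow> complex"
  proof
    fix x
    have "b x = (a x * cnj (b x)) * b x" using fun_cong[OF that(1), of x] by simp
    also have "\<dots> = a x * (b x * cnj (b x))" by (simp only: mult_ac)
    finally show "a x = b x" using char_cnj_mult[OF that(2)] by simp
  qed
  define J where "J = {\<xi> \<in> T - {\<lambda>x. 1}. (\<lambda>x. \<omega> x * cnj (\<xi> x)) \<in> T}"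
  have "J \<subseteq> insert \<omega> {\<xi> \<in> T. (\<lambda>x. \<omega> x * cnj (\<xi> x)) \<in> T - {\<lambda>x. 1}}"
    unfolding J_def using cancel[of \<omega>] Tc by auto
  then have "finite J" using fin by (meson finite_insert finite_subset)
  moreover have \<omega>J: "\<omega> \<in> J" using \<omega> T_one by (simp add: J_def char_cnj_mult[OF \<omega>c])
  moreover have "J \<subseteq> chars" unfolding J_def using Tc by blast
  ultimately obtain \<xi>0 where \<xi>0: "\<xi>0 \<in> J" "\<And>\<xi>. \<xi> \<in> J \<Longrightarrow> (\<lambda>x. \<xi> x * cnj (\<xi>0 x)) \<in> T"
    using finite_chars_minimum[of J] by blast
  have \<xi>0T: "\<xi>0 \<in> T - {\<lambda>x. 1}" using \<xi>0(1) by (simp add: J_def)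
  have \<xi>0c: "\<xi>0 \<in> chars" using \<xi>0T Tc by blast
  \<comment> \<open>A positive character not in J exceeds \<omega>, which in turn is at least
    \<xi>0.\<close>
  have least: "(\<lambda>x. \<zeta> x * cnj (\<xi>0 x)) \<in> T" if \<zeta>: "\<zeta> \<in> T - {\<lambda>x. 1}" for \<zeta>
  proof (cases "(\<lambda>x. \<omega> x * cnj (\<zeta> x)) \<in> T")
    case True
    then show ?thesis using \<zeta> by (intro \<xi>0(2)) (simp add: J_def)
  next
    case False
    have \<zeta>c: "\<zeta> \<in> chars" using \<zeta> Tc by blast
    have "(\<lambda>x. cnj (\<omega> x * cnj (\<zeta> x))) \<in> T"
      by (rule char_not_T_cnj[OF char_mult[OF \<omega>c char_cnj[OF \<zeta>c]] False])
    from T_mult[OF this \<xi>0(2)[OF \<omega>J]]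
    have "(\<lambda>x. cnj (\<omega> x * cnj (\<zeta> x)) * (\<omega> x * cnj (\<xi>0 x))) \<in> T" .
    moreover have "cnj (\<omega> x * cnj (\<zeta> x)) * (\<omega> x * cnj (\<xi>0 x)) = \<zeta> x * cnj (\<xi>0 x)" for x
    proof -
      have "cnj (\<omega> x * cnj (\<zeta> x)) * (\<omega> x * cnj (\<xi>0 x)) = \<zeta> x * cnj (\<xi>0 x) * (\<omega> x * cnj (\<omega> x))"
        by (simp add: mult_ac)
      then show ?thesis by (simp only: char_cnj_mult[OF \<omega>c] mult_1_right)
    qed
    ultimately show ?thesis by (simp only:)
  qed
  have "\<exists>n. \<zeta> = (\<lambda>x. \<xi>0 x ^ n)" if \<zeta>: "\<zeta> \<in> T" for \<zeta>
  proof (cases "\<zeta> = (\<lambda>x. 1)")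
    case True
    then show ?thesis by (intro exI[of _ 0]) simp
  next
    case False
    have \<zeta>c: "\<zeta> \<in> chars" using \<zeta> Tc by blast
    \<comment> \<open>Q n says that the n-th power of \<xi>0 is at least \<zeta>. For the least such
      n = k + 1, the quotient of \<zeta> by the k-th power is nontrivial and positive, hence at
      least \<xi>0, which forces \<zeta> to equal the power k + 1.\<close>
    define Q where "Q n \<longleftrightarrow> (\<lambda>x. \<xi>0 x ^ n * cnj (\<zeta> x)) \<in> T" for n
    have "\<exists>n. (\<lambda>x. \<xi>0 x ^ n * (inv\<^bsub>char_group\<^esub> \<zeta>) x) \<in> T"
      using arch \<zeta> False \<xi>0T
      unfolding archimedean_ordered_def cone_le_def char_group_simps char_group_pow by blast
    then have "\<exists>n. Q n" by (simp add: Q_def inv_char[OF \<zeta>c])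
    then have Qn: "Q (LEAST n. Q n)" by (auto intro: LeastI)
    have "\<not> Q 0"
    proof
      assume "Q 0"
      then have "(\<lambda>x. cnj (\<zeta> x)) \<in> T" by (simp add: Q_def)
      then show False using T_antisym[OF \<zeta>] False by blast
    qed
    then obtain k where k: "(LEAST n. Q n) = Suc k" using Qn by (cases "LEAST n. Q n") auto
    then have nQ: "\<not> Q k" using not_less_Least[of k Q] by simp
    have Qk: "(\<lambda>x. \<xi>0 x ^ Suc k * cnj (\<zeta> x)) \<in> T" using Qn k by (simp add: Q_def)
    have pc: "(\<lambda>x. \<xi>0 x ^ j) \<in> chars" for j by (rule char_power[OF \<xi>0c])
    let ?r = "\<lambda>x. \<zeta> x * cnj (\<xi>0 x ^ k)"
    have "(\<lambda>x. cnj (\<xi>0 x ^ k * cnj (\<zeta> x))) \<in> T"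
      using nQ unfolding Q_def by (intro char_not_T_cnj char_mult pc char_cnj \<zeta>c)
    then have r: "?r \<in> T" by (simp add: mult.commute)
    have "?r \<noteq> (\<lambda>x. 1)"
    proof
      assume "?r = (\<lambda>x. 1)"
      then have "\<zeta> = (\<lambda>x. \<xi>0 x ^ k)" by (rule cancel[OF _ pc])
      then have "Q k" using T_one char_cnj_mult[OF pc[of k]] by (simp add: Q_def)
      then show False using nQ by simp
    qed
    then have "(\<lambda>x. ?r x * cnj (\<xi>0 x)) \<in> T" using r least[of ?r] by blast
    then have t: "(\<lambda>x. \<zeta> x * cnj (\<xi>0 x ^ Suc k)) \<in> T" by (simp add: mult_ac)
    have "(\<lambda>x. cnj (\<zeta> x * cnj (\<xi>0 x ^ Suc k))) \<in> T" using Qk by (simp add: mult_ac)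
    from T_antisym[OF t this] have "\<zeta> = (\<lambda>x. \<xi>0 x ^ Suc k)" by (rule cancel[OF _ pc])
    then show ?thesis by blast
  qed
  from cyclic_iso_integer_group[OF \<xi>0T this] show False using not_Z by blast
qed

section \<open>The index of a Fredholm Toeplitz operator\<close>

text \<open>The operator is multiplication by \<omega> followed by the invertible B, and the
  coefficients of \<omega> f vanish at every \<xi> with 1 \<le> \<xi> < \<omega>. If the range had
  finite codimension, the preimages s b under B of finitely many representatives would have to
  reproduce every unit vector on this infinite set of characters.\<close>

lemma toeplitz_positive_char_not_fredholm:
  assumes g: "continuous_on UNIV g" and \<omega>: "\<omega> \<in> T - {\<lambda>x. 1}"
    and inf: "infinite {\<xi> \<in> T. (\<lambda>x. \<omega> x * cnj (\<xi> x)) \<in> T - {\<lambda>x. 1}}"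
  shows "\<not> fredholm m p H (toeplitz m T p (\<lambda>x. \<omega> x * exp (g x)))"
proof
  let ?A = "toeplitz m T p (\<lambda>x. \<omega> x * exp (g x))" and ?B = "toeplitz m T p (\<lambda>x. exp (g x))"
  let ?I = "{\<xi> \<in> T. (\<lambda>x. \<omega> x * cnj (\<xi> x)) \<in> T - {\<lambda>x. 1}}"
  assume "fredholm m p H ?A"
  then obtain B where B: "finite B" "B \<subseteq> H"
    "\<And>f. f \<in> H \<Longrightarrow> \<exists>c. \<exists>h\<in>op_range m H ?A. f = (\<lambda>x. (\<Sum>b\<in>B. c b * b x) + h x)"
    unfolding fredholm_def finite_dim_modulo_def by blast
  have \<omega>c: "\<omega> \<in> chars" using \<omega> T_chars by blast
  have \<omega>_closure: "\<omega> \<in> uniform_closure T"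
    using \<omega> by (intro trig_span_closure[OF T_chars] trig_span_base) auto
  have bB: "bounded_operator m p H H ?B"
    by (rule bounded_operator_toeplitz[OF continuous_on_exp[OF g]])
  obtain K where K: "\<And>f. f \<in> H \<Longrightarrow> N f \<le> K * N (?B f)" using toeplitz_exp(2)[OF g] by blast
  have "\<forall>b\<in>B. \<exists>b'. b' \<in> H \<and> (AE x in m. ?B b' x = b x)" using toeplitz_exp(1)[OF g] B(2) by blast
  then obtain s where s: "\<And>b. b \<in> B \<Longrightarrow> s b \<in> H" "\<And>b. b \<in> B \<Longrightarrow> AE x in m. ?B (s b) x = b x" by metis
  have "\<exists>c. \<forall>\<zeta>\<in>?I. (\<Sum>b\<in>B. c b * fc (s b) \<zeta>) = (if \<xi> = \<zeta> then 1 else 0)" if \<xi>: "\<xi> \<in> ?I" for \<xi>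
  proof -
    have \<xi>c: "\<xi> \<in> chars" and \<xi>H: "\<xi> \<in> H"
      using \<xi> T_chars Hp_trig_span[OF trig_span_base] by blast+
    obtain c h where ch: "h \<in> op_range m H ?A" "?B \<xi> = (\<lambda>x. (\<Sum>b\<in>B. c b * b x) + h x)"
      using B(3)[OF bounded_operatorD(1)[OF bB \<xi>H]] by blast
    obtain f where f: "f \<in> H" "AE x in m. h x = ?A f x" using ch(1) unfolding op_range_iff by blast
    have \<omega>f: "(\<lambda>x. \<omega> x * f x) \<in> H" by (rule Hp_mult_closure[OF \<omega>_closure f(1)])
    have A_eq: "?A f = ?B (\<lambda>x. \<omega> x * f x)" unfolding toeplitz_eq by (simp only: mult_ac)
    define S where "S x = (\<Sum>b\<in>B. c b * s b x)" for x
    have SH: "S \<in> H" unfolding S_def[abs_def] using s(1) by (intro Hp_sum Hp_cmult)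
    \<comment> \<open>B annihilates d almost everywhere and is bounded below, so \<xi> = S +
      \<omega> f almost everywhere.\<close>
    define d where "d x = \<xi> x - (S x + \<omega> x * f x)" for x
    have SfH: "(\<lambda>x. S x + \<omega> x * f x) \<in> H" by (rule Hp_add[OF SH \<omega>f])
    have dH: "d \<in> H" unfolding d_def[abs_def] by (rule Hp_diff[OF \<xi>H SfH])
    have "AE x in m. \<forall>b\<in>B. ?B (s b) x = b x" using B(1) s(2) by (subst AE_finite_all) auto
    with operator_lincomb[where B = B and f = s and c = c, OF bB s(1)] have "AE x in m. ?B S x = (\<Sum>b\<in>B. c b * b x)"
      unfolding S_def[abs_def] by (auto elim!: eventually_elim2)
    with operator_diff[OF bB \<xi>H SfH] bounded_operatorD(2)[OF bB SH \<omega>f] f(2)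
    have "AE x in m. ?B d x = 0"
      unfolding d_def[abs_def] by eventually_elim (simp add: ch(2) A_eq)
    then have "N (?B d) = 0"
      using Lp_norm_eq_0_iff[OF Hp_Lp[OF bounded_operatorD(1)[OF bB dH]] p_pos(1)] by simp
    then have "N d = 0" using K[OF dH] Lp_norm_nonneg[of m p d] by simp
    then have d0: "AE x in m. d x = 0" using Lp_norm_eq_0_iff[OF Hp_Lp[OF dH] p_pos(1)] by simp
    have "(\<Sum>b\<in>B. c b * fc (s b) \<zeta>) = (if \<xi> = \<zeta> then 1 else 0)" if \<zeta>: "\<zeta> \<in> ?I" for \<zeta>
    proof -
      have \<zeta>c: "\<zeta> \<in> chars" using \<zeta> T_chars by blast
      have "fc (\<lambda>x. \<omega> x * f x) \<zeta> = 0"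
      proof -
        have "(\<lambda>x. \<zeta> x * cnj (\<omega> x)) \<notin> T"
        proof
          assume "(\<lambda>x. \<zeta> x * cnj (\<omega> x)) \<in> T"
          then have "(\<lambda>x. cnj (\<omega> x * cnj (\<zeta> x))) \<in> T" by (simp add: mult.commute)
          then show False using \<zeta> T_antisym[of "\<lambda>x. \<omega> x * cnj (\<zeta> x)"] by blast
        qed
        then show ?thesis
          unfolding fourier_coeff_modulate using f(1) char_mult[OF \<zeta>c char_cnj[OF \<omega>c]] by (auto simp: Hp_iff)
      qed
      moreover have "fc S \<zeta> = (\<Sum>b\<in>B. c b * fc (s b) \<zeta>)"
        unfolding S_def[abs_def] using s(1) \<zeta>c by (intro fc_lincomb Hp_Lp)
      moreover have "fc d \<zeta> = fc \<xi> \<zeta> - (fc S \<zeta> + fc (\<lambda>x. \<omega> x * f x) \<zeta>)"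
        unfolding d_def[abs_def]
        using fourier_coeff_diff[OF Hp_Lp[OF \<xi>H] Hp_Lp[OF SfH] p \<zeta>c] fourier_coeff_add[OF Hp_Lp[OF SH] Hp_Lp[OF \<omega>f] p \<zeta>c]
        by simp
      moreover have "fc d \<zeta> = 0" using fc_AE_eq[OF d0 Hp_Lp[OF dH] Lp_zero \<zeta>c] by simp
      ultimately show ?thesis using fourier_coeff_char[OF \<zeta>c \<xi>c] by simp
    qed
    then show ?thesis by blast
  qed
  then show False by (rule no_finite_span_of_deltas[OF B(1) inf])
qed

text \<open>For 1 \<le> \<xi> < \<omega> the preimage of \<xi> under B is in the kernel, since
  dividing \<xi> by \<omega> moves it out of T. So the image under B of a finite-dimensional kernel
  would contain infinitely many characters.\<close>

lemma toeplitz_negative_char_not_fredholm: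
  assumes g: "continuous_on UNIV g" and \<omega>: "\<omega> \<in> T - {\<lambda>x. 1}"
    and inf: "infinite {\<xi> \<in> T. (\<lambda>x. \<omega> x * cnj (\<xi> x)) \<in> T - {\<lambda>x. 1}}"
  shows "\<not> fredholm m p H (toeplitz m T p (\<lambda>x. cnj (\<omega> x) * exp (g x)))"
proof
  let ?A = "toeplitz m T p (\<lambda>x. cnj (\<omega> x) * exp (g x))" and ?B = "toeplitz m T p (\<lambda>x. exp (g x))"
  let ?I = "{\<xi> \<in> T. (\<lambda>x. \<omega> x * cnj (\<xi> x)) \<in> T - {\<lambda>x. 1}}"
  assume "fredholm m p H ?A"
  then have "finite_dim_modulo (op_kernel m H ?A) (null_functions m)" by (simp add: fredholm_def)
  then obtain B where B: "finite B" "B \<subseteq> op_kernel m H ?A"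
    "\<And>f. f \<in> op_kernel m H ?A \<Longrightarrow> \<exists>c. \<exists>h\<in>null_functions m. f = (\<lambda>x. (\<Sum>b\<in>B. c b * b x) + h x)"
    unfolding finite_dim_modulo_def by blast
  have \<omega>c: "\<omega> \<in> chars" using \<omega> T_chars by blast
  have ceg: "continuous_on UNIV (\<lambda>x. exp (g x))" by (rule continuous_on_exp[OF g])
  have bB: "bounded_operator m p H H ?B" by (rule bounded_operator_toeplitz[OF ceg])
  have BH: "b \<in> H" if "b \<in> B" for b using that B(2) by (auto simp: op_kernel_def)
  have "\<exists>c. \<forall>\<zeta>\<in>?I. (\<Sum>b\<in>B. c b * fc (?B b) \<zeta>) = (if \<xi> = \<zeta> then 1 else 0)" if \<xi>: "\<xi> \<in> ?I" for \<xi>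
  proof -
    have \<xi>c: "\<xi> \<in> chars" and \<xi>H: "\<xi> \<in> H"
      using \<xi> T_chars Hp_trig_span[OF trig_span_base] by blast+
    obtain f where f: "f \<in> H" "AE x in m. ?B f x = \<xi> x" using toeplitz_exp(1)[OF g] \<xi>H by blast
    have egf: "(\<lambda>x. exp (g x) * f x) \<in> Lp m p" by (rule Lp_mult[OF ceg Hp_Lp[OF f(1)]])
    have cw: "continuous_on UNIV (\<lambda>x. cnj (\<omega> x))" by (rule char_continuous[OF char_cnj[OF \<omega>c]])
    \<comment> \<open>At \<eta> in T the product has the coefficient of exp g f, hence of B f and of
      \<xi>, at \<eta> \<omega>. It is 0 because \<eta> \<omega> \<ge> \<omega> > \<xi>.\<close>
    have "AE x in m. P (\<lambda>x. cnj (\<omega> x) * (exp (g x) * f x)) x = 0"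
    proof (rule P_AE_eqI[OF Lp_mult[OF cw egf] Hp_zero])
      fix \<eta> assume \<eta>: "\<eta> \<in> T"
      have \<eta>\<omega>: "(\<lambda>x. \<eta> x * \<omega> x) \<in> T" using T_mult \<eta> \<omega> by blast
      then have \<eta>\<omega>c: "(\<lambda>x. \<eta> x * \<omega> x) \<in> chars" using T_chars by blast
      have "fc (\<lambda>x. cnj (\<omega> x) * (exp (g x) * f x)) \<eta> = fc (\<lambda>x. exp (g x) * f x) (\<lambda>x. \<eta> x * \<omega> x)"
        using fourier_coeff_modulate[of "\<lambda>x. cnj (\<omega> x)"] by simp
      also have "\<dots> = fc (?B f) (\<lambda>x. \<eta> x * \<omega> x)" unfolding toeplitz_eq by (rule fc_P[OF egf \<eta>\<omega>, symmetric])
      also have "\<dots> = fc \<xi> (\<lambda>x. \<eta> x * \<omega> x)"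
        by (rule fc_AE_eq[OF f(2) Hp_Lp[OF bounded_operatorD(1)[OF bB f(1)]] Hp_Lp[OF \<xi>H] \<eta>\<omega>c])
      also have "\<dots> = 0"
      proof -
        have "\<xi> \<noteq> (\<lambda>x. \<eta> x * \<omega> x)"
        proof
          assume *: "\<xi> = (\<lambda>x. \<eta> x * \<omega> x)"
          have "(\<lambda>x. (\<omega> x * cnj (\<xi> x)) * \<eta> x) \<noteq> (\<lambda>x. 1)" using T_strict_mult[of _ \<eta>] \<xi> \<eta> by blast
          moreover have "(\<omega> x * cnj (\<xi> x)) * \<eta> x = 1" for x
          proof -
            have "(\<omega> x * cnj (\<xi> x)) * \<eta> x = \<xi> x * cnj (\<xi> x)" using fun_cong[OF *, of x] by simp
            then show ?thesis by (simp add: char_cnj_mult[OF \<xi>c])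
          qed
          ultimately show False by simp
        qed
        then show ?thesis using fourier_coeff_char[OF \<eta>\<omega>c \<xi>c] by simp
      qed
      finally show "fc (\<lambda>x. cnj (\<omega> x) * (exp (g x) * f x)) \<eta> = fc (\<lambda>x. 0) \<eta>" by simp
    qed
    then have "f \<in> op_kernel m H ?A" unfolding op_kernel_def toeplitz_eq using f(1) by (simp add: mult.assoc)
    then obtain c h where ch: "h \<in> null_functions m" "f = (\<lambda>x. (\<Sum>b\<in>B. c b * b x) + h x)" using B(3) by blast
    define S where "S x = (\<Sum>b\<in>B. c b * b x)" for x
    have SH: "S \<in> H" unfolding S_def[abs_def] using BH by (intro Hp_sum Hp_cmult)
    have "AE x in m. f x = S x" using ch by (auto simp: null_functions_def S_def elim: eventually_mono)
    moreover have "AE x in m. ?B S x = (\<Sum>b\<in>B. c b * ?B b x)"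
      unfolding S_def[abs_def] using operator_lincomb[OF bB, of B "\<lambda>b. b" c] BH by simp
    ultimately have "AE x in m. ?B f x = ?B S x" "AE x in m. ?B S x = (\<Sum>b\<in>B. c b * ?B b x)"
      using operator_cong_AE[OF bB f(1) SH] by auto
    from this f(2)
    have eq: "AE x in m. \<xi> x = (\<Sum>b\<in>B. c b * ?B b x)"
      by eventually_elim simp
    have BbH: "?B b \<in> H" if "b \<in> B" for b by (rule bounded_operatorD(1)[OF bB BH[OF that]])
    have "(\<Sum>b\<in>B. c b * fc (?B b) \<zeta>) = (if \<xi> = \<zeta> then 1 else 0)" if \<zeta>: "\<zeta> \<in> ?I" for \<zeta>
    proof -
      have \<zeta>c: "\<zeta> \<in> chars" using \<zeta> T_chars by blast
      have "(\<lambda>x. \<Sum>b\<in>B. c b * ?B b x) \<in> H" using BbH by (intro Hp_sum Hp_cmult)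
      from fc_AE_eq[OF eq Hp_Lp[OF \<xi>H] Hp_Lp[OF this] \<zeta>c]
      have "fc \<xi> \<zeta> = (\<Sum>b\<in>B. c b * fc (?B b) \<zeta>)"
        using fc_lincomb[of B ?B \<zeta> c] BbH \<zeta>c Hp_Lp by simp
      then show ?thesis using fourier_coeff_char[OF \<zeta>c \<xi>c] by simp
    qed
    then show ?thesis by blast
  qed
  then show False by (rule no_finite_span_of_deltas[OF B(1) inf])
qed

lemma fredholm_imp_invertible:
  assumes arch: "archimedean_ordered (char_group :: ('g \<Rightarrow> complex) monoid) T"
    and not_Z: "\<not> (char_group :: ('g \<Rightarrow> complex) monoid) \<cong> integer_group"
    and \<phi>: "continuous_on UNIV \<phi>" and fredholm: "fredholm m p H (toeplitz m T p \<phi>)"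
  shows "invertible_operator m p H (toeplitz m T p \<phi>)"
proof -
  obtain \<zeta> g where \<zeta>: "\<zeta> \<in> chars" "continuous_on UNIV g" "\<And>x. \<phi> x = \<zeta> x * exp (g x)"
    using nonvanishing_eq_char_times_exp[OF \<phi> fredholm_imp_nonvanishing[OF \<phi> fredholm]] by blast
  have \<phi>_eq: "\<phi> = (\<lambda>x. \<zeta> x * exp (g x))" using \<zeta>(3) by auto
  have "\<zeta> = (\<lambda>x. 1)"
  proof (rule ccontr)
    assume ne: "\<zeta> \<noteq> (\<lambda>x. 1)"
    show False
    proof (cases "\<zeta> \<in> T")
      case True
      then have \<omega>: "\<zeta> \<in> T - {\<lambda>x. 1}" using ne by simp
      show False
        using toeplitz_positive_char_not_fredholm[OF \<zeta>(2) \<omega> infinite_interval[OF arch not_Z \<omega>]] fredholm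
        unfolding \<phi>_eq by blast
    next
      case False
      define \<omega> where "\<omega> x = cnj (\<zeta> x)" for x
      have "\<omega> \<in> T" unfolding \<omega>_def[abs_def] by (rule char_not_T_cnj[OF \<zeta>(1) False])
      moreover have "\<omega> \<noteq> (\<lambda>x. 1)"
      proof
        assume "\<omega> = (\<lambda>x. 1)"
        then have "cnj (\<zeta> x) = 1" for x unfolding \<omega>_def[abs_def] by (rule fun_cong)
        then have "\<zeta> x = 1" for x by (metis complex_cnj_cnj complex_cnj_one)
        then show False using ne by auto
      qed
      ultimately have \<omega>: "\<omega> \<in> T - {\<lambda>x. 1}" by simp
      have "\<phi> = (\<lambda>x. cnj (\<omega> x) * exp (g x))" by (simp add: \<phi>_eq \<omega>_def)
      then show False
        using toeplitz_negative_char_not_fredholm[OF \<zeta>(2) \<omega> infinite_interval[OF arch not_Z \<omega>]] fredholm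
        by simp
    qed
  qed
  then have "\<phi> = (\<lambda>x. exp (g x))" by (simp add: \<phi>_eq)
  then show ?thesis using invertible_toeplitz_exp[OF \<zeta>(2)] by simp
qed

end

theorem corollary5:
  fixes m :: "'g::{topological_ab_group_add, t2_space} measure"
    and T :: "('g \<Rightarrow> complex) set"
    and p :: real
    and \<phi> :: "'g \<Rightarrow> complex"
  assumes "compact (UNIV :: 'g set)"
    and "connected (UNIV :: 'g set)"
    and "(UNIV :: 'g set) \<noteq> {0}"
    and "normalized_haar m"
    and "positive_cone (char_group :: ('g \<Rightarrow> complex) monoid) T"
    and "linearly_ordered (char_group :: ('g \<Rightarrow> complex) monoid) T"
    and "archimedean_ordered (char_group :: ('g \<Rightarrow> complex) monoid) T"
    and "\<not> (char_group :: ('g \<Rightarrow> complex) monoid) \<cong> integer_group"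
    and "1 < p"
    and "continuous_on UNIV \<phi>"
    and "fredholm m p (Hp m T p) (toeplitz m T p \<phi>)"
  shows "invertible_operator m p (Hp m T p) (toeplitz m T p \<phi>)"
proof -
  interpret toeplitz_setting m T p
    by unfold_locales (fact assms)+
  show ?thesis by (rule fredholm_imp_invertible) (fact assms)+
qed

end
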